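(* The algebra $Z_2(sl(3))$ is the quotient of the algebra $\mathcal{A}$ by the single additional relation $$\Omega=a_{12}(k_1,k_2,k_3,l_1,l_2,l_3),$$ the isomorphism being induced by the surjective morphism $\phi:\mathcal{A}\to Z_2(sl(3))$, $A\mapsto X$, $B\mapsto Y$, $C\mapsto Z$, $k_i\mapsto k_i$, $l_i\mapsto l_i$.
   Context: **The algebra $Z_2(sl(3))$.** $gl(3)$ is the complex Lie algebra with basis $e_{pq}$, $1\le p,q\le 3$, and $[e_{pq},e_{rs}]=\delta_{qr}e_{ps}-\delta_{sp}e_{rq}$; $sl(3)$ is its quotient by $e_{11}+e_{22}+e_{33}=0$, and $e_{pq}$ also denotes the image in $sl(3)$. In $U(sl(3))\otimes U(sl(3))$ put $e_{pq}^{(1)}=e_{pq}\otimes1$, $e_{pq}^{(2)}=1\otimes e_{pq}$, and let $\delta:U(sl(3))\to U(sl(3))\otimes U(sl(3))$ be the algebra homomorphism $\delta(e_{pq})=e_{pq}^{(1)}+e_{pq}^{(2)}$. Summation over repeated indices is implicit. The polarised traces are $T^{(a_1,\dots,a_d)}=e_{i_2i_1}^{(a_1)}e_{i_3i_2}^{(a_2)}\cdots e_{i_1i_d}^{(a_d)}$, $a_j\in\{1,2\}$, and $Z_2(sl(3))$ is the subalgebra of $U(sl(3))\otimes U(sl(3))$ generated by all of them (it is the centraliser of the image of $\delta$). Casimir elements of $U(sl(3))$: $\overline C^{(3)}=e_{i_1i_2}e_{i_2i_3}e_{i_3i_1}$, $C^{(2)}=e_{i_2i_1}e_{i_1i_2}$,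 $C^{(3)}=e_{i_2i_1}e_{i_3i_2}e_{i_1i_3}$. In $Z_2(sl(3))$ set $$k_1=C^{(2)}\otimes 1,\quad k_2=1\otimes C^{(2)},\quad k_3=\delta(C^{(2)}),$$ $$l_1=\tfrac12(C^{(3)}+\overline C^{(3)})\otimes 1,\quad l_2=1\otimes\tfrac12(C^{(3)}+\overline C^{(3)}),\quad l_3=-\delta\bigl(\tfrac12(C^{(3)}+\overline C^{(3)})\bigr),$$ $$X=\tfrac12(T^{(1,1,2)}-T^{(1,2,2)})+\tfrac13(l_1-l_2),$$ $$Y=T^{(1,1,2,2)}+\tfrac32(T^{(1,1,2)}+T^{(1,2,2)})-\tfrac1{12}(T^{(1,2)})^2-\tfrac5{12}T^{(1,1)}T^{(2,2)}+\tfrac52T^{(1,2)},\qquad Z=[X,Y].$$ **The algebra $\mathcal{A}$.** Here $k_1,k_2,k_3,l_1,l_2,l_3$ are indeterminates (central parameters). $S_3$ acts on $\mathbb{C}[k_1,k_2,k_3,l_1,l_2,l_3]$ by simultaneously permuting the indices of the $k_i$ and of the $l_i$; $Sym^+=\frac16\sum_{\pi\in S_3}\pi$ and $Sym^-=\frac16\sum_{\pi\in S_3}\mathrm{sgn}(\pi)\pi$. $\mathcal{A}$ is the associative unital algebra over $\mathbb{C}[k_1,k_2,k_3,l_1,l_2,l_3]$ generated by $A,B,C$ with defining relations $$[A,B]=C,\quad [A,C]=-6B^2+a_2A^2+a_5A+a_8,\quad [B,C]=-2A^3-a_2\{A,B\}-a_5B+a_6A+a_9,$$ where $\{A,B\}=AB+BA$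 and $$a_2=\tfrac12(k_1+k_2+k_3),\qquad a_5=Sym^-(2k_2l_1),$$ $$a_6=Sym^+\Bigl(\tfrac1{16}(-k_1^3+2k_1^2k_2-6k_1k_2k_3)+\tfrac38(k_1^2-2k_1k_2)+\tfrac16l_1^2-\tfrac53l_1l_2\Bigr),$$ $$a_8=Sym^+\Bigl(\tfrac1{128}(k_1^4-8k_1^3k_2+6k_1^2k_2^2+4k_1^2k_2k_3)-\tfrac1{32}(3k_1^3-6k_1^2k_2+2k_1k_2k_3)-\tfrac1{24}k_1(l_1^2-6l_2^2+4l_1l_2-26l_2l_3)+\tfrac12l_1^2+l_1l_2\Bigr),$$ $$a_9=Sym^-\Bigl(l_2\bigl(-\tfrac49l_1^2+\tfrac1{24}(k_1^3-2k_1^2k_2+k_1k_2^2+9k_1^2k_3)+\tfrac12(k_1^2-k_1k_2)\bigr)\Bigr).$$ **The Casimir element $\Omega$ of $\mathcal{A}$** (it is central): $$\Omega=x_1A+x_2B+x_3A^2+x_4\{A,B\}+x_5B^2+x_7ABA-A^4+4B^3+C^2,$$ $$x_1=6a_5+2a_9,\ x_2=-2a_6-2a_8,\ x_3=6a_2+a_6,\ x_4=-a_5,\ x_5=8a_2-24,\ x_7=-2a_2+12.$$ **The polynomial $a_{12}(k_1,k_2,k_3,l_1,l_2,l_3)$** is $$\begin{array}{l} Sym^+\Bigl( \frac{1}{4608}k_1^6 - \frac{1}{768}k_1^5 (1 + 2 k_2) + \frac{1}{768} k_1^4 (-39 + 6 k_2 + 5 k_2^2 + 3 k_2 k_3)-\frac{1}{1152}k_1^3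 (-648 - 468 k_2 \\ \quad + 6 k_2^2 + 5 k_2^3 - 6 k_2 k_3 + 6 k_2^2 k_3 + 2 l_1^2 + 8 l_1 l_2 - 12 l_2^2 + 140 l_2 l_3) - \frac{1}{2304}k_1^2 (2592 k_2 + 702 k_2^2 \\ \quad + 468 k_2 k_3 + 42 k_2^2 k_3 + k_2^2 k_3^2 - 40 l_1^2 - 40 k_2 l_1^2 + 416 l_1 l_2 - 16 k_2 l_1 l_2 + 144 k_3 l_1 l_2 - 464 l_2^2 \\ \quad + 56 k_2 l_2^2 - 360 k_3 l_2^2 - 560 l_2 l_3 - 720 k_3 l_2 l_3) -\frac{1}{288} k_1 (-108 k_2 k_3 - 24 l_1^2 + 68 k_2 l_1^2 + 17 k_2 k_3 l_1^2 \\ \quad - 672 l_1 l_2 - 52 k_2 l_1 l_2 - 296 k_3 l_1 l_2 - 2 k_2 k_3 l_1 l_2 - 48 l_2^2 - 206 k_3 l_2^2 + 1392 l_2 l_3) + \frac{1}{432}l_1 (-864 l_1 \\ \quad + l_1^3 - 1728 l_2 + 24 l_1^2 l_2 - 26 l_1 l_2^2 + 244 l_1 l_2 l_3)\Bigr). \end{array}$$ *)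

theory Defs
  imports
    "HOL-Analysis.Cartesian_Space"
    "HOL-Library.Poly_Mapping"
    "HOL-Library.Numeral_Type"
    "HOL-Combinatorics.Permutations"
    "HOL-Algebra.Algebraic_Closure_Type"
begin

section \<open>Complex vector spaces, algebras and Lie algebras\<close>

class complex_vector = ab_group_add +
  fixes scaleC :: "complex \<Rightarrow> 'a \<Rightarrow> 'a"  (infixr \<open>*\<^sub>C\<close> 75)
  assumes scaleC_add_right: "c *\<^sub>C (x + y) = c *\<^sub>C x + c *\<^sub>C y"
    and scaleC_add_left: "(c + d) *\<^sub>C x = c *\<^sub>C x + d *\<^sub>C x"
    and scaleC_scaleC: "c *\<^sub>C d *\<^sub>C x = (c * d) *\<^sub>C x"
    and scaleC_one: "1 *\<^sub>C x = x"
begin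

lemma scaleC_zero_right [simp]: "c *\<^sub>C 0 = 0"
  using scaleC_add_right[of c 0 0] by simp

lemma scaleC_zero_left [simp]: "0 *\<^sub>C x = 0"
  using scaleC_add_left[of 0 0 x] by simp

lemma scaleC_minus_right: "c *\<^sub>C (- x) = - (c *\<^sub>C x)"
  using scaleC_add_right[of c x "- x"] by (simp add: eq_neg_iff_add_eq_0 add.commute)

lemma scaleC_diff_right: "c *\<^sub>C (x - y) = c *\<^sub>C x - c *\<^sub>C y"
  using scaleC_add_right[of c "x - y" y] by simp

end

class complex_algebra_1 = complex_vector + ring_1 +
  assumes mult_scaleC_left: "(c *\<^sub>C x) * y = c *\<^sub>C (x * y)"
    and mult_scaleC_right: "x * (c *\<^sub>C y) = c *\<^sub>C (x * y)"

class complex_lie_algebra = complex_vector +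
  fixes lie :: "'a \<Rightarrow> 'a \<Rightarrow> 'a"
  assumes lie_add_left: "lie (x + y) z = lie x z + lie y z"
    and lie_add_right: "lie x (y + z) = lie x y + lie x z"
    and lie_scaleC_left: "lie (c *\<^sub>C x) y = c *\<^sub>C lie x y"
    and lie_scaleC_right: "lie x (c *\<^sub>C y) = c *\<^sub>C lie x y"
    and lie_self: "lie x x = 0"
    and jacobi: "lie x (lie y z) + lie y (lie z x) + lie z (lie x y) = 0"

definition complex_algebra_hom ::
    "('a::complex_algebra_1 \<Rightarrow> 'b::complex_algebra_1) \<Rightarrow> bool" where
  "complex_algebra_hom f \<longleftrightarrow>
     f 1 = 1 \<and> (\<forall>x y. f (x + y) = f x + f y) \<and> (\<forall>x y. f (x * y) = f x * f y) \<and>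
     (\<forall>c x. f (c *\<^sub>C x) = c *\<^sub>C f x)"

inductive_set generated_subalgebra :: "'a::complex_algebra_1 set \<Rightarrow> 'a set" for S where
  base: "x \<in> S \<Longrightarrow> x \<in> generated_subalgebra S"
| one: "1 \<in> generated_subalgebra S"
| add: "x \<in> generated_subalgebra S \<Longrightarrow> y \<in> generated_subalgebra S \<Longrightarrow>
    x + y \<in> generated_subalgebra S"
| mult: "x \<in> generated_subalgebra S \<Longrightarrow> y \<in> generated_subalgebra S \<Longrightarrow>
    x * y \<in> generated_subalgebra S"
| scale: "x \<in> generated_subalgebra S \<Longrightarrow> c *\<^sub>C x \<in> generated_subalgebra S"

definition commutator :: "'a::ring \<Rightarrow> 'a \<Rightarrow> 'a" where
  "commutator x y = x * y - y * x"

definition anticommutator :: "'a::ring \<Rightarrow> 'a \<Rightarrow> 'a" where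
  "anticommutator x y = x * y + y * x"

instantiation complex :: complex_algebra_1
begin
definition scaleC_complex :: "complex \<Rightarrow> complex \<Rightarrow> complex" where
  "scaleC_complex = (*)"
instance
  by standard (simp_all add: scaleC_complex_def algebra_simps)
end

lemma poly_mapping_sum_single:
  "p = (\<Sum>k\<in>Poly_Mapping.keys p. Poly_Mapping.single k (Poly_Mapping.lookup p k))"
proof (rule poly_mapping_eqI)
  fix k
  show "Poly_Mapping.lookup p k = Poly_Mapping.lookup
      (\<Sum>k\<in>Poly_Mapping.keys p. Poly_Mapping.single k (Poly_Mapping.lookup p k)) k"
    by (simp add: lookup_sum lookup_single when_def sum.delta in_keys_iff)
qed

lemma poly_mapping_induct_single [case_names zero single add]:
  fixes p :: "'a \<Rightarrow>\<^sub>0 'b::comm_monoid_add"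
  assumes z: "P 0" and s: "\<And>k v. P (Poly_Mapping.single k v)"
    and a: "\<And>p q. P p \<Longrightarrow> P q \<Longrightarrow> P (p + q)"
  shows "P p"
proof -
  have "P (\<Sum>k\<in>K. Poly_Mapping.single k (Poly_Mapping.lookup p k))" if "finite K" for K
    using that by induction (auto intro: z s a)
  from this[of "Poly_Mapping.keys p"] show ?thesis
    by (simp flip: poly_mapping_sum_single)
qed

instantiation poly_mapping :: (type, complex_vector) complex_vector
begin
lift_definition scaleC_poly_mapping :: "complex \<Rightarrow> ('a \<Rightarrow>\<^sub>0 'b) \<Rightarrow> 'a \<Rightarrow>\<^sub>0 'b"
  is "\<lambda>c f k. c *\<^sub>C f k"
  by (rule finite_subset[rotated]) auto
instance
  by standard (transfer; simp add: fun_eq_iff scaleC_add_right scaleC_add_left scaleC_scaleC scaleC_one)+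
end

lemma scaleC_single: "c *\<^sub>C Poly_Mapping.single k v = Poly_Mapping.single k (c *\<^sub>C v)"
  by transfer (auto simp: when_def fun_eq_iff)

instance poly_mapping :: (monoid_add, complex_algebra_1) complex_algebra_1
proof
  fix c and x y :: "'a \<Rightarrow>\<^sub>0 'b"
  show "c *\<^sub>C x * y = c *\<^sub>C (x * y)"
  proof (induction x rule: poly_mapping_induct_single)
    case (single k v)
    show ?case
      by (induction y rule: poly_mapping_induct_single)
        (simp_all add: scaleC_single mult_single mult_scaleC_left distrib_left scaleC_add_right)
  qed (simp_all add: distrib_right scaleC_add_right)
  show "x * c *\<^sub>C y = c *\<^sub>C (x * y)"
  proof (induction x rule: poly_mapping_induct_single)
    case (single k v)
    show ?case
      by (induction y rule: poly_mapping_induct_single)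
        (simp_all add: scaleC_single mult_single mult_scaleC_right distrib_left scaleC_add_right)
  qed (simp_all add: distrib_right scaleC_add_right)
qed


section \<open>Quotients by two-sided ideals\<close>

lemma ring_of_type_algebra_simps [simp]:
  "carrier (ring_of_type_algebra :: 'a::ring_1 ring) = UNIV"
  "monoid.mult (ring_of_type_algebra :: 'a::ring_1 ring) = (*)"
  "monoid.one (ring_of_type_algebra :: 'a::ring_1 ring) = 1"
  "ring.zero (ring_of_type_algebra :: 'a::ring_1 ring) = 0"
  "ring.add (ring_of_type_algebra :: 'a::ring_1 ring) = (+)"
  by (simp_all add: ring_of_type_algebra_def fun_eq_iff)

lemma ring_ring_of_type_algebra: "ring (ring_of_type_algebra :: 'a::ring_1 ring)"
proof -
  have "\<exists>y. x + y = 0" for x :: 'a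
    using add.right_inverse by blast
  thus ?thesis
    unfolding ring_of_type_algebra_def using add.right_inverse
    by unfold_locales (auto simp: algebra_simps Units_def)
qed

definition ideal_cong :: "'a::ring_1 set \<Rightarrow> 'a \<Rightarrow> 'a \<Rightarrow> bool" where
  "ideal_cong S x y \<longleftrightarrow> x - y \<in> Idl\<^bsub>ring_of_type_algebra\<^esub> S"

lemma ideal_UNIV_iff:
  fixes I :: "'a::ring_1 set"
  shows "ideal I ring_of_type_algebra \<longleftrightarrow>
    0 \<in> I \<and> (\<forall>x\<in>I. \<forall>y\<in>I. x + y \<in> I) \<and> (\<forall>x\<in>I. \<forall>a. a * x \<in> I \<and> x * a \<in> I)"
    (is "_ = ?R")
proof
  interpret R: ring "ring_of_type_algebra :: 'a ring"
    by (rule ring_ring_of_type_algebra)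
  show "?R" if "ideal I ring_of_type_algebra"
  proof -
    interpret ideal I "ring_of_type_algebra :: 'a ring" by fact
    show ?thesis
      using zero_closed a_closed I_l_closed I_r_closed by auto
  qed
  show "ideal I ring_of_type_algebra" if r: ?R
  proof (rule idealI[OF ring_ring_of_type_algebra])
    have inv: "inv\<^bsub>\<lparr>carrier = UNIV, monoid.mult = (+), one = 0\<rparr>\<^esub> x = - x" for x :: 'a
      unfolding m_inv_def by (rule the_equality) (auto simp: eq_neg_iff_add_eq_0)
    have minus: "- x \<in> I" if "x \<in> I" for x
      using r that by (metis mult_minus1)
    show "subgroup I (add_monoid (ring_of_type_algebra :: 'a ring))"
      using r minus by unfold_locales (auto simp: inv)
  qed (use r in auto)
qed

lemma ideal_Idl: "ideal (Idl\<^bsub>ring_of_type_algebra\<^esub> S) (ring_of_type_algebra :: 'a::ring_1 ring)"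
  by (rule ring.genideal_ideal[OF ring_ring_of_type_algebra]) simp

lemma
  fixes S :: "'a::ring_1 set"
  defines "I \<equiv> Idl\<^bsub>ring_of_type_algebra\<^esub> S"
  shows Idl_zero: "0 \<in> I"
    and Idl_add: "x \<in> I \<Longrightarrow> y \<in> I \<Longrightarrow> x + y \<in> I"
    and Idl_mult_left: "x \<in> I \<Longrightarrow> a * x \<in> I"
    and Idl_mult_right: "x \<in> I \<Longrightarrow> x * a \<in> I"
    and Idl_minus: "x \<in> I \<Longrightarrow> - x \<in> I"
  using ideal_Idl[of S] unfolding I_def ideal_UNIV_iff by (blast, blast, blast, blast, metis mult_minus1)

lemma Idl_scaleC:
  fixes x :: "'a::complex_algebra_1"
  assumes "x \<in> Idl\<^bsub>ring_of_type_algebra\<^esub> S"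
  shows "c *\<^sub>C x \<in> Idl\<^bsub>ring_of_type_algebra\<^esub> S"
  using Idl_mult_left[OF assms, of "c *\<^sub>C 1"] by (simp add: mult_scaleC_left)

lemma Idl_base: "x \<in> S \<Longrightarrow> x \<in> Idl\<^bsub>ring_of_type_algebra\<^esub> (S :: 'a::ring_1 set)"
  using ring.genideal_self[OF ring_ring_of_type_algebra, of S] by auto

lemma Idl_subset_kernel:
  fixes f :: "'a::ring_1 \<Rightarrow> 'b::ring_1"
  assumes add: "\<And>x y. f (x + y) = f x + f y" and mult: "\<And>x y. f (x * y) = f x * f y"
    and S: "\<And>x. x \<in> S \<Longrightarrow> f x = 0" and x: "x \<in> Idl\<^bsub>ring_of_type_algebra\<^esub> S"
  shows "f x = 0"
proof -
  have "f 0 = 0" using add[of 0 0] by simp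
  then have "ideal {x. f x = 0} ring_of_type_algebra"
    unfolding ideal_UNIV_iff by (auto simp: add mult)
  then have "Idl\<^bsub>ring_of_type_algebra\<^esub> S \<subseteq> {x. f x = 0}"
    using S by (intro ring.genideal_minimal[OF ring_ring_of_type_algebra]) auto
  with x show ?thesis by auto
qed

lemma equivp_ideal_cong: "equivp (ideal_cong S)"
proof (rule equivpI)
  show "reflp (ideal_cong S)"
    by (auto intro!: reflpI simp: ideal_cong_def Idl_zero)
  show "symp (ideal_cong S)"
  proof (rule sympI)
    fix x y :: 'a assume "ideal_cong S x y"
    then show "ideal_cong S y x"
      using Idl_minus[of "x - y" S] by (simp add: ideal_cong_def)
  qed
  show "transp (ideal_cong S)"
  proof (rule transpI)
    fix x y z :: 'a assume "ideal_cong S x y" "ideal_cong S y z"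
    then show "ideal_cong S x z"
      using Idl_add[of "x - y" S "y - z"] by (simp add: ideal_cong_def)
  qed
qed

lemma
  shows ideal_cong_base: "x - y \<in> S \<Longrightarrow> ideal_cong S x y"
    and ideal_cong_add:
      "ideal_cong S x x' \<Longrightarrow> ideal_cong S y y' \<Longrightarrow> ideal_cong S (x + y) (x' + y')"
    and ideal_cong_diff:
      "ideal_cong S x x' \<Longrightarrow> ideal_cong S y y' \<Longrightarrow> ideal_cong S (x - y) (x' - y')"
    and ideal_cong_uminus: "ideal_cong S x x' \<Longrightarrow> ideal_cong S (- x) (- x')"
    and ideal_cong_mult:
      "ideal_cong S x x' \<Longrightarrow> ideal_cong S y y' \<Longrightarrow> ideal_cong S (x * y) (x' * y')"
proof -
  show "x - y \<in> S \<Longrightarrow> ideal_cong S x y"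
    by (simp add: ideal_cong_def Idl_base)
  show "ideal_cong S x x' \<Longrightarrow> ideal_cong S y y' \<Longrightarrow> ideal_cong S (x + y) (x' + y')"
    unfolding ideal_cong_def by (drule (1) Idl_add) (simp add: add_diff_add)
  show "ideal_cong S x x' \<Longrightarrow> ideal_cong S (- x) (- x')"
    unfolding ideal_cong_def by (drule Idl_minus) simp
  show "ideal_cong S x x' \<Longrightarrow> ideal_cong S y y' \<Longrightarrow> ideal_cong S (x - y) (x' - y')"
    unfolding ideal_cong_def using Idl_add[of "x - x'" S "- (y - y')"] Idl_minus[of "y - y'" S]
    by (simp add: algebra_simps)
  assume "ideal_cong S x x'" "ideal_cong S y y'"
  then have "(x - x') * y + x' * (y - y') \<in> Idl\<^bsub>ring_of_type_algebra\<^esub> S"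
    unfolding ideal_cong_def by (intro Idl_add Idl_mult_left Idl_mult_right)
  then show "ideal_cong S (x * y) (x' * y')"
    by (simp add: ideal_cong_def algebra_simps)
qed

lemma ideal_cong_scaleC:
  fixes x :: "'a::complex_algebra_1"
  assumes "ideal_cong S x x'"
  shows "ideal_cong S (c *\<^sub>C x) (c *\<^sub>C x')"
  using Idl_scaleC[of "x - x'" S c] assms
  by (simp add: ideal_cong_def scaleC_diff_right)


section \<open>Free algebras\<close>

text \<open>
  The free monoid is written additively because the convolution product of
  \<^type>\<open>poly_mapping\<close> is built on the additive structure of the index type.
\<close>

datatype 'g free_mon = Free_Mon (letters: "'g list")

instantiation free_mon :: (type) monoid_add
begin
definition zero_free_mon :: "'a free_mon" where
  "0 = Free_Mon []"
definition plus_free_mon :: "'a free_mon \<Rightarrow> 'a free_mon \<Rightarrow> 'a free_mon" where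
  "v + w = Free_Mon (letters v @ letters w)"
instance
  by standard (simp_all add: zero_free_mon_def plus_free_mon_def)
end

type_synonym ('g, 'r) free_algebra = "'g free_mon \<Rightarrow>\<^sub>0 'r"

definition free_gen :: "'g \<Rightarrow> ('g, 'r::ring_1) free_algebra" where
  "free_gen g = Poly_Mapping.single (Free_Mon [g]) 1"

text \<open>The algebra homomorphism on the free algebra with prescribed values on the generators.\<close>

definition free_ext :: "('g \<Rightarrow> 'a::complex_algebra_1) \<Rightarrow> ('g, complex) free_algebra \<Rightarrow> 'a" where
  "free_ext f p =
    (\<Sum>w\<in>Poly_Mapping.keys p. Poly_Mapping.lookup p w *\<^sub>C prod_list (map f (letters w)))"

lemma free_ext_superset:
  assumes "finite K" "Poly_Mapping.keys p \<subseteq> K"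
  shows "free_ext f p = (\<Sum>w\<in>K. Poly_Mapping.lookup p w *\<^sub>C prod_list (map f (letters w)))"
  unfolding free_ext_def using assms by (intro sum.mono_neutral_left) (auto simp: in_keys_iff)

lemma free_ext_single: "free_ext f (Poly_Mapping.single w c) = c *\<^sub>C prod_list (map f (letters w))"
  by (subst free_ext_superset[of "{w}"]) auto

lemma free_ext_gen: "free_ext f (free_gen g) = f g"
  by (simp add: free_gen_def free_ext_single scaleC_one)

lemma free_ext_one: "free_ext f 1 = 1"
  using free_ext_single[of f 0 1] by (simp add: scaleC_one) (simp add: zero_free_mon_def)

lemma free_ext_zero: "free_ext f 0 = 0"
  by (simp add: free_ext_def)

lemma free_ext_add: "free_ext f (p + q) = free_ext f p + free_ext f q"
proof -
  let ?K = "Poly_Mapping.keys p \<union> Poly_Mapping.keys q"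
  have "Poly_Mapping.keys (p + q) \<subseteq> ?K" by (rule Poly_Mapping.keys_add)
  then show ?thesis
    by (simp add: free_ext_superset[of ?K] lookup_add scaleC_add_left sum.distrib)
qed

lemma free_ext_scaleC: "free_ext f (c *\<^sub>C p) = c *\<^sub>C free_ext f p"
  by (induction p rule: poly_mapping_induct_single)
    (simp_all add: free_ext_zero free_ext_add free_ext_single scaleC_single scaleC_add_right
      scaleC_scaleC scaleC_complex_def)

lemma free_ext_mult: "free_ext f (p * q) = free_ext f p * free_ext f q"
proof (induction p rule: poly_mapping_induct_single)
  case (single v c)
  show ?case
    by (induction q rule: poly_mapping_induct_single)
      (simp_all add: free_ext_zero free_ext_add free_ext_single mult_single distrib_left
        plus_free_mon_def mult_scaleC_left mult_scaleC_right scaleC_scaleC mult.commute)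
qed (simp_all add: free_ext_zero free_ext_add distrib_right)

lemma free_ext_minus: "free_ext f (p - q) = free_ext f p - free_ext f q"
  using free_ext_add[of f "p - q" q] by simp

lemma complex_algebra_hom_free_ext: "complex_algebra_hom (free_ext f)"
  by (simp add: complex_algebra_hom_def free_ext_one free_ext_add free_ext_mult free_ext_scaleC)


section \<open>Universal enveloping algebras\<close>

definition uea_relations :: "('g::complex_lie_algebra, complex) free_algebra set" where
  "uea_relations =
     {free_gen (x + y) - free_gen x - free_gen y | x y. True} \<union>
     {free_gen (c *\<^sub>C x) - c *\<^sub>C free_gen x | c x. True} \<union>
     {free_gen x * free_gen y - free_gen y * free_gen x - free_gen (lie x y) | x y. True}"

quotient_type (overloaded) 'g uea =
  "('g::complex_lie_algebra, complex) free_algebra" / "ideal_cong uea_relations"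
  by (rule equivp_ideal_cong)

instantiation uea :: (complex_lie_algebra) complex_algebra_1
begin
lift_definition zero_uea :: "'a uea" is 0 .
lift_definition one_uea :: "'a uea" is 1 .
lift_definition plus_uea :: "'a uea \<Rightarrow> 'a uea \<Rightarrow> 'a uea" is "(+)" by (rule ideal_cong_add)
lift_definition minus_uea :: "'a uea \<Rightarrow> 'a uea \<Rightarrow> 'a uea" is "(-)" by (rule ideal_cong_diff)
lift_definition uminus_uea :: "'a uea \<Rightarrow> 'a uea" is "uminus" by (rule ideal_cong_uminus)
lift_definition times_uea :: "'a uea \<Rightarrow> 'a uea \<Rightarrow> 'a uea" is "(*)" by (rule ideal_cong_mult)
lift_definition scaleC_uea :: "complex \<Rightarrow> 'a uea \<Rightarrow> 'a uea" is "(*\<^sub>C)" by (rule ideal_cong_scaleC)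
instance
proof
  show "(0 :: 'a uea) \<noteq> 1"
  proof
    assume "(0 :: 'a uea) = 1"
    then have "ideal_cong (uea_relations :: ('a, complex) free_algebra set) 0 1"
      by (simp add: zero_uea_def one_uea_def uea.abs_eq_iff)
    then have "- 1 \<in> Idl\<^bsub>ring_of_type_algebra\<^esub> (uea_relations :: ('a, complex) free_algebra set)"
      by (simp add: ideal_cong_def)
    then have "free_ext (\<lambda>_::'a. 0::complex) (- 1) = 0"
      by (rule Idl_subset_kernel[rotated 3])
        (auto simp: free_ext_add free_ext_mult free_ext_minus free_ext_gen free_ext_scaleC
          uea_relations_def)
    then show False
      using free_ext_minus[of "\<lambda>_::'a. 0::complex" 0 1] by (simp add: free_ext_one free_ext_zero)
  qed
qed (transfer; simp add: algebra_simps scaleC_add_right scaleC_add_left scaleC_scaleC scaleC_one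
    mult_scaleC_left mult_scaleC_right ideal_cong_def Idl_zero)+
end

lift_definition uea_incl :: "'g::complex_lie_algebra \<Rightarrow> 'g uea" is free_gen .

lemma uea_incl_add: "uea_incl (x + y) = uea_incl x + uea_incl y"
  by transfer (rule ideal_cong_base, auto simp: uea_relations_def algebra_simps)

lemma uea_incl_scaleC: "uea_incl (c *\<^sub>C x) = c *\<^sub>C uea_incl x"
  by transfer (rule ideal_cong_base, auto simp: uea_relations_def)

lemma uea_incl_lie: "commutator (uea_incl x) (uea_incl y) = uea_incl (lie x y)"
  unfolding commutator_def
  by transfer (rule ideal_cong_base, auto simp: uea_relations_def)


section \<open>Tensor products of algebras\<close>

text \<open>
  The multiplicative monoid of \<open>A \<times> B\<close>, written additively. Its monoid algebra is the free vector
  space on \<open>A \<times> B\<close> with \<open>(a, b) (a', b') = (a a', b b')\<close>. There the span of the bilinearity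
  relations below is already a two-sided ideal, so that the quotient by the ideal they generate is
  the usual tensor product over the complex numbers.
\<close>

datatype ('a, 'b) pair_mon = Pair_Mon 'a 'b

instantiation pair_mon :: (monoid_mult, monoid_mult) monoid_add
begin
definition zero_pair_mon :: "('a, 'b) pair_mon" where
  "0 = Pair_Mon 1 1"
fun plus_pair_mon :: "('a, 'b) pair_mon \<Rightarrow> ('a, 'b) pair_mon \<Rightarrow> ('a, 'b) pair_mon" where
  "Pair_Mon a b + Pair_Mon a' b' = Pair_Mon (a * a') (b * b')"
instance
proof
  fix u v w :: "('a, 'b) pair_mon"
  show "u + v + w = u + (v + w)" "0 + u = u" "u + 0 = u"
    by (cases u; cases v; cases w; simp add: zero_pair_mon_def mult.assoc)+
qed
end

definition free_pair :: "'a \<Rightarrow> 'b \<Rightarrow> ('a, 'b) pair_mon \<Rightarrow>\<^sub>0 complex" where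
  "free_pair a b = Poly_Mapping.single (Pair_Mon a b) 1"

definition tensor_relations ::
    "(('a::complex_algebra_1, 'b::complex_algebra_1) pair_mon \<Rightarrow>\<^sub>0 complex) set" where
  "tensor_relations =
     {free_pair (a + a') b - free_pair a b - free_pair a' b | a a' b. True} \<union>
     {free_pair a (b + b') - free_pair a b - free_pair a b' | a b b'. True} \<union>
     {free_pair (c *\<^sub>C a) b - c *\<^sub>C free_pair a b | c a b. True} \<union>
     {free_pair a (c *\<^sub>C b) - c *\<^sub>C free_pair a b | c a b. True}"

quotient_type (overloaded) ('a, 'b) tensor_algebra_product =
  "('a::complex_algebra_1, 'b::complex_algebra_1) pair_mon \<Rightarrow>\<^sub>0 complex" /
  "ideal_cong tensor_relations"
  by (rule equivp_ideal_cong)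

lemma exists_linear_functional:
  "\<exists>g :: 'a::complex_algebra_1 \<Rightarrow> complex.
     (\<forall>x y. g (x + y) = g x + g y) \<and> (\<forall>c x. g (c *\<^sub>C x) = c * g x) \<and> g 1 = 1"
proof -
  interpret V: vector_space "scaleC :: complex \<Rightarrow> 'a \<Rightarrow> 'a"
    by unfold_locales (simp_all add: scaleC_add_right scaleC_add_left scaleC_scaleC scaleC_one)
  interpret W: vector_space "(*) :: complex \<Rightarrow> complex \<Rightarrow> complex"
    by unfold_locales (simp_all add: algebra_simps)
  interpret VW: vector_space_pair "scaleC :: complex \<Rightarrow> 'a \<Rightarrow> 'a" "(*) :: complex \<Rightarrow> complex \<Rightarrow> complex" ..
  have "V.independent {1}" by simp
  from VW.linear_independent_extend[OF this, of "\<lambda>_. 1"]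
  obtain g where g: "Vector_Spaces.linear (*\<^sub>C) (*) g" "g (1::'a) = 1" by auto
  interpret g: Vector_Spaces.linear "(*\<^sub>C)" "(*)" g by fact
  show ?thesis using g(2) g.add g.scale by blast
qed

lemma tensor_relations_proper:
  "1 \<notin> Idl\<^bsub>ring_of_type_algebra\<^esub>
     (tensor_relations :: (('a::complex_algebra_1, 'b::complex_algebra_1) pair_mon \<Rightarrow>\<^sub>0 complex) set)"
proof -
  obtain g :: "'a \<Rightarrow> complex" where g: "\<And>x y. g (x + y) = g x + g y" "\<And>c x. g (c *\<^sub>C x) = c * g x" "g 1 = 1"
    using exists_linear_functional by blast
  obtain h :: "'b \<Rightarrow> complex" where h: "\<And>x y. h (x + y) = h x + h y" "\<And>c x. h (c *\<^sub>C x) = c * h x" "h 1 = 1"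
    using exists_linear_functional by blast
  define t where "t m = (case m of Pair_Mon a b \<Rightarrow> g a * h b)" for m :: "('a, 'b) pair_mon"
  define L where "L p = (\<Sum>m\<in>Poly_Mapping.keys p. Poly_Mapping.lookup p m * t m)"
    for p :: "('a, 'b) pair_mon \<Rightarrow>\<^sub>0 complex"
  have L_superset: "L p = (\<Sum>m\<in>K. Poly_Mapping.lookup p m * t m)"
    if "finite K" "Poly_Mapping.keys p \<subseteq> K" for p K
    unfolding L_def using that by (intro sum.mono_neutral_left) (auto simp: in_keys_iff)
  have L_single: "L (Poly_Mapping.single m c) = c * t m" for m c
    by (subst L_superset[of "{m}"]) auto
  have L_add: "L (p + q) = L p + L q" for p q
    using Poly_Mapping.keys_add[of p q]
    by (simp add: L_superset[of "Poly_Mapping.keys p \<union> Poly_Mapping.keys q"] lookup_add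
        distrib_right sum.distrib)
  have L_scaleC: "L (c *\<^sub>C p) = c * L p" for c p
    by (induction p rule: poly_mapping_induct_single)
      (simp_all add: L_def[of 0] L_add L_single scaleC_single scaleC_add_right scaleC_complex_def
        distrib_left)
  have L_0: "L 0 = 0" by (simp add: L_def)
  have L_minus: "L (p - q) = L p - L q" for p q
    using L_add[of "p - q" q] by simp
  define J where "J = {p. \<forall>u v. L (u * p * v) = 0}"
  have "ideal J ring_of_type_algebra"
    unfolding ideal_UNIV_iff J_def
    by (auto simp: L_0 L_add algebra_simps) (metis mult.assoc)+
  moreover have "r \<in> J" if "r \<in> tensor_relations" for r
  proof -
    have "L (u * r * v) = 0" for u v
    proof (induction u rule: poly_mapping_induct_single)
      case (single k c)
      show ?case
      proof (induction v rule: poly_mapping_induct_single)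
        case (single l d)
        obtain x y z w where kl: "k = Pair_Mon x y" "l = Pair_Mon z w"
          by (cases k; cases l)
        have key: "L (Poly_Mapping.single k c * free_pair a b * Poly_Mapping.single l d) =
            c * d * g (x * a * z) * h (y * b * w)" for a b
          by (simp add: kl free_pair_def mult_single L_single t_def)
        from that show ?case
          unfolding tensor_relations_def
          by (elim UnE CollectE exE conjE, simp_all add: left_diff_distrib right_diff_distrib L_minus
              L_scaleC key mult_scaleC_left mult_scaleC_right distrib_left distrib_right g h)
      qed (simp_all add: L_0 L_add distrib_left)
    qed (simp_all add: L_0 L_add distrib_right)
    then show ?thesis by (simp add: J_def)
  qed
  ultimately have "Idl\<^bsub>ring_of_type_algebra\<^esub> tensor_relations \<subseteq> J"
    by (intro ring.genideal_minimal[OF ring_ring_of_type_algebra]) auto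
  moreover have "L (1 * 1 * 1) = 1"
    using L_single[of 0 1] by simp (simp add: t_def zero_pair_mon_def g h)
  then have "1 \<notin> J"
    unfolding J_def by (metis (mono_tags, lifting) mem_Collect_eq zero_neq_one)
  ultimately show ?thesis by blast
qed

instantiation tensor_algebra_product :: (complex_algebra_1, complex_algebra_1) complex_algebra_1
begin
lift_definition zero_tensor_algebra_product :: "('a, 'b) tensor_algebra_product" is 0 .
lift_definition one_tensor_algebra_product :: "('a, 'b) tensor_algebra_product" is 1 .
lift_definition plus_tensor_algebra_product ::
  "('a, 'b) tensor_algebra_product \<Rightarrow> ('a, 'b) tensor_algebra_product \<Rightarrow> ('a, 'b) tensor_algebra_product"
  is "(+)" by (rule ideal_cong_add)
lift_definition minus_tensor_algebra_product ::
  "('a, 'b) tensor_algebra_product \<Rightarrow> ('a, 'b) tensor_algebra_product \<Rightarrow> ('a, 'b) tensor_algebra_product"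
  is "(-)" by (rule ideal_cong_diff)
lift_definition uminus_tensor_algebra_product ::
  "('a, 'b) tensor_algebra_product \<Rightarrow> ('a, 'b) tensor_algebra_product"
  is "uminus" by (rule ideal_cong_uminus)
lift_definition times_tensor_algebra_product ::
  "('a, 'b) tensor_algebra_product \<Rightarrow> ('a, 'b) tensor_algebra_product \<Rightarrow> ('a, 'b) tensor_algebra_product"
  is "(*)" by (rule ideal_cong_mult)
lift_definition scaleC_tensor_algebra_product ::
  "complex \<Rightarrow> ('a, 'b) tensor_algebra_product \<Rightarrow> ('a, 'b) tensor_algebra_product"
  is "(*\<^sub>C)" by (rule ideal_cong_scaleC)
instance
proof
  show "(0 :: ('a, 'b) tensor_algebra_product) \<noteq> 1"
  proof
    assume "(0 :: ('a, 'b) tensor_algebra_product) = 1"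
    then have "ideal_cong (tensor_relations :: (('a, 'b) pair_mon \<Rightarrow>\<^sub>0 complex) set) 0 1"
      by (simp add: zero_tensor_algebra_product_def one_tensor_algebra_product_def
          tensor_algebra_product.abs_eq_iff)
    then have "- 1 \<in> Idl\<^bsub>ring_of_type_algebra\<^esub> (tensor_relations :: (('a, 'b) pair_mon \<Rightarrow>\<^sub>0 complex) set)"
      by (simp add: ideal_cong_def)
    from Idl_minus[OF this] show False
      using tensor_relations_proper[where 'a = 'a and 'b = 'b] by simp
  qed
qed (transfer; simp add: algebra_simps scaleC_add_right scaleC_add_left scaleC_scaleC scaleC_one
    mult_scaleC_left mult_scaleC_right ideal_cong_def Idl_zero)+
end

lift_definition tensor ::
  "'a::complex_algebra_1 \<Rightarrow> 'b::complex_algebra_1 \<Rightarrow> ('a, 'b) tensor_algebra_product"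
  is free_pair .

lemma tensor_add_left: "tensor (a + a') b = tensor a b + tensor a' b"
  by transfer (rule ideal_cong_base, unfold tensor_relations_def diff_diff_eq[symmetric], blast)

lemma tensor_add_right: "tensor a (b + b') = tensor a b + tensor a b'"
  by transfer (rule ideal_cong_base, unfold tensor_relations_def diff_diff_eq[symmetric], blast)

lemma tensor_scaleC_left: "tensor (c *\<^sub>C a) b = c *\<^sub>C tensor a b"
  by transfer (rule ideal_cong_base, unfold tensor_relations_def, blast)

lemma tensor_scaleC_right: "tensor a (c *\<^sub>C b) = c *\<^sub>C tensor a b"
  by transfer (rule ideal_cong_base, unfold tensor_relations_def, blast)

lemma tensor_mult: "tensor a b * tensor a' b' = tensor (a * a') (b * b')"
  by transfer (simp add: free_pair_def mult_single ideal_cong_def Idl_zero)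

lemma tensor_one: "tensor 1 1 = 1"
  by transfer (simp add: free_pair_def ideal_cong_def Idl_zero flip: zero_pair_mon_def)

lemma tensor_diff_left: "tensor (a - a') b = tensor a b - tensor a' b"
  using tensor_add_left[of "a - a'" a' b] by simp

lemma tensor_diff_right: "tensor a (b - b') = tensor a b - tensor a b'"
  using tensor_add_right[of a "b - b'" b'] by simp


section \<open>The coproduct of a universal enveloping algebra\<close>

lift_definition coproduct ::
  "'g::complex_lie_algebra uea \<Rightarrow> ('g uea, 'g uea) tensor_algebra_product"
  is "free_ext (\<lambda>x. tensor (uea_incl x) 1 + tensor 1 (uea_incl x))"
proof -
  fix p q :: "('g, complex) free_algebra"
  let ?d = "\<lambda>x::'g. tensor (uea_incl x) 1 + tensor 1 (uea_incl x)"
  have lie: "?d x * ?d y - ?d y * ?d x = ?d (lie x y)" for x y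
    by (simp add: algebra_simps tensor_mult flip: uea_incl_lie)
      (simp add: commutator_def tensor_diff_left tensor_diff_right)
  assume "ideal_cong uea_relations p q"
  then have "p - q \<in> Idl\<^bsub>ring_of_type_algebra\<^esub> uea_relations"
    by (simp add: ideal_cong_def)
  then have "free_ext ?d (p - q) = 0"
    by (rule Idl_subset_kernel[rotated 3])
      (auto simp: free_ext_add free_ext_mult free_ext_minus free_ext_gen free_ext_scaleC
        uea_relations_def lie uea_incl_add uea_incl_scaleC tensor_add_left tensor_add_right
        tensor_scaleC_left tensor_scaleC_right scaleC_add_right)
  then show "free_ext ?d p = free_ext ?d q"
    by (simp add: free_ext_minus)
qed

lemma coproduct_incl: "coproduct (uea_incl x) = tensor (uea_incl x) 1 + tensor 1 (uea_incl x)"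
  by transfer (rule free_ext_gen)

lemma complex_algebra_hom_coproduct: "complex_algebra_hom coproduct"
  unfolding complex_algebra_hom_def
  by (intro conjI allI; transfer) (simp_all add: free_ext_one free_ext_add free_ext_mult free_ext_scaleC)


section \<open>The Lie algebra \<open>sl(3)\<close>\<close>

lemma mat_add: "mat c + mat d = (mat (c + d) :: complex^3^3)"
  by (simp add: mat_def vec_eq_iff)

lemma mat_uminus: "- mat c = (mat (- c) :: complex^3^3)"
  by (simp add: mat_def vec_eq_iff)

lemma mat_diff: "mat c - mat d = (mat (c - d) :: complex^3^3)"
  by (simp add: mat_def vec_eq_iff)

lemma mat_zero: "mat 0 = (0 :: complex^3^3)"
  by (simp add: mat_def vec_eq_iff)

definition matrix_scale :: "complex \<Rightarrow> complex^3^3 \<Rightarrow> complex^3^3" where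
  "matrix_scale c x = (\<chi> i j. c * x $ i $ j)"

lemma matrix_scale_mat: "matrix_scale c (mat d) = mat (c * d)"
  by (simp add: mat_def matrix_scale_def vec_eq_iff)

lemma matrix_scale_add: "matrix_scale c (x + y) = matrix_scale c x + matrix_scale c y"
  by (simp add: matrix_scale_def vec_eq_iff distrib_left)

lemma matrix_scale_add_scalar: "matrix_scale (c + d) x = matrix_scale c x + matrix_scale d x"
  by (simp add: matrix_scale_def vec_eq_iff distrib_right)

lemma matrix_scale_diff: "matrix_scale c (x - y) = matrix_scale c x - matrix_scale c y"
  by (simp add: matrix_scale_def vec_eq_iff right_diff_distrib)

lemma matrix_mult_mat_left: "mat c ** (x :: complex^3^3) = matrix_scale c x"
  by (simp add: matrix_matrix_mult_def mat_def matrix_scale_def vec_eq_iff if_distrib if_distribR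
      sum.delta' cong: if_cong)

lemma matrix_mult_mat_right: "(x :: complex^3^3) ** mat c = matrix_scale c x"
  by (simp add: matrix_matrix_mult_def mat_def matrix_scale_def vec_eq_iff if_distrib if_distribR
      sum.delta' mult.commute cong: if_cong)

lemma matrix_mult_scale_left: "matrix_scale c x ** y = matrix_scale c (x ** y)"
  by (simp add: matrix_matrix_mult_def matrix_scale_def vec_eq_iff sum_distrib_left mult.assoc)

lemma matrix_mult_scale_right: "x ** matrix_scale c y = matrix_scale c (x ** y)"
  by (simp add: matrix_matrix_mult_def matrix_scale_def vec_eq_iff sum_distrib_left mult.left_commute)

lemma matrix_mult_add_left: "(x + y) ** z = x ** z + (y ** z :: complex^3^3)"
  by (simp add: matrix_matrix_mult_def vec_eq_iff sum.distrib distrib_right)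

lemma matrix_mult_diff_left: "(x - y) ** z = x ** z - (y ** z :: complex^3^3)"
  by (simp add: matrix_matrix_mult_def vec_eq_iff sum_subtractf left_diff_distrib)

lemma matrix_mult_diff_right: "x ** (y - z) = x ** y - (x ** z :: complex^3^3)"
  by (simp add: matrix_matrix_mult_def vec_eq_iff sum_subtractf right_diff_distrib)

definition sl3_rel :: "complex^3^3 \<Rightarrow> complex^3^3 \<Rightarrow> bool" where
  "sl3_rel x y \<longleftrightarrow> (\<exists>c. x = y + mat c)"

lemma sl3_relI: "x = y + mat c \<Longrightarrow> sl3_rel x y"
  by (auto simp: sl3_rel_def)

lemma sl3_rel_refl: "sl3_rel x x"
  by (rule sl3_relI[of _ _ 0]) (simp add: mat_def vec_eq_iff)

text \<open>\<open>sl(3)\<close> as the quotient of \<open>gl(3)\<close> by the scalar matrices.\<close>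

quotient_type sl3 = "complex^3^3" / sl3_rel
proof (rule equivpI)
  show "reflp sl3_rel"
    by (rule reflpI) (rule sl3_rel_refl)
  show "symp sl3_rel"
  proof (rule sympI)
    fix x y assume "sl3_rel x y"
    then obtain c where "x = y + mat c" by (auto simp: sl3_rel_def)
    then have "y = x + mat (- c)" by (simp flip: mat_uminus)
    then show "sl3_rel y x" by (rule sl3_relI)
  qed
  show "transp sl3_rel"
  proof (rule transpI)
    fix x y z assume "sl3_rel x y" "sl3_rel y z"
    then obtain c d where "x = y + mat c" "y = z + mat d" by (auto simp: sl3_rel_def)
    then have "x = z + mat (d + c)" by (simp add: add.assoc flip: mat_add)
    then show "sl3_rel x z" by (rule sl3_relI)
  qed
qed

instantiation sl3 :: complex_lie_algebra
begin
lift_definition zero_sl3 :: sl3 is 0 .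
lift_definition plus_sl3 :: "sl3 \<Rightarrow> sl3 \<Rightarrow> sl3" is "(+)"
  by (unfold sl3_rel_def, elim exE, rule_tac x = "c + ca" in exI)
    (simp add: algebra_simps flip: mat_add)
lift_definition uminus_sl3 :: "sl3 \<Rightarrow> sl3" is uminus
  by (unfold sl3_rel_def, elim exE, rule_tac x = "- c" in exI) (simp flip: mat_uminus)
lift_definition minus_sl3 :: "sl3 \<Rightarrow> sl3 \<Rightarrow> sl3" is "(-)"
  by (unfold sl3_rel_def, elim exE, rule_tac x = "c - ca" in exI)
    (simp add: algebra_simps flip: mat_diff)
lift_definition scaleC_sl3 :: "complex \<Rightarrow> sl3 \<Rightarrow> sl3" is matrix_scale
  by (unfold sl3_rel_def, elim exE, rule_tac x = "complex * c" in exI)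
    (simp add: matrix_scale_add matrix_scale_mat)
lift_definition lie_sl3 :: "sl3 \<Rightarrow> sl3 \<Rightarrow> sl3" is "\<lambda>x y. x ** y - y ** x"
  by (unfold sl3_rel_def, elim exE, rule_tac x = 0 in exI)
    (simp add: matrix_mult_add_left matrix_add_ldistrib matrix_mult_mat_left matrix_mult_mat_right
      matrix_scale_add matrix_scale_mat mat_zero mult.commute)
instance
proof
  fix x y z :: sl3 and c d :: complex
  show "x + y + z = x + (y + z)" by transfer (simp add: add.assoc sl3_rel_refl)
  show "x + y = y + x" by transfer (simp add: add.commute sl3_rel_refl)
  show "0 + x = x" by transfer (simp add: sl3_rel_refl)
  show "- x + x = 0" by transfer (simp add: sl3_rel_refl)
  show "x - y = x + - y" by transfer (simp add: sl3_rel_refl)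
  show "c *\<^sub>C (x + y) = c *\<^sub>C x + c *\<^sub>C y"
    by transfer (simp add: matrix_scale_add sl3_rel_refl)
  show "(c + d) *\<^sub>C x = c *\<^sub>C x + d *\<^sub>C x"
    by transfer (simp add: matrix_scale_add_scalar sl3_rel_refl)
  show "c *\<^sub>C d *\<^sub>C x = (c * d) *\<^sub>C x"
    by transfer (simp add: matrix_scale_def mult.assoc sl3_rel_refl)
  show "1 *\<^sub>C x = x" by transfer (simp add: matrix_scale_def sl3_rel_refl)
  show "lie (x + y) z = lie x z + lie y z" "lie z (x + y) = lie z x + lie z y"
    by (transfer; simp add: matrix_mult_add_left matrix_add_ldistrib sl3_rel_refl add_diff_add)+
  show "lie (c *\<^sub>C x) y = c *\<^sub>C lie x y" "lie x (c *\<^sub>C y) = c *\<^sub>C lie x y"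
    by (transfer; simp add: matrix_mult_scale_left matrix_mult_scale_right matrix_scale_diff
        sl3_rel_refl)+
  show "lie x x = 0" by transfer (simp add: sl3_rel_refl)
  show "lie x (lie y z) + lie y (lie z x) + lie z (lie x y) = 0"
    by transfer (simp add: matrix_mult_diff_left matrix_mult_diff_right matrix_mul_assoc
        algebra_simps sl3_rel_refl)
qed
end

lift_definition sl3_unit :: "3 \<Rightarrow> 3 \<Rightarrow> sl3"
  is "\<lambda>p q. \<chi> i j. if i = p \<and> j = q then 1 else 0" .

lemma lie_sl3_unit:
  "lie (sl3_unit p q) (sl3_unit r s) =
    (if q = r then sl3_unit p s else 0) - (if s = p then sl3_unit r q else 0)"
proof -
  define E :: "3 \<Rightarrow> 3 \<Rightarrow> complex^3^3" where "E p q = (\<chi> i j. if i = p \<and> j = q then 1 else 0)" for p q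
  have E: "E p q ** E r s = (if q = r then E p s else 0)" for p q r s
  proof -
    have "(\<Sum>k\<in>UNIV. E p q $ i $ k * E r s $ k $ j) = (if q = r then E p s else 0) $ i $ j" for i j
    proof -
      have "(\<Sum>k\<in>UNIV. E p q $ i $ k * E r s $ k $ j) =
          (\<Sum>k\<in>UNIV. if k = q then (if i = p \<and> q = r \<and> j = s then 1 else 0) else 0)"
        by (rule sum.cong) (simp_all add: E_def)
      also have "\<dots> = (if i = p \<and> q = r \<and> j = s then 1 else 0)"
        by (subst sum.delta) simp_all
      also have "\<dots> = (if q = r then E p s else 0) $ i $ j"
        by (cases "q = r") (simp_all add: E_def)
      finally show ?thesis .
    qed
    then show ?thesis
      by (simp add: matrix_matrix_mult_def vec_eq_iff)
  qed
  have "sl3_unit p q = abs_sl3 (E p q)" for p q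
    by (simp add: sl3_unit.abs_eq E_def)
  then show ?thesis
    by (simp add: lie_sl3.abs_eq minus_sl3.abs_eq zero_sl3.abs_eq E)
qed

lemma sl3_unit_trace: "(\<Sum>p\<in>UNIV. sl3_unit p p) = 0"
proof -
  have "sl3_unit 1 1 + sl3_unit 2 2 + sl3_unit 3 3 = 0"
    by transfer (rule sl3_relI[of _ _ 1], simp add: mat_def vec_eq_iff forall_3)
  then show ?thesis by (simp add: sum_3)
qed


section \<open>The algebra \<open>Z\<^sub>2(sl(3))\<close>\<close>

type_synonym U2 = "(sl3 uea, sl3 uea) tensor_algebra_product"

definition gen :: "3 \<Rightarrow> 3 \<Rightarrow> sl3 uea" where
  "gen p q = uea_incl (sl3_unit p q)"

text \<open>The two copies are indexed by the type \<open>2\<close>, whose elements are \<open>1\<close> and \<open>2 = 0\<close>.\<close>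

definition copy_gen :: "2 \<Rightarrow> 3 \<Rightarrow> 3 \<Rightarrow> U2" where
  "copy_gen a p q = (if a = 1 then tensor (gen p q) 1 else tensor 1 (gen p q))"

lemma coproduct_gen: "coproduct (gen p q) = copy_gen 1 p q + copy_gen 2 p q"
  by (simp add: gen_def copy_gen_def coproduct_incl)

text \<open>The list \<open>is\<close> holds the summation indices \<open>i\<^sub>1, \<dots>, i\<^sub>d\<close>; the index after \<open>i\<^sub>d\<close> is \<open>i\<^sub>1\<close>.\<close>

definition polarised_trace :: "2 list \<Rightarrow> U2" where
  "polarised_trace as =
    (\<Sum>is | length is = length as.
      prod_list (map (\<lambda>j. copy_gen (as ! j) (is ! (Suc j mod length as)) (is ! j)) [0..<length as]))"

definition Z2_sl3 :: "U2 set" where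
  "Z2_sl3 = generated_subalgebra {polarised_trace as | as. as \<noteq> []}"

definition casimir2 :: "sl3 uea" where
  "casimir2 = (\<Sum>i\<^sub>1\<in>UNIV. \<Sum>i\<^sub>2\<in>UNIV. gen i\<^sub>2 i\<^sub>1 * gen i\<^sub>1 i\<^sub>2)"

definition casimir3 :: "sl3 uea" where
  "casimir3 = (\<Sum>i\<^sub>1\<in>UNIV. \<Sum>i\<^sub>2\<in>UNIV. \<Sum>i\<^sub>3\<in>UNIV. gen i\<^sub>2 i\<^sub>1 * gen i\<^sub>3 i\<^sub>2 * gen i\<^sub>1 i\<^sub>3)"

definition casimir3_bar :: "sl3 uea" where
  "casimir3_bar = (\<Sum>i\<^sub>1\<in>UNIV. \<Sum>i\<^sub>2\<in>UNIV. \<Sum>i\<^sub>3\<in>UNIV. gen i\<^sub>1 i\<^sub>2 * gen i\<^sub>2 i\<^sub>3 * gen i\<^sub>3 i\<^sub>1)"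

definition kU :: "3 \<Rightarrow> U2" where
  "kU i = (if i = 1 then tensor casimir2 1 else if i = 2 then tensor 1 casimir2
    else coproduct casimir2)"

definition lU :: "3 \<Rightarrow> U2" where
  "lU i = (let c = (1/2) *\<^sub>C (casimir3 + casimir3_bar) in
    if i = 1 then tensor c 1 else if i = 2 then tensor 1 c else - coproduct c)"

definition X_elem :: U2 where
  "X_elem = (1/2) *\<^sub>C (polarised_trace [1,1,2] - polarised_trace [1,2,2])
    + (1/3) *\<^sub>C (lU 1 - lU 2)"

definition Y_elem :: U2 where
  "Y_elem = polarised_trace [1,1,2,2]
    + (3/2) *\<^sub>C (polarised_trace [1,1,2] + polarised_trace [1,2,2])
    - (1/12) *\<^sub>C (polarised_trace [1,2])\<^sup>2
    - (5/12) *\<^sub>C (polarised_trace [1,1] * polarised_trace [2,2])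
    + (5/2) *\<^sub>C polarised_trace [1,2]"

definition Z_elem :: U2 where
  "Z_elem = commutator X_elem Y_elem"


section \<open>The polynomial ring of central parameters\<close>

datatype param = Par_k 3 | Par_l 3

type_synonym params = "(param \<Rightarrow>\<^sub>0 nat) \<Rightarrow>\<^sub>0 complex"

definition kp :: "3 \<Rightarrow> params" where
  "kp i = Poly_Mapping.single (Poly_Mapping.single (Par_k i) 1) 1"

definition lp :: "3 \<Rightarrow> params" where
  "lp i = Poly_Mapping.single (Poly_Mapping.single (Par_l i) 1) 1"

primrec perm_param :: "(3 \<Rightarrow> 3) \<Rightarrow> param \<Rightarrow> param" where
  "perm_param \<pi> (Par_k i) = Par_k (\<pi> i)"
| "perm_param \<pi> (Par_l i) = Par_l (\<pi> i)"

text \<open>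
  The coefficient of \<open>\<pi> p\<close> at a monomial \<open>m\<close> is the coefficient of \<open>p\<close> at the monomial \<open>m \<circ> \<pi>\<close>,
  so that \<open>\<pi>\<close> sends the variable with index \<open>i\<close> to the one with index \<open>\<pi> i\<close>.
\<close>

definition perm_poly :: "(3 \<Rightarrow> 3) \<Rightarrow> params \<Rightarrow> params" where
  "perm_poly \<pi> = Poly_Mapping.map_key (Poly_Mapping.map_key (perm_param \<pi>))"

definition Sym_plus :: "params \<Rightarrow> params" where
  "Sym_plus p = (1/6) *\<^sub>C (\<Sum>\<pi> | \<pi> permutes UNIV. perm_poly \<pi> p)"

definition Sym_minus :: "params \<Rightarrow> params" where
  "Sym_minus p = (1/6) *\<^sub>C (\<Sum>\<pi> | \<pi> permutes UNIV. of_int (sign \<pi>) * perm_poly \<pi> p)"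

lemma inj_perm_param:
  assumes "\<pi> permutes UNIV"
  shows "inj (perm_param \<pi>)"
proof (rule injI)
  fix x y assume "perm_param \<pi> x = perm_param \<pi> y"
  with permutes_inj[OF assms] show "x = y"
    by (cases x; cases y) (auto dest: injD)
qed

lemma inv_perm_param:
  assumes "\<pi> permutes UNIV"
  shows "perm_param \<pi> (perm_param (Hilbert_Choice.inv \<pi>) x) = x"
  using permutes_inverses[OF assms] by (cases x) auto

lemma inj_map_key_perm_param:
  assumes "\<pi> permutes UNIV"
  shows "inj (Poly_Mapping.map_key (perm_param \<pi>) :: (param \<Rightarrow>\<^sub>0 nat) \<Rightarrow> _)"
proof (rule inj_on_inverseI)
  fix m :: "param \<Rightarrow>\<^sub>0 nat"
  have "perm_param \<pi> \<circ> perm_param (Hilbert_Choice.inv \<pi>) = (\<lambda>x. x)"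
    using inv_perm_param[OF assms] by (simp add: fun_eq_iff)
  then show "Poly_Mapping.map_key (perm_param (Hilbert_Choice.inv \<pi>)) (Poly_Mapping.map_key (perm_param \<pi>) m) = m"
    using inj_perm_param[OF assms] inj_perm_param[OF permutes_inv[OF assms]]
    by (simp add: Poly_Mapping.map_key_compose Poly_Mapping.map_key_id)
qed

lemma perm_poly_single:
  assumes "\<pi> permutes UNIV"
  shows "perm_poly \<pi> (Poly_Mapping.single m c) =
    Poly_Mapping.single (Poly_Mapping.map_key (perm_param (Hilbert_Choice.inv \<pi>)) m) c"
proof -
  have "perm_param (Hilbert_Choice.inv \<pi>) \<circ> perm_param \<pi> = (\<lambda>x. x)"
    using inv_perm_param[OF permutes_inv[OF assms]] permutes_inv_inv[OF assms]
    by (simp add: fun_eq_iff)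
  then have "Poly_Mapping.map_key (perm_param \<pi>) (Poly_Mapping.map_key (perm_param (Hilbert_Choice.inv \<pi>)) m) = m"
    using inj_perm_param[OF assms] inj_perm_param[OF permutes_inv[OF assms]]
    by (simp add: Poly_Mapping.map_key_compose Poly_Mapping.map_key_id)
  then show ?thesis
    unfolding perm_poly_def
    by (metis Poly_Mapping.map_key_single[OF inj_map_key_perm_param[OF assms]])
qed

lemma perm_poly_kp: "\<pi> permutes UNIV \<Longrightarrow> perm_poly \<pi> (kp i) = kp (\<pi> i)"
  and perm_poly_lp: "\<pi> permutes UNIV \<Longrightarrow> perm_poly \<pi> (lp i) = lp (\<pi> i)"
proof -
  assume p: "\<pi> permutes UNIV"
  have "Poly_Mapping.map_key (perm_param (Hilbert_Choice.inv \<pi>)) (Poly_Mapping.single x (1::nat)) =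
      Poly_Mapping.single (perm_param \<pi> x) 1" for x
    using Poly_Mapping.map_key_single[OF inj_perm_param[OF permutes_inv[OF p]], of "perm_param \<pi> x"]
      inv_perm_param[OF permutes_inv[OF p], of x] permutes_inv_inv[OF p] by simp
  then show "perm_poly \<pi> (kp i) = kp (\<pi> i)" "perm_poly \<pi> (lp i) = lp (\<pi> i)"
    by (simp_all add: kp_def lp_def perm_poly_single[OF p])
qed

lemma perm_poly_zero: "\<pi> permutes UNIV \<Longrightarrow> perm_poly \<pi> 0 = 0"
  by (simp add: perm_poly_def inj_map_key_perm_param)

lemma perm_poly_add: "\<pi> permutes UNIV \<Longrightarrow> perm_poly \<pi> (p + q) = perm_poly \<pi> p + perm_poly \<pi> q"
  by (simp add: perm_poly_def inj_map_key_perm_param Poly_Mapping.map_key_plus)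

lemma perm_poly_mult:
  assumes p: "\<pi> permutes UNIV"
  shows "perm_poly \<pi> (p * q) = perm_poly \<pi> p * perm_poly \<pi> q"
proof (induction p rule: poly_mapping_induct_single)
  case (single m c)
  show ?case
    by (induction q rule: poly_mapping_induct_single)
      (simp_all add: perm_poly_zero[OF p] perm_poly_add[OF p] distrib_left mult_single
        perm_poly_single[OF p] Poly_Mapping.map_key_plus[OF inj_perm_param[OF permutes_inv[OF p]]])
qed (simp_all add: perm_poly_zero[OF p] perm_poly_add[OF p] distrib_right)

lemma perm_poly_scaleC:
  assumes p: "\<pi> permutes UNIV"
  shows "perm_poly \<pi> (c *\<^sub>C q) = c *\<^sub>C perm_poly \<pi> q"
  by (induction q rule: poly_mapping_induct_single)
    (simp_all add: perm_poly_zero[OF p] perm_poly_add[OF p] scaleC_add_right scaleC_single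
      perm_poly_single[OF p])

abbreviation (input) "k1 \<equiv> kp 1"
abbreviation (input) "k2 \<equiv> kp 2"
abbreviation (input) "k3 \<equiv> kp 3"
abbreviation (input) "l1 \<equiv> lp 1"
abbreviation (input) "l2 \<equiv> lp 2"
abbreviation (input) "l3 \<equiv> lp 3"

definition a2 :: params where
  "a2 = (1/2) *\<^sub>C (k1 + k2 + k3)"

definition a5 :: params where
  "a5 = Sym_minus (2 * k2 * l1)"

definition a6 :: params where
  "a6 = Sym_plus (
      (1/16) *\<^sub>C (- (k1^3) + 2 * k1^2 * k2 - 6 * k1 * k2 * k3)
    + (3/8) *\<^sub>C (k1^2 - 2 * k1 * k2)
    + (1/6) *\<^sub>C l1^2
    - (5/3) *\<^sub>C (l1 * l2))"

definition a8 :: params where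
  "a8 = Sym_plus (
      (1/128) *\<^sub>C (k1^4 - 8 * k1^3 * k2 + 6 * k1^2 * k2^2 + 4 * k1^2 * k2 * k3)
    - (1/32) *\<^sub>C (3 * k1^3 - 6 * k1^2 * k2 + 2 * k1 * k2 * k3)
    - (1/24) *\<^sub>C (k1 * (l1^2 - 6 * l2^2 + 4 * l1 * l2 - 26 * l2 * l3))
    + (1/2) *\<^sub>C l1^2
    + l1 * l2)"

definition a9 :: params where
  "a9 = Sym_minus (l2 * (
    - ((4/9) *\<^sub>C l1^2)
    + (1/24) *\<^sub>C (k1^3 - 2 * k1^2 * k2 + k1 * k2^2 + 9 * k1^2 * k3)
    + (1/2) *\<^sub>C (k1^2 - k1 * k2)))"

definition a12 :: params where
  "a12 = Sym_plus (
      (1/4608) *\<^sub>C k1^6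
    - (1/768) *\<^sub>C (k1^5 * (1 + 2 * k2))
    + (1/768) *\<^sub>C (k1^4 * (- 39 + 6 * k2 + 5 * k2^2 + 3 * k2 * k3))
    - (1/1152) *\<^sub>C (k1^3 * (- 648 - 468 * k2 + 6 * k2^2 + 5 * k2^3 - 6 * k2 * k3
        + 6 * k2^2 * k3 + 2 * l1^2 + 8 * l1 * l2 - 12 * l2^2 + 140 * l2 * l3))
    - (1/2304) *\<^sub>C (k1^2 * (2592 * k2 + 702 * k2^2 + 468 * k2 * k3 + 42 * k2^2 * k3
        + k2^2 * k3^2 - 40 * l1^2 - 40 * k2 * l1^2 + 416 * l1 * l2 - 16 * k2 * l1 * l2
        + 144 * k3 * l1 * l2 - 464 * l2^2 + 56 * k2 * l2^2 - 360 * k3 * l2^2 - 560 * l2 * l3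
        - 720 * k3 * l2 * l3))
    - (1/288) *\<^sub>C (k1 * (- 108 * k2 * k3 - 24 * l1^2 + 68 * k2 * l1^2 + 17 * k2 * k3 * l1^2
        - 672 * l1 * l2 - 52 * k2 * l1 * l2 - 296 * k3 * l1 * l2 - 2 * k2 * k3 * l1 * l2
        - 48 * l2^2 - 206 * k3 * l2^2 + 1392 * l2 * l3))
    + (1/432) *\<^sub>C (l1 * (- 864 * l1 + l1^3 - 1728 * l2 + 24 * l1^2 * l2 - 26 * l1 * l2^2
        + 244 * l1 * l2 * l3)))"


section \<open>The algebra \<open>\<A>\<close>\<close>

datatype abc = Gen_A | Gen_B | Gen_C

definition A_relations :: "(abc, params) free_algebra set" where
  "A_relations = (let
      A = free_gen Gen_A; B = free_gen Gen_B; C = free_gen Gen_C;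
      \<kappa> = (\<lambda>p. Poly_Mapping.single 0 p)
    in {commutator A B - C,
        commutator A C - (- 6 * B^2 + \<kappa> a2 * A^2 + \<kappa> a5 * A + \<kappa> a8),
        commutator B C - (- 2 * A^3 - \<kappa> a2 * anticommutator A B - \<kappa> a5 * B + \<kappa> a6 * A + \<kappa> a9)})"

quotient_type alg_A = "(abc, params) free_algebra" / "ideal_cong A_relations"
  by (rule equivp_ideal_cong)

text \<open>The constant term is an algebra homomorphism killing all relations, hence \<open>0 \<noteq> 1\<close> in \<open>\<A>\<close>.\<close>

lemma lookup_zero_mult:
  fixes p q :: "'m::monoid_add \<Rightarrow>\<^sub>0 'r::semiring_0"
  assumes m: "\<And>u v :: 'm. u + v = 0 \<longleftrightarrow> u = 0 \<and> v = 0"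
  shows "Poly_Mapping.lookup (p * q) 0 = Poly_Mapping.lookup p 0 * Poly_Mapping.lookup q 0"
proof (induction p rule: poly_mapping_induct_single)
  case (single u c)
  show ?case
    by (induction q rule: poly_mapping_induct_single)
      (simp_all add: mult_single lookup_single when_def m lookup_add distrib_left)
qed (simp_all add: lookup_add distrib_right)

definition const_param :: "params \<Rightarrow> complex" where
  "const_param p = Poly_Mapping.lookup p 0"

lemma monomial_sum_zero_iff: "u + v = 0 \<longleftrightarrow> u = 0 \<and> v = 0" for u v :: "param \<Rightarrow>\<^sub>0 nat"
  by (auto simp: poly_mapping_eq_iff fun_eq_iff lookup_add)

lemma const_param_simps:
  "const_param 0 = 0" "const_param (p + q) = const_param p + const_param q"
  "const_param (p - q) = const_param p - const_param q" "const_param (- p) = - const_param p"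
  "const_param (c *\<^sub>C p) = c * const_param p"
  "const_param (p * q) = const_param p * const_param q"
  "const_param (kp i) = 0" "const_param (lp i) = 0"
proof -
  have [simp]: "Poly_Mapping.single x (Suc 0) \<noteq> 0" for x :: param
    by (metis lookup_single_eq lookup_zero nat.distinct(1))
  show "const_param 0 = 0" "const_param (p + q) = const_param p + const_param q"
    "const_param (p - q) = const_param p - const_param q" "const_param (- p) = - const_param p"
    "const_param (c *\<^sub>C p) = c * const_param p"
    "const_param (p * q) = const_param p * const_param q"
    "const_param (kp i) = 0" "const_param (lp i) = 0"
    unfolding const_param_def
    by (simp_all add: lookup_add lookup_minus lookup_zero_mult monomial_sum_zero_iff kp_def lp_def
    lookup_single when_def scaleC_poly_mapping.rep_eq scaleC_complex_def)
qed

lemma const_param_power: "const_param p = 0 \<Longrightarrow> n > 0 \<Longrightarrow> const_param (p ^ n) = 0"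
  by (cases n) (simp_all add: const_param_simps)

lemma const_param_sum: "const_param (sum f S) = (\<Sum>x\<in>S. const_param (f x))"
  by (induction S rule: infinite_finite_induct) (simp_all add: const_param_simps)

lemma const_param_perm_poly: "\<pi> permutes UNIV \<Longrightarrow> const_param (perm_poly \<pi> p) = const_param p"
  by (simp add: const_param_def perm_poly_def Poly_Mapping.map_key.rep_eq inj_map_key_perm_param
      inj_perm_param)

lemma const_param_Sym: "const_param p = 0 \<Longrightarrow> const_param (Sym_plus p) = 0"
    "const_param p = 0 \<Longrightarrow> const_param (Sym_minus p) = 0"
  by (simp_all add: Sym_plus_def Sym_minus_def const_param_simps const_param_sum
      const_param_perm_poly)

lemma const_param_a8: "const_param a8 = 0" and const_param_a9: "const_param a9 = 0"
  unfolding a8_def a9_def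
  by (rule const_param_Sym; simp add: const_param_simps const_param_power)+

lemma A_relations_proper: "1 \<notin> Idl\<^bsub>ring_of_type_algebra\<^esub> A_relations"
proof
  define \<epsilon> where "\<epsilon> p = const_param (Poly_Mapping.lookup p 0)" for p :: "(abc, params) free_algebra"
  have word: "u + v = 0 \<longleftrightarrow> u = 0 \<and> v = 0" for u v :: "abc free_mon"
    by (cases u; cases v) (auto simp: zero_free_mon_def plus_free_mon_def)
  have add: "\<epsilon> (p + q) = \<epsilon> p + \<epsilon> q" for p q
    by (simp add: \<epsilon>_def lookup_add const_param_simps)
  have diff: "\<epsilon> (p - q) = \<epsilon> p - \<epsilon> q" for p q
    by (simp add: \<epsilon>_def lookup_minus const_param_simps)
  have mult: "\<epsilon> (p * q) = \<epsilon> p * \<epsilon> q" for p q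
    by (simp add: \<epsilon>_def lookup_zero_mult word const_param_simps)
  have minus: "\<epsilon> (- p) = - \<epsilon> p" for p
    by (simp add: \<epsilon>_def const_param_simps)
  have gen: "\<epsilon> (free_gen g) = 0" for g
    by (simp add: \<epsilon>_def free_gen_def lookup_single zero_free_mon_def when_def const_param_simps)
  have coeff: "\<epsilon> (Poly_Mapping.single 0 p) = const_param p" for p
    by (simp add: \<epsilon>_def)
  assume "1 \<in> Idl\<^bsub>ring_of_type_algebra\<^esub> A_relations"
  then have "\<epsilon> 1 = 0"
    by (rule Idl_subset_kernel[OF add mult, rotated])
      (auto simp: A_relations_def Let_def commutator_def anticommutator_def add diff minus mult gen coeff
        power2_eq_square power3_eq_cube const_param_a8 const_param_a9)
  moreover have "\<epsilon> 1 = 1"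
    by (simp add: \<epsilon>_def const_param_def lookup_one)
  ultimately show False by simp
qed

instantiation alg_A :: complex_algebra_1
begin
lift_definition zero_alg_A :: alg_A is 0 .
lift_definition one_alg_A :: alg_A is 1 .
lift_definition plus_alg_A :: "alg_A \<Rightarrow> alg_A \<Rightarrow> alg_A" is "(+)" by (rule ideal_cong_add)
lift_definition minus_alg_A :: "alg_A \<Rightarrow> alg_A \<Rightarrow> alg_A" is "(-)" by (rule ideal_cong_diff)
lift_definition uminus_alg_A :: "alg_A \<Rightarrow> alg_A" is "uminus" by (rule ideal_cong_uminus)
lift_definition times_alg_A :: "alg_A \<Rightarrow> alg_A \<Rightarrow> alg_A" is "(*)" by (rule ideal_cong_mult)
lift_definition scaleC_alg_A :: "complex \<Rightarrow> alg_A \<Rightarrow> alg_A" is "(*\<^sub>C)" by (rule ideal_cong_scaleC)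
instance
proof
  show "(0 :: alg_A) \<noteq> 1"
  proof
    assume "(0 :: alg_A) = 1"
    then have "- 1 \<in> Idl\<^bsub>ring_of_type_algebra\<^esub> A_relations"
      by (simp add: zero_alg_A_def one_alg_A_def alg_A.abs_eq_iff ideal_cong_def)
    from Idl_minus[OF this] show False
      using A_relations_proper by simp
  qed
qed (transfer; simp add: algebra_simps scaleC_add_right scaleC_add_left scaleC_scaleC scaleC_one
    mult_scaleC_left mult_scaleC_right ideal_cong_def Idl_zero)+
end

definition coeff_A :: "params \<Rightarrow> alg_A" where
  "coeff_A p = abs_alg_A (Poly_Mapping.single 0 p)"

lift_definition A_A :: alg_A is "free_gen Gen_A" .
lift_definition B_A :: alg_A is "free_gen Gen_B" .
lift_definition C_A :: alg_A is "free_gen Gen_C" .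

lemma numeral_alg_A: "numeral n = abs_alg_A (numeral n)"
  by (induction n) (simp_all only: numeral.simps one_alg_A_def plus_alg_A.abs_eq)

lemmas alg_A_abs_eq = coeff_A_def A_A.abs_eq B_A.abs_eq C_A.abs_eq numeral_alg_A
  plus_alg_A.abs_eq minus_alg_A.abs_eq uminus_alg_A.abs_eq times_alg_A.abs_eq

lemma commutator_A_B: "commutator A_A B_A = C_A"
  unfolding commutator_def alg_A_abs_eq alg_A.abs_eq_iff
  by (rule ideal_cong_base) (unfold A_relations_def commutator_def Let_def, blast)

lemma commutator_A_C:
  "commutator A_A C_A = - 6 * B_A^2 + coeff_A a2 * A_A^2 + coeff_A a5 * A_A + coeff_A a8"
  unfolding commutator_def power2_eq_square alg_A_abs_eq alg_A.abs_eq_iff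
  by (rule ideal_cong_base) (unfold A_relations_def commutator_def power2_eq_square Let_def, blast)

lemma commutator_B_C:
  "commutator B_A C_A = - 2 * A_A^3 - coeff_A a2 * anticommutator A_A B_A - coeff_A a5 * B_A
    + coeff_A a6 * A_A + coeff_A a9"
  unfolding commutator_def anticommutator_def power3_eq_cube alg_A_abs_eq alg_A.abs_eq_iff
  by (rule ideal_cong_base)
    (unfold A_relations_def commutator_def anticommutator_def power3_eq_cube Let_def, blast)

definition Omega :: alg_A where
  "Omega = (let
      x1 = 6 * a5 + 2 * a9;
      x2 = - 2 * a6 - 2 * a8;
      x3 = 6 * a2 + a6;
      x4 = - a5;
      x5 = 8 * a2 - 24;
      x7 = - 2 * a2 + 12
    in coeff_A x1 * A_A + coeff_A x2 * B_A + coeff_A x3 * A_A^2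
      + coeff_A x4 * anticommutator A_A B_A + coeff_A x5 * B_A^2
      + coeff_A x7 * (A_A * B_A * A_A) - A_A^4 + 4 * B_A^3 + C_A^2)"

end

theory Submission
  imports Defs "HOL-Computational_Algebra.Polynomial" "HOL-Computational_Algebra.Fundamental_Theorem_Algebra" "HOL-Algebra.QuotRing"
begin

text \<open>
  Modulo products of shorter traces, antisymmetrisation over four indices with three values expresses all
  polarised traces by \<open>k\<^sub>i\<close>, \<open>l\<^sub>i\<close>, \<open>X\<close>, \<open>Y\<close> and one trace \<open>s\<close> of length 6, whose square is reducible as well. So
  \<open>Z\<^sub>2(sl(3))\<close> is spanned by the products \<open>f(k, l) Y\<^sup>j X\<^sup>i s\<^sup>e\<close> with \<open>e \<le> 1\<close>. It acts on the singular vectors in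
  a tensor product of a Verma module and a module of functions. On one-parameter families of such vectors
  the \<open>k\<^sub>i\<close>, \<open>l\<^sub>i\<close> are scalars, which can be prescribed, while \<open>X\<close> and \<open>Y\<close> are second order difference operators.
  Their leading coefficients show that the \<open>f(k, l) Y\<^sup>j X\<^sup>i Z\<^sup>e\<close> are independent, so that \<open>Z\<close> can replace \<open>s\<close>, and
  that an element acting without shifts, or commuting with \<open>X\<close> and \<open>Y\<close>, is a polynomial in \<open>k\<close>, \<open>l\<close>. This applies
  to \<open>[X, Z] + 6 Y\<^sup>2 - a\<^sub>2 X\<^sup>2 - a\<^sub>5 X\<close>, to its counterpart for \<open>[Y, Z]\<close> and to \<open>\<Omega>\<close>. The polynomials \<open>a\<^sub>8\<close>, \<open>a\<^sub>9\<close>, \<open>a\<^sub>1\<^sub>2\<close> are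
  found on a hypersurface of parameters where \<open>X\<close>, \<open>Y\<close>, \<open>Z\<close> have a common eigenvector; its degree in \<open>l\<^sub>1\<close> exceeds
  that of the polynomials in question. Finally \<open>\<A>/(\<Omega> - a\<^sub>1\<^sub>2)\<close> is spanned by the same normal forms.
\<close>

section \<open>Full contractions\<close>

text \<open>Weighted filtrations take the place of dimension counts. The weights 2, 3, 3, 4, 6 of
  \<open>k\<close>, \<open>l\<close>, \<open>X\<close>, \<open>Y\<close>, \<open>s\<close> are trace
  lengths, commutators lose one unit of weight, and \<open>Z\<close> has weight 3 + 4 - 1 = 6; so
  every reduction may be done modulo lower terms. One scheme, \<open>sorted_filtration\<close>,
  yields the normal forms three times: inside the tensor product with \<open>s_elem\<close> and with
  \<open>Z_elem\<close>, and in the abstract algebra modulo \<open>Omega - a12\<close>. Spanning on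
  the abstract side meets independence on the concrete side, so no kernel is left. The shape of the
  last part comes from the size of the identities: the diagonal parts of the commutator relations
  and the value of \<open>Omega\<close> are never compared at a generic point of a line. They are
  shown to be scalars of bounded weight, after which special points suffice. Linear systems between
  traces are solved by applying real-valued functionals, because equations between real numbers are
  accessible to simplification and linear arithmetic. Verma indices and exponents are complex
  numbers, so coefficients are polynomials in them and parameters can take any complex
  value.\<close>

abbreviation "ptrace \<equiv> polarised_trace"

text \<open>Adjacent transpositions generate all rearrangements: the head of the first list is
  carried to its place in the second, and the tail is treated by induction behind the growing prefix
  \<open>ws\<close>. Swaps are demanded only for rearrangements of \<open>xs\<close>, since the
  relation it is applied to needs its lists to stay closed.\<close>

lemma rel_of_mset_eq:
  assumes mset: "mset xs = mset ys"
    and refl: "\<And>as. R as as" and trans: "\<And>as bs cs. R as bs \<Longrightarrow> R bs cs \<Longrightarrow> R as cs"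
    and swap: "\<And>us x y vs. mset (us @ x # y # vs) = mset xs \<Longrightarrow> R (us @ x # y # vs) (us @ y # x # vs)"
  shows "R xs ys"
proof -
  have move: "R (ws @ x # us @ vs) (ws @ us @ x # vs)"
    if "mset (ws @ x # us @ vs) = mset xs" for ws x us vs
    using that
  proof (induction us arbitrary: ws)
    case Nil
    show ?case by (simp add: refl)
  next
    case (Cons u us)
    have "R (ws @ x # u # us @ vs) (ws @ u # x # us @ vs)"
      using Cons.prems by (intro swap) simp
    moreover have "R ((ws @ [u]) @ x # us @ vs) ((ws @ [u]) @ us @ x # vs)"
      using Cons.prems by (intro Cons.IH) (simp add: add_mset_commute[of x u])
    ultimately show ?case using trans by simp
  qed
  have "R (ws @ as) (ws @ bs)" if "mset as = mset bs" "mset (ws @ as) = mset xs" for ws as bs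
    using that
  proof (induction as arbitrary: ws bs)
    case Nil
    then show ?case by (simp add: refl)
  next
    case (Cons a as)
    then have "a \<in> set bs"
      by (metis list.set_intros(1) set_mset_mset)
    then obtain us vs where bs: "bs = us @ a # vs"
      by (meson split_list)
    have "R ((ws @ [a]) @ as) ((ws @ [a]) @ us @ vs)"
      using Cons.prems bs by (intro Cons.IH) auto
    moreover have "R (ws @ a # us @ vs) (ws @ us @ a # vs)"
      using Cons.prems bs by (intro move) auto
    ultimately show ?case unfolding bs using trans by simp
  qed
  from this[of xs ys "[]"] mset show ?thesis by simp
qed

lemma uea_incl_zero: "uea_incl 0 = 0"
  using uea_incl_add[of 0 0] by simp

lemma uea_incl_diff: "uea_incl (x - y) = uea_incl x - uea_incl y"
  using uea_incl_add[of "x - y" y] by simp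

lemma gen_commute:
  "gen p q * gen r s - gen r s * gen p q =
    (if q = r then gen p s else 0) - (if s = p then gen r q else 0)"
  using uea_incl_lie[of "sl3_unit p q" "sl3_unit r s"]
  by (auto simp: commutator_def gen_def lie_sl3_unit uea_incl_diff uea_incl_zero)

lemma gen_trace: "gen 1 1 + gen 2 2 + gen 3 3 = 0"
proof -
  have "uea_incl (sl3_unit 1 1 + sl3_unit 2 2 + sl3_unit 3 3) = uea_incl 0"
    using sl3_unit_trace unfolding sum_3 by (rule arg_cong)
  then show ?thesis by (simp only: gen_def uea_incl_add uea_incl_zero)
qed

lemma tensor_zero [simp]: "tensor 0 b = 0" "tensor a 0 = 0"
  using tensor_add_left[of 0 0 b] tensor_add_right[of a 0 0] by simp_all

lemma copy_gen_commute:
  "copy_gen a p q * copy_gen b r s - copy_gen b r s * copy_gen a p q =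
    (if a = b then (if q = r then copy_gen a p s else 0) - (if s = p then copy_gen a r q else 0) else 0)"
proof (cases "a = b")
  case True
  have "copy_gen a p q * copy_gen a r s - copy_gen a r s * copy_gen a p q =
      (if a = 1 then tensor (gen p q * gen r s - gen r s * gen p q) 1
       else tensor 1 (gen p q * gen r s - gen r s * gen p q))"
    by (simp add: copy_gen_def tensor_mult tensor_diff_left tensor_diff_right)
  then show ?thesis
    unfolding gen_commute using True by (simp add: copy_gen_def tensor_diff_left tensor_diff_right)
next
  case False
  then have "a = 1 \<and> b = 2 \<or> a = 2 \<and> b = 1"
    using exhaust_2[of a] exhaust_2[of b] by auto
  with False show ?thesis
    by (auto simp: copy_gen_def tensor_mult)
qed

lemma copy_gen_trace: "copy_gen a 1 1 + copy_gen a 2 2 + copy_gen a 3 3 = 0"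
  using arg_cong[OF gen_trace, of "\<lambda>x. tensor x (1 :: sl3 uea)"]
    arg_cong[OF gen_trace, of "\<lambda>x. tensor (1 :: sl3 uea) x"]
  by (simp add: copy_gen_def tensor_add_left tensor_add_right)

type_synonym entry = "2 \<times> nat \<times> nat"

definition ent :: "(nat \<Rightarrow> 3) \<Rightarrow> entry \<Rightarrow> U2" where
  "ent idx e = (case e of (a, x, y) \<Rightarrow> copy_gen a (idx y) (idx x))"

abbreviation ent_in :: "entry \<Rightarrow> nat" where "ent_in e \<equiv> fst (snd e)"
abbreviation ent_out :: "entry \<Rightarrow> nat" where "ent_out e \<equiv> snd (snd e)"

definition names :: "entry list \<Rightarrow> nat set" where
  "names L = ent_in ` set L"

text \<open>
  A list of entries stands for the ordered product of the \<open>F\<^sub>x\<^sub>y = e\<^sub>y\<^sub>x\<close> it names, summed over all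
  values of the names. It is a full contraction when each name occurs once as a row and once as a
  column index.
\<close>

definition closed_list :: "entry list \<Rightarrow> bool" where
  "closed_list L \<longleftrightarrow> distinct (map ent_in L) \<and> distinct (map ent_out L) \<and> ent_out ` set L = ent_in ` set L"

definition contract :: "entry list \<Rightarrow> U2" where
  "contract L = (\<Sum>idx\<in>names L \<rightarrow>\<^sub>E UNIV. prod_list (map (ent idx) L))"

lemma finite_names [simp]: "finite (names L)"
  by (simp add: names_def)

lemma finite_index_maps [simp]: "finite N \<Longrightarrow> finite (N \<rightarrow>\<^sub>E (UNIV :: 3 set))"
  by (simp add: finite_PiE)

lemma closed_list_mset:
  assumes "mset L = mset L'"
  shows "closed_list L \<longleftrightarrow> closed_list L'"
proof -
  have "distinct (map f L) \<longleftrightarrow> distinct (map f L')" for f :: "entry \<Rightarrow> nat"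
    using assms by (intro mset_eq_imp_distinct_iff) simp
  moreover have "set L = set L'"
    using assms by (rule mset_eq_setD)
  ultimately show ?thesis by (simp add: closed_list_def)
qed

lemma names_mset: "mset L = mset L' \<Longrightarrow> names L = names L'"
  unfolding names_def by (drule mset_eq_setD) simp

definition rename :: "(nat \<Rightarrow> nat) \<Rightarrow> entry \<Rightarrow> entry" where
  "rename \<rho> e = (case e of (a, x, y) \<Rightarrow> (a, \<rho> x, \<rho> y))"

lemma ent_rename: "ent idx (rename \<rho> e) = ent (idx \<circ> \<rho>) e"
  by (cases e) (simp add: ent_def rename_def)

lemma ent_cong: "idx (ent_in e) = idx' (ent_in e) \<Longrightarrow> idx (ent_out e) = idx' (ent_out e) \<Longrightarrow> ent idx e = ent idx' e"
  by (cases e) (simp add: ent_def)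

lemma prod_ent_cong:
  "(\<And>x. x \<in> ent_in ` set L \<union> ent_out ` set L \<Longrightarrow> idx x = idx' x) \<Longrightarrow>
    prod_list (map (ent idx) L) = prod_list (map (ent idx') L)"
  by (intro arg_cong[where f = prod_list] map_cong refl ent_cong) auto

text \<open>A Kronecker delta between two different names eliminates one of them. Together with the
  next lemma, for a name on which the summand does not depend, this turns commutators of matrix
  entries into shorter contractions.\<close>

lemma sum_identify_names:
  fixes g :: "(nat \<Rightarrow> 3) \<Rightarrow> 'a::comm_monoid_add"
  assumes N: "finite N" "x \<in> N" "y \<in> N" "x \<noteq> y"
    and g: "\<And>idx idx'. (\<And>z. z \<in> N \<Longrightarrow> idx z = idx' z) \<Longrightarrow> g idx = g idx'"
  shows "(\<Sum>idx\<in>N \<rightarrow>\<^sub>E UNIV. if idx x = idx y then g idx else 0) = (\<Sum>idx\<in>(N - {x}) \<rightarrow>\<^sub>E UNIV. g (idx(x := idx y)))"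
proof -
  have "(\<Sum>idx\<in>N \<rightarrow>\<^sub>E UNIV. if idx x = idx y then g idx else 0) = (\<Sum>idx\<in>{idx \<in> N \<rightarrow>\<^sub>E UNIV. idx x = idx y}. g idx)"
    using N by (intro sum.inter_filter[symmetric]) auto
  also have "\<dots> = (\<Sum>idx\<in>(N - {x}) \<rightarrow>\<^sub>E UNIV. g (idx(x := idx y)))"
  proof (rule sum.reindex_bij_witness[where i = "\<lambda>idx. idx(x := idx y)" and j = "\<lambda>idx. restrict idx (N - {x})"])
    fix idx :: "nat \<Rightarrow> 3" assume "idx \<in> {idx \<in> N \<rightarrow>\<^sub>E UNIV. idx x = idx y}"
    then show "(restrict idx (N - {x}))(x := restrict idx (N - {x}) y) = idx"
      using N by (auto simp: fun_eq_iff PiE_def extensional_def)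
    then show "g ((restrict idx (N - {x}))(x := restrict idx (N - {x}) y)) = g idx" by simp
  qed (use N in \<open>auto simp: PiE_def extensional_def fun_eq_iff\<close>)
  finally show ?thesis .
qed

lemma sum_free_name:
  fixes g :: "(nat \<Rightarrow> 3) \<Rightarrow> 'a::comm_monoid_add"
  assumes N: "finite N" "x \<in> N"
    and g: "\<And>idx idx'. (\<And>z. z \<in> N - {x} \<Longrightarrow> idx z = idx' z) \<Longrightarrow> g idx = g idx'"
  shows "(\<Sum>idx\<in>N \<rightarrow>\<^sub>E UNIV. g idx) = (\<Sum>c\<in>(UNIV::3 set). \<Sum>idx\<in>(N - {x}) \<rightarrow>\<^sub>E UNIV. g idx)"
proof -
  have "(\<Sum>idx\<in>N \<rightarrow>\<^sub>E UNIV. g idx) = (\<Sum>(c, idx)\<in>(UNIV::3 set) \<times> ((N - {x}) \<rightarrow>\<^sub>E UNIV). g idx)"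
  proof (rule sum.reindex_bij_witness[where i = "\<lambda>(c, idx). idx(x := c)" and j = "\<lambda>idx. (idx x, restrict idx (N - {x}))"])
    fix idx :: "nat \<Rightarrow> 3" assume idx: "idx \<in> N \<rightarrow>\<^sub>E UNIV"
    show "(case (idx x, restrict idx (N - {x})) of (c, idx) \<Rightarrow> idx(x := c)) = idx"
      using idx N by (auto simp: PiE_def extensional_def fun_eq_iff)
    show "(idx x, restrict idx (N - {x})) \<in> UNIV \<times> ((N - {x}) \<rightarrow>\<^sub>E UNIV)"
      by auto
    show "(case (idx x, restrict idx (N - {x})) of (c, idx) \<Rightarrow> g idx) = g idx"
      by (simp, rule g) simp
  next
    fix p :: "3 \<times> (nat \<Rightarrow> 3)" assume p: "p \<in> UNIV \<times> ((N - {x}) \<rightarrow>\<^sub>E UNIV)"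
    obtain c idx where p_eq: "p = (c, idx)" by (cases p)
    have "idx z = undefined" if "z \<notin> N - {x}" for z
      using p that unfolding p_eq PiE_def extensional_def by blast
    then show "(\<lambda>idx. (idx x, restrict idx (N - {x}))) (case p of (c, idx) \<Rightarrow> idx(x := c)) = p"
      by (auto simp: p_eq fun_eq_iff)
    show "(case p of (c, idx) \<Rightarrow> idx(x := c)) \<in> N \<rightarrow>\<^sub>E UNIV"
      using p N by (auto simp: p_eq PiE_def extensional_def)
  qed
  also have "\<dots> = (\<Sum>c\<in>(UNIV::3 set). \<Sum>idx\<in>(N - {x}) \<rightarrow>\<^sub>E UNIV. g idx)"
    by (rule sum.cartesian_product[symmetric])
  finally show ?thesis .
qed

section \<open>Contractions as combinations of products of traces\<close>

inductive trace_span :: "nat \<Rightarrow> U2 \<Rightarrow> bool" where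
  one: "trace_span 0 1"
| scale: "trace_span n x \<Longrightarrow> trace_span n (c *\<^sub>C x)"
| add: "trace_span n x \<Longrightarrow> trace_span n y \<Longrightarrow> trace_span n (x + y)"
| mono: "trace_span m x \<Longrightarrow> m \<le> n \<Longrightarrow> trace_span n x"
| mult: "as \<noteq> [] \<Longrightarrow> trace_span n x \<Longrightarrow> trace_span (length as + n) (ptrace as * x)"

lemma trace_span_zero: "trace_span n 0"
  using trace_span.mono[OF trace_span.scale[OF trace_span.one, of 0], of n] by simp

lemma scaleC_minus_one: "(-1) *\<^sub>C x = - x"
  using scaleC_add_left[of "-1" 1 x] by (simp add: scaleC_one eq_neg_iff_add_eq_0)

lemma trace_span_uminus: "trace_span n x \<Longrightarrow> trace_span n (- x)"
  using trace_span.scale[of n x "-1"] by (simp add: scaleC_minus_one)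

lemma trace_span_diff: "trace_span n x \<Longrightarrow> trace_span n y \<Longrightarrow> trace_span n (x - y)"
  using trace_span.add[of n x "- y"] trace_span_uminus[of n y] by simp

lemma trace_span_sum: "(\<And>i. i \<in> I \<Longrightarrow> trace_span n (f i)) \<Longrightarrow> trace_span n (sum f I)"
  by (induction I rule: infinite_finite_induct) (auto intro: trace_span_zero trace_span.add)

lemma trace_span_mult:
  assumes "trace_span m x" "trace_span n y"
  shows "trace_span (m + n) (x * y)"
  using assms
proof (induction rule: trace_span.induct)
  case one
  then show ?case by simp
next
  case (scale m x c)
  then show ?case by (simp add: mult_scaleC_left trace_span.scale)
next
  case (add m x x')
  then show ?case by (simp add: distrib_right trace_span.add)
next
  case (mono k x m)
  then show ?case by (auto intro: trace_span.mono[of "k + n"])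
next
  case (mult as m x)
  then show ?case
    using trace_span.mult[of as "m + n" "x * y"] by (simp add: mult.assoc add.assoc)
qed

lemma trace_span_trace: "as \<noteq> [] \<Longrightarrow> trace_span (length as) (ptrace as)"
  using trace_span.mult[OF _ trace_span.one, of as] by simp

definition loop :: "2 list \<Rightarrow> nat list \<Rightarrow> entry list" where
  "loop w ns = zip w (zip ns (tl ns @ [hd ns]))"

lemma loop_simps:
  assumes "length ns = length w" "w \<noteq> []"
  shows "map ent_in (loop w ns) = ns" "map ent_out (loop w ns) = tl ns @ [hd ns]"
    "length (loop w ns) = length w"
  using assms by (auto simp: loop_def intro!: nth_equalityI)

lemma trace_eq_contract_loop:
  assumes len: "length ns = length w" "w \<noteq> []" and "distinct ns"
  shows "contract (loop w ns) = ptrace w"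
proof -
  let ?d = "length w"
  have ns: "names (loop w ns) = set ns"
    using loop_simps(1)[OF len] unfolding names_def by (metis set_map)
  have nth: "(tl ns @ [hd ns]) ! j = ns ! (Suc j mod ?d)" if "j < ?d" for j
    using that len by (cases "Suc j = ?d"; cases ns) (auto simp: nth_append)
  have val: "prod_list (map (ent idx) (loop w ns)) =
      prod_list (map (\<lambda>j. copy_gen (w ! j) (map idx ns ! (Suc j mod ?d)) (map idx ns ! j)) [0..<?d])" for idx
  proof (intro arg_cong[where f = prod_list] nth_equalityI)
    fix j assume "j < length (map (ent idx) (loop w ns))"
    then have j: "j < ?d" by (simp add: loop_simps(3)[OF len])
    then have "Suc j mod ?d < length ns" using len by (metis mod_less_divisor length_greater_0_conv)
    then show "map (ent idx) (loop w ns) ! j = map (\<lambda>j. copy_gen (w ! j) (map idx ns ! (Suc j mod ?d)) (map idx ns ! j)) [0..<?d] ! j"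
      using j len nth[OF j] by (simp add: loop_def ent_def)
  qed (simp add: loop_simps(3)[OF len])
  show ?thesis
    unfolding contract_def polarised_trace_def ns val
  proof (rule sum.reindex_bij_witness[where j = "\<lambda>idx. map idx ns"
        and i = "\<lambda>is. restrict (\<lambda>n. the (map_of (zip ns is) n)) (set ns)"])
    fix idx :: "nat \<Rightarrow> 3" assume idx: "idx \<in> set ns \<rightarrow>\<^sub>E UNIV"
    show "restrict (\<lambda>n. the (map_of (zip ns (map idx ns)) n)) (set ns) = idx"
      using idx by (auto simp: fun_eq_iff map_of_zip_map PiE_def extensional_def)
    show "map idx ns \<in> {is. length is = ?d}" using len by simp
  next
    fix "is" :: "3 list" assume "is \<in> {is. length is = ?d}"
    then have l: "length is = length ns" using len by simp
    show "restrict (\<lambda>n. the (map_of (zip ns is) n)) (set ns) \<in> set ns \<rightarrow>\<^sub>E UNIV" by simp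
    show "map (restrict (\<lambda>n. the (map_of (zip ns is) n)) (set ns)) ns = is"
      using l assms by (intro nth_equalityI) (simp_all add: map_of_zip_nth)
  qed simp
qed

lemma contract_append:
  assumes "names L \<inter> names L' = {}" "closed_list L" "closed_list L'"
  shows "contract (L @ L') = contract L * contract L'"
proof -
  have out: "ent_out ` set L \<subseteq> names L" "ent_out ` set L' \<subseteq> names L'"
    using assms by (auto simp: closed_list_def names_def)
  have N: "names (L @ L') = names L \<union> names L'" by (auto simp: names_def)
  have "contract L * contract L' =
      (\<Sum>(f, g)\<in>(names L \<rightarrow>\<^sub>E UNIV) \<times> (names L' \<rightarrow>\<^sub>E UNIV). prod_list (map (ent f) L) * prod_list (map (ent g) L'))"
    unfolding contract_def by (simp add: sum_product sum.cartesian_product)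
  also have "\<dots> = contract (L @ L')"
    unfolding contract_def N
  proof (rule sum.reindex_bij_witness[where i = "\<lambda>idx. (restrict idx (names L), restrict idx (names L'))"
        and j = "\<lambda>(f, g) x. if x \<in> names L then f x else g x"])
    fix p :: "(nat \<Rightarrow> 3) \<times> (nat \<Rightarrow> 3)" assume p: "p \<in> (names L \<rightarrow>\<^sub>E UNIV) \<times> (names L' \<rightarrow>\<^sub>E UNIV)"
    obtain f g where fg: "p = (f, g)" by (cases p)
    have f: "f x = undefined" if "x \<notin> names L" for x
      using p that unfolding fg PiE_def extensional_def by blast
    have g: "g x = undefined" if "x \<notin> names L'" for x
      using p that unfolding fg PiE_def extensional_def by blast
    let ?h = "\<lambda>x. if x \<in> names L then f x else g x"
    have "restrict ?h (names L) = f" using f by (auto simp: fun_eq_iff)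
    moreover have "restrict ?h (names L') = g" using g assms(1) by (auto simp: fun_eq_iff)
    ultimately show "(\<lambda>idx. (restrict idx (names L), restrict idx (names L'))) (case p of (f, g) \<Rightarrow> \<lambda>x. if x \<in> names L then f x else g x) = p"
      by (simp add: fg)
    show "(case p of (f, g) \<Rightarrow> \<lambda>x. if x \<in> names L then f x else g x) \<in> names L \<union> names L' \<rightarrow>\<^sub>E UNIV"
      using g by (auto simp: fg PiE_def extensional_def)
    have "prod_list (map (ent ?h) L) = prod_list (map (ent f) L)"
      using out by (intro prod_ent_cong) (auto simp: names_def)
    moreover have "prod_list (map (ent ?h) L') = prod_list (map (ent g) L')"
      using out assms(1) by (intro prod_ent_cong) (auto simp: names_def)
    ultimately show "prod_list (map (ent (case p of (f, g) \<Rightarrow> \<lambda>x. if x \<in> names L then f x else g x)) (L @ L')) =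
        (case p of (f, g) \<Rightarrow> prod_list (map (ent f) L) * prod_list (map (ent g) L'))"
      by (simp add: fg)
  next
    fix idx :: "nat \<Rightarrow> 3" assume idx: "idx \<in> names L \<union> names L' \<rightarrow>\<^sub>E UNIV"
    then have "idx x = undefined" if "x \<notin> names L" "x \<notin> names L'" for x
      using that unfolding PiE_def extensional_def by blast
    then show "(case (restrict idx (names L), restrict idx (names L')) of (f, g) \<Rightarrow> \<lambda>x. if x \<in> names L then f x else g x) = idx"
      by (auto simp: fun_eq_iff)
  qed auto
  finally show ?thesis by simp
qed

lemma contract_Nil: "contract [] = 1"
  by (simp add: contract_def names_def)

lemma closed_list_loop: "length ns = length w \<Longrightarrow> w \<noteq> [] \<Longrightarrow> distinct ns \<Longrightarrow> closed_list (loop w ns)"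
  unfolding closed_list_def set_map[symmetric]
  by (cases ns) (auto simp: loop_simps simp del: set_map)

lemma names_loop: "length ns = length w \<Longrightarrow> w \<noteq> [] \<Longrightarrow> names (loop w ns) = set ns"
  using loop_simps(1)[of ns w] unfolding names_def by (metis set_map)

lemma closed_list_appendD:
  assumes LL': "closed_list (L @ L')" and L: "closed_list L"
  shows "closed_list L'" "names L \<inter> names L' = {}"
proof -
  have i: "ent_in ` set L \<inter> ent_in ` set L' = {}" and o: "ent_out ` set L \<inter> ent_out ` set L' = {}"
    and io: "ent_out ` set L \<union> ent_out ` set L' = ent_in ` set L \<union> ent_in ` set L'"
    and d: "distinct (map ent_in L')" "distinct (map ent_out L')"
    using LL' unfolding closed_list_def map_append distinct_append set_append image_Un set_map by simp_all
  have "ent_out ` set L = ent_in ` set L"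
    using L by (simp add: closed_list_def)
  moreover have "D = B" if "A \<inter> B = {}" "C \<inter> D = {}" "C \<union> D = A \<union> B" "C = A" for A B C D :: "nat set"
    using that by blast
  ultimately have "ent_out ` set L' = ent_in ` set L'"
    using i o io by metis
  with d show "closed_list L'" by (simp add: closed_list_def)
  from i show "names L \<inter> names L' = {}" by (simp add: names_def)
qed

text \<open>In a closed list the passage from the row name to the column name of an entry is a
  permutation of the names, and a loop is one of its cycles. The inner claim follows a path: it is
  prolonged by the entry of the rest \<open>R\<close> that starts at the open end \<open>y\<close>,
  until \<open>y\<close> is the first name.\<close>

lemma extract_loop:
  assumes "closed_list L" "L \<noteq> []"
  obtains w ns L' where "w \<noteq> []" "length ns = length w" "distinct ns" "mset L = mset (loop w ns @ L')"
proof -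
  have "\<exists>w ns L'. w \<noteq> [] \<and> length ns = length w \<and> distinct ns \<and> mset L = mset (loop w ns @ L')"
    if "w \<noteq> []" "length ns = length w" "mset L = mset (zip w (zip ns (tl ns @ [y])) @ R)" for w ns y R
    using that
  proof (induction R arbitrary: w ns y rule: measure_induct_rule[where f = length])
    case (less R)
    have ns: "ns \<noteq> []" using less.prems by auto
    let ?P = "zip w (zip ns (tl ns @ [y]))"
    have ins: "map ent_in ?P = ns" and outs: "map ent_out ?P = tl ns @ [y]"
      using less.prems by (auto intro!: nth_equalityI)
    have ins': "ent_in ` set ?P = set ns" and outs': "ent_out ` set ?P = set (tl ns @ [y])"
      using ins outs by (metis set_map)+
    have "closed_list (?P @ R)"
      using assms(1) closed_list_mset[OF less.prems(3)] by simp
    then have d: "distinct ns" "distinct (tl ns @ [y])"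
        "set (tl ns @ [y]) \<union> ent_out ` set R = set ns \<union> ent_in ` set R"
      unfolding closed_list_def map_append ins outs set_append image_Un ins' outs' by auto
    show ?case
    proof (cases "y = hd ns")
      case True
      then have "mset L = mset (loop w ns @ R)"
        using less.prems(3) by (simp add: loop_def)
      then show ?thesis using less.prems d(1) by blast
    next
      case False
      \<comment> \<open>Column names are distinct, so a path can return only to its first
        name.\<close>
      have "y \<notin> set ns"
        using False d(2) ns by (cases ns) auto
      then have "y \<in> ent_in ` set R" using d(3) by auto
      then obtain a z where "(a, y, z) \<in> set R" by auto
      then obtain R1 R2 where R: "R = R1 @ (a, y, z) # R2" by (meson split_list)
      have "zip (w @ [a]) (zip (ns @ [y]) (tl (ns @ [y]) @ [z])) = ?P @ [(a, y, z)]"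
        using ns less.prems zip_append[of ns "tl ns @ [y]" "[y]" "[z]"]
          zip_append[of w "zip ns (tl ns @ [y])" "[a]" "[(y, z)]"] by simp
      then have "mset L = mset (zip (w @ [a]) (zip (ns @ [y]) (tl (ns @ [y]) @ [z])) @ R1 @ R2)"
        using less.prems(3) R by (simp only: mset_append mset.simps) simp
      note * = this
      show ?thesis
        by (rule less.IH[OF _ _ _ *]) (use less.prems R in auto)
    qed
  qed
  moreover obtain a x y R where "L = (a, x, y) # R"
    using assms(2) by (cases L) auto
  then have "mset L = mset (zip [a] (zip [x] (tl [x] @ [y])) @ R)" by simp
  ultimately show ?thesis
    using that by (metis length_Cons list.distinct(1) list.size(3))
qed


text \<open>One half of the commutator of two entries of the same copy: a delta between the row name
  \<open>x\<close> of the first and the column name \<open>y'\<close> of the second, with one entry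
  less. If the names differ, the renaming \<open>\<rho>\<close> merges them. If they agree, the name
  disappears and leaves a factor 3, the trace of the identity matrix.\<close>

lemma closed_list_contract_name:
  assumes L: "closed_list (us @ (a, x, y) # (a, x', y') # vs)"
    and IH: "\<And>L'. closed_list L' \<Longrightarrow> length L' = n \<Longrightarrow> trace_span n (contract L')"
    and n: "n = length us + length vs + 1"
    and N: "N = names (us @ (a, x, y) # (a, x', y') # vs)"
  shows "trace_span n (\<Sum>idx\<in>N \<rightarrow>\<^sub>E UNIV. if idx x = idx y' then prod_list (map (ent idx) (us @ (a, x', y) # vs)) else 0)"
proof -
  let ?L = "us @ (a, x', y) # vs"
  let ?I = "ent_in ` set ?L" and ?O = "ent_out ` set ?L"
  have ins: "distinct (map ent_in ?L)" "x \<notin> ?I" and outs: "distinct (map ent_out ?L)" "y' \<notin> ?O"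
    and io: "insert y' ?O = insert x ?I"
    using L unfolding closed_list_def by (auto simp: image_Un)
  have NI: "N = insert x ?I" and N_fin: "finite N"
    unfolding N names_def by (auto simp: image_Un)
  then have NO: "N = insert y' ?O" using io by simp
  have N_x: "N - {x} = ?I" using NI ins(2) by auto
  have N_xy: "x \<in> N" "y' \<in> N" using NI NO by auto
  have len: "length ?L = n" using n by simp
  show ?thesis
  proof (cases "x = y'")
    case True
    have O_I: "?O = ?I" using NI NO ins(2) outs(2) True by (metis insert_ident)
    then have cl: "closed_list ?L" using ins outs by (simp add: closed_list_def)
    have "(\<Sum>idx\<in>N \<rightarrow>\<^sub>E UNIV. prod_list (map (ent idx) ?L)) =
        (\<Sum>c\<in>(UNIV::3 set). \<Sum>idx\<in>(N - {x}) \<rightarrow>\<^sub>E UNIV. prod_list (map (ent idx) ?L))"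
      using N_fin N_xy(1)
    proof (rule sum_free_name)
      fix idx idx' :: "nat \<Rightarrow> 3" assume "\<And>z. z \<in> N - {x} \<Longrightarrow> idx z = idx' z"
      then show "prod_list (map (ent idx) ?L) = prod_list (map (ent idx') ?L)"
        unfolding N_x using O_I by (intro prod_ent_cong) blast
    qed
    also have "\<dots> = (\<Sum>c\<in>(UNIV::3 set). contract ?L)"
      unfolding N_x contract_def names_def ..
    finally show ?thesis
      using True IH[OF cl len] by (simp only: refl if_True) (intro trace_span_sum)
  next
    case False
    define \<rho> where "\<rho> = (\<lambda>z. if z = x then y' else z)"
    have y'_I: "y' \<in> ?I" and x_O: "x \<in> ?O" using NI NO N_xy False by auto
    have \<rho>_in: "map ent_in (map (rename \<rho>) ?L) = map ent_in ?L"
    proof -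
      have "ent_in (rename \<rho> e) = ent_in e" if "e \<in> set ?L" for e
      proof -
        have "ent_in e \<noteq> x" using ins(2) that by blast
        then show ?thesis by (cases e) (simp add: rename_def \<rho>_def)
      qed
      then show ?thesis
        unfolding map_map by (intro map_cong refl) (simp only: comp_apply)
    qed
    have \<rho>_out: "map ent_out (map (rename \<rho>) ?L) = map \<rho> (map ent_out ?L)"
      unfolding map_map by (intro map_cong refl) (auto simp: rename_def)
    have "inj_on \<rho> ?O" using outs(2) by (auto simp: inj_on_def \<rho>_def)
    then have d_out: "distinct (map ent_out (map (rename \<rho>) ?L))"
      unfolding \<rho>_out using outs(1) by (simp only: distinct_map set_map)
    have "\<rho> ` ?O = insert y' (?O - {x})" using x_O outs(2) by (auto simp: \<rho>_def)
    also have "\<dots> = ?I" using NI NO False ins(2) outs(2) N_x by auto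
    finally have s_out: "ent_out ` set (map (rename \<rho>) ?L) = ?I"
      using \<rho>_out by (metis set_map)
    have s_in: "ent_in ` set (map (rename \<rho>) ?L) = ?I"
      using \<rho>_in by (metis set_map)
    have cl: "closed_list (map (rename \<rho>) ?L)"
      unfolding closed_list_def s_in s_out \<rho>_in using d_out ins(1) by blast
    have "(\<Sum>idx\<in>N \<rightarrow>\<^sub>E UNIV. if idx x = idx y' then prod_list (map (ent idx) ?L) else 0) =
        (\<Sum>idx\<in>(N - {x}) \<rightarrow>\<^sub>E UNIV. prod_list (map (ent (idx(x := idx y'))) ?L))"
      using N_fin N_xy False
    proof (rule sum_identify_names)
      fix idx idx' :: "nat \<Rightarrow> 3" assume "\<And>z. z \<in> N \<Longrightarrow> idx z = idx' z"
      then show "prod_list (map (ent idx) ?L) = prod_list (map (ent idx') ?L)"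
        using NI NO by (intro prod_ent_cong) blast
    qed
    also have "\<dots> = contract (map (rename \<rho>) ?L)"
    proof -
      have "idx(x := idx y') = idx \<circ> \<rho>" for idx :: "nat \<Rightarrow> 3" by (auto simp: \<rho>_def fun_eq_iff)
      then have "map (ent (idx(x := idx y'))) ?L = map (ent idx) (map (rename \<rho>) ?L)" for idx
        unfolding map_map by (intro map_cong refl) (simp only: comp_apply ent_rename)
      then show ?thesis
        unfolding contract_def names_def s_in N_x by (simp only:)
    qed
    finally show ?thesis
      using IH[OF cl] len by (simp only: length_map)
  qed
qed

lemma contract_swap:
  assumes L: "closed_list (us @ e # e' # vs)"
    and IH: "\<And>L'. closed_list L' \<Longrightarrow> length L' = n \<Longrightarrow> trace_span n (contract L')"
    and n: "n = length us + length vs + 1"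
  shows "trace_span n (contract (us @ e # e' # vs) - contract (us @ e' # e # vs))"
proof -
  obtain a x y where e: "e = (a, x, y)" by (cases e)
  obtain b x' y' where e': "e' = (b, x', y')" by (cases e')
  define N where "N = names (us @ e # e' # vs)"
  have N': "names (us @ e' # e # vs) = N" unfolding N_def by (rule names_mset) simp
  have L': "closed_list (us @ e' # e # vs)"
    using L by (subst closed_list_mset[of _ "us @ e # e' # vs"]) simp_all
  have comm: "ent idx e * ent idx e' - ent idx e' * ent idx e =
      (if a = b then (if idx x = idx y' then ent idx (a, x', y) else 0) - (if idx x' = idx y then ent idx (a, x, y') else 0) else 0)" for idx
    unfolding e e' ent_def prod.case copy_gen_commute by simp
  have "contract (us @ e # e' # vs) - contract (us @ e' # e # vs) =
      (\<Sum>idx\<in>N \<rightarrow>\<^sub>E UNIV. prod_list (map (ent idx) us) * (ent idx e * ent idx e' - ent idx e' * ent idx e) * prod_list (map (ent idx) vs))"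
    unfolding contract_def N' N_def[symmetric] sum_subtractf[symmetric]
    by (intro sum.cong refl) (simp add: algebra_simps)
  also have "trace_span n \<dots>"
  proof (cases "a = b")
    case False
    then show ?thesis by (simp add: comm trace_span_zero)
  next
    case True
    have "(\<Sum>idx\<in>N \<rightarrow>\<^sub>E UNIV. prod_list (map (ent idx) us) * (ent idx e * ent idx e' - ent idx e' * ent idx e) * prod_list (map (ent idx) vs)) =
       (\<Sum>idx\<in>N \<rightarrow>\<^sub>E UNIV. if idx x = idx y' then prod_list (map (ent idx) (us @ (a, x', y) # vs)) else 0) -
       (\<Sum>idx\<in>N \<rightarrow>\<^sub>E UNIV. if idx x' = idx y then prod_list (map (ent idx) (us @ (a, x, y') # vs)) else 0)"
      unfolding sum_subtractf[symmetric] comm using True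
      by (intro sum.cong refl) (simp add: algebra_simps)
    also have "trace_span n \<dots>"
    proof (rule trace_span_diff)
      show "trace_span n (\<Sum>idx\<in>N \<rightarrow>\<^sub>E UNIV. if idx x = idx y' then prod_list (map (ent idx) (us @ (a, x', y) # vs)) else 0)"
        using L True by (intro closed_list_contract_name[OF _ IH n N_def[unfolded e e' True[symmetric]]]) (simp_all add: e e')
      show "trace_span n (\<Sum>idx\<in>N \<rightarrow>\<^sub>E UNIV. if idx x' = idx y then prod_list (map (ent idx) (us @ (a, x, y') # vs)) else 0)"
        using L' True by (intro closed_list_contract_name[OF _ IH n N'[symmetric, unfolded e e' True[symmetric]]]) (simp_all add: e e')
    qed
    finally show ?thesis .
  qed
  finally show ?thesis .
qed

text \<open>The bound for shorter lists is a hypothesis because the lemma is applied inside the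
  induction that proves \<open>contract_trace_span\<close>; \<open>contract_permute\<close>
  discharges it afterwards.\<close>

lemma contract_permute_aux:
  assumes L: "closed_list L" and M: "mset L = mset M"
    and IH: "\<And>L'. closed_list L' \<Longrightarrow> length L' < length L \<Longrightarrow> trace_span (length L') (contract L')"
  shows "trace_span (length L - 1) (contract L - contract M)"
  using M
proof (rule rel_of_mset_eq[where R = "\<lambda>as bs. trace_span (length L - 1) (contract as - contract bs)"])
  show "trace_span (length L - 1) (contract as - contract as)" for as
    by (simp add: trace_span_zero)
  show "trace_span (length L - 1) (contract as - contract cs)"
    if "trace_span (length L - 1) (contract as - contract bs)" "trace_span (length L - 1) (contract bs - contract cs)" for as bs cs
    using trace_span.add[OF that] by simp
  fix us x y vs assume m: "mset (us @ x # y # vs) = mset L"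
  then have l: "length L = length us + length vs + 2"
    using mset_eq_length[OF m] by simp
  have "trace_span (length L - 1) (contract L')" if "closed_list L'" "length L' = length L - 1" for L'
    using IH[OF that(1)] that(2) l by simp
  then show "trace_span (length L - 1) (contract (us @ x # y # vs) - contract (us @ y # x # vs))"
    using L closed_list_mset[OF m] l by (intro contract_swap) auto
qed

text \<open>Modulo lower terms the entries may be rearranged so that one cycle of the underlying
  permutation comes first and splits off as a trace; what remains is a shorter closed list.\<close>

theorem contract_trace_span: "closed_list L \<Longrightarrow> trace_span (length L) (contract L)"
proof (induction L rule: measure_induct_rule[where f = length])
  case (less L)
  show ?case
  proof (cases "L = []")
    case True
    then show ?thesis by (simp add: contract_Nil trace_span.one)
  next
    case False
    with less.prems obtain w ns L' where w: "w \<noteq> []" "length ns = length w" "distinct ns"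
      and m: "mset L = mset (loop w ns @ L')"
      by (rule extract_loop)
    have cl: "closed_list (loop w ns)" using w closed_list_loop by blast
    have cl2: "closed_list (loop w ns @ L')" using less.prems closed_list_mset[OF m] by simp
    have cl': "closed_list L'" and dj: "names (loop w ns) \<inter> names L' = {}"
      using closed_list_appendD[OF cl2 cl] by blast+
    have len: "length L = length w + length L'"
      using mset_eq_length[OF m] w by (simp add: loop_simps)
    have "trace_span (length L - 1) (contract L - contract (loop w ns @ L'))"
      using less.prems m less.IH by (rule contract_permute_aux)
    then have "trace_span (length L) (contract L - contract (loop w ns @ L'))"
      by (rule trace_span.mono) simp
    moreover have "contract (loop w ns @ L') = ptrace w * contract L'"
      using dj cl cl' w by (simp add: contract_append trace_eq_contract_loop)
    moreover have "trace_span (length L) (ptrace w * contract L')"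
      unfolding len using w cl' len by (intro trace_span.mult less.IH) auto
    ultimately show ?thesis
      using trace_span.add by fastforce
  qed
qed

lemma contract_permute:
  assumes "closed_list L" "mset L = mset M"
  shows "trace_span (length L - 1) (contract L - contract M)"
  using assms contract_trace_span by (intro contract_permute_aux)

section \<open>The fundamental trace identity\<close>

lemma closed_list_append:
  assumes "closed_list L" "closed_list L'" "names L \<inter> names L' = {}"
  shows "closed_list (L @ L')"
  using assms unfolding closed_list_def names_def map_append distinct_append set_append image_Un set_map
  by simp

lemma contract_loops:
  assumes "\<And>w ns. (w, ns) \<in> set ps \<Longrightarrow> w \<noteq> [] \<and> length ns = length w" "distinct (concat (map snd ps))"
  defines "L \<equiv> concat (map (\<lambda>p. loop (fst p) (snd p)) ps)"
  shows "contract L = prod_list (map (\<lambda>p. ptrace (fst p)) ps)" "closed_list L" "names L = set (concat (map snd ps))"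
proof -
  let ?L = "\<lambda>ps. concat (map (\<lambda>p. loop (fst p) (snd p)) ps)"
  have "contract (?L ps) = prod_list (map (\<lambda>p. ptrace (fst p)) ps) \<and> closed_list (?L ps)
      \<and> names (?L ps) = set (concat (map snd ps))"
  using assms(1,2)
proof (induction ps)
  case Nil
  show ?case
    by (simp add: contract_Nil closed_list_def names_def)
next
  case (Cons p ps)
  obtain w ns where p: "p = (w, ns)" by (cases p)
  have w: "w \<noteq> []" "length ns = length w" "distinct ns" "set ns \<inter> set (concat (map snd ps)) = {}"
    using Cons.prems p by auto
  have prems: "\<And>w ns. (w, ns) \<in> set ps \<Longrightarrow> w \<noteq> [] \<and> length ns = length w" "distinct (concat (map snd ps))"
    using Cons.prems by auto
  note IH = Cons.IH[OF prems, THEN conjunct1] Cons.IH[OF prems, THEN conjunct2, THEN conjunct1]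
    Cons.IH[OF prems, THEN conjunct2, THEN conjunct2]
  have cl: "closed_list (loop w ns)" using w closed_list_loop by blast
  have nm: "names (loop w ns) = set ns" using w names_loop by blast
  have dj: "names (loop w ns) \<inter> names (concat (map (\<lambda>p. loop (fst p) (snd p)) ps)) = {}"
    using w(4) IH(3) nm by simp
  have "contract (?L (p # ps)) = prod_list (map (\<lambda>p. ptrace (fst p)) (p # ps))"
    using contract_append[OF dj cl IH(2)] trace_eq_contract_loop[OF w(2,1,3)] IH(1) by (simp add: p)
  moreover have "closed_list (?L (p # ps))"
    using closed_list_append[OF cl IH(2) dj] by (simp add: p)
  moreover have "names (?L (p # ps)) = set (concat (map snd (p # ps)))"
    using nm IH(3) by (simp add: p names_def image_Un)
  ultimately show ?case by blast
qed
  then show "contract L = prod_list (map (\<lambda>p. ptrace (fst p)) ps)" "closed_list L" "names L = set (concat (map snd ps))"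
    unfolding L_def by blast+
qed

text \<open>A loop whose final column name is left open. Permuting these final names among several
  paths recombines them into loops along the cycles of the permutation.\<close>

definition open_path :: "2 list \<Rightarrow> nat list \<Rightarrow> nat \<Rightarrow> entry list" where
  "open_path w ns y = zip w (zip ns (tl ns @ [y]))"

lemma loop_open_path: "loop w ns = open_path w ns (hd ns)"
  by (simp add: loop_def open_path_def)

lemma open_path_append:
  assumes "length ns = length w" "ns \<noteq> []" "ns' \<noteq> []"
  shows "open_path (w @ w') (ns @ ns') y = open_path w ns (hd ns') @ open_path w' ns' y"
proof -
  have "tl (ns @ ns') @ [y] = (tl ns @ [hd ns']) @ (tl ns' @ [y])"
    using assms by simp
  moreover have "length ns = length (tl ns @ [hd ns'])"
    using assms by (cases ns) auto
  ultimately have "zip (ns @ ns') (tl (ns @ ns') @ [y]) = zip ns (tl ns @ [hd ns']) @ zip ns' (tl ns' @ [y])"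
    by (simp only: zip_append)
  then show ?thesis
    using assms unfolding open_path_def by simp
qed

lemma length_open_path: "length ns = length w \<Longrightarrow> ns \<noteq> [] \<Longrightarrow> length (open_path w ns y) = length w"
  by (simp add: open_path_def)

text \<open>The value \<open>j\<close> of the last column index is a separate argument, so that
  antisymmetrisation can act on it alone.\<close>

definition path_value :: "2 list \<Rightarrow> nat list \<Rightarrow> (nat \<Rightarrow> 3) \<Rightarrow> 3 \<Rightarrow> U2" where
  "path_value w ns idx j = prod_list (map (ent idx) (zip (butlast w) (zip (butlast ns) (tl ns))))
    * copy_gen (last w) j (idx (last ns))"

lemma prod_open_path:
  assumes "length ns = length w" "ns \<noteq> []"
  shows "prod_list (map (ent idx) (open_path w ns y)) = path_value w ns idx (idx y)"
proof -
  obtain ns' n where ns: "ns = ns' @ [n]" using assms by (cases ns rule: rev_cases) auto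
  obtain w' a where w: "w = w' @ [a]" using assms by (cases w rule: rev_cases) auto
  have "zip ns (tl ns @ [y]) = zip ns' (tl ns) @ [(n, y)]"
    unfolding ns by (subst zip_append) auto
  then have "open_path w ns y = zip w' (zip ns' (tl ns)) @ [(a, n, y)]"
    using assms unfolding open_path_def by (simp add: w ns zip_append)
  then show ?thesis
    by (simp add: path_value_def ns w ent_def)
qed

text \<open>Two of the four arguments coincide, and exchanging them matches the even with the odd
  permutations. This is where the size 3 of the matrices enters.\<close>

lemma alternating_four:
  fixes \<Phi> :: "3 \<Rightarrow> 3 \<Rightarrow> 3 \<Rightarrow> 3 \<Rightarrow> 'a::ab_group_add"
  shows "\<Phi> i j k l + \<Phi> i k l j + \<Phi> i l j k + \<Phi> j i l k + \<Phi> j k i l + \<Phi> j l k i + \<Phi> k i j l + \<Phi> k j l i + \<Phi> k l i j + \<Phi> l i k j + \<Phi> l j i k + \<Phi> l k j i =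
    \<Phi> i j l k + \<Phi> i k j l + \<Phi> i l k j + \<Phi> j i k l + \<Phi> j k l i + \<Phi> j l i k + \<Phi> k i l j + \<Phi> k j i l + \<Phi> k l j i + \<Phi> l i j k + \<Phi> l j k i + \<Phi> l k i j"
proof -
  have "i = j \<or> i = k \<or> i = l \<or> j = k \<or> j = l \<or> k = l"
    using exhaust_3[of i] exhaust_3[of j] exhaust_3[of k] exhaust_3[of l] by metis
  then show ?thesis by (elim disjE) (simp_all add: ac_simps)
qed

lemma trace_span_sum_list:
  assumes "list_all (\<lambda>x. trace_span n (contract (fst x) - f (snd x))) xs"
  shows "trace_span n (sum_list (map (\<lambda>x. contract (fst x)) xs) - sum_list (map (\<lambda>x. f (snd x)) xs))"
  using assms
proof (induction xs)
  case (Cons x xs)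
  have "trace_span n (contract (fst x) - f (snd x))"
    using Cons.prems by simp
  moreover have "trace_span n (sum_list (map (\<lambda>x. contract (fst x)) xs) - sum_list (map (\<lambda>x. f (snd x)) xs))"
    using Cons.prems by (intro Cons.IH) auto
  ultimately have "trace_span n ((contract (fst x) - f (snd x)) +
      (sum_list (map (\<lambda>x. contract (fst x)) xs) - sum_list (map (\<lambda>x. f (snd x)) xs)))"
    by (rule trace_span.add)
  then show ?case by (simp add: algebra_simps)
qed (simp add: trace_span_zero)

text \<open>
  Antisymmetrising four column indices that range over three values gives zero. The 24 resulting
  contractions are, up to lower terms, the products of traces along the cycles of the permutation.
\<close>

theorem fundamental_trace_identity:
  assumes ne: "a \<noteq> []" "b \<noteq> []" "c \<noteq> []" "d \<noteq> []"
  shows "trace_span (length a + length b + length c + length d - 1)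
    ((ptrace a * ptrace b * ptrace c * ptrace d + ptrace a * ptrace (b @ c @ d) + ptrace a * ptrace (b @ d @ c) + ptrace (a @ b) * ptrace (c @ d) + ptrace (a @ b @ c) * ptrace d + ptrace (a @ b @ d) * ptrace c + ptrace (a @ c @ b) * ptrace d + ptrace (a @ c @ d) * ptrace b + ptrace (a @ c) * ptrace (b @ d) + ptrace (a @ d @ b) * ptrace c + ptrace (a @ d @ c) * ptrace b + ptrace (a @ d) * ptrace (b @ c))
     - (ptrace a * ptrace b * ptrace (c @ d) + ptrace a * ptrace (b @ c) * ptrace d + ptrace a * ptrace (b @ d) * ptrace c + ptrace (a @ b) * ptrace c * ptrace d + ptrace (a @ b @ c @ d) + ptrace (a @ b @ d @ c) + ptrace (a @ c @ d @ b) + ptrace (a @ c) * ptrace b * ptrace d + ptrace (a @ c @ b @ d) + ptrace (a @ d @ c @ b) + ptrace (a @ d) * ptrace b * ptrace c + ptrace (a @ d @ b @ c)))"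
proof -
  define na where "na = [0..<length a]"
  define nb where "nb = [length a..<length a + length b]"
  define nc where "nc = [length a + length b..<length a + length b + length c]"
  define nd where "nd = [length a + length b + length c..<length a + length b + length c + length d]"
  let ?n = "length a + length b + length c + length d"
  have len: "length na = length a" "length nb = length b" "length nc = length c" "length nd = length d"
    by (simp_all add: na_def nb_def nc_def nd_def)
  have ne': "na \<noteq> []" "nb \<noteq> []" "nc \<noteq> []" "nd \<noteq> []"
    using len ne by auto
  have dist: "distinct na" "distinct nb" "distinct nc" "distinct nd"
    "set na \<inter> set nb = {}" "set na \<inter> set nc = {}" "set na \<inter> set nd = {}"
    "set nb \<inter> set nc = {}" "set nb \<inter> set nd = {}" "set nc \<inter> set nd = {}"
    "set nb \<inter> set na = {}" "set nc \<inter> set na = {}" "set nd \<inter> set na = {}"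
    "set nc \<inter> set nb = {}" "set nd \<inter> set nb = {}" "set nd \<inter> set nc = {}"
    by (auto simp: na_def nb_def nc_def nd_def)
  have dn: "\<And>x. x \<in> set na \<Longrightarrow> x \<notin> set nb" "\<And>x. x \<in> set na \<Longrightarrow> x \<notin> set nc" "\<And>x. x \<in> set na \<Longrightarrow> x \<notin> set nd" "\<And>x. x \<in> set nb \<Longrightarrow> x \<notin> set nc" "\<And>x. x \<in> set nb \<Longrightarrow> x \<notin> set nd" "\<And>x. x \<in> set nc \<Longrightarrow> x \<notin> set nd"
    using dist by blast+
  \<comment> \<open>Four consecutive open paths; the arguments are their final names. In the lists
    \<open>?ev\<close> and \<open>?od\<close> below every even or odd choice of final names is
    paired with the loops that it produces.\<close>
  define S where "S x y z u = open_path a na x @ open_path b nb y @ open_path c nc z @ open_path d nd u" for x y z u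
  define N where "N = set na \<union> set nb \<union> set nc \<union> set nd"
  have names_S: "names (S x y z u) = N" for x y z u
  proof -
    have "ent_in ` set (open_path w ns y) = set ns" if "length ns = length w" "ns \<noteq> []" for w ns y
    proof -
      have "map ent_in (open_path w ns y) = ns"
        using that by (intro nth_equalityI) (auto simp: open_path_def)
      then show ?thesis by (metis set_map)
    qed
    then show ?thesis
      using len ne' by (simp add: S_def N_def names_def image_Un Un_assoc)
  qed
  have len_S: "length (S x y z u) = ?n" for x y z u
    using len ne' by (simp add: S_def length_open_path)
  have S_loops: "trace_span (?n - 1) (contract (S x y z u) - prod_list (map (\<lambda>p. ptrace (fst p)) ps))"
    if "mset (S x y z u) = mset (concat (map (\<lambda>p. loop (fst p) (snd p)) ps))"
      "\<And>w ns. (w, ns) \<in> set ps \<Longrightarrow> w \<noteq> [] \<and> length ns = length w" "distinct (concat (map snd ps))" for x y z u ps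
  proof -
    note loops = contract_loops[OF that(2,3)]
    have "closed_list (S x y z u)"
      using loops(2) closed_list_mset[OF that(1)] by simp
    from contract_permute[OF this that(1)] show ?thesis
      by (simp only: len_S loops(1))
  qed
  let ?ev = "[(S (hd na) (hd nb) (hd nc) (hd nd), [(a, na), (b, nb), (c, nc), (d, nd)]), (S (hd na) (hd nc) (hd nd) (hd nb), [(a, na), (b @ c @ d, nb @ nc @ nd)]), (S (hd na) (hd nd) (hd nb) (hd nc), [(a, na), (b @ d @ c, nb @ nd @ nc)]), (S (hd nb) (hd na) (hd nd) (hd nc), [(a @ b, na @ nb), (c @ d, nc @ nd)]), (S (hd nb) (hd nc) (hd na) (hd nd), [(a @ b @ c, na @ nb @ nc), (d, nd)]), (S (hd nb) (hd nd) (hd nc) (hd na), [(a @ b @ d, na @ nb @ nd), (c, nc)]), (S (hd nc) (hd na) (hd nb) (hd nd), [(a @ c @ b, na @ nc @ nb), (d, nd)]), (S (hd nc) (hd nb) (hd nd) (hd na), [(a @ c @ d, na @ nc @ nd), (b, nb)]), (S (hd nc) (hd nd) (hd na) (hd nb), [(a @ c, na @ nc), (b @ d, nb @ nd)]), (S (hd nd) (hd na) (hd nc) (hd nb), [(a @ d @ b, na @ nd @ nb), (c, nc)]), (S (hd nd) (hd nb) (hd na) (hd nc), [(a @ d @ c, na @ nd @ nc), (b, nb)]), (S (hd nd) (hd nc) (hd nb) (hd na), [(a @ d, na @ nd), (b @ c, nb @ nc)])]"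
  let ?od = "[(S (hd na) (hd nb) (hd nd) (hd nc), [(a, na), (b, nb), (c @ d, nc @ nd)]), (S (hd na) (hd nc) (hd nb) (hd nd), [(a, na), (b @ c, nb @ nc), (d, nd)]), (S (hd na) (hd nd) (hd nc) (hd nb), [(a, na), (b @ d, nb @ nd), (c, nc)]), (S (hd nb) (hd na) (hd nc) (hd nd), [(a @ b, na @ nb), (c, nc), (d, nd)]), (S (hd nb) (hd nc) (hd nd) (hd na), [(a @ b @ c @ d, na @ nb @ nc @ nd)]), (S (hd nb) (hd nd) (hd na) (hd nc), [(a @ b @ d @ c, na @ nb @ nd @ nc)]), (S (hd nc) (hd na) (hd nd) (hd nb), [(a @ c @ d @ b, na @ nc @ nd @ nb)]), (S (hd nc) (hd nb) (hd na) (hd nd), [(a @ c, na @ nc), (b, nb), (d, nd)]), (S (hd nc) (hd nd) (hd nb) (hd na), [(a @ c @ b @ d, na @ nc @ nb @ nd)]), (S (hd nd) (hd na) (hd nb) (hd nc), [(a @ d @ c @ b, na @ nd @ nc @ nb)]), (S (hd nd) (hd nb) (hd nc) (hd na), [(a @ d, na @ nd), (b, nb), (c, nc)]), (S (hd nd) (hd nc) (hd na) (hd nb), [(a @ d @ b @ c, na @ nd @ nb @ nc)])]"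
  let ?T = "\<lambda>ps. prod_list (map (\<lambda>p. ptrace (fst p)) ps)"
  have ev: "trace_span (?n - 1) (sum_list (map (\<lambda>x. contract (fst x)) ?ev) - sum_list (map (\<lambda>x. ?T (snd x)) ?ev))"
    by (rule trace_span_sum_list[where f = ?T], unfold list.pred_inject fst_conv snd_conv, intro conjI TrueI S_loops)
      (auto simp: S_def loop_open_path open_path_append len ne ne' dist dest: dn)
  have od: "trace_span (?n - 1) (sum_list (map (\<lambda>x. contract (fst x)) ?od) - sum_list (map (\<lambda>x. ?T (snd x)) ?od))"
    by (rule trace_span_sum_list[where f = ?T], unfold list.pred_inject fst_conv snd_conv, intro conjI TrueI S_loops)
      (auto simp: S_def loop_open_path open_path_append len ne ne' dist dest: dn)
  have "sum_list (map (\<lambda>x. contract (fst x)) ?ev) = sum_list (map (\<lambda>x. contract (fst x)) ?od)"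
  proof -
    have "prod_list (map (ent idx) (S x y z u)) = path_value a na idx (idx x) * path_value b nb idx (idx y)
        * path_value c nc idx (idx z) * path_value d nd idx (idx u)" for idx x y z u
      using len ne' by (simp add: S_def prod_open_path mult.assoc)
    then show ?thesis
      using alternating_four[of "\<lambda>i j k l. path_value a na idx i * path_value b nb idx j
          * path_value c nc idx k * path_value d nd idx l" "idx (hd na)" "idx (hd nb)" "idx (hd nc)" "idx (hd nd)" for idx]
      by (simp add: contract_def names_S flip: sum.distrib) (simp add: add.assoc)
  qed
  moreover have "(b - t) - (a - s) = s - t" if "a = b" for a b s t :: U2
    using that by simp
  note diff_swap = this
  ultimately have "trace_span (?n - 1) (sum_list (map (\<lambda>x. ?T (snd x)) ?ev) - sum_list (map (\<lambda>x. ?T (snd x)) ?od))"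
    using trace_span_diff[OF od ev] by (subst (asm) diff_swap)
  then show ?thesis
    by (simp add: add.assoc mult.assoc)
qed


section \<open>Cyclic invariance and commutativity up to lower terms\<close>

lemma trace_rotate:
  assumes "u \<noteq> []" "v \<noteq> []"
  shows "trace_span (length u + length v - 1) (ptrace (u @ v) - ptrace (v @ u))"
proof -
  define nu where "nu = [0..<length u]"
  define nv where "nv = [length u..<length u + length v]"
  have n: "length nu = length u" "length nv = length v" "nu \<noteq> []" "nv \<noteq> []" "distinct (nu @ nv)" "distinct (nv @ nu)"
    using assms by (auto simp: nu_def nv_def)
  have "mset (loop (u @ v) (nu @ nv)) = mset (loop (v @ u) (nv @ nu))"
    using n by (simp add: loop_open_path open_path_append)
  moreover have "closed_list (loop (u @ v) (nu @ nv))"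
    using n assms by (intro closed_list_loop) auto
  ultimately have "trace_span (length (loop (u @ v) (nu @ nv)) - 1) (contract (loop (u @ v) (nu @ nv)) - contract (loop (v @ u) (nv @ nu)))"
    by (intro contract_permute)
  then show ?thesis
    using n assms by (simp add: trace_eq_contract_loop loop_simps)
qed

lemma trace_commutator:
  assumes "u \<noteq> []" "v \<noteq> []"
  shows "trace_span (length u + length v - 1)
    (ptrace u * ptrace v - ptrace v * ptrace u)"
proof -
  define nu where "nu = [0..<length u]"
  define nv where "nv = [length u..<length u + length v]"
  have n: "length nu = length u" "length nv = length v" "distinct nu" "distinct nv" "set nu \<inter> set nv = {}"
    by (auto simp: nu_def nv_def)
  have cl: "closed_list (loop u nu)" "closed_list (loop v nv)"
    using n assms by (simp_all add: closed_list_loop)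
  have dj: "names (loop u nu) \<inter> names (loop v nv) = {}" "names (loop v nv) \<inter> names (loop u nu) = {}"
    using n assms by (simp_all add: names_loop Int_commute)
  have "trace_span (length (loop u nu @ loop v nv) - 1) (contract (loop u nu @ loop v nv) - contract (loop v nv @ loop u nu))"
    by (rule contract_permute) (simp_all add: closed_list_append cl dj)
  then show ?thesis
    using n assms by (simp add: contract_append[OF dj(1) cl] contract_append[OF dj(2) cl(2,1)] trace_eq_contract_loop loop_simps)
qed

lemma trace_span_0: "trace_span 0 x \<Longrightarrow> \<exists>c. x = c *\<^sub>C 1"
proof (induction "0::nat" x rule: trace_span.induct)
  case one
  show ?case by (metis scaleC_one)
next
  case (scale x c)
  then show ?case by (auto simp: scaleC_scaleC)
next
  case (add x y)
  then show ?case by (metis scaleC_add_left)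
qed auto

lemma trace_span_commutator_trace:
  assumes "trace_span n y" "as \<noteq> []"
  shows "trace_span (length as + n - 1) (ptrace as * y - y * ptrace as)"
  using assms(1)
proof induction
  case one
  show ?case by (simp add: trace_span_zero)
next
  case (scale n x c)
  then show ?case
    using trace_span.scale[of _ _ c] by (simp add: mult_scaleC_left mult_scaleC_right flip: scaleC_diff_right)
next
  case (add n x y)
  then show ?case
    using trace_span.add[OF add.IH] by (simp add: algebra_simps)
next
  case (mono m x n)
  then show ?case by (auto intro: trace_span.mono)
next
  case (mult bs n x)
  have pos: "length as > 0" "length bs > 0" using mult assms(2) by auto
  have "trace_span (length as + length bs - 1 + n)
      ((ptrace as * ptrace bs - ptrace bs * ptrace as) * x)"
    using trace_commutator[OF assms(2) mult.hyps(1)] mult.hyps(2) by (rule trace_span_mult)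
  moreover have "trace_span (length bs + (length as + n - 1))
      (ptrace bs * (ptrace as * x - x * ptrace as))"
    using mult by (intro trace_span.mult)
  moreover have "length as + length bs - 1 + n = length as + (length bs + n) - 1"
    "length bs + (length as + n - 1) = length as + (length bs + n) - 1" using pos by linarith+
  ultimately have "trace_span (length as + (length bs + n) - 1)
      ((ptrace as * ptrace bs - ptrace bs * ptrace as) * x
        + ptrace bs * (ptrace as * x - x * ptrace as))"
    by (metis trace_span.add)
  then show ?case by (simp add: algebra_simps)
qed

text \<open>The associated graded algebra is commutative: on two traces the top weight cancels
  because both products contain the same entries, and the commutator is a derivation in each
  argument.\<close>

theorem trace_span_commutator:
  assumes x: "trace_span m x" and y: "trace_span n y"
  shows "trace_span (m + n - 1) (x * y - y * x)"
\<comment> \<open>With truncated subtraction the weights add up correctly only for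
  \<open>n > 0\<close>; for \<open>n = 0\<close> the element \<open>y\<close> is a scalar.\<close>
proof (cases "n = 0")
  case True
  then obtain c where "y = c *\<^sub>C 1" using y trace_span_0 by blast
  then show ?thesis by (simp add: mult_scaleC_left mult_scaleC_right trace_span_zero)
next
  case False
  from x show ?thesis
  proof induction
    case one
    show ?case by (simp add: trace_span_zero)
  next
    case (scale m x c)
    then show ?case
      using trace_span.scale[of _ _ c] by (simp add: mult_scaleC_left mult_scaleC_right flip: scaleC_diff_right)
  next
    case (add m x x')
    then show ?case
      using trace_span.add[OF add.IH] by (simp add: algebra_simps)
  next
    case (mono k x m)
    then show ?case by (auto intro: trace_span.mono)
  next
    case (mult as m x)
    have "trace_span (length as + (m + n - 1)) (ptrace as * (x * y - y * x))"
      using mult by (intro trace_span.mult)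
    moreover have "trace_span (length as + n - 1 + m) ((ptrace as * y - y * ptrace as) * x)"
      using trace_span_commutator_trace[OF y mult.hyps(1)] mult.hyps(2) by (rule trace_span_mult)
    moreover have "length as + (m + n - 1) = length as + m + n - 1"
      "length as + n - 1 + m = length as + m + n - 1" using False by auto
    ultimately have "trace_span (length as + m + n - 1)
        (ptrace as * (x * y - y * x) + (ptrace as * y - y * ptrace as) * x)"
      by (metis trace_span.add)
    then show ?case by (simp add: algebra_simps)
  qed
qed

section \<open>Commutation with the diagonal copy\<close>

definition diag :: "3 \<Rightarrow> 3 \<Rightarrow> U2" where
  "diag p q = copy_gen 1 p q + copy_gen 2 p q"

lemma diag_commute:
  "diag p q * copy_gen a r s - copy_gen a r s * diag p q =
    (if q = r then copy_gen a p s else 0) - (if s = p then copy_gen a r q else 0)"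
proof -
  have "diag p q * copy_gen a r s - copy_gen a r s * diag p q =
      (copy_gen 1 p q * copy_gen a r s - copy_gen a r s * copy_gen 1 p q)
      + (copy_gen 2 p q * copy_gen a r s - copy_gen a r s * copy_gen 2 p q)"
    by (simp add: diag_def algebra_simps)
  also have "\<dots> = (if q = r then copy_gen a p s else 0) - (if s = p then copy_gen a r q else 0)"
    unfolding copy_gen_commute using exhaust_2[of a] by auto
  finally show ?thesis .
qed

text \<open>Row and column values are read from separate maps: the derivation given by a diagonal
  generator changes a single index of a single entry, after which the two occurrences of a name may
  have different values.\<close>

definition row_col_prod :: "(nat \<Rightarrow> 3) \<Rightarrow> (nat \<Rightarrow> 3) \<Rightarrow> entry list \<Rightarrow> U2" where
  "row_col_prod idx \<kappa> L = prod_list (map (\<lambda>(a, x, y). copy_gen a (\<kappa> y) (idx x)) L)"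

lemma row_col_prod_simps [simp]:
  "row_col_prod idx \<kappa> [] = 1"
  "row_col_prod idx \<kappa> ((a, x, y) # L) = copy_gen a (\<kappa> y) (idx x) * row_col_prod idx \<kappa> L"
  by (simp_all add: row_col_prod_def)

lemma prod_ent_row_col: "prod_list (map (ent idx) L) = row_col_prod idx idx L"
  unfolding row_col_prod_def by (intro arg_cong[where f = prod_list] map_cong) (auto simp: ent_def)

lemma row_col_prod_upd:
  "n \<notin> ent_out ` set L \<Longrightarrow> row_col_prod idx (\<kappa>(n := q)) L = row_col_prod idx \<kappa> L"
  "n \<notin> ent_in ` set L \<Longrightarrow> row_col_prod (idx(n := q)) \<kappa> L = row_col_prod idx \<kappa> L"
  by (induction L) auto

lemma diag_row_col_prod:
  assumes "distinct (map ent_in L)" "distinct (map ent_out L)"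
  shows "diag q p * row_col_prod idx \<kappa> L - row_col_prod idx \<kappa> L * diag q p =
    (\<Sum>n\<in>ent_out ` set L. if \<kappa> n = p then row_col_prod idx (\<kappa>(n := q)) L else 0) -
    (\<Sum>n\<in>ent_in ` set L. if idx n = q then row_col_prod (idx(n := p)) \<kappa> L else 0)"
  using assms
proof (induction L)
  case (Cons e L)
  obtain a x y where e: "e = (a, x, y)" by (cases e)
  have x: "x \<notin> ent_in ` set L" and y: "y \<notin> ent_out ` set L"
    using Cons.prems by (auto simp: e)
  have d: "distinct (map ent_in L)" "distinct (map ent_out L)" using Cons.prems by auto
  let ?c = "copy_gen a (\<kappa> y) (idx x)" and ?G = "row_col_prod idx \<kappa> L"
  have "diag q p * row_col_prod idx \<kappa> (e # L) - row_col_prod idx \<kappa> (e # L) * diag q p =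
      (diag q p * ?c - ?c * diag q p) * ?G + ?c * (diag q p * ?G - ?G * diag q p)"
    by (simp add: e algebra_simps)
  also have "\<dots> = ((if \<kappa> y = p then copy_gen a q (idx x) * ?G else 0)
        + (\<Sum>n\<in>ent_out ` set L. if \<kappa> n = p then ?c * row_col_prod idx (\<kappa>(n := q)) L else 0))
      - ((if idx x = q then copy_gen a (\<kappa> y) p * ?G else 0)
        + (\<Sum>n\<in>ent_in ` set L. if idx n = q then ?c * row_col_prod (idx(n := p)) \<kappa> L else 0))"
    unfolding diag_commute Cons.IH[OF d]
    by (simp add: algebra_simps sum_distrib_left if_distrib[of "\<lambda>z. ?c * z"] cong: if_cong)
  also have "(if \<kappa> y = p then copy_gen a q (idx x) * ?G else 0)
        + (\<Sum>n\<in>ent_out ` set L. if \<kappa> n = p then ?c * row_col_prod idx (\<kappa>(n := q)) L else 0)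
      = (\<Sum>n\<in>ent_out ` set (e # L). if \<kappa> n = p then row_col_prod idx (\<kappa>(n := q)) (e # L) else 0)"
  proof -
    have "(\<Sum>n\<in>ent_out ` set L. if \<kappa> n = p then ?c * row_col_prod idx (\<kappa>(n := q)) L else 0) =
        (\<Sum>n\<in>ent_out ` set L. if \<kappa> n = p then row_col_prod idx (\<kappa>(n := q)) (e # L) else 0)"
      using y by (intro sum.cong refl) (auto simp: e)
    then show ?thesis using y by (simp add: e row_col_prod_upd)
  qed
  also have "(if idx x = q then copy_gen a (\<kappa> y) p * ?G else 0)
        + (\<Sum>n\<in>ent_in ` set L. if idx n = q then ?c * row_col_prod (idx(n := p)) \<kappa> L else 0)
      = (\<Sum>n\<in>ent_in ` set (e # L). if idx n = q then row_col_prod (idx(n := p)) \<kappa> (e # L) else 0)"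
  proof -
    have "(\<Sum>n\<in>ent_in ` set L. if idx n = q then ?c * row_col_prod (idx(n := p)) \<kappa> L else 0) =
        (\<Sum>n\<in>ent_in ` set L. if idx n = q then row_col_prod (idx(n := p)) \<kappa> (e # L) else 0)"
      using x by (intro sum.cong refl) (auto simp: e)
    then show ?thesis using x by (simp add: e row_col_prod_upd)
  qed
  finally show ?case .
qed simp

text \<open>Every name occurs once as a row and once as a column index, and the two contributions of
  the derivation cancel after summation: resetting the value of the name is a bijection between the
  index maps with value \<open>p\<close> there and those with value \<open>q\<close>.\<close>

lemma diag_contract:
  assumes "closed_list L"
  shows "diag q p * contract L = contract L * diag q p"
proof -
  let ?N = "names L" and ?G = row_col_prod
  have out: "ent_out ` set L = ?N" and d: "distinct (map ent_in L)" "distinct (map ent_out L)"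
    using assms by (auto simp: closed_list_def names_def)
  have swap: "(\<Sum>idx\<in>?N \<rightarrow>\<^sub>E UNIV. if idx n = p then ?G idx (idx(n := q)) L else 0) =
      (\<Sum>idx\<in>?N \<rightarrow>\<^sub>E UNIV. if idx n = q then ?G (idx(n := p)) idx L else 0)" if n: "n \<in> ?N" for n
  proof -
    have "(\<Sum>idx\<in>{idx \<in> ?N \<rightarrow>\<^sub>E UNIV. idx n = p}. ?G idx (idx(n := q)) L) =
        (\<Sum>idx\<in>{idx \<in> ?N \<rightarrow>\<^sub>E UNIV. idx n = q}. ?G (idx(n := p)) idx L)"
      using n by (intro sum.reindex_bij_witness[where i = "\<lambda>idx. idx(n := p)" and j = "\<lambda>idx. idx(n := q)"])
        (auto simp: PiE_def extensional_def fun_upd_idem)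
    then show ?thesis by (simp add: sum.inter_filter)
  qed
  have "diag q p * contract L - contract L * diag q p =
      (\<Sum>idx\<in>?N \<rightarrow>\<^sub>E UNIV. diag q p * ?G idx idx L - ?G idx idx L * diag q p)"
    by (simp add: contract_def prod_ent_row_col sum_distrib_left sum_distrib_right sum_subtractf)
  also have "\<dots> = (\<Sum>idx\<in>?N \<rightarrow>\<^sub>E UNIV. \<Sum>n\<in>?N. if idx n = p then ?G idx (idx(n := q)) L else 0)
      - (\<Sum>idx\<in>?N \<rightarrow>\<^sub>E UNIV. \<Sum>n\<in>?N. if idx n = q then ?G (idx(n := p)) idx L else 0)"
    unfolding diag_row_col_prod[OF d] out by (simp add: sum_subtractf names_def)
  also have "\<dots> = (\<Sum>n\<in>?N. \<Sum>idx\<in>?N \<rightarrow>\<^sub>E UNIV. if idx n = p then ?G idx (idx(n := q)) L else 0)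
      - (\<Sum>n\<in>?N. \<Sum>idx\<in>?N \<rightarrow>\<^sub>E UNIV. if idx n = q then ?G (idx(n := p)) idx L else 0)"
    by (intro arg_cong2[where f = "(-)"] sum.swap)
  also have "\<dots> = 0"
    using swap by simp
  finally show ?thesis by simp
qed

lemma diag_trace_span: "trace_span n x \<Longrightarrow> diag q p * x = x * diag q p"
proof (induction rule: trace_span.induct)
  case (mult as n x)
  let ?ns = "[0..<length as]"
  have "contract (loop as ?ns) = ptrace as" "closed_list (loop as ?ns)"
    using mult by (simp_all add: trace_eq_contract_loop closed_list_loop)
  then have "diag q p * ptrace as = ptrace as * diag q p"
    using diag_contract by metis
  then show ?case using mult by (metis mult.assoc)
qed (auto simp: mult_scaleC_left mult_scaleC_right algebra_simps)

lemma Z2_sl3_iff_trace_span: "z \<in> Z2_sl3 \<longleftrightarrow> (\<exists>n. trace_span n z)"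
proof
  assume "z \<in> Z2_sl3"
  then show "\<exists>n. trace_span n z"
    unfolding Z2_sl3_def
  proof induction
    case (base x)
    then show ?case using trace_span_trace by auto
  next
    case (add x y)
    then obtain m n where "trace_span m x" "trace_span n y" by auto
    then have "trace_span (max m n) x" "trace_span (max m n) y"
      by (auto intro: trace_span.mono)
    then show ?case by (blast intro: trace_span.add)
  qed (auto intro: trace_span.one trace_span.scale trace_span_mult)
next
  assume "\<exists>n. trace_span n z"
  then obtain n where "trace_span n z" ..
  then show "z \<in> Z2_sl3"
    unfolding Z2_sl3_def
    by induction (auto intro: generated_subalgebra.intros)
qed

section \<open>Casimir elements and centrality of the parameters\<close>

definition cubic :: "2 \<Rightarrow> 2 \<Rightarrow> 2 \<Rightarrow> U2" where
  "cubic a b c = (\<Sum>i\<in>UNIV. \<Sum>j\<in>UNIV. \<Sum>k\<in>UNIV. copy_gen a j i * copy_gen b k j * copy_gen c i k)"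

definition cubic_bar :: "2 \<Rightarrow> 2 \<Rightarrow> 2 \<Rightarrow> U2" where
  "cubic_bar a b c = (\<Sum>i\<in>UNIV. \<Sum>j\<in>UNIV. \<Sum>k\<in>UNIV. copy_gen a i j * copy_gen b j k * copy_gen c k i)"

definition quadratic :: "2 \<Rightarrow> 2 \<Rightarrow> U2" where
  "quadratic a b = (\<Sum>i\<in>UNIV. \<Sum>j\<in>UNIV. copy_gen a j i * copy_gen b i j)"

lemma sum_lists_Suc:
  fixes f :: "'i::finite list \<Rightarrow> 'a::comm_monoid_add"
  shows "(\<Sum>is | length is = Suc n. f is) = (\<Sum>i\<in>UNIV. \<Sum>is | length is = n. f (i # is))"
proof -
  have "(\<Sum>is | length is = Suc n. f is) = (\<Sum>(i, is)\<in>UNIV \<times> {is. length is = n}. f (i # is))"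
    by (rule sum.reindex_bij_witness[where i = "\<lambda>(i, is). i # is" and j = "\<lambda>is. (hd is, tl is)"])
      (auto simp: length_Suc_conv)
  then show ?thesis by (simp only: sum.cartesian_product)
qed

lemma polarised_trace_2: "ptrace [a, b] = quadratic a b"
  by (simp add: polarised_trace_def quadratic_def sum_lists_Suc numeral_2_eq_2 upt_rec)

lemma polarised_trace_3: "ptrace [a, b, c] = cubic a b c"
  by (simp add: polarised_trace_def cubic_def sum_lists_Suc numeral_2_eq_2 upt_rec mult.assoc)

lemma polarised_trace_1: "ptrace [a] = 0"
  using copy_gen_trace[of a] by (simp add: polarised_trace_def sum_lists_Suc sum_3)

lemma sum_index_maps_insert:
  fixes g :: "(nat \<Rightarrow> 3) \<Rightarrow> 'a::comm_monoid_add"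
  assumes "x \<notin> N"
  shows "(\<Sum>idx\<in>insert x N \<rightarrow>\<^sub>E UNIV. g idx) = (\<Sum>i\<in>UNIV. \<Sum>idx\<in>N \<rightarrow>\<^sub>E UNIV. g (idx(x := i)))"
proof -
  have "(\<Sum>idx\<in>insert x N \<rightarrow>\<^sub>E UNIV. g idx) = (\<Sum>(i, idx)\<in>UNIV \<times> (N \<rightarrow>\<^sub>E UNIV). g (idx(x := i)))"
    unfolding PiE_insert_eq using inj_combinator[OF assms, of "\<lambda>_. UNIV"]
    by (subst sum.reindex) (auto simp: case_prod_unfold)
  then show ?thesis by (simp only: sum.cartesian_product)
qed

lemma cubic_bar_eq_contract: "cubic_bar a b c = contract [(a, 2, 1), (b, 3, 2), (c, 1, 3)]"
proof -
  have "contract [(a, 2, 1), (b, 3, 2), (c, 1, 3)] =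
      (\<Sum>j\<in>UNIV. \<Sum>k\<in>UNIV. \<Sum>i\<in>UNIV. copy_gen a i j * copy_gen b j k * copy_gen c k i)"
    by (simp add: contract_def names_def insert_commute[of "Suc 0"] sum_index_maps_insert ent_def mult.assoc
      flip: numeral_eq_Suc One_nat_def)
  also have "\<dots> = (\<Sum>j\<in>UNIV. \<Sum>i\<in>UNIV. \<Sum>k\<in>UNIV. copy_gen a i j * copy_gen b j k * copy_gen c k i)"
    by (rule sum.cong[OF refl], rule sum.swap)
  also have "\<dots> = cubic_bar a b c"
    unfolding cubic_bar_def by (rule sum.swap)
  finally show ?thesis by simp
qed

lemma closed_list_cubic_bar: "closed_list [(a, 2, 1), (b, 3, 2), (c, 1, 3)]"
  by (auto simp: closed_list_def)

text \<open>When the names are followed from row to column, the entries of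
  \<open>cubic_bar a b c\<close> form a loop in the order \<open>a\<close>, \<open>c\<close>,
  \<open>b\<close>.\<close>

lemma cubic_bar_trace: "trace_span 2 (cubic_bar a b c - ptrace [a, c, b])"
proof -
  have "trace_span (length [(a, 2::nat, 1::nat), (b, 3, 2), (c, 1, 3)] - 1)
      (contract [(a, 2, 1), (b, 3, 2), (c, 1, 3)] - contract (loop [a, c, b] [2, 1, 3]))"
    using closed_list_cubic_bar by (rule contract_permute) (simp add: loop_def)
  then show ?thesis
    by (simp add: cubic_bar_eq_contract trace_eq_contract_loop numeral_2_eq_2)
qed

lemma tensor_sum: "tensor (sum f A) b = (\<Sum>x\<in>A. tensor (f x) b)" "tensor a (sum g A) = (\<Sum>x\<in>A. tensor a (g x))"
  by (induction A rule: infinite_finite_induct) (simp_all add: tensor_add_left tensor_add_right)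

lemma tensor_casimir:
  "tensor casimir2 1 = quadratic 1 1" "tensor 1 casimir2 = quadratic 2 2"
  "tensor casimir3 1 = cubic 1 1 1" "tensor 1 casimir3 = cubic 2 2 2"
  "tensor casimir3_bar 1 = cubic_bar 1 1 1" "tensor 1 casimir3_bar = cubic_bar 2 2 2"
  by (simp_all add: casimir2_def casimir3_def casimir3_bar_def quadratic_def cubic_def cubic_bar_def
      tensor_sum copy_gen_def tensor_mult)

lemma coproduct_simps:
  "coproduct (x + y) = coproduct x + coproduct y" "coproduct (x * y) = coproduct x * coproduct y"
  "coproduct (c *\<^sub>C x) = c *\<^sub>C coproduct x"
  using complex_algebra_hom_coproduct by (auto simp: complex_algebra_hom_def)

lemma coproduct_sum: "coproduct (sum f A) = (\<Sum>x\<in>A. coproduct (f x))"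
proof (induction A rule: infinite_finite_induct)
  have "coproduct 0 = 0" using coproduct_simps(1)[of 0 0] by simp
  then show "coproduct (sum f A) = (\<Sum>x\<in>A. coproduct (f x))" if "infinite A" for A using that by simp
  show "coproduct (sum f {}) = (\<Sum>x\<in>{}. coproduct (f x))" using \<open>coproduct 0 = 0\<close> by simp
qed (simp add: coproduct_simps)

lemma coproduct_casimir2:
  "coproduct casimir2 = quadratic 1 1 + quadratic 1 2 + quadratic 2 1 + quadratic 2 2"
  by (simp add: casimir2_def quadratic_def coproduct_sum coproduct_simps coproduct_gen
      distrib_left distrib_right sum.distrib ac_simps)

lemma coproduct_casimir3:
  "coproduct casimir3 = cubic 1 1 1 + cubic 1 1 2 + cubic 1 2 1 + cubic 2 1 1
    + cubic 1 2 2 + cubic 2 1 2 + cubic 2 2 1 + cubic 2 2 2"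
  by (simp add: casimir3_def cubic_def coproduct_sum coproduct_simps coproduct_gen
      distrib_left distrib_right sum.distrib ac_simps)

lemma coproduct_casimir3_bar:
  "coproduct casimir3_bar = cubic_bar 1 1 1 + cubic_bar 1 1 2 + cubic_bar 1 2 1 + cubic_bar 2 1 1
    + cubic_bar 1 2 2 + cubic_bar 2 1 2 + cubic_bar 2 2 1 + cubic_bar 2 2 2"
  by (simp add: casimir3_bar_def cubic_bar_def coproduct_sum coproduct_simps coproduct_gen
      distrib_left distrib_right sum.distrib ac_simps)

lemma commute_add: "(x + y) * z = z * (x + y)" if "x * z = z * x" "y * z = z * y" for x y z :: "'a::ring"
  using that by (simp add: distrib_left distrib_right)

lemma commute_mult: "(x * y) * z = z * (x * y)" if "x * z = z * x" "y * z = z * y" for x y z :: "'a::ring"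
  using that by (metis mult.assoc)

lemma commute_sum: "sum f A * z = z * sum f A" if "\<And>i. i \<in> A \<Longrightarrow> f i * z = z * f i" for z :: "'a::ring"
  using that by (simp add: sum_distrib_left sum_distrib_right)

lemma commute_prod_list: "prod_list xs * z = z * prod_list xs" if "\<And>x. x \<in> set xs \<Longrightarrow> x * z = z * x" for z :: "'a::ring_1"
  using that by (induction xs) (auto intro!: commute_mult)

lemma commute_scaleC: "(c *\<^sub>C x) * z = z * (c *\<^sub>C x)" if "x * z = z * x" for x z :: "'a::complex_algebra_1"
  using that by (simp add: mult_scaleC_left mult_scaleC_right)

lemma commute_trace_span:
  assumes "\<And>a p q. copy_gen a p q * z = z * copy_gen a p q" and "trace_span n x"
  shows "x * z = z * x"
  using assms(2)
proof induction
  case (mult as n x)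
  have "ptrace as * z = z * ptrace as"
    unfolding polarised_trace_def using assms(1) by (intro commute_sum commute_prod_list) auto
  with mult show ?case by (intro commute_mult)
qed (auto intro: commute_add commute_scaleC)

text \<open>Generators of the other copy commute factor by factor, and diagonal ones by
  \<open>diag_contract\<close>. A generator of the same copy is the difference of the two.\<close>

lemma contract_one_copy_central:
  assumes "closed_list L" "\<And>e. e \<in> set L \<Longrightarrow> fst e = a"
  shows "copy_gen b p q * contract L = contract L * copy_gen b p q"
proof -
  have other: "contract L * copy_gen b p q = copy_gen b p q * contract L" if "a \<noteq> b" for b p q
  proof -
    have "copy_gen a r s * copy_gen b p q = copy_gen b p q * copy_gen a r s" for r s
      using copy_gen_commute[of a r s b p q] that by simp
    then show ?thesis
      unfolding contract_def using assms(2)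
      by (intro commute_sum commute_prod_list) (auto simp: ent_def split: prod.splits)
  qed
  show ?thesis
  proof (cases "a = b")
    case False
    then show ?thesis using other by metis
  next
    case True
    obtain c where c: "c \<noteq> a" "diag p q = copy_gen b p q + copy_gen c p q"
      using exhaust_2[of a] True by (metis diag_def add.commute one_neq_zero zero_neq_one_class.zero_neq_one exhaust_2)
    then show ?thesis
      using diag_contract[OF assms(1), of p q] other[of c p q] by (simp add: algebra_simps)
  qed
qed

lemma quadratic_central: "copy_gen b p q * quadratic a a = quadratic a a * copy_gen b p q"
  and cubic_central: "copy_gen b p q * cubic a a a = cubic a a a * copy_gen b p q"
  and cubic_bar_central: "copy_gen b p q * cubic_bar a a a = cubic_bar a a a * copy_gen b p q"
proof -
  have loop: "copy_gen b p q * ptrace w = ptrace w * copy_gen b p q"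
    if "w \<noteq> []" "set w = {a}" for w
  proof -
    have "set (map fst (loop w [0..<length w])) = {a}"
      using that by (simp add: loop_def map_fst_zip)
    then have "fst e = a" if "e \<in> set (loop w [0..<length w])" for e
      using that by (metis image_eqI set_map singletonD)
    moreover have "closed_list (loop w [0..<length w])" using that by (intro closed_list_loop) auto
    ultimately show ?thesis
      using contract_one_copy_central[of "loop w [0..<length w]" a b p q] that
      by (simp add: trace_eq_contract_loop)
  qed
  from loop[of "[a, a]"] show "copy_gen b p q * quadratic a a = quadratic a a * copy_gen b p q"
    by (simp add: polarised_trace_2)
  from loop[of "[a, a, a]"] show "copy_gen b p q * cubic a a a = cubic a a a * copy_gen b p q"
    by (simp add: polarised_trace_3)
  show "copy_gen b p q * cubic_bar a a a = cubic_bar a a a * copy_gen b p q"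
    unfolding cubic_bar_eq_contract by (rule contract_one_copy_central[OF closed_list_cubic_bar]) auto
qed

lemma coproduct_commute_trace_span:
  assumes "trace_span n x"
  shows "coproduct casimir2 * x = x * coproduct casimir2"
    "coproduct casimir3 * x = x * coproduct casimir3"
    "coproduct casimir3_bar * x = x * coproduct casimir3_bar"
proof -
  have "coproduct (gen p q) * x = x * coproduct (gen p q)" for p q
    using diag_trace_span[OF assms] by (simp add: coproduct_gen diag_def)
  then show "coproduct casimir2 * x = x * coproduct casimir2"
    "coproduct casimir3 * x = x * coproduct casimir3"
    "coproduct casimir3_bar * x = x * coproduct casimir3_bar"
    unfolding casimir2_def casimir3_def casimir3_bar_def coproduct_sum coproduct_simps
    by (intro commute_sum commute_mult; simp)+
qed

lemma three_cases: "i = 1 \<or> i = 2 \<or> i = (3::3)"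
  by (rule exhaust_3)

lemma kU_lU_simps:
  "kU 1 = quadratic 1 1" "kU 2 = quadratic 2 2" "kU 3 = coproduct casimir2"
  "lU 1 = (1/2) *\<^sub>C (cubic 1 1 1 + cubic_bar 1 1 1)"
  "lU 2 = (1/2) *\<^sub>C (cubic 2 2 2 + cubic_bar 2 2 2)"
  "lU 3 = - ((1/2) *\<^sub>C (coproduct casimir3 + coproduct casimir3_bar))"
  by (simp_all add: kU_def lU_def Let_def tensor_casimir tensor_add_left tensor_add_right
      tensor_scaleC_left tensor_scaleC_right coproduct_simps)

lemma kU_central: "trace_span n x \<Longrightarrow> kU i * x = x * kU i"
  and lU_central: "trace_span n x \<Longrightarrow> lU i * x = x * lU i"
proof -
  assume x: "trace_span n x"
  show "kU i * x = x * kU i"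
    using three_cases[of i] commute_trace_span[OF _ x] quadratic_central coproduct_commute_trace_span[OF x]
    by (elim disjE) (simp_all add: kU_lU_simps)
  have "copy_gen b p q * ((1/2) *\<^sub>C (cubic a a a + cubic_bar a a a)) =
      ((1/2) *\<^sub>C (cubic a a a + cubic_bar a a a)) * copy_gen b p q" for a b p q
    by (intro commute_scaleC[symmetric] commute_add) (simp_all add: cubic_central cubic_bar_central)
  then have "(1/2) *\<^sub>C (cubic a a a + cubic_bar a a a) * x = x * (1/2) *\<^sub>C (cubic a a a + cubic_bar a a a)" for a
    using commute_trace_span[OF _ x] by metis
  moreover have "(1/2) *\<^sub>C (coproduct casimir3 + coproduct casimir3_bar) * x =
      x * (1/2) *\<^sub>C (coproduct casimir3 + coproduct casimir3_bar)"
    by (intro commute_scaleC commute_add coproduct_commute_trace_span[OF x])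
  ultimately show "lU i * x = x * lU i"
    using three_cases[of i] by (elim disjE) (simp_all add: kU_lU_simps)
qed

section \<open>Words in two letters\<close>

text \<open>
  The linear consequences of cyclic invariance and of the trace identity, for functions on words in
  two letters. From length 7 on they force everything to vanish: modulo products of shorter traces,
  a prefix of length 6 lies in the free nil algebra of index 3, which is nilpotent of class 6.
\<close>

lemma nil_three_words:
  fixes f :: "'a list \<Rightarrow> real"
  assumes nil: "\<forall>p a b c q. a \<noteq> [] \<longrightarrow> b \<noteq> [] \<longrightarrow> c \<noteq> [] \<longrightarrow> length (p @ a @ b @ c @ q) = 6 \<longrightarrow>
      f (p @ a @ b @ c @ q) + f (p @ a @ c @ b @ q) + f (p @ b @ a @ c @ q)
      + f (p @ b @ c @ a @ q) + f (p @ c @ a @ b @ q) + f (p @ c @ b @ a @ q) = 0"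
  shows "f [x, x, x, x, x, x] = 0 \<and> f [y, x, x, x, x, x] = 0 \<and> f [x, y, x, x, x, x] = 0 \<and> f [x, x, y, x, x, x] = 0 \<and> f [x, x, x, y, x, x] = 0 \<and> f [x, x, x, x, y, x] = 0 \<and> f [x, x, x, x, x, y] = 0 \<and> f [y, y, x, x, x, x] = 0 \<and> f [y, x, y, x, x, x] = 0 \<and> f [y, x, x, y, x, x] = 0 \<and> f [y, x, x, x, y, x] = 0 \<and> f [y, x, x, x, x, y] = 0 \<and> f [x, y, y, x, x, x] = 0 \<and> f [x, y, x, y, x, x] = 0 \<and> f [x, y, x, x, y, x] = 0 \<and> f [x, y, x, x, x, y] = 0 \<and> f [x, x, y, y, x, x] = 0 \<and> f [x, x, y, x, y, x] = 0 \<and> f [x, x, y, x, x, y] = 0 \<and> f [x, x, x, y, y, x] = 0 \<and> f [x, x, x, y, x, y] = 0 \<and> f [x, x, x, x, y, y] = 0 \<and> f [y, y, y, x, x, x] = 0 \<and> f [y, y, x, y, x, x] = 0 \<and> f [y, y, x, x, y, x] = 0 \<and> f [y, y, x, x, x, y] = 0 \<and> f [y, x, y, y, x, x] = 0 \<and> f [y, x, y, x, y, x] = 0 \<and> f [y, x, y, x, x, y] = 0 \<and> f [y, x, x, y, y, x] = 0 \<and> f [y, x, x, y, x, y] = 0 \<and> f [y, x, x, x, y, y] = 0 \<and> f [x, y, y, y, x, x] = 0 \<and> f [x, y, y, x, y, x] = 0 \<and> f [x, y, y, x, x, y] = 0 \<and> f [x, y, x, y, y, x] = 0 \<and> f [x,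 y, x, y, x, y] = 0 \<and> f [x, y, x, x, y, y] = 0 \<and> f [x, x, y, y, y, x] = 0 \<and> f [x, x, y, y, x, y] = 0 \<and> f [x, x, y, x, y, y] = 0 \<and> f [x, x, x, y, y, y] = 0"
proof -
  note sym = nil[rule_format]
  have w111111: "f [x, x, x, x, x, x] = 0"
    using sym[of "[x]" "[x]" "[x]" "[]" "[x, x, x]"] by (simp add: eval_nat_numeral)
  have w211111: "f [y, x, x, x, x, x] = 0"
    using sym[of "[x]" "[x]" "[x]" "[y]" "[x, x]"] by (simp add: eval_nat_numeral)
  have w121111: "f [x, y, x, x, x, x] = 0"
    using sym[of "[x]" "[x]" "[x]" "[x, y]" "[x]"] by (simp add: eval_nat_numeral)
  have w112111: "f [x, x, y, x, x, x] = 0"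
    using sym[of "[x]" "[x]" "[x]" "[x, x, y]" "[]"] by (simp add: eval_nat_numeral)
  have w111211: "f [x, x, x, y, x, x] = 0"
    using sym[of "[x]" "[x]" "[x]" "[]" "[y, x, x]"] by (simp add: eval_nat_numeral)
  have w111121: "f [x, x, x, x, y, x] = 0"
    using sym[of "[x]" "[x]" "[x]" "[]" "[x, y, x]"] by (simp add: eval_nat_numeral)
  have w111112: "f [x, x, x, x, x, y] = 0"
    using sym[of "[x]" "[x]" "[x]" "[]" "[x, x, y]"] by (simp add: eval_nat_numeral)
  have w221111: "f [y, y, x, x, x, x] = 0"
    using sym[of "[x]" "[x]" "[x]" "[y, y]" "[x]"] by (simp add: eval_nat_numeral)
  have w212111: "f [y, x, y, x, x, x] = 0"
    using sym[of "[x]" "[x]" "[x]" "[y, x, y]" "[]"] by (simp add: eval_nat_numeral)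
  have w211121: "f [y, x, x, x, y, x] = 0"
    using sym[of "[x]" "[x]" "[x]" "[y]" "[y, x]"] by (simp add: eval_nat_numeral)
  have w211112: "f [y, x, x, x, x, y] = 0"
    using sym[of "[x]" "[x]" "[x]" "[y]" "[x, y]"] by (simp add: eval_nat_numeral)
  have w122111: "f [x, y, y, x, x, x] = 0"
    using sym[of "[x]" "[x]" "[x]" "[x, y, y]" "[]"] by (simp add: eval_nat_numeral)
  have w121112: "f [x, y, x, x, x, y] = 0"
    using sym[of "[x]" "[x]" "[x]" "[x, y]" "[y]"] by (simp add: eval_nat_numeral)
  have w111221: "f [x, x, x, y, y, x] = 0"
    using sym[of "[x]" "[x]" "[x]" "[]" "[y, y, x]"] by (simp add: eval_nat_numeral)
  have w111212: "f [x, x, x, y, x, y] = 0"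
    using sym[of "[x]" "[x]" "[x]" "[]" "[y, x, y]"] by (simp add: eval_nat_numeral)
  have w111122: "f [x, x, x, x, y, y] = 0"
    using sym[of "[x]" "[x]" "[x]" "[]" "[x, y, y]"] by (simp add: eval_nat_numeral)
  have w112211: "f [x, x, y, y, x, x] = 0"
    using sym[of "[x]" "[x]" "[y, y]" "[]" "[x, x]"] by (simp add: eval_nat_numeral w122111 w221111)
  have w211211: "f [y, x, x, y, x, x] = 0"
    using sym[of "[x]" "[x]" "[y]" "[y]" "[x, x]"] by (simp add: eval_nat_numeral w212111 w221111)
  have w121211: "f [x, y, x, y, x, x] = 0"
    using sym[of "[x]" "[y, x]" "[y, x]" "[]" "[x]"] by (simp add: eval_nat_numeral w211211 w212111)
  have w112121: "f [x, x, y, x, y, x] = 0"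
    using sym[of "[x]" "[x]" "[y, x, y]" "[]" "[x]"] by (simp add: eval_nat_numeral w121211 w212111)
  have w121121: "f [x, y, x, x, y, x] = 0"
    using sym[of "[x]" "[x]" "[y]" "[]" "[x, y, x]"] by (simp add: eval_nat_numeral w112121 w211121)
  have w112112: "f [x, x, y, x, x, y] = 0"
    using sym[of "[x]" "[x]" "[y]" "[]" "[x, x, y]"] by (simp add: eval_nat_numeral w121112 w211112)
  have w222111: "f [y, y, y, x, x, x] = 0"
    using sym[of "[y]" "[y]" "[y]" "[]" "[x, x, x]"] by (simp add: eval_nat_numeral)
  have w221112: "f [y, y, x, x, x, y] = 0"
    using sym[of "[x]" "[x]" "[x]" "[y, y]" "[y]"] by (simp add: eval_nat_numeral)
  have w212121: "f [y, x, y, x, y, x] = 0"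
    using sym[of "[y, x]" "[y, x]" "[y, x]" "[]" "[]"] by (simp add: eval_nat_numeral)
  have w211122: "f [y, x, x, x, y, y] = 0"
    using sym[of "[x]" "[x]" "[x]" "[y]" "[y, y]"] by (simp add: eval_nat_numeral)
  have w122211: "f [x, y, y, y, x, x] = 0"
    using sym[of "[y]" "[y]" "[y]" "[x]" "[x, x]"] by (simp add: eval_nat_numeral)
  have w121212: "f [x, y, x, y, x, y] = 0"
    using sym[of "[x, y]" "[x, y]" "[x, y]" "[]" "[]"] by (simp add: eval_nat_numeral)
  have w112221: "f [x, x, y, y, y, x] = 0"
    using sym[of "[y]" "[y]" "[y]" "[x, x]" "[x]"] by (simp add: eval_nat_numeral)
  have w111222: "f [x, x, x, y, y, y] = 0"
    using sym[of "[x]" "[x]" "[x]" "[]" "[y, y, y]"] by (simp add: eval_nat_numeral)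
  \<comment> \<open>The other twelve words with three letters \<open>y\<close> are coupled by a
    linear system, which is solved as a whole.\<close>
  have rest: "f [y, y, x, y, x, x] = 0" "f [y, y, x, x, y, x] = 0" "f [y, x, y, y, x, x] = 0" "f [y, x, y, x, x, y] = 0" "f [y, x, x, y, y, x] = 0" "f [y, x, x, y, x, y] = 0" "f [x, y, y, x, y, x] = 0" "f [x, y, y, x, x, y] = 0" "f [x, y, x, y, y, x] = 0" "f [x, y, x, x, y, y] = 0" "f [x, x, y, y, x, y] = 0" "f [x, x, y, x, y, y] = 0"
    using sym[of "[y]" "[y]" "[y, x]" "[]" "[x, x]"]
      sym[of "[y]" "[y]" "[y, x, x]" "[]" "[x]"]
      sym[of "[x]" "[x]" "[y, y]" "[y]" "[x]"]
      sym[of "[x, y, x]" "[y]" "[y]" "[]" "[x]"]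
      sym[of "[x]" "[x]" "[y, x, y]" "[y]" "[]"]
      sym[of "[x]" "[y]" "[y]" "[]" "[x, y, x]"]
      sym[of "[x]" "[y]" "[y]" "[]" "[x, x, y]"]
      sym[of "[x, x]" "[y]" "[y]" "[]" "[x, y]"]
      sym[of "[x]" "[x]" "[y, y]" "[]" "[x, y]"]
      sym[of "[x]" "[x]" "[y, x, y]" "[]" "[y]"]
      sym[of "[x]" "[x]" "[y]" "[]" "[x, y, y]"]
      sym[of "[x, y, x, x]" "[y]" "[y]" "[]" "[]"]
    w121212 w211122 w212121 w221112 w222111
    by (simp_all add: eval_nat_numeral)
  show ?thesis
    by (intro conjI) (fact w111111 w211111 w121111 w112111 w111211 w111121 w111112 w221111 w212111 w211121 w211112 w122111 w121112 w111221 w111212 w111122 w112211 w211211 w121211 w112121 w121121 w112112 w222111 w221112 w212121 w211122 w122211 w121212 w112221 w111222 rest)+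
qed

text \<open>One of the two letters occurs at most three times among six, so
  \<open>nil_three_words\<close> and its copy with the letters exchanged cover all words.\<close>

lemma nil_three_nilpotent:
  fixes f :: "bool list \<Rightarrow> real"
  assumes nil: "\<forall>p a b c q. a \<noteq> [] \<longrightarrow> b \<noteq> [] \<longrightarrow> c \<noteq> [] \<longrightarrow> length (p @ a @ b @ c @ q) = 6 \<longrightarrow>
      f (p @ a @ b @ c @ q) + f (p @ a @ c @ b @ q) + f (p @ b @ a @ c @ q)
      + f (p @ b @ c @ a @ q) + f (p @ c @ a @ b @ q) + f (p @ c @ b @ a @ q) = 0"
    and "length w = 6"
  shows "f w = 0"
proof -
  obtain a b c d e g where w: "w = [a, b, c, d, e, g]"
    using \<open>length w = 6\<close> by (auto simp: eval_nat_numeral length_Suc_conv)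
  note vanish = nil_three_words[where f = f and x = True and y = False, OF nil]
      nil_three_words[where f = f and x = False and y = True, OF nil]
  show ?thesis
    unfolding w by (cases a; cases b; cases c; cases d; cases e; cases g; simp add: vanish)
qed

abbreviation (input) "tt \<equiv> True"
abbreviation (input) "ff \<equiv> False"

text \<open>Models a functional on the traces of length \<open>n\<close> that kills lower weights
  and products of shorter traces: of the trace identity only the six terms with a single trace
  remain. Values are real, so that linear systems between them can be solved directly.\<close>

locale cyclic_trace_function =
  fixes f :: "bool list \<Rightarrow> real" and n :: nat
  assumes cyc: "u \<noteq> [] \<Longrightarrow> v \<noteq> [] \<Longrightarrow> length (u @ v) = n \<Longrightarrow> f (u @ v) = f (v @ u)"
    and fti: "a \<noteq> [] \<Longrightarrow> b \<noteq> [] \<Longrightarrow> c \<noteq> [] \<Longrightarrow> d \<noteq> [] \<Longrightarrow> length (a @ b @ c @ d) = n \<Longrightarrow>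
      f (a @ b @ c @ d) + f (a @ b @ d @ c) + f (a @ c @ b @ d)
      + f (a @ c @ d @ b) + f (a @ d @ b @ c) + f (a @ d @ c @ b) = 0"
begin

lemma rotate: "length w = n \<Longrightarrow> f (rotate k w) = f w"
proof (induction k)
  case (Suc k)
  have "f (rotate1 v) = f v" if "length v = n" for v
  proof (cases v)
    case (Cons a u)
    then show ?thesis using cyc[of "[a]" u] that by (cases "u = []") auto
  qed simp
  from this[of "rotate k w"] Suc show ?case by simp
qed simp

text \<open>One word from each rotation class is enough. That \<open>reps\<close> meets every class
  is a finite check, done by evaluation.\<close>

lemma vanish_by_rotation:
  assumes "\<forall>w\<in>set (List.n_lists n [tt, ff]). \<exists>k\<in>set [0..<n]. rotate k w \<in> set reps"
    and "\<And>w. w \<in> set reps \<Longrightarrow> f w = 0" and "length w = n"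
  shows "f w = 0"
proof -
  have "w \<in> set (List.n_lists n [tt, ff])"
    using assms(3) by (auto simp: set_n_lists)
  then obtain k where "rotate k w \<in> set reps" using assms(1) by blast
  then show ?thesis using assms(2,3) rotate by metis
qed


lemma words_4:
  assumes n: "n = 4" and "f [tt, tt, ff, ff] = 0"
  shows "length w = n \<Longrightarrow> f w = 0"
proof -
  have v1111: "f [tt, tt, tt, tt] = 0"
    using n fti[of "[tt]" "[tt]" "[tt]" "[tt]"] by (simp add: eval_nat_numeral)
  have v1112: "f [tt, tt, tt, ff] = 0"
    using n fti[of "[tt]" "[tt]" "[tt]" "[ff]"] cyc[of "[tt, tt, ff]" "[tt]"] cyc[of "[tt, ff]" "[tt, tt]"] by (simp add: eval_nat_numeral)
  have v1212: "f [tt, ff, tt, ff] = 0"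
    using n fti[of "[tt]" "[tt]" "[ff]" "[ff]"] cyc[of "[tt, ff, ff]" "[tt]"] assms(2) by (simp add: eval_nat_numeral)
  have v1222: "f [tt, ff, ff, ff] = 0"
    using n fti[of "[tt]" "[ff]" "[ff]" "[ff]"] by (simp add: eval_nat_numeral)
  have v2222: "f [ff, ff, ff, ff] = 0"
    using n fti[of "[ff]" "[ff]" "[ff]" "[ff]"] by (simp add: eval_nat_numeral)
  let ?reps = "[[tt, tt, tt, tt], [tt, tt, tt, ff], [tt, tt, ff, ff], [tt, ff, tt, ff], [tt, ff, ff, ff], [ff, ff, ff, ff]]"
  show "f w = 0" if "length w = n"
  proof (rule vanish_by_rotation[where reps = "?reps"])
    show "\<forall>w\<in>set (List.n_lists n [tt, ff]). \<exists>k\<in>set [0..<n]. rotate k w \<in> set ?reps"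
      unfolding n by code_simp
  qed (use that assms(2) in \<open>auto simp: v1111 v1112 v1212 v1222 v2222\<close>)
qed

text \<open>In contrast to lengths 4 and 6, no value has to be assumed zero; accordingly there is no
  generator of weight 5.\<close>

lemma words_5:
  assumes n: "n = 5"
  shows "length w = n \<Longrightarrow> f w = 0"
proof -
  have v11111: "f [tt, tt, tt, tt, tt] = 0"
    using n fti[of "[tt]" "[tt]" "[tt]" "[tt, tt]"] by (simp add: eval_nat_numeral)
  have v11112: "f [tt, tt, tt, tt, ff] = 0"
    using n fti[of "[tt]" "[tt]" "[tt]" "[tt, ff]"] cyc[of "[tt, tt, tt, ff]" "[tt]"] cyc[of "[tt, tt, ff]" "[tt, tt]"] by (simp add: eval_nat_numeral)
  have v11122: "f [tt, tt, tt, ff, ff] = 0"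
    using n fti[of "[tt]" "[tt]" "[tt]" "[ff, ff]"] cyc[of "[tt, tt, ff, ff]" "[tt]"] cyc[of "[tt, ff, ff]" "[tt, tt]"] by (simp add: eval_nat_numeral)
  have v11212: "f [tt, tt, ff, tt, ff] = 0"
    using n fti[of "[tt]" "[tt]" "[tt, ff]" "[ff]"] cyc[of "[tt, tt, ff, ff]" "[tt]"] cyc[of "[tt, ff]" "[tt, tt, ff]"] cyc[of "[tt, ff, tt, ff]" "[tt]"] v11122 by (simp add: eval_nat_numeral)
  have v11222: "f [tt, tt, ff, ff, ff] = 0"
    using n fti[of "[tt, tt]" "[ff]" "[ff]" "[ff]"] by (simp add: eval_nat_numeral)
  have v12122: "f [tt, ff, tt, ff, ff] = 0"
    using n fti[of "[tt]" "[tt]" "[ff]" "[ff, ff]"] cyc[of "[tt, ff, ff]" "[tt, ff]"] cyc[of "[tt, ff, ff, ff]" "[tt]"] v11222 by (simp add: eval_nat_numeral)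
  have v12222: "f [tt, ff, ff, ff, ff] = 0"
    using n fti[of "[tt]" "[ff]" "[ff]" "[ff, ff]"] by (simp add: eval_nat_numeral)
  have v22222: "f [ff, ff, ff, ff, ff] = 0"
    using n fti[of "[ff]" "[ff]" "[ff]" "[ff, ff]"] by (simp add: eval_nat_numeral)
  let ?reps = "[[tt, tt, tt, tt, tt], [tt, tt, tt, tt, ff], [tt, tt, tt, ff, ff], [tt, tt, ff, tt, ff], [tt, tt, ff, ff, ff], [tt, ff, tt, ff, ff], [tt, ff, ff, ff, ff], [ff, ff, ff, ff, ff]]"
  show "f w = 0" if "length w = n"
  proof (rule vanish_by_rotation[where reps = "?reps"])
    show "\<forall>w\<in>set (List.n_lists n [tt, ff]). \<exists>k\<in>set [0..<n]. rotate k w \<in> set ?reps"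
      unfolding n by code_simp
  qed (use that in \<open>auto simp: v11111 v11112 v11122 v11212 v11222 v12122 v12222 v22222\<close>)
qed

text \<open>Up to rotation one free parameter is left, the value at the word of
  \<open>s_elem\<close>; a second class takes the opposite value.\<close>

lemma words_6_values:
  assumes n: "n = 6"
  shows "f [tt, tt, tt, tt, tt, tt] = 0" "f [tt, tt, tt, tt, tt, ff] = 0" "f [tt, tt, tt, tt, ff, ff] = 0" "f [tt, tt, tt, ff, tt, ff] = 0" "f [tt, tt, tt, ff, ff, ff] = 0" "f [tt, tt, ff, tt, tt, ff] = 0" "f [tt, tt, ff, tt, ff, ff] = - f [tt, tt, ff, ff, tt, ff]" "f [tt, tt, ff, ff, ff, ff] = 0" "f [tt, ff, tt, ff, tt, ff] = 0" "f [tt, ff, tt, ff, ff, ff] = 0" "f [tt, ff, ff, tt, ff, ff] = 0" "f [tt, ff, ff, ff, ff, ff] = 0" "f [ff, ff, ff, ff, ff, ff] = 0"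
proof -
  have v111111: "f [tt, tt, tt, tt, tt, tt] = 0"
    using n fti[of "[tt]" "[tt]" "[tt]" "[tt, tt, tt]"] by (simp add: eval_nat_numeral)
  have v111112: "f [tt, tt, tt, tt, tt, ff] = 0"
    using n fti[of "[tt]" "[tt]" "[tt]" "[tt, tt, ff]"] cyc[of "[tt, tt, tt, tt, ff]" "[tt]"] cyc[of "[tt, tt, tt, ff]" "[tt, tt]"] by (simp add: eval_nat_numeral)
  have v111122: "f [tt, tt, tt, tt, ff, ff] = 0"
    using n fti[of "[tt]" "[tt]" "[tt]" "[tt, ff, ff]"] cyc[of "[tt, tt, tt, ff, ff]" "[tt]"] cyc[of "[tt, tt, ff, ff]" "[tt, tt]"] by (simp add: eval_nat_numeral)
  have v111212: "f [tt, tt, tt, ff, tt, ff] = 0"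
    using n fti[of "[tt]" "[tt]" "[tt]" "[ff, tt, ff]"] cyc[of "[tt, tt, ff, tt, ff]" "[tt]"] cyc[of "[tt, ff, tt, ff]" "[tt, tt]"] by (simp add: eval_nat_numeral)
  have v112112: "f [tt, tt, ff, tt, tt, ff] = 0"
    using n fti[of "[tt]" "[tt]" "[tt, ff]" "[tt, ff]"] cyc[of "[tt, tt, ff, tt, ff]" "[tt]"] v111212 by (simp add: eval_nat_numeral)
  have v111222: "f [tt, tt, tt, ff, ff, ff] = 0"
    using n fti[of "[tt]" "[tt]" "[tt]" "[ff, ff, ff]"] cyc[of "[tt, tt, ff, ff, ff]" "[tt]"] cyc[of "[tt, ff, ff, ff]" "[tt, tt]"] by (simp add: eval_nat_numeral)
  have v112122: "f [tt, tt, ff, tt, ff, ff] = - f [tt, tt, ff, ff, tt, ff]"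
    using n fti[of "[tt]" "[tt]" "[tt, ff]" "[ff, ff]"] cyc[of "[tt, tt, ff, ff, ff]" "[tt]"] cyc[of "[tt, ff, ff]" "[tt, tt, ff]"] cyc[of "[tt, ff, ff, tt, ff]" "[tt]"] v111222 by (simp add: eval_nat_numeral)
  have v121212: "f [tt, ff, tt, ff, tt, ff] = 0"
    using n fti[of "[tt]" "[tt]" "[ff]" "[ff, tt, ff]"] cyc[of "[tt, ff, tt, ff, ff]" "[tt]"] cyc[of "[tt, ff, ff, tt, ff]" "[tt]"] v112122 by (simp add: eval_nat_numeral)
  have v112222: "f [tt, tt, ff, ff, ff, ff] = 0"
    using n fti[of "[tt, tt]" "[ff]" "[ff]" "[ff, ff]"] by (simp add: eval_nat_numeral)
  have v121222: "f [tt, ff, tt, ff, ff, ff] = 0"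
    using n fti[of "[tt, ff, tt]" "[ff]" "[ff]" "[ff]"] by (simp add: eval_nat_numeral)
  have v122122: "f [tt, ff, ff, tt, ff, ff] = 0"
    using n fti[of "[tt]" "[tt]" "[ff, ff]" "[ff, ff]"] cyc[of "[tt, ff, ff, ff, ff]" "[tt]"] v112222 by (simp add: eval_nat_numeral)
  have v122222: "f [tt, ff, ff, ff, ff, ff] = 0"
    using n fti[of "[tt]" "[ff]" "[ff]" "[ff, ff, ff]"] by (simp add: eval_nat_numeral)
  have v222222: "f [ff, ff, ff, ff, ff, ff] = 0"
    using n fti[of "[ff]" "[ff]" "[ff]" "[ff, ff, ff]"] by (simp add: eval_nat_numeral)
  show "f [tt, tt, tt, tt, tt, tt] = 0" "f [tt, tt, tt, tt, tt, ff] = 0" "f [tt, tt, tt, tt, ff, ff] = 0" "f [tt, tt, tt, ff, tt, ff] = 0" "f [tt, tt, tt, ff, ff, ff] = 0" "f [tt, tt, ff, tt, tt, ff] = 0" "f [tt, tt, ff, tt, ff, ff] = - f [tt, tt, ff, ff, tt, ff]" "f [tt, tt, ff, ff, ff, ff] = 0" "f [tt, ff, tt, ff, tt, ff] = 0" "f [tt, ff, tt, ff, ff, ff] = 0" "f [tt, ff, ff, tt, ff, ff] = 0" "f [tt, ff, ff, ff, ff, ff] = 0" "f [ff, ff, ff, ff, ff, ff] = 0"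
    by (fact v111111 v111112 v111122 v111212 v112112 v111222 v112122 v121212 v112222 v121222 v122122 v122222 v222222)+
qed

lemma words_6:
  assumes n: "n = 6" and "f [tt, tt, ff, ff, tt, ff] = 0"
  shows "length w = n \<Longrightarrow> f w = 0"
proof -
  let ?reps = "[[tt, tt, tt, tt, tt, tt], [tt, tt, tt, tt, tt, ff], [tt, tt, tt, tt, ff, ff], [tt, tt, tt, ff, tt, ff], [tt, tt, tt, ff, ff, ff], [tt, tt, ff, tt, tt, ff], [tt, tt, ff, tt, ff, ff], [tt, tt, ff, ff, tt, ff], [tt, tt, ff, ff, ff, ff], [tt, ff, tt, ff, tt, ff], [tt, ff, tt, ff, ff, ff], [tt, ff, ff, tt, ff, ff], [tt, ff, ff, ff, ff, ff], [ff, ff, ff, ff, ff, ff]]"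
  show "f w = 0" if "length w = n"
  proof (rule vanish_by_rotation[where reps = "?reps"])
    show "\<forall>w\<in>set (List.n_lists n [tt, ff]). \<exists>k\<in>set [0..<n]. rotate k w \<in> set ?reps"
      unfolding n by code_simp
  qed (use that words_6_values[OF n] assms(2) in auto)
qed

lemma words_long:
  assumes n: "n \<ge> 7" and w: "length w = n"
  shows "f w = 0"
proof -
  define d where "d = drop 6 w"
  have d: "d \<noteq> []" "length d = n - 6" and w_eq: "w = take 6 w @ d"
    using n w by (auto simp: d_def)
  have "f (take 6 w @ d) = 0"
  proof (rule nil_three_nilpotent[where f = "\<lambda>u. f (u @ d)"])
    show "length (take 6 w) = 6" using n w by simp
  next
    show "\<forall>p a b c q. a \<noteq> [] \<longrightarrow> b \<noteq> [] \<longrightarrow> c \<noteq> [] \<longrightarrow> length (p @ a @ b @ c @ q) = 6 \<longrightarrow>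
      f ((p @ a @ b @ c @ q) @ d) + f ((p @ a @ c @ b @ q) @ d) + f ((p @ b @ a @ c @ q) @ d)
      + f ((p @ b @ c @ a @ q) @ d) + f ((p @ c @ a @ b @ q) @ d) + f ((p @ c @ b @ a @ q) @ d) = 0"
    proof (intro allI impI)
    fix p a b c q :: "bool list" assume a: "a \<noteq> []" "b \<noteq> []" "c \<noteq> []" and l: "length (p @ a @ b @ c @ q) = 6"
    \<comment> \<open>The tail \<open>d\<close> is nonempty because the length is at least 7.
      Rotating \<open>v\<close> to the end thus puts the nonempty word \<open>q @ d @ p\<close> in
      front, as first argument of the trace identity, even if \<open>p\<close> and \<open>q\<close>
      are empty.\<close>
    have rot: "f ((p @ v @ q) @ d) = f ((q @ d @ p) @ v)" if "length v = length a + length b + length c" "v \<noteq> []" for v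
      using rotate[of "(p @ v @ q) @ d" "length p + length v"] rotate_append[of "p @ v" "q @ d"] that l d n by simp
    show "f ((p @ a @ b @ c @ q) @ d) + f ((p @ a @ c @ b @ q) @ d) + f ((p @ b @ a @ c @ q) @ d)
      + f ((p @ b @ c @ a @ q) @ d) + f ((p @ c @ a @ b @ q) @ d) + f ((p @ c @ b @ a @ q) @ d) = 0"
      using fti[of "q @ d @ p" a b c] a l d n
        rot[of "a @ b @ c"] rot[of "a @ c @ b"] rot[of "b @ a @ c"] rot[of "b @ c @ a"] rot[of "c @ a @ b"] rot[of "c @ b @ a"]
      by simp
    qed
  qed
  then show ?thesis using w_eq by simp
qed

lemma all_words:
  assumes "n \<ge> 4" "length w = n" "n = 4 \<Longrightarrow> f [tt, tt, ff, ff] = 0"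
    "n = 6 \<Longrightarrow> f [tt, tt, ff, ff, tt, ff] = 0"
  shows "f w = 0"
proof -
  consider "n = 4" | "n = 5" | "n = 6" | "n \<ge> 7" using assms(1) by linarith
  then show ?thesis
    using assms words_4 words_5 words_6 words_long by cases blast+
qed

end

section \<open>Generators of the span of the traces\<close>

definition real_linear :: "('a::complex_vector \<Rightarrow> real) \<Rightarrow> bool" where
  "real_linear g \<longleftrightarrow> (\<forall>x y. g (x + y) = g x + g y) \<and> (\<forall>r x. g (complex_of_real r *\<^sub>C x) = r * g x)"

lemma real_linear_simps:
  assumes "real_linear g"
  shows "g (x + y) = g x + g y" "g 0 = 0" "g (x - y) = g x - g y" "g (- x) = - g x"
    "g (complex_of_real r *\<^sub>C x) = r * g x"
proof -
  show add: "g (x + y) = g x + g y" for x y using assms by (simp add: real_linear_def)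
  show zero: "g 0 = 0" using add[of 0 0] by simp
  show "g (x - y) = g x - g y" using add[of "x - y" y] by simp
  show "g (- x) = - g x" using add[of x "- x"] zero by simp
  show "g (complex_of_real r *\<^sub>C x) = r * g x" using assms by (simp add: real_linear_def)
qed

text \<open>A vector outside a subspace is separated from it by a linear functional, defined on a
  basis of the subspace extended by the vector. Its real part still separates, so that computations
  modulo a subspace become equations between real numbers.\<close>

lemma member_by_functionals:
  fixes P :: "'a::complex_vector \<Rightarrow> bool"
  assumes zero: "P 0" and add: "\<And>x y. P x \<Longrightarrow> P y \<Longrightarrow> P (x + y)" and scale: "\<And>c x. P x \<Longrightarrow> P (c *\<^sub>C x)"
    and vanish: "\<And>g. real_linear g \<Longrightarrow> (\<And>y. P y \<Longrightarrow> g y = 0) \<Longrightarrow> g x = 0"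
  shows "P x"
proof (rule ccontr)
  assume x: "\<not> P x"
  interpret V: vector_space "scaleC :: complex \<Rightarrow> 'a \<Rightarrow> 'a"
    by unfold_locales (simp_all add: scaleC_add_right scaleC_add_left scaleC_scaleC scaleC_one)
  interpret W: vector_space "(*) :: complex \<Rightarrow> complex \<Rightarrow> complex"
    by unfold_locales (simp_all add: algebra_simps)
  interpret VW: vector_space_pair "scaleC :: complex \<Rightarrow> 'a \<Rightarrow> 'a" "(*) :: complex \<Rightarrow> complex \<Rightarrow> complex" ..
  have "V.subspace (Collect P)"
    unfolding V.subspace_def using zero add scale by auto
  then have span: "V.span (Collect P) = Collect P"
    by (simp add: V.span_eq_iff)
  obtain B where B: "B \<subseteq> Collect P" "V.independent B" "Collect P \<subseteq> V.span B"
    using V.maximal_independent_subset by blast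
  have "V.span B \<subseteq> Collect P"
    using V.span_mono[OF B(1)] span by simp
  then have "x \<notin> V.span B" using x by auto
  then have ind: "V.independent (insert x B)"
    using B(2) by (simp add: V.independent_insert)
  have xB: "x \<notin> B" using \<open>x \<notin> V.span B\<close> V.span_base by blast
  from VW.linear_independent_extend[OF ind, of "\<lambda>b. if b = x then 1 else 0"]
  obtain h where h': "Vector_Spaces.linear (*\<^sub>C) (*) h" "\<forall>b\<in>insert x B. h b = (if b = x then 1 else 0)"
    by blast
  note h = h'(1) h'(2)[rule_format]
  interpret h: Vector_Spaces.linear "(*\<^sub>C)" "(*)" h by (rule h(1))
  have "h y = 0" if "P y" for y
  proof -
    have "y \<in> V.span B" using that B(3) by auto
    moreover have "h b = 0" if "b \<in> B" for b using h(2)[of b] that xB by auto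
    ultimately show ?thesis
      using h.eq_0_on_span by blast
  qed
  moreover have "real_linear (\<lambda>y. Re (h y))"
    by (simp add: real_linear_def h.add h.scale)
  ultimately have "Re (h x) = 0" using vanish by force
  then show False using h(2)[of x] by simp
qed

text \<open>Generic in the algebra and in the values \<open>v g\<close>: the same filtration serves
  the tensor product, the variant with one generator set to zero, and the abstract algebra.\<close>

inductive filt :: "('g \<Rightarrow> 'a::complex_algebra_1) \<Rightarrow> ('g \<Rightarrow> nat) \<Rightarrow> nat \<Rightarrow> 'a \<Rightarrow> bool" for v w where
  one: "filt v w 0 1"
| scale: "filt v w n x \<Longrightarrow> filt v w n (c *\<^sub>C x)"
| add: "filt v w n x \<Longrightarrow> filt v w n y \<Longrightarrow> filt v w n (x + y)"
| mono: "filt v w m x \<Longrightarrow> m \<le> n \<Longrightarrow> filt v w n x"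
| mult: "filt v w n x \<Longrightarrow> filt v w (w g + n) (v g * x)"

lemma filt_zero: "filt v w n 0"
  using filt.mono[OF filt.scale[OF filt.one, of v w 0], of n] by simp

lemma filt_uminus: "filt v w n x \<Longrightarrow> filt v w n (- x)"
  using filt.scale[of v w n x "-1"] by (simp add: scaleC_minus_one)

lemma filt_diff: "filt v w n x \<Longrightarrow> filt v w n y \<Longrightarrow> filt v w n (x - y)"
  using filt.add[of v w n x "- y"] filt_uminus[of v w n y] by simp

lemma filt_mult:
  assumes "filt v w m x" "filt v w n y"
  shows "filt v w (m + n) (x * y)"
  using assms
proof (induction rule: filt.induct)
  case one
  then show ?case by simp
next
  case (scale m x c)
  then show ?case by (simp add: mult_scaleC_left filt.scale)
next
  case (add m x x')
  then show ?case by (simp add: distrib_right filt.add)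
next
  case (mono k x m)
  then show ?case by (auto intro: filt.mono[of v w "k + n"])
next
  case (mult m x g)
  then show ?case
    using filt.mult[of v w "m + n" "x * y" g] by (simp add: mult.assoc add.assoc)
qed

lemma filt_gen: "filt v w (w g) (v g)"
  using filt.mult[OF filt.one, of v w g] by simp

lemma filt_transfer:
  assumes "filt v w n x" "\<And>g. filt v' w' (w g) (v g)"
  shows "filt v' w' n x"
  using assms(1)
proof induction
  case (mult n x g)
  then show ?case using filt_mult[OF assms(2)] by blast
qed (auto intro: filt.intros)

datatype zgen = ZK 3 | ZL 3 | ZX | ZY | ZS

definition s_elem :: U2 where
  "s_elem = ptrace [1, 1, 2, 2, 1, 2]"

fun zval :: "zgen \<Rightarrow> U2" where
  "zval (ZK i) = kU i" | "zval (ZL i) = lU i" | "zval ZX = X_elem" | "zval ZY = Y_elem" | "zval ZS = s_elem"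

fun zwt :: "zgen \<Rightarrow> nat" where
  "zwt (ZK i) = 2" | "zwt (ZL i) = 3" | "zwt ZX = 3" | "zwt ZY = 4" | "zwt ZS = 6"

text \<open>Setting the generator of weight 6 to zero leaves the span of the words without it.\<close>

definition zval0 :: "zgen \<Rightarrow> U2" where
  "zval0 g = (if g = ZS then 0 else zval g)"

abbreviation "gen_filt \<equiv> filt zval zwt"
abbreviation "low_filt \<equiv> filt zval0 zwt"

lemma low_gen_filt: "low_filt n x \<Longrightarrow> gen_filt n x"
  by (erule filt_transfer) (simp add: zval0_def filt_zero filt_gen)

lemma gen_low_filt: "gen_filt n x \<Longrightarrow> n < 6 \<Longrightarrow> low_filt n x"
proof (induction rule: filt.induct)
  case (mult n x g)
  then have "g \<noteq> ZS" by auto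
  then have "zval0 g = zval g" by (simp add: zval0_def)
  with mult show ?case using filt.mult[of zval0 zwt n x g] by simp
qed (auto intro: filt.intros)

lemma quadratic_trace_span: "trace_span 2 (quadratic a b)"
  using trace_span_trace[of "[a, b]"] by (simp add: polarised_trace_2 numeral_2_eq_2)

lemma cubic_trace_span: "trace_span 3 (cubic a b c)"
  using trace_span_trace[of "[a, b, c]"] by (simp add: polarised_trace_3 numeral_3_eq_3)

lemma cubic_bar_trace_span: "trace_span 3 (cubic_bar a b c)"
proof -
  have "trace_span 3 (cubic_bar a b c - cubic a c b)"
    using cubic_bar_trace[of a b c] by (auto simp: polarised_trace_3 intro: trace_span.mono)
  from trace_span.add[OF this cubic_trace_span[of a c b]] show ?thesis by simp
qed

lemma kU_trace_span: "trace_span 2 (kU i)" and lU_trace_span: "trace_span 3 (lU i)"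
  using three_cases[of i]
  by (auto simp: kU_lU_simps coproduct_casimir2 coproduct_casimir3 coproduct_casimir3_bar
      intro!: trace_span.add trace_span.scale trace_span_uminus quadratic_trace_span cubic_trace_span cubic_bar_trace_span)

lemma X_trace_span: "trace_span 3 X_elem"
  unfolding X_elem_def polarised_trace_3
  by (intro trace_span.add trace_span.scale trace_span_diff cubic_trace_span lU_trace_span)

lemma Y_trace_span: "trace_span 4 Y_elem"
proof -
  have "trace_span (2 + 2) (quadratic a b * quadratic c d)" for a b c d
    by (intro trace_span_mult quadratic_trace_span)
  then have q: "trace_span 4 (quadratic a b * quadratic c d)" for a b c d by simp
  have q': "trace_span 4 (quadratic a b)" for a b
    by (rule trace_span.mono[OF quadratic_trace_span]) simp
  have c: "trace_span 4 (cubic a b c)" for a b c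
    by (rule trace_span.mono[OF cubic_trace_span]) simp
  have "trace_span 4 (ptrace [1,1,2,2])"
    using trace_span_trace[of "[1,1,2,2]"] by (simp add: eval_nat_numeral)
  then show ?thesis
    unfolding Y_elem_def polarised_trace_3 polarised_trace_2 power2_eq_square
    by (intro trace_span.add trace_span.scale trace_span_diff c q q')
qed

lemma s_trace_span: "trace_span 6 s_elem"
  using trace_span_trace[of "[1,1,2,2,1,2]"] by (simp add: s_elem_def eval_nat_numeral)

lemma zval_trace_span: "trace_span (zwt g) (zval g)"
  by (cases g) (simp_all add: kU_trace_span lU_trace_span X_trace_span Y_trace_span s_trace_span)

lemma gen_filt_trace_span: "gen_filt n x \<Longrightarrow> trace_span n x"
proof (induction rule: filt.induct)
  case (mult n x g)
  then show ?case by (intro trace_span_mult zval_trace_span)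
qed (auto intro: trace_span.intros)

lemma trace_span_gen_filt_aux:
  assumes "trace_span m x" "m \<le> n" "\<And>w. w \<noteq> [] \<Longrightarrow> length w \<le> n \<Longrightarrow> gen_filt (length w) (ptrace w)"
  shows "gen_filt m x"
  using assms(1,2)
proof induction
  case (mult as m x)
  then show ?case by (intro filt_mult assms(3)) auto
next
  case (mono k x m)
  then show ?case by (auto intro: filt.mono)
qed (auto intro: filt.intros)

definition letter :: "bool \<Rightarrow> 2" where
  "letter b = (if b then 1 else 2)"

lemma letter_word: "\<exists>v. w = map letter v"
proof -
  have "\<exists>b. a = letter b" for a
    using exhaust_2[of a] by (auto simp: letter_def intro: exI[of _ True] exI[of _ False])
  then have "a = letter (inv_into UNIV letter a)" for a by (metis f_inv_into_f rangeI)
  then have "w = map letter (map (inv_into UNIV letter) w)" by (simp add: map_idI)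
  then show ?thesis by blast
qed

lemma cyclic_trace_functionI:
  assumes g: "real_linear g" and low: "\<And>x. trace_span (n - 1) x \<Longrightarrow> g x = 0"
    and prod: "\<And>us. list_all (\<lambda>u. u \<noteq> []) us \<Longrightarrow> length us > 1 \<Longrightarrow> sum_list (map length us) = n \<Longrightarrow>
      g (prod_list (map ptrace us)) = 0"
  shows "cyclic_trace_function (\<lambda>w. g (ptrace (map letter w))) n"
proof
  fix u v :: "bool list" assume "u \<noteq> []" "v \<noteq> []" "length (u @ v) = n"
  then have "g (ptrace (map letter u @ map letter v) - ptrace (map letter v @ map letter u)) = 0"
    using trace_rotate[of "map letter u" "map letter v"] by (intro low) simp
  then show "g (ptrace (map letter (u @ v))) = g (ptrace (map letter (v @ u)))"
    by (simp add: real_linear_simps[OF g])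
next
  fix a b c d :: "bool list"
  assume ne: "a \<noteq> []" "b \<noteq> []" "c \<noteq> []" "d \<noteq> []" and n: "length (a @ b @ c @ d) = n"
  let ?T = "\<lambda>w. ptrace (map letter w)"
  note fti = fundamental_trace_identity[of "map letter a" "map letter b" "map letter c" "map letter d"]
  have n': "n = length a + length b + length c + length d" using n by simp
  have p2: "g (ptrace u * ptrace v) = 0" if "u \<noteq> []" "v \<noteq> []" "length u + length v = n" for u v
    using prod[of "[u, v]"] that by simp
  have p3: "g (ptrace u * (ptrace v * ptrace w)) = 0"
    if "u \<noteq> []" "v \<noteq> []" "w \<noteq> []" "length u + length v + length w = n" for u v w
    using prod[of "[u, v, w]"] that by simp
  have p4: "g (ptrace u * (ptrace v * (ptrace w * ptrace x))) = 0"
    if "u \<noteq> []" "v \<noteq> []" "w \<noteq> []" "x \<noteq> []" "length u + length v + length w + length x = n" for u v w x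
    using prod[of "[u, v, w, x]"] that by simp
  have "trace_span (n - 1) E \<Longrightarrow> g E = 0" for E by (rule low)
  from this[OF fti[unfolded length_map, folded n']]
  show "g (?T (a @ b @ c @ d)) + g (?T (a @ b @ d @ c)) + g (?T (a @ c @ b @ d))
      + g (?T (a @ c @ d @ b)) + g (?T (a @ d @ b @ c)) + g (?T (a @ d @ c @ b)) = 0"
    using ne by (simp add: real_linear_simps[OF g] p2 p3 p4 n' mult.assoc)
qed

text \<open>Induction on the length, modulo \<open>gen_filt\<close> of that weight: shorter traces
  and products of traces vanish under the functional, which leaves a
  \<open>cyclic_trace_function\<close>. The generators account for what it leaves free:
  \<open>kU\<close> in length 2, \<open>lU\<close> and \<open>X_elem\<close> in length 3,
  \<open>Y_elem\<close> in length 4, \<open>s_elem\<close> in length 6.\<close>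

lemma trace_gen_filt: "w \<noteq> [] \<Longrightarrow> gen_filt (length w) (ptrace w)"
proof (induction "length w" arbitrary: w rule: less_induct)
  case less
  let ?n = "length w"
  have short: "gen_filt (length u) (ptrace u)" if "u \<noteq> []" "length u < ?n" for u
    using less.hyps that by blast
  have span: "gen_filt m x" if "trace_span m x" "m < ?n" for m x
    using that(1) order_refl[of m] by (rule trace_span_gen_filt_aux) (use that(2) short in auto)
  show ?case
  proof (rule member_by_functionals)
    fix g :: "U2 \<Rightarrow> real" assume g: "real_linear g" and g0: "\<And>y. gen_filt ?n y \<Longrightarrow> g y = 0"
    have low: "g x = 0" if "trace_span (?n - 1) x" for x
      using g0[OF filt.mono[OF span[OF that]]] less.prems by simp
    have gen0: "g y = 0" if "gen_filt m y" "m \<le> ?n" for m y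
      using g0[OF filt.mono[OF that]] .
    have prod: "g (prod_list (map ptrace us)) = 0"
      if "list_all (\<lambda>u. u \<noteq> []) us" "length us > 1" "sum_list (map length us) = ?n" for us
    proof -
      have lt: "length u < ?n" if "u \<in> set us" for u
      proof -
        obtain as bs where us: "us = as @ u # bs" using \<open>u \<in> set us\<close> by (meson split_list)
        with \<open>length us > 1\<close> have "as @ bs \<noteq> []" by (cases as) auto
        then obtain u' where "u' \<in> set (as @ bs)" by (meson last_in_set)
        then have "u' \<noteq> []" "length u' \<le> sum_list (map length (as @ bs))"
          using \<open>list_all _ us\<close> us member_le_sum_list[of "length u'" "map length (as @ bs)"]
          by (auto simp: list_all_iff)
        moreover have "?n = length u + sum_list (map length (as @ bs))"
          using \<open>sum_list (map length us) = ?n\<close> us by simp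
        ultimately show ?thesis using length_greater_0_conv[of u'] by linarith
      qed
      have "gen_filt (sum_list (map length vs)) (prod_list (map ptrace vs))"
        if "set vs \<subseteq> set us" for vs
        using that
      proof (induction vs)
        case (Cons v vs)
        then have "gen_filt (length v) (ptrace v)"
          using lt \<open>list_all _ us\<close> by (intro short) (auto simp: list_all_iff)
        with Cons show ?case by (auto intro: filt_mult)
      qed (simp add: filt.one)
      from this[of us] that(3) show ?thesis by (auto intro: g0)
    qed
    interpret cyclic_trace_function "\<lambda>w. g (ptrace (map letter w))" ?n
      using g low prod by (rule cyclic_trace_functionI)
    obtain v where w: "w = map letter v" using letter_word by blast
    have half: "g ((1/2) *\<^sub>C x) = g x / 2" "g ((1/3) *\<^sub>C x) = g x / 3" "g ((3/2) *\<^sub>C x) = 3 / 2 * g x"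
      "g ((1/12) *\<^sub>C x) = g x / 12" "g ((5/12) *\<^sub>C x) = 5 / 12 * g x" "g ((5/2) *\<^sub>C x) = 5 / 2 * g x" for x
      using real_linear_simps(5)[OF g, of "1/2" x] real_linear_simps(5)[OF g, of "1/3" x] real_linear_simps(5)[OF g, of "3/2" x]
        real_linear_simps(5)[OF g, of "1/12" x] real_linear_simps(5)[OF g, of "5/12" x] real_linear_simps(5)[OF g, of "5/2" x] by simp_all
    note g_simps = real_linear_simps(1-4)[OF g] half
    have quad: "g (quadratic a b) = 0" if "?n = 2" for a b
    proof -
      have k: "g (kU i) = 0" for i using gen0[OF filt_gen[of zval zwt "ZK i"]] that by simp
      have "g (quadratic 1 2) = g (quadratic 2 1)"
        using cyc[of "[tt]" "[ff]"] that by (simp add: letter_def polarised_trace_2)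
      moreover have "g (quadratic 1 1) = 0" "g (quadratic 2 2) = 0"
          "g (quadratic 1 1) + g (quadratic 1 2) + g (quadratic 2 1) + g (quadratic 2 2) = 0"
        using k[of 1] k[of 2] k[of 3] by (simp_all add: kU_lU_simps coproduct_casimir2 g_simps)
      ultimately show ?thesis using exhaust_2[of a] exhaust_2[of b] by auto
    qed
    have cub: "g (cubic a b c) = 0" if n: "?n = 3" for a b c
    proof -
      have l: "g (lU i) = 0" and x: "g X_elem = 0" for i
        using gen0[OF filt_gen[of zval zwt "ZL i"]] gen0[OF filt_gen[of zval zwt ZX]] n by simp_all
      have rot: "g (cubic 1 2 1) = g (cubic 1 1 2)" "g (cubic 2 1 1) = g (cubic 1 1 2)"
        "g (cubic 2 1 2) = g (cubic 1 2 2)" "g (cubic 2 2 1) = g (cubic 1 2 2)"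
        using cyc[of "[tt, ff]" "[tt]"] cyc[of "[ff]" "[tt, tt]"]
          cyc[of "[ff]" "[tt, ff]"] cyc[of "[ff, ff]" "[tt]"]  cyc[of "[ff]" "[ff, tt]"] n
        by (simp_all add: letter_def polarised_trace_3)
      have bar: "g (cubic_bar a b c) = g (cubic a c b)" for a b c
        using low[of "cubic_bar a b c - cubic a c b"] cubic_bar_trace[of a b c] n
        by (simp add: polarised_trace_3 g_simps)
      have "g (cubic 1 1 1) = 0" "g (cubic 2 2 2) = 0"
        using l[of 1] l[of 2] by (simp_all add: kU_lU_simps g_simps bar)
      moreover have "g (cubic 1 1 2) = g (cubic 1 2 2)"
        using x l[of 1] l[of 2] by (simp add: X_elem_def polarised_trace_3 g_simps)
      moreover have "g (cubic 1 1 1) + 3 * g (cubic 1 1 2) + 3 * g (cubic 1 2 2) + g (cubic 2 2 2) = 0"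
        using l[of 3] by (simp add: kU_lU_simps coproduct_casimir3 coproduct_casimir3_bar g_simps bar rot)
      ultimately show ?thesis
        using exhaust_2[of a] exhaust_2[of b] exhaust_2[of c] rot by auto
    qed
    have "?n \<ge> 1" using less.prems by (cases w) auto
    then consider "?n = 1" | "?n = 2" | "?n = 3" | "?n \<ge> 4" by linarith
    then show "g (ptrace w) = 0"
    proof cases
      case 1
      then obtain a where "w = [a]" by (auto simp: length_Suc_conv)
      then show ?thesis by (simp add: polarised_trace_1 g_simps)
    next
      case 2
      then obtain a b where "w = [a, b]" by (auto simp: eval_nat_numeral length_Suc_conv)
      then show ?thesis using quad[OF 2] by (simp add: polarised_trace_2)
    next
      case 3
      then obtain a b c where "w = [a, b, c]" by (auto simp: eval_nat_numeral length_Suc_conv)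
      then show ?thesis using cub[OF 3] by (simp add: polarised_trace_3)
    next
      case 4
      have "g (ptrace (map letter [tt, tt, ff, ff])) = 0" if n: "?n = 4"
      proof -
        have "gen_filt 4 (ptrace [a, b] * ptrace [c, d])" for a b c d
          using filt_mult[OF short[of "[a, b]"] short[of "[c, d]"]] n by (simp add: eval_nat_numeral)
        moreover have "g (cubic a b c) = 0" "g (quadratic a b) = 0" for a b c
          using gen0[OF short[of "[a, b, c]"]] gen0[OF short[of "[a, b]"]] n by (simp_all add: polarised_trace_2 polarised_trace_3)
        ultimately show ?thesis
          using gen0[OF filt_gen[of zval zwt ZY]] n
          by (simp add: Y_elem_def g_simps g0 polarised_trace_2 polarised_trace_3 power2_eq_square letter_def)
      qed
      moreover have "g (ptrace (map letter [tt, tt, ff, ff, tt, ff])) = 0" if n: "?n = 6"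
        using gen0[OF filt_gen[of zval zwt ZS]] n by (simp add: s_elem_def letter_def)
      ultimately show ?thesis
        using all_words[OF 4, of v] w by simp
    qed
  qed (auto intro: filt.intros filt_zero)
qed

theorem trace_span_iff_gen_filt: "trace_span n x \<longleftrightarrow> gen_filt n x"
  using trace_span_gen_filt_aux[OF _ order_refl] trace_gen_filt gen_filt_trace_span by blast

text \<open>The condition \<open>6 \<le> n \<or> z = 0\<close> compensates for the truncated
  subtraction: for \<open>n < 6\<close> no multiple of \<open>s_elem\<close> is allowed.\<close>

definition normal_filt :: "nat \<Rightarrow> U2 \<Rightarrow> bool" where
  "normal_filt n x \<longleftrightarrow> (\<exists>y z. low_filt n y \<and> low_filt (n - 6) z \<and> (6 \<le> n \<or> z = 0) \<and> x = y + z * s_elem)"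

lemma normal_filt_low: "low_filt n x \<Longrightarrow> normal_filt n x"
  unfolding normal_filt_def by (intro exI[of _ x] exI[of _ 0]) (simp add: filt_zero)

lemma normal_filtE:
  assumes "normal_filt n x"
  obtains y z where "low_filt n y" "x = y + z * s_elem" "low_filt (n - 6) z" "6 \<le> n \<or> z = 0"
  using assms unfolding normal_filt_def by blast

lemma normal_filtI:
  "low_filt n y \<Longrightarrow> low_filt (n - 6) z \<Longrightarrow> 6 \<le> n \<or> z = 0 \<Longrightarrow> normal_filt n (y + z * s_elem)"
  unfolding normal_filt_def by blast

lemma normal_filt_mono:
  assumes "normal_filt m x" "m \<le> n"
  shows "normal_filt n x"
proof -
  obtain y z where x: "low_filt m y" "x = y + z * s_elem" "low_filt (m - 6) z" "6 \<le> m \<or> z = 0"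
    using assms(1) by (rule normal_filtE)
  have "low_filt n y" "low_filt (n - 6) z"
    using filt.mono[OF x(1) assms(2)] filt.mono[OF x(3), of "n - 6"] assms(2) by auto
  with x(4) assms(2) show ?thesis unfolding x(2) by (intro normal_filtI) auto
qed

lemma normal_filt_low_s:
  assumes "low_filt m z" "m + 6 \<le> n"
  shows "normal_filt n (z * s_elem)"
proof -
  have "low_filt (n - 6) z" using assms by (auto intro: filt.mono)
  from normal_filtI[OF filt_zero this] show ?thesis using assms(2) by simp
qed

lemma normal_filt_add:
  assumes "normal_filt n x" "normal_filt n x'"
  shows "normal_filt n (x + x')"
proof -
  obtain y z where x: "low_filt n y" "x = y + z * s_elem" "low_filt (n - 6) z" "6 \<le> n \<or> z = 0"
    using assms(1) by (rule normal_filtE)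
  obtain y' z' where x': "low_filt n y'" "x' = y' + z' * s_elem" "low_filt (n - 6) z'" "6 \<le> n \<or> z' = 0"
    using assms(2) by (rule normal_filtE)
  have "low_filt n (y + y')" "low_filt (n - 6) (z + z')" using x x' by (auto intro: filt.add)
  moreover have "x + x' = (y + y') + (z + z') * s_elem" by (simp add: x x' algebra_simps)
  moreover have "6 \<le> n \<or> z + z' = 0" using x(4) x'(4) by auto
  ultimately show ?thesis by (simp only: normal_filtI)
qed

lemma normal_filt_scale: "normal_filt n x \<Longrightarrow> normal_filt n (c *\<^sub>C x)"
proof (erule normal_filtE)
  fix y z assume x: "low_filt n y" "x = y + z * s_elem" "low_filt (n - 6) z" "6 \<le> n \<or> z = 0"
  have "normal_filt n (c *\<^sub>C y + (c *\<^sub>C z) * s_elem)"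
    using x by (intro normal_filtI filt.scale) auto
  then show "normal_filt n (c *\<^sub>C x)"
    by (simp add: x(2) scaleC_add_right mult_scaleC_left)
qed

section \<open>Reordering products and eliminating the square of \<open>s_elem\<close>\<close>

lemma gen_filt_commutator: "gen_filt m x \<Longrightarrow> gen_filt n y \<Longrightarrow> gen_filt (m + n - 1) (x * y - y * x)"
  using trace_span_commutator trace_span_iff_gen_filt by blast

lemma gen_filt_s: "gen_filt 6 s_elem"
  using filt_gen[of zval zwt ZS] by simp

lemma low_normal_mult:
  assumes "low_filt i x" "normal_filt j y"
  shows "normal_filt (i + j) (x * y)"
proof -
  obtain a z where y: "low_filt j a" "y = a + z * s_elem" "low_filt (j - 6) z" "6 \<le> j \<or> z = 0"
    using assms(2) by (rule normal_filtE)
  have "normal_filt (i + j) (x * a)"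
    using assms(1) y(1) by (intro normal_filt_low filt_mult)
  moreover have "normal_filt (i + j) (x * z * s_elem)"
  proof (cases "j < 6")
    case True
    then show ?thesis using y(4) by (simp add: normal_filt_low filt_zero)
  next
    case False
    then show ?thesis using filt_mult[OF assms(1) y(3)] by (intro normal_filt_low_s) auto
  qed
  ultimately show ?thesis
    using normal_filt_add by (simp add: y(2) distrib_left mult.assoc)
qed

text \<open>Moving \<open>y\<close> past \<open>s_elem\<close> costs a commutator of smaller weight,
  which the hypothesis \<open>less\<close> brings to normal form.\<close>

lemma normal_low_mult:
  assumes x: "normal_filt i x" and y: "low_filt j y"
    and less: "\<And>m x. m < i + j \<Longrightarrow> gen_filt m x \<Longrightarrow> normal_filt m x"
  shows "normal_filt (i + j) (x * y)"
proof -
  obtain a z where a: "low_filt i a" "x = a + z * s_elem" "low_filt (i - 6) z" "6 \<le> i \<or> z = 0"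
    using x by (rule normal_filtE)
  have "normal_filt (i + j) (z * s_elem * y)"
  proof (cases "i < 6")
    case True
    then show ?thesis using a(4) by (simp add: normal_filt_low filt_zero)
  next
    case False
    have "gen_filt (i - 6 + (6 + j - 1)) (z * (s_elem * y - y * s_elem))"
      by (rule filt_mult[OF low_gen_filt[OF a(3)] gen_filt_commutator[OF gen_filt_s low_gen_filt[OF y]]])
    then have "normal_filt (i + j) (z * (s_elem * y - y * s_elem))"
      using False by (intro normal_filt_mono[OF less]) auto
    moreover have "normal_filt (i + j) (z * y * s_elem)"
      using filt_mult[OF a(3) y] False by (intro normal_filt_low_s) auto
    ultimately have "normal_filt (i + j) (z * (s_elem * y - y * s_elem) + z * y * s_elem)"
      by (rule normal_filt_add)
    then show ?thesis by (simp add: algebra_simps)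
  qed
  moreover have "normal_filt (i + j) (a * y)"
    using a(1) y by (intro normal_filt_low filt_mult)
  ultimately show ?thesis
    using normal_filt_add by (simp add: a(2) distrib_right)
qed

text \<open>The one new term is the square of \<open>s_elem\<close>, which appears from weight 12
  on. Its reduction enters as a hypothesis because it is itself deduced from the normal forms of
  weight below 12.\<close>

lemma normal_filt_step:
  assumes less: "\<And>m x. m < n \<Longrightarrow> gen_filt m x \<Longrightarrow> normal_filt m x"
    and square: "12 \<le> n \<Longrightarrow> normal_filt 12 (s_elem * s_elem)"
    and "gen_filt k x" "k \<le> n"
  shows "normal_filt k x"
  using assms(3,4)
proof induction
  case (mult m x g)
  then have x: "normal_filt m x" by simp
  show ?case
  proof (cases "g = ZS")
    case False
    then have "zval0 g = zval g" by (simp add: zval0_def)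
    then have "low_filt (zwt g) (zval g)" using filt_gen[of zval0 zwt g] by simp
    then show ?thesis using x by (rule low_normal_mult)
  next
    case True
    obtain y z where y: "low_filt m y" "x = y + z * s_elem" "low_filt (m - 6) z" "6 \<le> m \<or> z = 0"
      using x by (rule normal_filtE)
    have m: "6 + m \<le> n" using mult.prems True by simp
    have "gen_filt (6 + m - 1) (s_elem * y - y * s_elem)"
      by (rule gen_filt_commutator[OF gen_filt_s low_gen_filt[OF y(1)]])
    then have "normal_filt (6 + m) (s_elem * y - y * s_elem)"
      using m by (intro normal_filt_mono[OF less]) auto
    moreover have "normal_filt (6 + m) (y * s_elem)"
      using y(1) by (intro normal_filt_low_s) auto
    ultimately have sy: "normal_filt (6 + m) (s_elem * y)"
      using normal_filt_add by fastforce
    have "normal_filt (6 + m) (s_elem * z * s_elem)"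
    proof (cases "m < 6")
      case True
      then show ?thesis using y(4) by (simp add: normal_filt_low filt_zero)
    next
      case False
      have "gen_filt (6 + (m - 6) - 1 + 6) ((s_elem * z - z * s_elem) * s_elem)"
        by (rule filt_mult[OF gen_filt_commutator[OF gen_filt_s low_gen_filt[OF y(3)]] gen_filt_s])
      then have "normal_filt (6 + m) ((s_elem * z - z * s_elem) * s_elem)"
        using m False by (intro normal_filt_mono[OF less]) auto
      moreover have "normal_filt (m - 6 + 12) (z * (s_elem * s_elem))"
        using m False by (intro low_normal_mult y square) auto
      then have "normal_filt (6 + m) (z * (s_elem * s_elem))"
        using False by (rule_tac normal_filt_mono) auto
      ultimately have "normal_filt (6 + m) ((s_elem * z - z * s_elem) * s_elem + z * (s_elem * s_elem))"
        by (rule normal_filt_add)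
      then show ?thesis by (simp add: algebra_simps)
    qed
    with sy show ?thesis
      using True normal_filt_add by (simp add: y(2) distrib_left mult.assoc)
  qed
next
  case one
  then show ?case by (intro normal_filt_low filt.one)
next
  case (mono m x k)
  then show ?case by (auto intro: normal_filt_mono)
qed (auto intro: normal_filt_add normal_filt_scale)

lemma trace_low_filt: "w \<noteq> [] \<Longrightarrow> length w < 6 \<Longrightarrow> low_filt (length w) (ptrace w)"
  by (intro gen_low_filt trace_gen_filt)

lemma prod_trace_low_filt:
  "list_all (\<lambda>u. u \<noteq> []) us \<Longrightarrow> \<forall>u\<in>set us. length u < 6 \<Longrightarrow>
    low_filt (sum_list (map length us)) (prod_list (map ptrace us))"
proof (induction us)
  case (Cons u us)
  then show ?case using filt_mult[OF trace_low_filt] by auto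
qed (simp add: filt.one)

text \<open>In total length 12 a product of three or four nonempty words therefore has at most one
  factor of length 6 or more, as a normal form permits.\<close>

lemma count_long_words:
  "list_all (\<lambda>u. u \<noteq> []) us \<Longrightarrow> 5 * length (filter (\<lambda>u. length u \<ge> 6) us) + length us \<le> sum_list (map length us)"
proof (induction us)
  case (Cons u us)
  then have "length u \<ge> 1" by (cases u) auto
  with Cons show ?case by simp
qed simp

text \<open>Prepared for \<open>s_square_normal\<close>: modulo \<open>low_filt\<close> these traces
  are 0, \<open>s_elem\<close> or \<open>- s_elem\<close>.\<close>

lemma traces_length_6:
  "low_filt 6 (ptrace [1, 2, 1, 2, 1, 2])" "low_filt 6 (ptrace [2, 1, 2, 1, 2, 1])"
  "low_filt 6 (ptrace [1, 2, 1, 2, 1, 1])" "low_filt 6 (ptrace [2, 1, 1, 2, 1, 2] + s_elem)"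
  "low_filt 6 (ptrace [1, 2, 2, 1, 2, 1] - s_elem)"
proof -
  have main: "g (ptrace [1, 2, 1, 2, 1, 2]) = 0" "g (ptrace [2, 1, 2, 1, 2, 1]) = 0"
    "g (ptrace [1, 2, 1, 2, 1, 1]) = 0" "g (ptrace [2, 1, 1, 2, 1, 2] + s_elem) = 0"
    "g (ptrace [1, 2, 2, 1, 2, 1] - s_elem) = 0"
    if g: "real_linear g" and g0: "\<And>y. low_filt 6 y \<Longrightarrow> g y = 0" for g :: "U2 \<Rightarrow> real"
  proof -
    interpret cyclic_trace_function "\<lambda>w. g (ptrace (map letter w))" 6
      using g
    proof (rule cyclic_trace_functionI)
      fix x assume "trace_span (6 - 1) x"
      then have "gen_filt 5 x" by (simp add: trace_span_iff_gen_filt)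
      then show "g x = 0" by (intro g0 filt.mono[OF gen_low_filt]) auto
    next
      fix us :: "2 list list" assume us: "list_all (\<lambda>u. u \<noteq> []) us" "length us > 1" "sum_list (map length us) = 6"
      have "length u < 6" if "u \<in> set us" for u
      proof -
        obtain as bs where us': "us = as @ u # bs" using \<open>u \<in> set us\<close> by (meson split_list)
        with us(2) have "as @ bs \<noteq> []" by (cases as) auto
        then obtain u' where u': "u' \<in> set (as @ bs)" by (meson last_in_set)
        have "u' \<noteq> []" using us(1) us' u' by (auto simp: list_all_iff)
        have "length u' \<le> sum_list (map length (as @ bs))"
          using u' by (intro member_le_sum_list) auto
        moreover have "length u' \<ge> 1" using \<open>u' \<noteq> []\<close> by (cases u') auto
        ultimately show ?thesis using us(3) us' by simp
      qed
      then show "g (prod_list (map ptrace us)) = 0"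
        using us prod_trace_low_filt[of us] by (auto intro: g0)
    qed
    note v = words_6_values[OF refl]
    show "g (ptrace [1, 2, 1, 2, 1, 2]) = 0"
      using v(9) by (simp add: letter_def)
    show "g (ptrace [2, 1, 2, 1, 2, 1]) = 0"
      using v(9) rotate[of "[tt, ff, tt, ff, tt, ff]" 1] by (simp add: letter_def)
    show "g (ptrace [1, 2, 1, 2, 1, 1]) = 0"
      using v(4) cyc[of "[tt, tt]" "[tt, ff, tt, ff]"] by (simp add: letter_def)
    show "g (ptrace [2, 1, 1, 2, 1, 2] + s_elem) = 0"
      using v(7) cyc[of "[tt, tt, ff, tt, ff]" "[ff]"]
      by (simp add: letter_def s_elem_def real_linear_simps[OF g])
    show "g (ptrace [1, 2, 2, 1, 2, 1] - s_elem) = 0"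
      using cyc[of "[tt]" "[tt, ff, ff, tt, ff]"]
      by (simp add: letter_def s_elem_def real_linear_simps[OF g])
  qed
  show "low_filt 6 (ptrace [1, 2, 1, 2, 1, 2])"
    by (rule member_by_functionals) (use main in \<open>auto intro: filt.intros filt_zero\<close>)
  show "low_filt 6 (ptrace [2, 1, 2, 1, 2, 1])"
    by (rule member_by_functionals) (use main in \<open>auto intro: filt.intros filt_zero\<close>)
  show "low_filt 6 (ptrace [1, 2, 1, 2, 1, 1])"
    by (rule member_by_functionals) (use main in \<open>auto intro: filt.intros filt_zero\<close>)
  show "low_filt 6 (ptrace [2, 1, 1, 2, 1, 2] + s_elem)"
    by (rule member_by_functionals) (use main in \<open>auto intro: filt.intros filt_zero\<close>)
  show "low_filt 6 (ptrace [1, 2, 2, 1, 2, 1] - s_elem)"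
    by (rule member_by_functionals) (use main in \<open>auto intro: filt.intros filt_zero\<close>)
qed

text \<open>
  The six instances of the trace identity in degree 12 below involve the same traces of length 12, which
  cancel in a suitable combination and leave a nonzero multiple of the square.
\<close>

lemma s_square_normal:
  assumes less: "\<And>m x. m < 12 \<Longrightarrow> gen_filt m x \<Longrightarrow> normal_filt m x"
  shows "normal_filt 12 (s_elem * s_elem)"
proof (rule member_by_functionals)
  fix g :: "U2 \<Rightarrow> real" assume g: "real_linear g" and g0: "\<And>y. normal_filt 12 y \<Longrightarrow> g y = 0"
  note g_simps = real_linear_simps(1-4)[OF g]
  have low: "g x = 0" if "trace_span 11 x" for x
    using that by (intro g0 normal_filt_mono[OF less]) (auto simp: trace_span_iff_gen_filt)
  have T: "normal_filt (length u) (ptrace u)" if "u \<noteq> []" "length u < 12" for u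
    using less[OF that(2) trace_gen_filt[OF that(1)]] .
  have prod: "normal_filt (sum_list (map length us)) (prod_list (map ptrace us))"
    if "list_all (\<lambda>u. u \<noteq> [] \<and> length u < 12) us" "sum_list (map length us) \<le> 12" "length (filter (\<lambda>u. length u \<ge> 6) us) \<le> 1" for us
    using that
  proof (induction us)
    case (Cons u us)
    show ?case
    proof (cases "length u < 6")
      case True
      then have "low_filt (length u) (ptrace u)" using Cons.prems by (intro trace_low_filt) auto
      moreover have "normal_filt (sum_list (map length us)) (prod_list (map ptrace us))"
        using Cons True by auto
      ultimately show ?thesis using low_normal_mult by simp
    next
      case False
      then have "filter (\<lambda>u. length u \<ge> 6) us = []" using Cons.prems(3) by simp
      then have "low_filt (sum_list (map length us)) (prod_list (map ptrace us))"
        using Cons.prems(1) by (intro prod_trace_low_filt) (auto simp: list_all_iff filter_empty_conv not_le)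
      moreover have "normal_filt (length u) (ptrace u)" using Cons.prems(1) by (intro T) auto
      ultimately show ?thesis
        using normal_low_mult[OF _ _ less] Cons.prems(2) by simp
    qed
  qed (simp add: normal_filt_low filt.one)
  have p2: "g (ptrace u * ptrace v) = 0"
    if "u \<noteq> []" "v \<noteq> []" "length u + length v = 12" "length u \<noteq> 6" for u v
    using prod[of "[u, v]"] that g0[of "ptrace u * ptrace v"] by (cases u; cases v) auto
  have p3: "g (ptrace u * (ptrace v * ptrace w)) = 0"
    if "u \<noteq> []" "v \<noteq> []" "w \<noteq> []" "length u + length v + length w = 12" for u v w
  proof -
    have "length u \<ge> 1" "length v \<ge> 1" "length w \<ge> 1" using that by (cases u; cases v; cases w; simp)+
    then have "normal_filt 12 (prod_list (map ptrace [u, v, w]))"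
      using prod[of "[u, v, w]"] count_long_words[of "[u, v, w]"] that by (simp del: filter.simps add: add.assoc)
    then show ?thesis by (simp add: g0)
  qed
  have p4: "g (ptrace u * (ptrace v * (ptrace w * ptrace x))) = 0"
    if "u \<noteq> []" "v \<noteq> []" "w \<noteq> []" "x \<noteq> []" "length u + length v + length w + length x = 12" for u v w x
  proof -
    have "length u \<ge> 1" "length v \<ge> 1" "length w \<ge> 1" "length x \<ge> 1" using that by (cases u; cases v; cases w; cases x; simp)+
    then have "normal_filt 12 (prod_list (map ptrace [u, v, w, x]))"
      using prod[of "[u, v, w, x]"] count_long_words[of "[u, v, w, x]"] that by (simp del: filter.simps add: add.assoc)
    then show ?thesis by (simp add: g0)
  qed
  have rot: "g (ptrace (u @ v)) = g (ptrace (v @ u))"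
    if "u \<noteq> []" "v \<noteq> []" "length u + length v = 12" for u v
    using low[of "ptrace (u @ v) - ptrace (v @ u)"] trace_rotate[OF that(1,2)] that(3)
    by (simp add: g_simps)
  have fti: "g (ptrace (a @ b @ c @ d)) + g (ptrace (a @ b @ d @ c)) + g (ptrace (a @ c @ b @ d))
      + g (ptrace (a @ c @ d @ b)) + g (ptrace (a @ d @ b @ c)) + g (ptrace (a @ d @ c @ b)) =
      g (ptrace a * ptrace (b @ c @ d)) + g (ptrace a * ptrace (b @ d @ c))
      + g (ptrace (a @ b) * ptrace (c @ d)) + g (ptrace (a @ b @ c) * ptrace d)
      + g (ptrace (a @ b @ d) * ptrace c) + g (ptrace (a @ c @ b) * ptrace d)
      + g (ptrace (a @ c @ d) * ptrace b) + g (ptrace (a @ c) * ptrace (b @ d))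
      + g (ptrace (a @ d @ b) * ptrace c) + g (ptrace (a @ d @ c) * ptrace b)
      + g (ptrace (a @ d) * ptrace (b @ c))"
    if ne: "a \<noteq> []" "b \<noteq> []" "c \<noteq> []" "d \<noteq> []" and n: "length a + length b + length c + length d = 12" for a b c d
  proof -
    have "trace_span (length a + length b + length c + length d - 1) E \<Longrightarrow> g E = 0" for E
      using low[of E] n by simp
    from this[OF fundamental_trace_identity[OF ne]] show ?thesis
      using ne n by (simp add: g_simps p3 p4 mult.assoc)
  qed
  have low_s: "normal_filt 12 (x * s_elem)" "normal_filt 12 (s_elem * x)" if "low_filt 6 x" for x
  proof -
    show x: "normal_filt 12 (x * s_elem)" using that by (intro normal_filt_low_s) auto
    have "gen_filt (6 + 6 - 1) (s_elem * x - x * s_elem)"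
      by (rule gen_filt_commutator[OF gen_filt_s low_gen_filt[OF that]])
    then have "normal_filt 12 (s_elem * x - x * s_elem)"
      by (intro normal_filt_mono[OF less]) auto
    from normal_filt_add[OF this x] show "normal_filt 12 (s_elem * x)" by simp
  qed
  have low6: "length u = 6 \<Longrightarrow> u \<noteq> []" for u :: "2 list" by auto
  have p2_left: "g (ptrace u * ptrace v) = 0" if "low_filt 6 (ptrace u)" "length v = 6" for u v
    using low_normal_mult[OF that(1) T[of v]] that(2) low6 by (intro g0) simp
  have p2_right: "g (ptrace u * ptrace v) = 0" if "low_filt 6 (ptrace v)" "length u = 6" for u v
    using normal_low_mult[OF T[of u] that(1) less] that(2) low6 by (intro g0) simp
  have p2_s: "g (ptrace u * ptrace v) = - g (s_elem * s_elem)"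
    if u: "low_filt 6 (ptrace u - s_elem)" and v: "low_filt 6 (ptrace v + s_elem)" for u v
  proof -
    let ?u = "ptrace u - s_elem" and ?v = "ptrace v + s_elem"
    have "normal_filt 12 (?u * ?v)"
      using filt_mult[OF u v] by (auto intro: normal_filt_low)
    then have "g (?u * ?v) = 0" "g (?u * s_elem) = 0" "g (s_elem * ?v) = 0"
      using low_s u v by (auto intro: g0)
    moreover have "ptrace u * ptrace v = ?u * ?v - ?u * s_elem + s_elem * ?v - s_elem * s_elem"
      by (simp add: algebra_simps)
    ultimately show ?thesis by (simp only: g_simps)
  qed
  have s: "low_filt 6 (ptrace [1, 1, 2, 2, 1, 2] - s_elem)" by (simp add: s_elem_def filt_zero)
  note low6 = traces_length_6 s
  have r1: "2 * g (ptrace [1, 1, 2, 1, 2, 1, 1, 2, 2, 1, 2, 2]) + 2 * g (ptrace [1, 1, 2, 1, 2, 1, 2, 2, 1, 2, 1, 2]) + 2 * g (ptrace [1, 1, 2, 1, 1, 2, 1, 2, 2, 2, 1, 2]) = - 2 * g (s_elem * s_elem)"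
    using fti[of "[1]" "[2, 2, 1, 2]" "[2, 1, 1, 2, 1, 2]" "[1]"]
      rot[of "[1, 1, 2, 2, 1, 2, 2]" "[1, 1, 2, 1, 2]"] rot[of "[1, 2]" "[1, 1, 2, 1, 2, 1, 2, 2, 1, 2]"] rot[of "[1, 2, 1, 1, 2, 1, 2, 2, 2, 1, 2]" "[1]"] rot[of "[1, 2, 2, 1, 2, 1, 2]" "[1, 1, 2, 1, 2]"] rot[of "[1, 2, 2, 1, 2, 2]" "[1, 1, 2, 1, 2, 1]"]
    by (simp add: p2 p2_left p2_right p2_s low6 polarised_trace_1 g_simps)
  have r2: "2 * g (ptrace [1, 1, 1, 2, 2, 1, 2, 2, 1, 2, 1, 2]) + 2 * g (ptrace [1, 1, 2, 1, 2, 2, 1, 2, 1, 2, 1, 2]) + 2 * g (ptrace [1, 1, 2, 1, 2, 1, 1, 2, 2, 1, 2, 2]) = 0"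
    using fti[of "[1, 2, 1, 2, 1, 1]" "[1, 2, 2, 1]" "[2]" "[2]"]
      rot[of "[1, 2, 1, 2]" "[1, 1, 1, 2, 2, 1, 2, 2]"] rot[of "[1, 2, 1, 2]" "[1, 1, 2, 1, 2, 2, 1, 2]"] rot[of "[1, 2, 1, 2, 1, 1, 2, 2, 1, 2, 2]" "[1]"]
    by (simp add: p2 p2_left p2_right p2_s low6 polarised_trace_1 g_simps)
  have r3: "6 * g (ptrace [1, 1, 1, 2, 2, 1, 2, 2, 1, 2, 1, 2]) = 0"
    using fti[of "[2, 1]" "[2, 1]" "[2, 1]" "[1, 1, 2, 2, 1, 2]"]
      rot[of "[2]" "[1, 1, 1, 2, 2, 1, 2, 2, 1, 2, 1]"] rot[of "[2, 1, 2]" "[1, 1, 1, 2, 2, 1, 2, 2, 1]"] rot[of "[2, 1, 2, 1, 2]" "[1, 1, 1, 2, 2, 1, 2]"]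
    by (simp add: p2 p2_left p2_right p2_s low6 polarised_trace_1 g_simps)
  have r4: "6 * g (ptrace [1, 1, 2, 1, 2, 2, 1, 2, 1, 2, 1, 2]) = 0"
    using fti[of "[1, 2, 1, 2, 2, 1]" "[2, 1]" "[2, 1]" "[2, 1]"]
      rot[of "[1, 2, 1, 2, 2, 1, 2, 1, 2, 1, 2]" "[1]"]
    by (simp add: p2 p2_left p2_right p2_s low6 polarised_trace_1 g_simps)
  have r5: "6 * g (ptrace [1, 1, 2, 1, 2, 1, 2, 2, 1, 2, 1, 2]) = 0"
    using fti[of "[1, 2]" "[1, 2]" "[2, 1, 2, 1, 2, 1]" "[1, 2]"]
      rot[of "[1, 2, 1, 2, 1, 2, 2, 1, 2, 1, 2]" "[1]"] rot[of "[1, 2, 1, 2, 2, 1, 2, 1, 2]" "[1, 1, 2]"] rot[of "[1, 2, 2, 1, 2, 1, 2]" "[1, 1, 2, 1, 2]"]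
    by (simp add: p2 p2_left p2_right p2_s low6 polarised_trace_1 g_simps)
  have r6: "6 * g (ptrace [1, 1, 2, 1, 1, 2, 1, 2, 2, 2, 1, 2]) = 0"
    using fti[of "[1, 2, 1, 1, 2, 1, 1, 2, 1]" "[2]" "[2]" "[2]"]
      rot[of "[1, 2]" "[1, 1, 2, 1, 1, 2, 1, 2, 2, 2]"]
    by (simp add: p2 p2_left p2_right p2_s low6 polarised_trace_1 g_simps)
  \<comment> \<open>\<open>r3\<close> to \<open>r6\<close> kill four of the five traces of length
    12, \<open>r2\<close> then kills the fifth, and \<open>r1\<close> is left with
    \<open>- 2 * g (s_elem * s_elem)\<close>.\<close>
  show "g (s_elem * s_elem) = 0"
    using r1 r2 r3 r4 r5 r6 by linarith
qed (auto intro: normal_filt_add normal_filt_scale normal_filt_low filt_zero)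

theorem gen_filt_normal: "gen_filt n x \<Longrightarrow> normal_filt n x"
proof (induction n arbitrary: x rule: less_induct)
  case (less n)
  have "normal_filt 12 (s_elem * s_elem)" if "12 \<le> n"
    using less.IH that by (intro s_square_normal) auto
  with less show ?case
    using normal_filt_step[of n n x] by blast
qed

section \<open>Homomorphisms out of the tensor product\<close>

text \<open>Tracelessness makes the linear extension of \<open>E\<close> from matrix units vanish on
  scalar matrices, hence well defined on the quotient. The last conclusion lets commutation with the
  \<open>E p q\<close> be extended to all values; \<open>uea_hom_exists\<close> carries it on to the
  enveloping algebra.\<close>

lemma sl3_hom_exists:
  fixes E :: "3 \<Rightarrow> 3 \<Rightarrow> 'a::complex_algebra_1"
  assumes rel: "\<And>p q r s. E p q * E r s - E r s * E p q =
      (if q = r then E p s else 0) - (if s = p then E r q else 0)"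
    and trace: "(\<Sum>p\<in>UNIV. E p p) = 0"
  obtains e :: "sl3 \<Rightarrow> 'a" where "\<And>x y. e (x + y) = e x + e y" "\<And>c x. e (c *\<^sub>C x) = c *\<^sub>C e x"
    "\<And>x y. e (lie x y) = e x * e y - e y * e x" "\<And>p q. e (sl3_unit p q) = E p q"
    "\<And>x. \<exists>c. e x = (\<Sum>p\<in>UNIV. \<Sum>q\<in>UNIV. c p q *\<^sub>C E p q)"
proof -
  define m :: "complex^3^3 \<Rightarrow> 'a" where "m x = (\<Sum>p\<in>UNIV. \<Sum>q\<in>UNIV. (x $ p $ q) *\<^sub>C E p q)" for x
  have m_add: "m (x + y) = m x + m y" for x y
    by (simp add: m_def scaleC_add_left sum.distrib)
  have m_scale: "m (matrix_scale c x) = c *\<^sub>C m x" for c x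
    unfolding m_def matrix_scale_def by (simp add: sum_3 scaleC_add_right scaleC_scaleC)
  have m_mat: "m (mat c) = 0" for c
  proof -
    have "m (mat c) = c *\<^sub>C (\<Sum>p\<in>UNIV. E p p)"
      unfolding m_def mat_def by (simp add: sum_3 scaleC_add_right)
    then show ?thesis by (simp add: trace)
  qed
  have m_uminus: "m (- x) = - m x" for x
    using m_add[of x "- x"] m_mat[of 0] by (simp add: mat_zero eq_neg_iff_add_eq_0 add.commute)
  have m_diff: "m (x - y) = m x - m y" for x y
    using m_add[of x "- y"] by (simp add: m_uminus)
  have unit: "m (\<chi> i j. if i = p \<and> j = q then 1 else 0) = E p q" for p q
    unfolding m_def using three_cases[of p] three_cases[of q]
    by (elim disjE) (simp_all add: sum_3 scaleC_one)
  have scaleC_sum: "c *\<^sub>C sum f A = (\<Sum>i\<in>A. c *\<^sub>C f i)" for c and f :: "3 \<Rightarrow> 'a" and A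
    by (induction A rule: infinite_finite_induct) (simp_all add: scaleC_add_right)
  have swap: "(\<Sum>p\<in>UNIV. \<Sum>q\<in>UNIV. \<Sum>r\<in>UNIV. \<Sum>s\<in>UNIV. F p q r s) =
      (\<Sum>r\<in>UNIV. \<Sum>s\<in>UNIV. \<Sum>p\<in>UNIV. \<Sum>q\<in>UNIV. F p q r s)" for F :: "3 \<Rightarrow> 3 \<Rightarrow> 3 \<Rightarrow> 3 \<Rightarrow> 'a"
  proof -
    have "(\<Sum>p\<in>UNIV. \<Sum>q\<in>UNIV. \<Sum>r\<in>UNIV. \<Sum>s\<in>UNIV. F p q r s) =
        (\<Sum>p\<in>UNIV. \<Sum>r\<in>UNIV. \<Sum>q\<in>UNIV. \<Sum>s\<in>UNIV. F p q r s)"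
      by (rule sum.cong[OF refl], rule sum.swap)
    also have "\<dots> = (\<Sum>r\<in>UNIV. \<Sum>p\<in>UNIV. \<Sum>q\<in>UNIV. \<Sum>s\<in>UNIV. F p q r s)"
      by (rule sum.swap)
    also have "\<dots> = (\<Sum>r\<in>UNIV. \<Sum>p\<in>UNIV. \<Sum>s\<in>UNIV. \<Sum>q\<in>UNIV. F p q r s)"
      by (rule sum.cong[OF refl], rule sum.cong[OF refl], rule sum.swap)
    also have "\<dots> = (\<Sum>r\<in>UNIV. \<Sum>s\<in>UNIV. \<Sum>p\<in>UNIV. \<Sum>q\<in>UNIV. F p q r s)"
      by (rule sum.cong[OF refl], rule sum.swap)
    finally show ?thesis .
  qed
  have prod: "m x * m y =
      (\<Sum>p\<in>UNIV. \<Sum>q\<in>UNIV. \<Sum>r\<in>UNIV. \<Sum>s\<in>UNIV. (x $ p $ q * y $ r $ s) *\<^sub>C (E p q * E r s))" for x y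
    by (subst swap) (simp only: m_def sum_distrib_right sum_distrib_left mult_scaleC_left
        mult_scaleC_right scaleC_scaleC scaleC_sum mult.commute)
  have m_mult: "m (x ** y) = (\<Sum>p\<in>UNIV. \<Sum>q\<in>UNIV. \<Sum>r\<in>UNIV. \<Sum>s\<in>UNIV. (x $ p $ q * y $ r $ s) *\<^sub>C
      (if q = r then E p s else 0))" for x y :: "complex^3^3"
  proof -
    have "(\<Sum>r\<in>UNIV. \<Sum>s\<in>UNIV. (x $ p $ q * y $ r $ s) *\<^sub>C (if q = r then E p s else 0)) =
        (\<Sum>s\<in>UNIV. (x $ p $ q * y $ q $ s) *\<^sub>C E p s)" for p q :: 3
      using three_cases[of q] by (elim disjE) (simp_all add: sum_3)
    then have "(\<Sum>p\<in>UNIV. \<Sum>q\<in>UNIV. \<Sum>r\<in>UNIV. \<Sum>s\<in>UNIV. (x $ p $ q * y $ r $ s) *\<^sub>C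
        (if q = r then E p s else 0)) = (\<Sum>p\<in>UNIV. \<Sum>q\<in>UNIV. \<Sum>s\<in>UNIV. (x $ p $ q * y $ q $ s) *\<^sub>C E p s)"
      by simp
    also have "\<dots> = (\<Sum>p\<in>UNIV. \<Sum>s\<in>UNIV. \<Sum>q\<in>UNIV. (x $ p $ q * y $ q $ s) *\<^sub>C E p s)"
      by (rule sum.cong[OF refl], rule sum.swap)
    also have "\<dots> = m (x ** y)"
      unfolding m_def matrix_matrix_mult_def by (simp add: sum_3 scaleC_add_left)
    finally show ?thesis ..
  qed
  have m_lie: "m (x ** y - y ** x) = m x * m y - m y * m x" for x y
  proof -
    have "m y * m x = (\<Sum>p\<in>UNIV. \<Sum>q\<in>UNIV. \<Sum>r\<in>UNIV. \<Sum>s\<in>UNIV. (x $ p $ q * y $ r $ s) *\<^sub>C (E r s * E p q))"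
      unfolding prod by (subst swap) (simp only: mult.commute)
    moreover have "m (y ** x) = (\<Sum>p\<in>UNIV. \<Sum>q\<in>UNIV. \<Sum>r\<in>UNIV. \<Sum>s\<in>UNIV. (x $ p $ q * y $ r $ s) *\<^sub>C
        (if s = p then E r q else 0))"
      unfolding m_mult by (subst swap) (simp only: mult.commute)
    ultimately show ?thesis
      unfolding m_diff prod m_mult
      by (simp only: sum_subtractf[symmetric] scaleC_diff_right[symmetric] rel)
  qed
  define e where "e x = m (rep_sl3 x)" for x
  have e_abs: "e (abs_sl3 x) = m x" for x
  proof -
    have "sl3_rel (rep_sl3 (abs_sl3 x)) x"
      by (simp flip: sl3.abs_eq_iff add: Quotient3_abs_rep[OF Quotient3_sl3])
    then show ?thesis by (auto simp: sl3_rel_def e_def m_add m_mat)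
  qed
  show ?thesis
  proof
    fix x y :: sl3 and c p q
    obtain x' y' where xy: "x = abs_sl3 x'" "y = abs_sl3 y'"
      by (metis Quotient3_abs_rep[OF Quotient3_sl3])
    show "e (x + y) = e x + e y" "e (c *\<^sub>C x) = c *\<^sub>C e x" "e (lie x y) = e x * e y - e y * e x"
      unfolding xy
      by (simp_all add: plus_sl3.abs_eq scaleC_sl3.abs_eq lie_sl3.abs_eq e_abs m_add m_scale m_lie)
    show "e (sl3_unit p q) = E p q" by (simp add: sl3_unit.abs_eq e_abs unit)
    show "\<exists>c. e x = (\<Sum>p\<in>UNIV. \<Sum>q\<in>UNIV. c p q *\<^sub>C E p q)" by (auto simp: e_def m_def)
  qed
qed

lemma commute_sum_scaleC:
  fixes z :: "'a::complex_algebra_1"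
  assumes "\<And>p q. E p q * z = z * E p q"
  shows "(\<Sum>p\<in>A. \<Sum>q\<in>B. c p q *\<^sub>C E p q) * z = z * (\<Sum>p\<in>A. \<Sum>q\<in>B. c p q *\<^sub>C E p q)"
  by (intro commute_sum commute_scaleC assms)

lemma uea_hom_exists:
  fixes e :: "'g::complex_lie_algebra \<Rightarrow> 'a::complex_algebra_1"
  assumes add: "\<And>x y. e (x + y) = e x + e y" and scale: "\<And>c x. e (c *\<^sub>C x) = c *\<^sub>C e x"
    and lie: "\<And>x y. e (lie x y) = e x * e y - e y * e x"
  obtains f where "complex_algebra_hom f" "\<And>x. f (uea_incl x) = e x"
    "\<And>z. \<forall>x. e x * z = z * e x \<Longrightarrow> \<forall>a. f a * z = z * f a"
proof -
  have cong: "free_ext e p = free_ext e q" if "ideal_cong uea_relations p q" for p q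
  proof -
    have "p - q \<in> Idl\<^bsub>ring_of_type_algebra\<^esub> uea_relations"
      using that by (simp add: ideal_cong_def)
    then have "free_ext e (p - q) = 0"
      by (rule Idl_subset_kernel[rotated 3])
        (auto simp: free_ext_add free_ext_mult free_ext_minus free_ext_gen free_ext_scaleC
          uea_relations_def add scale lie)
    then show ?thesis by (simp add: free_ext_minus)
  qed
  define f where "f a = free_ext e (rep_uea a)" for a
  have f_abs: "f (abs_uea p) = free_ext e p" for p
    unfolding f_def
    by (rule cong) (simp flip: uea.abs_eq_iff add: Quotient3_abs_rep[OF Quotient3_uea])
  have rep: "\<exists>p. a = abs_uea p" for a :: "'g uea"
    by (metis Quotient3_abs_rep[OF Quotient3_uea])
  show ?thesis
  proof
    show "complex_algebra_hom f"
      unfolding complex_algebra_hom_def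
    proof (intro conjI allI)
      show "f 1 = 1" by (simp add: one_uea_def f_abs free_ext_one)
      fix a b :: "'g uea" and c :: complex
      obtain p where a: "a = abs_uea p" using rep[of a] by (rule exE)
      obtain q where b: "b = abs_uea q" using rep[of b] by (rule exE)
      show "f (a + b) = f a + f b" "f (a * b) = f a * f b" "f (c *\<^sub>C a) = c *\<^sub>C f a"
        unfolding a b by (simp_all add: plus_uea.abs_eq times_uea.abs_eq scaleC_uea.abs_eq f_abs
            free_ext_add free_ext_mult free_ext_scaleC)
    qed
    show "f (uea_incl x) = e x" for x by (simp add: uea_incl.abs_eq f_abs free_ext_gen)
    fix z
    assume z: "\<forall>x. e x * z = z * e x"
    show "\<forall>a. f a * z = z * f a"
    proof
    fix a :: "'g uea"
    obtain p where a: "a = abs_uea p" using rep[of a] by (rule exE)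
    have "free_ext e p * z = z * free_ext e p"
    proof (induction p rule: poly_mapping_induct_single)
      case (single w c)
      have "prod_list (map e (letters w)) * z = z * prod_list (map e (letters w))"
        by (rule commute_prod_list) (auto simp: z)
      then show ?case by (simp add: free_ext_single commute_scaleC)
    qed (simp_all add: free_ext_zero free_ext_add algebra_simps)
    then show "f a * z = z * f a" by (simp add: a f_abs)
    qed
  qed
qed

lemma tensor_hom_exists:
  fixes f :: "'a::complex_algebra_1 \<Rightarrow> 'c::complex_algebra_1" and g :: "'b::complex_algebra_1 \<Rightarrow> 'c"
  assumes f: "complex_algebra_hom f" and g: "complex_algebra_hom g"
    and comm: "\<And>a b. f a * g b = g b * f a"
  obtains h where "complex_algebra_hom h" "\<And>a b. h (tensor a b) = f a * g b"
proof -
  define t where "t w = (case w of Pair_Mon a b \<Rightarrow> f a * g b)" for w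
  have t0: "t 0 = 1" using f g by (simp add: t_def zero_pair_mon_def complex_algebra_hom_def)
  have t_add: "t (v + w) = t v * t w" for v w
  proof -
    obtain a b where v: "v = Pair_Mon a b" by (cases v)
    obtain a' b' where w: "w = Pair_Mon a' b'" by (cases w)
    have "f a * f a' * (g b * g b') = f a * (f a' * g b) * g b'" by (simp only: mult.assoc)
    also have "\<dots> = f a * (g b * f a') * g b'" by (simp only: comm)
    also have "\<dots> = f a * g b * (f a' * g b')" by (simp only: mult.assoc)
    finally show ?thesis using f g by (simp add: t_def v w complex_algebra_hom_def)
  qed
  define L where "L p = (\<Sum>w\<in>Poly_Mapping.keys p. Poly_Mapping.lookup p w *\<^sub>C t w)" for p
  have L_superset: "L p = (\<Sum>w\<in>K. Poly_Mapping.lookup p w *\<^sub>C t w)"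
    if "finite K" "Poly_Mapping.keys p \<subseteq> K" for p K
    unfolding L_def using that by (intro sum.mono_neutral_left) (auto simp: in_keys_iff)
  have L_single: "L (Poly_Mapping.single w c) = c *\<^sub>C t w" for w c
    by (subst L_superset[of "{w}"]) auto
  have L_zero: "L 0 = 0" by (simp add: L_def)
  have L_add: "L (p + q) = L p + L q" for p q
  proof -
    let ?K = "Poly_Mapping.keys p \<union> Poly_Mapping.keys q"
    have "Poly_Mapping.keys (p + q) \<subseteq> ?K" by (rule Poly_Mapping.keys_add)
    then show ?thesis
      by (simp add: L_superset[of ?K] lookup_add scaleC_add_left sum.distrib)
  qed
  have L_diff: "L (p - q) = L p - L q" for p q using L_add[of "p - q" q] by simp
  have L_scale: "L (c *\<^sub>C p) = c *\<^sub>C L p" for c p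
    by (induction p rule: poly_mapping_induct_single)
      (simp_all add: L_zero L_add L_single scaleC_single scaleC_add_right scaleC_scaleC scaleC_complex_def)
  have L_mult: "L (p * q) = L p * L q" for p q
  proof (induction p rule: poly_mapping_induct_single)
    case (single v c)
    show ?case
      by (induction q rule: poly_mapping_induct_single)
        (simp_all add: L_zero L_add L_single mult_single t_add distrib_left mult_scaleC_left
          mult_scaleC_right scaleC_scaleC mult.commute)
  qed (simp_all add: L_zero L_add distrib_right)
  have cong: "L p = L q" if "ideal_cong tensor_relations p q" for p q
  proof -
    have "p - q \<in> Idl\<^bsub>ring_of_type_algebra\<^esub> tensor_relations"
      using that by (simp add: ideal_cong_def)
    then have "L (p - q) = 0"
      by (rule Idl_subset_kernel[OF L_add L_mult, rotated])
        (use f g in \<open>unfold tensor_relations_def, elim UnE CollectE exE conjE,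
          simp_all add: L_diff L_scale L_single free_pair_def t_def complex_algebra_hom_def scaleC_one
            distrib_left distrib_right mult_scaleC_left mult_scaleC_right\<close>)
    then show ?thesis by (simp add: L_diff)
  qed
  define h where "h a = L (rep_tensor_algebra_product a)" for a
  have h_abs: "h (abs_tensor_algebra_product p) = L p" for p
    unfolding h_def
    by (rule cong) (simp flip: tensor_algebra_product.abs_eq_iff
        add: Quotient3_abs_rep[OF Quotient3_tensor_algebra_product])
  have rep: "\<exists>p. a = abs_tensor_algebra_product p" for a :: "('a, 'b) tensor_algebra_product"
    by (metis Quotient3_abs_rep[OF Quotient3_tensor_algebra_product])
  show ?thesis
  proof
    show "complex_algebra_hom h"
      unfolding complex_algebra_hom_def
    proof (intro conjI allI)
      show "h 1 = 1"
        using L_single[of 0 1] by (simp add: one_tensor_algebra_product_def h_abs t0 scaleC_one)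
      fix a b :: "('a, 'b) tensor_algebra_product" and c :: complex
      obtain p where a: "a = abs_tensor_algebra_product p" using rep[of a] by (rule exE)
      obtain q where b: "b = abs_tensor_algebra_product q" using rep[of b] by (rule exE)
      show "h (a + b) = h a + h b" "h (a * b) = h a * h b" "h (c *\<^sub>C a) = c *\<^sub>C h a"
        unfolding a b by (simp_all add: plus_tensor_algebra_product.abs_eq L_add L_mult L_scale h_abs
            times_tensor_algebra_product.abs_eq scaleC_tensor_algebra_product.abs_eq)
    qed
    show "h (tensor a b) = f a * g b" for a b
      by (simp add: tensor.abs_eq h_abs free_pair_def L_single t_def scaleC_one)
  qed
qed

lemma U2_hom_exists:
  fixes E :: "2 \<Rightarrow> 3 \<Rightarrow> 3 \<Rightarrow> 'a::complex_algebra_1"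
  assumes rel: "\<And>a p q r s. E a p q * E a r s - E a r s * E a p q =
      (if q = r then E a p s else 0) - (if s = p then E a r q else 0)"
    and trace: "\<And>a. (\<Sum>p\<in>UNIV. E a p p) = 0"
    and comm: "\<And>p q r s. E 1 p q * E 2 r s = E 2 r s * E 1 p q"
  obtains f where "complex_algebra_hom f" "\<And>a p q. f (copy_gen a p q) = E a p q"
proof -
  obtain e1 where e1: "\<And>x y. e1 (x + y) = e1 x + e1 y" "\<And>c x. e1 (c *\<^sub>C x) = c *\<^sub>C e1 x"
    "\<And>x y. e1 (lie x y) = e1 x * e1 y - e1 y * e1 x" "\<And>p q. e1 (sl3_unit p q) = E 1 p q"
    "\<And>x. \<exists>c. e1 x = (\<Sum>p\<in>UNIV. \<Sum>q\<in>UNIV. c p q *\<^sub>C E 1 p q)"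
    by (rule sl3_hom_exists[OF rel[of 1] trace[of 1]]) (rule that)
  obtain e2 where e2: "\<And>x y. e2 (x + y) = e2 x + e2 y" "\<And>c x. e2 (c *\<^sub>C x) = c *\<^sub>C e2 x"
    "\<And>x y. e2 (lie x y) = e2 x * e2 y - e2 y * e2 x" "\<And>p q. e2 (sl3_unit p q) = E 2 p q"
    "\<And>x. \<exists>c. e2 x = (\<Sum>p\<in>UNIV. \<Sum>q\<in>UNIV. c p q *\<^sub>C E 2 p q)"
    by (rule sl3_hom_exists[OF rel[of 2] trace[of 2]]) (rule that)
  obtain f1 where f1: "complex_algebra_hom f1" "\<And>x. f1 (uea_incl x) = e1 x"
    "\<And>z. \<forall>x. e1 x * z = z * e1 x \<Longrightarrow> \<forall>a. f1 a * z = z * f1 a"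
    by (rule uea_hom_exists[OF e1(1-3)]) (rule that)
  obtain f2 where f2: "complex_algebra_hom f2" "\<And>x. f2 (uea_incl x) = e2 x"
    "\<And>z. \<forall>x. e2 x * z = z * e2 x \<Longrightarrow> \<forall>a. f2 a * z = z * f2 a"
    by (rule uea_hom_exists[OF e2(1-3)]) (rule that)
  have "e1 x * E 2 r s = E 2 r s * e1 x" for x r s
  proof -
    obtain c where c: "e1 x = (\<Sum>p\<in>UNIV. \<Sum>q\<in>UNIV. c p q *\<^sub>C E 1 p q)" using e1(5) by blast
    show ?thesis unfolding c by (rule commute_sum_scaleC) (rule comm)
  qed
  then have "f1 a * E 2 r s = E 2 r s * f1 a" for a r s using f1(3) by blast
  then have "e2 x * f1 a = f1 a * e2 x" for x a
  proof -
    assume 1: "\<And>a r s. f1 a * E 2 r s = E 2 r s * f1 a"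
    obtain c where c: "e2 x = (\<Sum>p\<in>UNIV. \<Sum>q\<in>UNIV. c p q *\<^sub>C E 2 p q)" using e2(5) by blast
    show ?thesis unfolding c by (rule commute_sum_scaleC) (rule 1[symmetric])
  qed
  then have "f2 b * f1 a = f1 a * f2 b" for a b using f2(3) by blast
  then have "f1 a * f2 b = f2 b * f1 a" for a b by (rule sym)
  then obtain h where h: "complex_algebra_hom h" "\<And>a b. h (tensor a b) = f1 a * f2 b"
    by (rule tensor_hom_exists[OF f1(1) f2(1)]) (rule that)
  have "h (copy_gen a p q) = E a p q" for a p q
  proof -
    have "a = 1 \<or> a = 2" by (rule exhaust_2)
    then show ?thesis
      using f1(1) f2(1) by (auto simp: copy_gen_def h(2) gen_def f1(2) f2(2) e1(4) e2(4) complex_algebra_hom_def)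
  qed
  with h(1) that show ?thesis by blast
qed

text \<open>All linear operators on all functions, without any support condition, so that
  combinations of shifts with arbitrary function coefficients live in a single
  \<open>complex_algebra_1\<close>.\<close>

typedef 'a endo = "{T :: ('a \<Rightarrow> complex) \<Rightarrow> 'a \<Rightarrow> complex.
    (\<forall>f g. T (\<lambda>x. f x + g x) = (\<lambda>x. T f x + T g x)) \<and> (\<forall>c f. T (\<lambda>x. c * f x) = (\<lambda>x. c * T f x))}"
  morphisms app_endo Endo
  by (rule exI[of _ id]) simp

setup_lifting type_definition_endo

instantiation endo :: (type) complex_algebra_1
begin
lift_definition zero_endo :: "'a endo" is "\<lambda>f x. 0" by simp
lift_definition one_endo :: "'a endo" is "\<lambda>f. f" by simp
lift_definition plus_endo :: "'a endo \<Rightarrow> 'a endo \<Rightarrow> 'a endo" is "\<lambda>S T f x. S f x + T f x"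
  by (simp add: algebra_simps)
lift_definition minus_endo :: "'a endo \<Rightarrow> 'a endo \<Rightarrow> 'a endo" is "\<lambda>S T f x. S f x - T f x"
  by (simp add: algebra_simps)
lift_definition uminus_endo :: "'a endo \<Rightarrow> 'a endo" is "\<lambda>T f x. - T f x"
  by simp
lift_definition times_endo :: "'a endo \<Rightarrow> 'a endo \<Rightarrow> 'a endo" is "\<lambda>S T f. S (T f)"
  by simp
lift_definition scaleC_endo :: "complex \<Rightarrow> 'a endo \<Rightarrow> 'a endo" is "\<lambda>c T f x. c * T f x"
  by (simp add: algebra_simps)
instance
proof
  show "(0 :: 'a endo) \<noteq> 1"
    by transfer (metis zero_neq_one)
qed (transfer; simp add: fun_eq_iff algebra_simps)+
end

lemmas app_endo_simps = zero_endo.rep_eq one_endo.rep_eq plus_endo.rep_eq minus_endo.rep_eq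
  uminus_endo.rep_eq times_endo.rep_eq scaleC_endo.rep_eq

lemma endo_eqI: "(\<And>f x. app_endo S f x = app_endo T f x) \<Longrightarrow> S = T"
  by (simp add: fun_eq_iff flip: app_endo_inject)

lemma app_endo_add: "app_endo T (\<lambda>x. f x + g x) x = app_endo T f x + app_endo T g x"
  and app_endo_scale: "app_endo T (\<lambda>x. c * f x) x = c * app_endo T f x"
  using app_endo[of T] by auto

lemma app_endo_zero: "app_endo T (\<lambda>x. 0) x = 0"
  using app_endo_scale[of T 0 "\<lambda>x. 0" x] by simp

lemma app_endo_sum: "app_endo (sum T A) f x = (\<Sum>i\<in>A. app_endo (T i) f x)"
  by (induction A rule: infinite_finite_induct) (simp_all add: app_endo_simps)

section \<open>A representation on singular vectors\<close>

type_synonym point = "complex \<times> complex \<times> complex \<times> complex \<times> complex"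

lemma three_neq [simp]: "(2::3) \<noteq> 1" "(3::3) \<noteq> 1" "(3::3) \<noteq> 2" "(1::3) \<noteq> 2" "(1::3) \<noteq> 3" "(2::3) \<noteq> 3"
  by simp_all

text \<open>If \<open>h\<close> is the monomial \<open>x1^n1 x3^n3 y1^m1 y2^m2 y3^m3\<close> viewed
  as a function of its exponents, this is the vector field \<open>x_q d/dx_p - y_p d/dy_q\<close> on
  the cone \<open>x1 y1 + x2 y2 + x3 y3 = 0\<close>, with \<open>x2\<close> eliminated. These vector
  fields compose in the order opposite to the operators on \<open>h\<close>, which accounts for the
  bracket of \<open>gl(3)\<close>. The exponents are arbitrary complex numbers.\<close>

definition second_gl :: "3 \<Rightarrow> 3 \<Rightarrow> (point \<Rightarrow> complex) \<Rightarrow> point \<Rightarrow> complex" where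
  "second_gl p q h = (\<lambda>(n1, n3, m1, m2, m3).
    if p = 1 then
      if q = 1 then (n1 - m1) * h (n1, n3, m1, m2, m3)
      else if q = 2 then - (n1 + m2) * h (n1, n3, m1 + 1, m2 - 1, m3)
        - n1 * h (n1 - 1, n3 + 1, m1, m2 - 1, m3 + 1)
      else n1 * h (n1 - 1, n3 + 1, m1, m2, m3) - m3 * h (n1, n3, m1 + 1, m2, m3 - 1)
    else if p = 2 then
      if q = 1 then - m1 * h (n1, n3, m1 - 1, m2 + 1, m3)
      else if q = 2 then - m2 * h (n1, n3, m1, m2, m3)
      else - m3 * h (n1, n3, m1, m2 + 1, m3 - 1)
    else
      if q = 1 then n3 * h (n1 + 1, n3 - 1, m1, m2, m3) - m1 * h (n1, n3, m1 - 1, m2, m3 + 1)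
      else if q = 2 then - (n3 + m2) * h (n1, n3, m1, m2 - 1, m3 + 1)
        - n3 * h (n1 + 1, n3 - 1, m1 + 1, m2 - 1, m3)
      else (n3 - m3) * h (n1, n3, m1, m2, m3))"

lemma second_gl_simps:
  "second_gl 1 1 h (n1, n3, m1, m2, m3) = (n1 - m1) * h (n1, n3, m1, m2, m3)"
  "second_gl 1 2 h (n1, n3, m1, m2, m3) = - (n1 + m2) * h (n1, n3, m1 + 1, m2 - 1, m3)
        - n1 * h (n1 - 1, n3 + 1, m1, m2 - 1, m3 + 1)"
  "second_gl 1 3 h (n1, n3, m1, m2, m3) = n1 * h (n1 - 1, n3 + 1, m1, m2, m3) - m3 * h (n1, n3, m1 + 1, m2, m3 - 1)"
  "second_gl 2 1 h (n1, n3, m1, m2, m3) = - m1 * h (n1, n3, m1 - 1, m2 + 1, m3)"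
  "second_gl 2 2 h (n1, n3, m1, m2, m3) = - m2 * h (n1, n3, m1, m2, m3)"
  "second_gl 2 3 h (n1, n3, m1, m2, m3) = - m3 * h (n1, n3, m1, m2 + 1, m3 - 1)"
  "second_gl 3 1 h (n1, n3, m1, m2, m3) = n3 * h (n1 + 1, n3 - 1, m1, m2, m3) - m1 * h (n1, n3, m1 - 1, m2, m3 + 1)"
  "second_gl 3 2 h (n1, n3, m1, m2, m3) = - (n3 + m2) * h (n1, n3, m1, m2 - 1, m3 + 1)
        - n3 * h (n1 + 1, n3 - 1, m1 + 1, m2 - 1, m3)"
  "second_gl 3 3 h (n1, n3, m1, m2, m3) = (n3 - m3) * h (n1, n3, m1, m2, m3)"
  by (simp_all add: second_gl_def)

lift_definition G2 :: "3 \<Rightarrow> 3 \<Rightarrow> point endo" is second_gl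
  by (auto simp: second_gl_def fun_eq_iff algebra_simps)

lemma add_one_diff: "x + 1 - 1 = (x::complex)" "x - 1 + 1 = x" "x + 1 + 1 = x + 2" "x - 1 - 1 = x - 2"
  by simp_all

lemma G2_rel: "G2 p q * G2 r s - G2 r s * G2 p q = (if q = r then G2 p s else 0) - (if s = p then G2 r q else 0)"
proof (rule endo_eqI)
  fix h and x :: point
  obtain n1 n3 m1 m2 m3 where x: "x = (n1, n3, m1, m2, m3)" by (rule prod_cases5)
  have "second_gl p q (second_gl r s h) (n1, n3, m1, m2, m3) - second_gl r s (second_gl p q h) (n1, n3, m1, m2, m3)
      = (if q = r then second_gl p s h (n1, n3, m1, m2, m3) else 0)
        - (if s = p then second_gl r q h (n1, n3, m1, m2, m3) else 0)"
    using three_cases[of p] three_cases[of q] three_cases[of r] three_cases[of s]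
    apply (elim disjE)
    apply (simp_all only: second_gl_simps three_neq if_True if_False simp_thms add_one_diff)
    apply (simp_all add: algebra_simps)
    done
  then show "app_endo (G2 p q * G2 r s - G2 r s * G2 p q) h x =
      app_endo ((if q = r then G2 p s else 0) - (if s = p then G2 r q else 0)) h x"
    by (simp add: x app_endo_simps G2.rep_eq split: if_splits)
qed

type_synonym 'b verma = "(complex \<times> complex \<times> complex) \<times> 'b"

text \<open>The dual of a Verma module in coordinates. Evaluation at \<open>(0, 0, 0)\<close> is
  annihilated by \<open>e21\<close>, \<open>e31\<close>, \<open>e32\<close> and has the weights
  \<open>P\<close>, \<open>0\<close>, \<open>- Q\<close>; for natural indices, \<open>g\<close> at
  \<open>(i, j, k)\<close> is \<open>(-1)^k\<close> times the value at \<open>(0, 0, 0)\<close> of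
  \<open>e23^k e12^i e13^j g\<close>. The argument \<open>x\<close> belongs to the second tensor
  factor.\<close>

definition first_gl :: "complex \<Rightarrow> complex \<Rightarrow> 3 \<Rightarrow> 3 \<Rightarrow> ('b verma \<Rightarrow> complex) \<Rightarrow> 'b verma \<Rightarrow> complex" where
  "first_gl P Q p q g = (\<lambda>((i, j, k), x).
    if p = 1 then
      if q = 1 then (P - i - j) * g ((i, j, k), x)
      else if q = 2 then g ((i + 1, j, k), x)
      else g ((i, j + 1, k), x)
    else if p = 2 then
      if q = 1 then i * (P - i + 1 - j + k) * g ((i - 1, j, k), x)
        + j * g ((i, j - 1, k + 1), x)
      else if q = 2 then (i - k) * g ((i, j, k), x)
      else i * g ((i - 1, j + 1, k), x) - g ((i, j, k + 1), x)
    else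
      if q = 1 then j * (P + Q - i - j + 1 - k) * g ((i, j - 1, k), x)
        + i * k * (Q - k + 1) * g ((i - 1, j, k - 1), x)
      else if q = 2 then j * g ((i + 1, j - 1, k), x) + k * (k - 1 - Q) * g ((i, j, k - 1), x)
      else (j - Q + k) * g ((i, j, k), x))"

lemma first_gl_simps:
  "first_gl P Q 1 1 g ((i, j, k), x) = (P - i - j) * g ((i, j, k), x)"
  "first_gl P Q 1 2 g ((i, j, k), x) = g ((i + 1, j, k), x)"
  "first_gl P Q 1 3 g ((i, j, k), x) = g ((i, j + 1, k), x)"
  "first_gl P Q 2 1 g ((i, j, k), x) = i * (P - i + 1 - j + k) * g ((i - 1, j, k), x)
        + j * g ((i, j - 1, k + 1), x)"
  "first_gl P Q 2 2 g ((i, j, k), x) = (i - k) * g ((i, j, k), x)"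
  "first_gl P Q 2 3 g ((i, j, k), x) = i * g ((i - 1, j + 1, k), x) - g ((i, j, k + 1), x)"
  "first_gl P Q 3 1 g ((i, j, k), x) = j * (P + Q - i - j + 1 - k) * g ((i, j - 1, k), x)
        + i * k * (Q - k + 1) * g ((i - 1, j, k - 1), x)"
  "first_gl P Q 3 2 g ((i, j, k), x) = j * g ((i + 1, j - 1, k), x) + k * (k - 1 - Q) * g ((i, j, k - 1), x)"
  "first_gl P Q 3 3 g ((i, j, k), x) = (j - Q + k) * g ((i, j, k), x)"
  by (simp_all add: first_gl_def)

lift_definition G1 :: "complex \<Rightarrow> complex \<Rightarrow> 3 \<Rightarrow> 3 \<Rightarrow> 'b verma endo" is first_gl
  by (auto simp: first_gl_def fun_eq_iff algebra_simps)

lemma G1_rel: "G1 P Q p q * G1 P Q r s - G1 P Q r s * G1 P Q p q =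
    (if q = r then G1 P Q p s else 0) - (if s = p then G1 P Q r q else (0 :: 'b verma endo))"
proof (rule endo_eqI)
  fix g and y :: "'b verma"
  obtain i j k x where y: "y = ((i, j, k), x)" by (metis surj_pair)
  have "first_gl P Q p q (first_gl P Q r s g) ((i, j, k), x) - first_gl P Q r s (first_gl P Q p q g) ((i, j, k), x)
      = (if q = r then first_gl P Q p s g ((i, j, k), x) else 0)
        - (if s = p then first_gl P Q r q g ((i, j, k), x) else 0)"
    using three_cases[of p] three_cases[of q] three_cases[of r] three_cases[of s]
    apply (elim disjE)
    apply (simp_all only: first_gl_simps three_neq if_True if_False simp_thms add_one_diff)
    apply (simp_all add: algebra_simps)
    done
  then show "app_endo (G1 P Q p q * G1 P Q r s - G1 P Q r s * G1 P Q p q) g y =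
      app_endo ((if q = r then G1 P Q p s else 0) - (if s = p then G1 P Q r q else 0)) g y"
    by (simp add: y app_endo_simps G1.rep_eq split: if_splits)
qed

text \<open>The trace is central, so subtracting it turns a representation of \<open>gl(3)\<close>
  into one of the quotient \<open>sl(3)\<close>.\<close>

definition traceless :: "(3 \<Rightarrow> 3 \<Rightarrow> 'a::complex_algebra_1) \<Rightarrow> 3 \<Rightarrow> 3 \<Rightarrow> 'a" where
  "traceless G p q = G p q - (if p = q then (1/3) *\<^sub>C (\<Sum>r\<in>UNIV. G r r) else 0)"

lemma
  assumes rel: "\<And>p q r s. G p q * G r s - G r s * G p q = (if q = r then G p s else 0) - (if s = p then G r q else 0)"
  shows traceless_rel: "traceless G p q * traceless G r s - traceless G r s * traceless G p q =
      (if q = r then traceless G p s else 0) - (if s = p then traceless G r q else 0)"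
    and traceless_trace: "(\<Sum>p\<in>UNIV. traceless G p p) = 0"
proof -
  let ?T = "\<Sum>r\<in>UNIV. G r r"
  have "(\<Sum>r\<in>UNIV. G p q * G r r - G r r * G p q) = 0" for p q
    unfolding rel by (simp add: sum_subtractf)
  then have T: "G p q * ?T = ?T * G p q" for p q
    by (simp add: sum_distrib_left sum_distrib_right sum_subtractf)
  let ?c = "\<lambda>p q. if p = q then (1/3) *\<^sub>C ?T else 0"
  have c: "?c p q * G r s = G r s * ?c p q" "?c p q * ?c r s = ?c r s * ?c p q" for p q r s
    by (simp_all add: T mult_scaleC_left mult_scaleC_right)
  have "traceless G p q * traceless G r s - traceless G r s * traceless G p q = G p q * G r s - G r s * G p q"
    unfolding traceless_def
    by (simp only: left_diff_distrib right_diff_distrib c[of p q r s] c(1)[of r s p q]) simp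
  then show "traceless G p q * traceless G r s - traceless G r s * traceless G p q =
      (if q = r then traceless G p s else 0) - (if s = p then traceless G r q else 0)"
    unfolding rel by (auto simp: traceless_def)
  have "(1/3) *\<^sub>C x + ((1/3) *\<^sub>C x + (1/3) *\<^sub>C x) = x" for x :: 'a
    by (simp add: scaleC_one flip: scaleC_add_left)
  then show "(\<Sum>p\<in>UNIV. traceless G p p) = 0"
    unfolding traceless_def sum_subtractf by (simp only: sum_3 add.assoc simp_thms if_True diff_self)
qed

lift_definition pointwise :: "'b endo \<Rightarrow> 'b verma endo" is "\<lambda>T g (n, x). T (\<lambda>x. g (n, x)) x"
  by (auto simp: fun_eq_iff)

lemma pointwise_app: "app_endo (pointwise T) g (n, x) = app_endo T (\<lambda>x. g (n, x)) x"
  by (simp add: pointwise.rep_eq)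

lemma pointwise_simps:
  fixes S T :: "'b endo" and f :: "'c \<Rightarrow> 'b endo"
  shows "pointwise (S * T) = pointwise S * pointwise T" "pointwise (S - T) = pointwise S - pointwise T"
  "pointwise 0 = 0" "pointwise (sum f A) = (\<Sum>i\<in>A. pointwise (f i))"
proof -
  have add: "pointwise (S + T) = pointwise S + pointwise T" for S T :: "'b endo"
    by (rule endo_eqI) (auto simp: pointwise_app app_endo_simps)
  show zero: "pointwise 0 = 0"
    by (rule endo_eqI) (auto simp: pointwise_app app_endo_simps)
  show "pointwise (sum f A) = (\<Sum>i\<in>A. pointwise (f i))"
    by (induction A rule: infinite_finite_induct) (simp_all add: zero add)
  show "pointwise (S * T) = pointwise S * pointwise T" "pointwise (S - T) = pointwise S - pointwise T"
    by (rule endo_eqI; auto simp: pointwise_app app_endo_simps)+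
qed

abbreviation E2 :: "3 \<Rightarrow> 3 \<Rightarrow> point endo" where
  "E2 \<equiv> traceless G2"

definition E12 :: "complex \<Rightarrow> complex \<Rightarrow> 2 \<Rightarrow> 3 \<Rightarrow> 3 \<Rightarrow> point verma endo" where
  "E12 P Q a p q = (if a = 1 then traceless (G1 P Q) p q else pointwise (E2 p q))"

lemma app_endo_diff: "app_endo T (\<lambda>x. f x - g x) x = app_endo T f x - app_endo T g x"
  using app_endo_add[of T f "\<lambda>x. - g x" x] app_endo_scale[of T "-1" g x] by simp

lemma first_gl_pointwise:
  fixes T :: "'b endo"
  shows "G1 P Q p q * pointwise T = pointwise T * G1 P Q p q"
proof (rule endo_eqI)
  fix g :: "'b verma \<Rightarrow> complex" and y :: "'b verma"
  obtain i j k x where y: "y = ((i, j, k), x)" by (metis surj_pair)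
  show "app_endo (G1 P Q p q * pointwise T) g y = app_endo (pointwise T * G1 P Q p q) g y"
    unfolding y using three_cases[of p] three_cases[of q]
    by (elim disjE) (simp_all add: app_endo_simps G1.rep_eq pointwise_app first_gl_simps app_endo_add
        app_endo_diff app_endo_scale)
qed

lemma module_exists: "\<exists>\<Phi>. complex_algebra_hom \<Phi> \<and> (\<forall>a p q. \<Phi> (copy_gen a p q) = E12 P Q a p q)"
proof -
  have rel: "E12 P Q a p q * E12 P Q a r s - E12 P Q a r s * E12 P Q a p q =
      (if q = r then E12 P Q a p s else 0) - (if s = p then E12 P Q a r q else 0)" for a p q r s
  proof (cases "a = 1")
    case True
    then show ?thesis
      by (simp only: E12_def simp_thms if_True) (rule traceless_rel[OF G1_rel])
  next
    case False
    have "pointwise (E2 p q * E2 r s - E2 r s * E2 p q) =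
        pointwise ((if q = r then E2 p s else 0) - (if s = p then E2 r q else 0))"
      by (simp only: traceless_rel[OF G2_rel])
    with False show ?thesis unfolding E12_def by (simp add: pointwise_simps split: if_splits)
  qed
  have trace: "(\<Sum>p\<in>UNIV. E12 P Q a p p) = 0" for a
  proof (cases "a = 1")
    case True
    then show ?thesis
      by (simp only: E12_def simp_thms if_True) (rule traceless_trace[OF G1_rel])
  next
    case False
    have "pointwise (\<Sum>p\<in>UNIV. E2 p p) = 0"
      by (simp only: traceless_trace[OF G2_rel] pointwise_simps)
    with False show ?thesis unfolding E12_def by (simp add: pointwise_simps)
  qed
  have comm: "E12 P Q 1 p q * E12 P Q 2 r s = E12 P Q 2 r s * E12 P Q 1 p q" for p q r s
    by (simp add: E12_def traceless_def first_gl_pointwise sum_distrib_left sum_distrib_right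
        mult_scaleC_left mult_scaleC_right left_diff_distrib right_diff_distrib)
  show ?thesis
    by (rule U2_hom_exists[OF rel trace comm]) blast+
qed

definition act :: "complex \<Rightarrow> complex \<Rightarrow> U2 \<Rightarrow> point verma endo" where
  "act P Q = (SOME \<Phi>. complex_algebra_hom \<Phi> \<and> (\<forall>a p q. \<Phi> (copy_gen a p q) = E12 P Q a p q))"

lemma
  shows act_one: "act P Q 1 = 1" and act_add: "act P Q (x + y) = act P Q x + act P Q y"
    and act_mult: "act P Q (x * y) = act P Q x * act P Q y"
    and act_scaleC: "act P Q (c *\<^sub>C x) = c *\<^sub>C act P Q x"
    and act_gen: "act P Q (copy_gen a p q) = E12 P Q a p q"
proof -
  have "complex_algebra_hom (act P Q) \<and> (\<forall>a p q. act P Q (copy_gen a p q) = E12 P Q a p q)"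
    unfolding act_def by (rule someI_ex[OF module_exists])
  then show "act P Q 1 = 1" "act P Q (x + y) = act P Q x + act P Q y"
    "act P Q (x * y) = act P Q x * act P Q y" "act P Q (c *\<^sub>C x) = c *\<^sub>C act P Q x"
    "act P Q (copy_gen a p q) = E12 P Q a p q"
    unfolding complex_algebra_hom_def by simp_all
qed

lemma act_zero: "act P Q 0 = 0"
  using act_scaleC[of P Q 0 0] by simp

lemma act_sum: "act P Q (sum f A) = (\<Sum>i\<in>A. act P Q (f i))"
  by (induction A rule: infinite_finite_induct) (simp_all add: act_zero act_add)

text \<open>The coefficients of the first action vanish where an index would leave the naturals.\<close>

definition nat_zero :: "('b verma \<Rightarrow> complex) \<Rightarrow> bool" where
  "nat_zero f \<longleftrightarrow> (\<forall>i\<in>\<nat>. \<forall>j\<in>\<nat>. \<forall>k\<in>\<nat>. \<forall>x. f ((i, j, k), x) = 0)"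

definition keeps_nat_zero :: "'b verma endo \<Rightarrow> bool" where
  "keeps_nat_zero T \<longleftrightarrow> (\<forall>f. nat_zero f \<longrightarrow> nat_zero (app_endo T f))"

lemma keeps_nat_zero_closed:
  "keeps_nat_zero 0" "keeps_nat_zero 1"
  "keeps_nat_zero S \<Longrightarrow> keeps_nat_zero T \<Longrightarrow> keeps_nat_zero (S + T)"
  "keeps_nat_zero S \<Longrightarrow> keeps_nat_zero T \<Longrightarrow> keeps_nat_zero (S - T)"
  "keeps_nat_zero S \<Longrightarrow> keeps_nat_zero T \<Longrightarrow> keeps_nat_zero (S * T)"
  "keeps_nat_zero T \<Longrightarrow> keeps_nat_zero (c *\<^sub>C T)"
  by (auto simp: keeps_nat_zero_def nat_zero_def app_endo_simps)

lemma keeps_nat_zero_sum: "(\<And>i. i \<in> A \<Longrightarrow> keeps_nat_zero (f i)) \<Longrightarrow> keeps_nat_zero (sum f A)"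
  by (induction A rule: infinite_finite_induct) (auto intro: keeps_nat_zero_closed)

lemma keeps_nat_zero_G1: "keeps_nat_zero (G1 P Q p q)"
  unfolding keeps_nat_zero_def nat_zero_def
proof (intro allI ballI impI)
  fix f :: "'b verma \<Rightarrow> complex" and i j k :: complex and x
  assume f: "\<forall>i\<in>\<nat>. \<forall>j\<in>\<nat>. \<forall>k\<in>\<nat>. \<forall>x. f ((i, j, k), x) = 0"
    and ijk: "i \<in> \<nat>" "j \<in> \<nat>" "k \<in> \<nat>"
  \<comment> \<open>A term that lowers an index carries this index as a factor: at 0 the term
    disappears, otherwise the lowered index is again natural.\<close>
  have "i = 0 \<or> i - 1 \<in> \<nat>" if "i \<in> \<nat>" for i :: complex
  proof -
    obtain n where "i = of_nat n" using \<open>i \<in> \<nat>\<close> by (rule Nats_cases)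
    then show ?thesis by (cases n) auto
  qed
  from this[OF ijk(1)] this[OF ijk(2)] this[OF ijk(3)]
  have "i = 0 \<or> i - 1 \<in> \<nat>" "j = 0 \<or> j - 1 \<in> \<nat>" "k = 0 \<or> k - 1 \<in> \<nat>" .
  with f ijk show "app_endo (G1 P Q p q) f ((i, j, k), x) = 0"
    using three_cases[of p] three_cases[of q]
    by (elim disjE) (simp_all add: G1.rep_eq first_gl_simps Nats_add)
qed

lemma keeps_nat_zero_pointwise: "keeps_nat_zero (pointwise T)"
  by (auto simp: keeps_nat_zero_def nat_zero_def pointwise_app app_endo_zero)

lemma keeps_nat_zero_trace_span: "trace_span n z \<Longrightarrow> keeps_nat_zero (act P Q z)"
proof (induction rule: trace_span.induct)
  case (mult as n x)
  have "keeps_nat_zero (act P Q (copy_gen a p q))" for a p q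
    unfolding act_gen E12_def traceless_def
    by (auto intro!: keeps_nat_zero_closed keeps_nat_zero_sum keeps_nat_zero_G1 keeps_nat_zero_pointwise)
  then have "keeps_nat_zero (act P Q (prod_list (map (\<lambda>j. copy_gen (a j) (p j) (q j)) js)))" for a p q js
    by (induction js) (auto simp: act_one act_mult intro: keeps_nat_zero_closed)
  then have "keeps_nat_zero (act P Q (ptrace as))"
    unfolding polarised_trace_def act_sum by (intro keeps_nat_zero_sum)
  with mult show ?case by (simp add: act_mult keeps_nat_zero_closed)
qed (auto simp: act_one act_add act_scaleC intro: keeps_nat_zero_closed)

section \<open>Singular vectors and the induced operators\<close>

definition singular :: "complex \<Rightarrow> complex \<Rightarrow> (point verma \<Rightarrow> complex) \<Rightarrow> bool" where
  "singular P Q g \<longleftrightarrow> nat_zero (app_endo (act P Q (diag 1 2)) g) \<and>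
    nat_zero (app_endo (act P Q (diag 1 3)) g) \<and> nat_zero (app_endo (act P Q (diag 2 3)) g)"

lemma act_diag: "act P Q (diag p q) = traceless (G1 P Q) p q + pointwise (E2 p q)"
  by (simp add: diag_def act_add act_gen E12_def)

text \<open>Each raising operator moves one Verma index up, so being singular is a recursion that
  determines \<open>g\<close> at natural indices from its values at
  \<open>(0, 0, 0)\<close>.\<close>

lemma singular_iff:
  "singular P Q g \<longleftrightarrow> (\<forall>i\<in>\<nat>. \<forall>j\<in>\<nat>. \<forall>k\<in>\<nat>. \<forall>x.
    g ((i + 1, j, k), x) = - app_endo (E2 1 2) (\<lambda>x. g ((i, j, k), x)) x \<and>
    g ((i, j + 1, k), x) = - app_endo (E2 1 3) (\<lambda>x. g ((i, j, k), x)) x \<and>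
    g ((i, j, k + 1), x) = i * g ((i - 1, j + 1, k), x) + app_endo (E2 2 3) (\<lambda>x. g ((i, j, k), x)) x)"
proof -
  have "a + b = 0 \<longleftrightarrow> a = - b" "a - b + c = 0 \<longleftrightarrow> b = a + c" for a b c :: complex
    by (auto simp: eq_neg_iff_add_eq_0 algebra_simps)
  then show ?thesis
    unfolding singular_def act_diag nat_zero_def
    by (simp add: app_endo_simps pointwise_app traceless_def G1.rep_eq first_gl_simps del: split_paired_All)
      blast
qed

lemma singular_zero:
  assumes g: "singular P Q g" and base: "\<And>x. g ((0, 0, 0), x) = 0"
  shows "nat_zero g"
proof -
  note rec = g[unfolded singular_iff, rule_format]
  have 0: "g ((of_nat i, 0, 0), x) = 0" for i x
  proof (induction i arbitrary: x)
    case (Suc i)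
    then show ?case using rec[of "of_nat i" 0 0 x] by (simp add: app_endo_zero add.commute)
  qed (simp add: base)
  have 1: "g ((of_nat i, of_nat j, 0), x) = 0" for i j x
  proof (induction j arbitrary: x)
    case (Suc j)
    then show ?case using rec[of "of_nat i" "of_nat j" 0 x] by (simp add: app_endo_zero add.commute)
  qed (simp add: 0)
  have "g ((of_nat i, of_nat j, of_nat k), x) = 0" for i j k x
  proof (induction k arbitrary: i j x)
    case (Suc k)
    have "of_nat i * g ((of_nat i - 1, of_nat j + 1, of_nat k), x) = 0"
      using Suc[of "i - 1" "Suc j" x] by (cases i) (simp_all add: add.commute)
    with Suc show ?case using rec[of "of_nat i" "of_nat j" "of_nat k" x]
      by (simp add: app_endo_zero add.commute)
  qed (simp add: 1)
  then show ?thesis unfolding nat_zero_def by (auto elim!: Nats_cases)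
qed

text \<open>The solution of this recursion with initial values \<open>h\<close>. The complex indices
  are rounded to natural numbers; singularity is a statement about natural indices, where the
  rounding is exact.\<close>

definition singular_vector :: "(point \<Rightarrow> complex) \<Rightarrow> point verma \<Rightarrow> complex" where
  "singular_vector h = (\<lambda>((a, b, c), x).
    let i = nat \<lfloor>Re a\<rfloor>; j = nat \<lfloor>Re b\<rfloor>; k = nat \<lfloor>Re c\<rfloor>
    in (-1) ^ (i + j) * app_endo (E2 1 3 ^ j * E2 1 2 ^ i * E2 2 3 ^ k) h x)"

lemma singular_vector_nat:
  "singular_vector h ((of_nat i, of_nat j, of_nat k), x) =
    (-1) ^ (i + j) * app_endo (E2 1 3 ^ j * E2 1 2 ^ i * E2 2 3 ^ k) h x"
  by (simp add: singular_vector_def)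

lemma singular_vector_base: "singular_vector h ((0, 0, 0), x) = h x"
  using singular_vector_nat[of h 0 0 0 x] by (simp add: app_endo_simps)

text \<open>\<open>E2 1 2\<close> and \<open>E2 2 3\<close> have the commutator
  \<open>E2 1 3\<close>, which commutes with both. Moving \<open>E2 2 3\<close> through the
  \<open>i\<close>th power of \<open>E2 1 2\<close> thus produces \<open>i\<close> times
  \<open>E2 1 3\<close>, the extra term of the third recursion.\<close>

lemma singular_singular_vector: "singular P Q (singular_vector h)"
proof -
  have c: "E2 1 2 * E2 1 3 = E2 1 3 * E2 1 2" "E2 1 3 * E2 2 3 = E2 2 3 * E2 1 3"
    and c3: "E2 1 2 * E2 2 3 = E2 2 3 * E2 1 2 + E2 1 3"
    using traceless_rel[OF G2_rel, of 1 2 1 3] traceless_rel[OF G2_rel, of 1 3 2 3]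
      traceless_rel[OF G2_rel, of 1 2 2 3]
    by (simp_all add: algebra_simps)
  have pow: "E2 1 2 * E2 1 3 ^ j = E2 1 3 ^ j * E2 1 2" "E2 1 3 ^ j * E2 2 3 = E2 2 3 * E2 1 3 ^ j" for j
    using power_commuting_commutes[of "E2 1 3" "E2 1 2" j] power_commuting_commutes[of "E2 1 3" "E2 2 3" j] c
    by simp_all
  have pow3: "E2 1 2 ^ i * E2 2 3 = E2 2 3 * E2 1 2 ^ i + of_nat i *\<^sub>C (E2 1 3 * E2 1 2 ^ (i - 1))" for i
  proof (induction i)
    case (Suc i)
    have "E2 1 2 ^ Suc i * E2 2 3 = E2 1 2 * (E2 2 3 * E2 1 2 ^ i + of_nat i *\<^sub>C (E2 1 3 * E2 1 2 ^ (i - 1)))"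
      by (simp add: mult.assoc Suc)
    also have "\<dots> = E2 1 2 * E2 2 3 * E2 1 2 ^ i + of_nat i *\<^sub>C (E2 1 2 * E2 1 3 * E2 1 2 ^ (i - 1))"
      by (simp add: distrib_left mult_scaleC_right mult.assoc)
    also have "\<dots> = E2 2 3 * E2 1 2 ^ Suc i + (E2 1 3 * E2 1 2 ^ i + of_nat i *\<^sub>C (E2 1 3 * (E2 1 2 * E2 1 2 ^ (i - 1))))"
      by (simp only: c c3) (simp add: distrib_right mult.assoc)
    also have "of_nat i *\<^sub>C (E2 1 3 * (E2 1 2 * E2 1 2 ^ (i - 1))) = of_nat i *\<^sub>C (E2 1 3 * E2 1 2 ^ i)"
      by (cases i) simp_all
    finally show ?case by (simp add: scaleC_add_left scaleC_one)
  qed simp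
  have up: "complex_of_nat i + 1 = of_nat (Suc i)" for i by simp
  have scale: "app_endo T (\<lambda>x. (-1) ^ n * f x) x = (-1) ^ n * app_endo T f x" for T :: "point endo" and n f x
    by (rule app_endo_scale)
  have app: "app_endo T (app_endo S h) x = app_endo (T * S) h x" for T S :: "point endo" and x
    by (simp add: app_endo_simps)
  have "of_nat i * singular_vector h ((of_nat i - 1, of_nat j + 1, of_nat k), x) =
     (-1) ^ (i + j) * (of_nat i * app_endo (E2 1 3 ^ Suc j * E2 1 2 ^ (i - 1) * E2 2 3 ^ k) h x)" for i j k x
  proof (cases i)
    case (Suc i')
    have "of_nat i - 1 = complex_of_nat i'" by (simp add: Suc)
    then show ?thesis by (simp only: up singular_vector_nat) (simp add: Suc)
  qed simp
  moreover have "app_endo (E2 1 3 ^ j * E2 1 2 ^ i * E2 2 3 ^ Suc k) h x =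
      of_nat i * app_endo (E2 1 3 ^ Suc j * E2 1 2 ^ (i - 1) * E2 2 3 ^ k) h x +
      app_endo (E2 2 3 * (E2 1 3 ^ j * E2 1 2 ^ i * E2 2 3 ^ k)) h x" for i j k x
  proof -
    have "E2 1 3 ^ j * E2 1 2 ^ i * E2 2 3 ^ Suc k = E2 1 3 ^ j * (E2 1 2 ^ i * E2 2 3) * E2 2 3 ^ k"
      by (simp add: mult.assoc)
    also have "\<dots> = of_nat i *\<^sub>C (E2 1 3 ^ Suc j * E2 1 2 ^ (i - 1) * E2 2 3 ^ k)
        + E2 1 3 ^ j * E2 2 3 * E2 1 2 ^ i * E2 2 3 ^ k"
      by (simp add: pow3 distrib_left distrib_right mult_scaleC_left mult_scaleC_right mult.assoc
          power_commutes[symmetric] power_Suc2 del: power_Suc)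
    also have "\<dots> = of_nat i *\<^sub>C (E2 1 3 ^ Suc j * E2 1 2 ^ (i - 1) * E2 2 3 ^ k)
        + E2 2 3 * (E2 1 3 ^ j * E2 1 2 ^ i * E2 2 3 ^ k)"
      by (simp only: pow mult.assoc)
    finally show ?thesis by (simp add: app_endo_simps)
  qed
  moreover have "E2 1 3 ^ j * E2 1 2 ^ Suc i * E2 2 3 ^ k = E2 1 2 * (E2 1 3 ^ j * E2 1 2 ^ i * E2 2 3 ^ k)" for i j k
    by (simp add: pow mult.assoc[symmetric])
  moreover have "E2 1 3 ^ Suc j * E2 1 2 ^ i * E2 2 3 ^ k = E2 1 3 * (E2 1 3 ^ j * E2 1 2 ^ i * E2 2 3 ^ k)" for i j k
    by (simp add: mult.assoc)
  ultimately show ?thesis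
    unfolding singular_iff
    by (safe elim!: Nats_cases; simp only: up singular_vector_nat scale app) (simp_all add: distrib_left)
qed

lemma singular_unique:
  assumes g: "singular P Q g"
  shows "nat_zero (\<lambda>y. g y - singular_vector (\<lambda>x. g ((0, 0, 0), x)) y)"
proof (rule singular_zero)
  show "singular P Q (\<lambda>y. g y - singular_vector (\<lambda>x. g ((0, 0, 0), x)) y)"
    using g singular_singular_vector[of P Q "\<lambda>x. g ((0, 0, 0), x)"]
    unfolding singular_def nat_zero_def by (simp add: app_endo_diff)
qed (simp add: singular_vector_base)

lemma singular_act:
  assumes "trace_span n z" "singular P Q g"
  shows "singular P Q (app_endo (act P Q z) g)"
proof -
  have "app_endo (act P Q (diag p q)) (app_endo (act P Q z) g) =
      app_endo (act P Q z) (app_endo (act P Q (diag p q)) g)" for p q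
    using diag_trace_span[OF assms(1), of p q] by (simp flip: act_mult times_endo.rep_eq add: fun_cong[OF times_endo.rep_eq[symmetric]])
  then show ?thesis
    using assms keeps_nat_zero_trace_span[OF assms(1), of P Q]
    unfolding singular_def keeps_nat_zero_def by simp
qed

text \<open>Invariants preserve singular vectors, and these correspond to their values
  \<open>h\<close> at \<open>(0, 0, 0)\<close>; \<open>rho\<close> is the induced action on
  \<open>h\<close>. In \<open>rho_mult\<close> the right factor has to preserve singularity and the
  left one has to respect \<open>nat_zero\<close>.\<close>

definition rho :: "complex \<Rightarrow> complex \<Rightarrow> U2 \<Rightarrow> (point \<Rightarrow> complex) \<Rightarrow> point \<Rightarrow> complex" where
  "rho P Q z h x = app_endo (act P Q z) (singular_vector h) ((0, 0, 0), x)"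

lemma rho_add: "rho P Q (z + w) h x = rho P Q z h x + rho P Q w h x"
  and rho_scaleC: "rho P Q (c *\<^sub>C z) h x = c * rho P Q z h x"
  and rho_one: "rho P Q 1 h x = h x"
  by (simp_all add: rho_def act_add act_scaleC act_one app_endo_simps singular_vector_base)

lemma rho_mult:
  assumes w: "trace_span m w" and z: "trace_span n z"
  shows "rho P Q (w * z) h = rho P Q w (rho P Q z h)"
proof
  fix x
  let ?g = "app_endo (act P Q z) (singular_vector h)"
  have "singular P Q ?g" by (rule singular_act[OF z singular_singular_vector])
  then have "nat_zero (\<lambda>y. ?g y - singular_vector (rho P Q z h) y)"
    using singular_unique[of P Q ?g] unfolding rho_def by simp
  then have "nat_zero (app_endo (act P Q w) (\<lambda>y. ?g y - singular_vector (rho P Q z h) y))"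
    using keeps_nat_zero_trace_span[OF w] unfolding keeps_nat_zero_def by blast
  then have "app_endo (act P Q w) (\<lambda>y. ?g y - singular_vector (rho P Q z h) y) ((0, 0, 0), x) = 0"
    unfolding nat_zero_def using Nats_0 by blast
  then show "rho P Q (w * z) h x = rho P Q w (rho P Q z h) x"
    by (simp add: rho_def act_mult app_endo_simps app_endo_diff)
qed

definition hw :: "complex \<Rightarrow> complex \<Rightarrow> 3 \<Rightarrow> complex" where
  "hw P Q p = (if p = 1 then P else if p = 2 then 0 else - Q) - (P - Q) / 3"

lemma sum_G1: "(\<Sum>r\<in>UNIV. G1 P Q r r) = (P - Q) *\<^sub>C 1"
proof (rule endo_eqI)
  fix g and y :: "'a verma"
  obtain i j k x where y: "y = ((i, j, k), x)" by (metis surj_pair)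
  show "app_endo (\<Sum>r\<in>UNIV. G1 P Q r r) g y = app_endo ((P - Q) *\<^sub>C 1) g y"
    unfolding y by (simp add: sum_3 app_endo_simps G1.rep_eq first_gl_simps algebra_simps)
qed

lemma first_app: "app_endo (traceless (G1 P Q) p q) g y =
    first_gl P Q p q g y - (if p = q then (P - Q) / 3 * g y else 0)"
  by (simp add: traceless_def sum_G1 app_endo_simps G1.rep_eq)

lemma rho_first_diag: "rho P Q (copy_gen 1 p p * z) h x = hw P Q p * rho P Q z h x"
  using three_cases[of p]
  by (elim disjE) (simp_all add: rho_def act_mult act_gen E12_def app_endo_simps first_app first_gl_simps
      hw_def algebra_simps)

lemma rho_first_lower:
  "rho P Q (copy_gen 1 2 1 * z) h x = 0" "rho P Q (copy_gen 1 3 1 * z) h x = 0" "rho P Q (copy_gen 1 3 2 * z) h x = 0"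
  by (simp_all add: rho_def act_mult act_gen E12_def app_endo_simps first_app first_gl_simps)

text \<open>On a singular vector a raising generator of the first copy equals minus the one of the
  second copy, provided that it stands on the right, next to the vector.\<close>

lemma rho_first_raise:
  assumes pq: "(p, q) \<in> {(1, 2), (1, 3), (2, 3)}"
  shows "rho P Q (copy_gen 1 r s * copy_gen 1 p q) h x = - app_endo (E2 p q) (rho P Q (copy_gen 1 r s) h) x"
    and "rho P Q (copy_gen 1 p q) h x = - app_endo (E2 p q) h x"
proof -
  let ?g = "singular_vector h"
  have "nat_zero (app_endo (act P Q (diag p q)) ?g)"
    using singular_singular_vector[of P Q h] pq unfolding singular_def by auto
  then have z: "nat_zero (\<lambda>y. app_endo (act P Q (copy_gen 1 p q)) ?g y + app_endo (pointwise (E2 p q)) ?g y)"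
    by (simp add: diag_def act_add act_gen E12_def app_endo_simps)
  have "keeps_nat_zero (act P Q (copy_gen 1 r s))"
    unfolding act_gen E12_def traceless_def
    by (auto intro!: keeps_nat_zero_closed keeps_nat_zero_sum keeps_nat_zero_G1)
  then have "nat_zero (app_endo (act P Q (copy_gen 1 r s)) (\<lambda>y. app_endo (act P Q (copy_gen 1 p q)) ?g y
      + app_endo (pointwise (E2 p q)) ?g y))"
    using z unfolding keeps_nat_zero_def by blast
  then have "app_endo (act P Q (copy_gen 1 r s)) (\<lambda>y. app_endo (act P Q (copy_gen 1 p q)) ?g y
      + app_endo (pointwise (E2 p q)) ?g y) ((0, 0, 0), x) = 0"
    unfolding nat_zero_def using Nats_0 by blast
  moreover have "act P Q (copy_gen 1 r s) * pointwise (E2 p q) = pointwise (E2 p q) * act P Q (copy_gen 1 r s)"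
    by (simp add: act_gen E12_def traceless_def first_gl_pointwise sum_distrib_left sum_distrib_right
        mult_scaleC_left mult_scaleC_right left_diff_distrib right_diff_distrib)
  then have "app_endo (act P Q (copy_gen 1 r s)) (app_endo (pointwise (E2 p q)) ?g) ((0, 0, 0), x) =
      app_endo (pointwise (E2 p q)) (app_endo (act P Q (copy_gen 1 r s)) ?g) ((0, 0, 0), x)"
    by (metis times_endo.rep_eq)
  ultimately show "rho P Q (copy_gen 1 r s * copy_gen 1 p q) h x = - app_endo (E2 p q) (rho P Q (copy_gen 1 r s) h) x"
    by (simp add: rho_def[abs_def] act_mult app_endo_simps app_endo_add pointwise_app eq_neg_iff_add_eq_0)
  have "app_endo (act P Q (copy_gen 1 p q)) ?g ((0, 0, 0), x) + app_endo (pointwise (E2 p q)) ?g ((0, 0, 0), x) = 0"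
    using z unfolding nat_zero_def using Nats_0 by blast
  then show "rho P Q (copy_gen 1 p q) h x = - app_endo (E2 p q) h x"
    by (simp add: rho_def pointwise_app singular_vector_base eq_neg_iff_add_eq_0)
qed

lemma rho_first:
  "rho P Q (copy_gen 1 1 1) h x = hw P Q 1 * h x" "rho P Q (copy_gen 1 2 2) h x = hw P Q 2 * h x"
  "rho P Q (copy_gen 1 3 3) h x = hw P Q 3 * h x"
  "rho P Q (copy_gen 1 2 1) h x = 0" "rho P Q (copy_gen 1 3 1) h x = 0" "rho P Q (copy_gen 1 3 2) h x = 0"
  "rho P Q (copy_gen 1 1 2) h x = - app_endo (E2 1 2) h x"
  "rho P Q (copy_gen 1 1 3) h x = - app_endo (E2 1 3) h x"
  "rho P Q (copy_gen 1 2 3) h x = - app_endo (E2 2 3) h x"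
  using rho_first_diag[of P Q _ 1 h x] rho_first_lower[of P Q 1 h x] rho_first_raise(2)
  by (simp_all add: rho_one)

lemma rho_second: "rho P Q (copy_gen 2 p q * z) h x = app_endo (E2 p q) (rho P Q z h) x"
  by (simp add: rho_def[abs_def] act_mult act_gen E12_def app_endo_simps pointwise_app)

lemma rho_sum: "rho P Q (sum f A) h x = (\<Sum>i\<in>A. rho P Q (f i) h x)"
  by (simp add: rho_def act_sum app_endo_sum)

lemma rho_diff: "rho P Q (z - w) h x = rho P Q z h x - rho P Q w h x"
  using rho_add[of P Q "z - w" w h x] by simp

text \<open>The square of the generator matrix of the first copy on singular vectors: lowering
  factors are moved to the left, where they vanish at \<open>(0, 0, 0)\<close>, and raising factors
  to the right, where they become operators of the second copy.\<close>

definition square_endo :: "complex \<Rightarrow> complex \<Rightarrow> 3 \<Rightarrow> 3 \<Rightarrow> point endo" where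
  "square_endo P Q p r =
    (if p = 1 \<and> r = 1 then (hw P Q 1)\<^sup>2 *\<^sub>C 1
     else if p = 2 \<and> r = 2 then ((hw P Q 2)\<^sup>2 + hw P Q 1 - hw P Q 2) *\<^sub>C 1
     else if p = 3 \<and> r = 3 then ((hw P Q 3)\<^sup>2 + hw P Q 1 + hw P Q 2 - 2 * hw P Q 3) *\<^sub>C 1
     else if p = 2 \<and> r = 1 then (1 - hw P Q 1 - hw P Q 2) *\<^sub>C E2 1 2
     else if p = 3 \<and> r = 2 then (2 - hw P Q 2 - hw P Q 3) *\<^sub>C E2 2 3
     else if p = 3 \<and> r = 1 then (1 - hw P Q 1 - hw P Q 3) *\<^sub>C E2 1 3 + E2 1 2 * E2 2 3
     else 0)"

lemma rho_first_square:
  "(\<Sum>q\<in>UNIV. rho P Q (copy_gen 1 q p * copy_gen 1 r q) h x) = app_endo (square_endo P Q p r) h x"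
proof -
  have swap: "rho P Q (copy_gen 1 q p * copy_gen 1 r q) h x = rho P Q (copy_gen 1 r q * copy_gen 1 q p) h x
      + ((if p = r then rho P Q (copy_gen 1 q q) h x else 0) - rho P Q (copy_gen 1 r p) h x)" for q p r
  proof -
    have "copy_gen 1 q p * copy_gen 1 r q = copy_gen 1 r q * copy_gen 1 q p
        + ((if p = r then copy_gen 1 q q else 0) - copy_gen 1 r p)"
      using copy_gen_commute[of 1 q p 1 r q] by (simp add: algebra_simps)
    moreover have "rho P Q 0 h x = 0" using rho_scaleC[of P Q 0 0 h x] by simp
    ultimately show ?thesis by (simp add: rho_add rho_diff)
  qed
  note swap = swap[of 1 2 1] swap[of 1 2 2] swap[of 1 2 3] swap[of 1 3 1] swap[of 1 3 2] swap[of 1 3 3]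
    swap[of 2 3 2] swap[of 2 3 3]
  note rules = rho_first_diag rho_first_lower rho_first
  have "rho P Q (copy_gen 1 2 3 * copy_gen 1 1 2) h x = app_endo (E2 1 2 * E2 2 3) h x"
    using rho_first_raise(1)[of 1 2 P Q 2 3 h x] app_endo_scale[of "E2 1 2" "-1" "app_endo (E2 2 3) h" x]
    by (simp add: rho_first(9)[abs_def] app_endo_simps)
  then show ?thesis
    using three_cases[of p] three_cases[of r]
    by (elim disjE) (simp_all add: sum_3 swap rules square_endo_def app_endo_simps power2_eq_square algebra_simps)
qed

definition square2 :: "3 \<Rightarrow> 3 \<Rightarrow> point endo" where
  "square2 p r = (\<Sum>q\<in>UNIV. E2 q p * E2 r q)"

definition endo12 :: "complex \<Rightarrow> complex \<Rightarrow> point endo" where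
  "endo12 P Q = (\<Sum>p\<in>UNIV. hw P Q p *\<^sub>C E2 p p) - (E2 2 1 * E2 1 2 + E2 3 1 * E2 1 3 + E2 3 2 * E2 2 3)"

definition endo122 :: "complex \<Rightarrow> complex \<Rightarrow> point endo" where
  "endo122 P Q = (\<Sum>p\<in>UNIV. hw P Q p *\<^sub>C square2 p p)
    - (square2 1 2 * E2 1 2 + square2 1 3 * E2 1 3 + square2 2 3 * E2 2 3)"

definition endo112 :: "complex \<Rightarrow> complex \<Rightarrow> point endo" where
  "endo112 P Q = (\<Sum>p\<in>UNIV. \<Sum>r\<in>UNIV. E2 p r * square_endo P Q p r)"

definition endo1122 :: "complex \<Rightarrow> complex \<Rightarrow> point endo" where
  "endo1122 P Q = (\<Sum>p\<in>UNIV. \<Sum>r\<in>UNIV. square2 r p * square_endo P Q p r)"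

lemma copies_commute: "copy_gen 1 p q * copy_gen 2 r s = copy_gen 2 r s * copy_gen 1 p q"
  using copy_gen_commute[of 1 p q 2 r s] by simp

lemma copies_commute_left: "copy_gen 1 p q * (copy_gen 2 r s * z) = copy_gen 2 r s * (copy_gen 1 p q * z)"
  by (simp only: mult.assoc[symmetric] copies_commute)

lemma polarised_trace_4: "ptrace [a, b, c, d] = (\<Sum>i\<in>UNIV. \<Sum>j\<in>UNIV. \<Sum>k\<in>UNIV. \<Sum>l\<in>UNIV.
    copy_gen a j i * (copy_gen b k j * (copy_gen c l k * copy_gen d i l)))"
  by (simp add: polarised_trace_def sum_lists_Suc numeral_2_eq_2 upt_rec)

text \<open>The second copy is moved to the left, so that its operators are applied last and the
  first copy meets the singular vector directly. The same is done for the longer traces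
  below.\<close>

lemma rho_12: "rho P Q (ptrace [1, 2]) h x = app_endo (endo12 P Q) h x"
proof -
  have "rho P Q (ptrace [1, 2]) h x =
      (\<Sum>i\<in>UNIV. \<Sum>j\<in>UNIV. app_endo (E2 i j) (rho P Q (copy_gen 1 j i) h) x)"
    by (simp only: polarised_trace_2 quadratic_def rho_sum copies_commute rho_second)
  also have "\<dots> = app_endo (endo12 P Q) h x"
    by (simp add: sum_3 rho_first[abs_def] endo12_def app_endo_simps app_endo_scale app_endo_zero
        app_endo_scale[of _ "-1", simplified])
  finally show ?thesis .
qed

lemma rho_122: "rho P Q (ptrace [1, 2, 2]) h x = app_endo (endo122 P Q) h x"
proof -
  have "rho P Q (ptrace [1, 2, 2]) h x =
      (\<Sum>i\<in>UNIV. \<Sum>j\<in>UNIV. \<Sum>k\<in>UNIV. app_endo (E2 k j) (app_endo (E2 i k) (rho P Q (copy_gen 1 j i) h)) x)"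
    by (simp only: polarised_trace_3 cubic_def rho_sum copies_commute copies_commute_left mult.assoc
        rho_second[abs_def])
  also have "\<dots> = app_endo (endo122 P Q) h x"
    by (simp add: sum_3 rho_first[abs_def] endo122_def square2_def app_endo_simps app_endo_scale[abs_def] app_endo_zero[abs_def]
        app_endo_scale[of _ "-1", simplified, abs_def] distrib_right mult.assoc) (simp add: algebra_simps)
  finally show ?thesis .
qed

lemma rho_112: "rho P Q (ptrace [1, 1, 2]) h x = app_endo (endo112 P Q) h x"
proof -
  have "rho P Q (ptrace [1, 1, 2]) h x = (\<Sum>i\<in>UNIV. \<Sum>j\<in>UNIV. \<Sum>k\<in>UNIV.
      app_endo (E2 i k) (rho P Q (copy_gen 1 j i * copy_gen 1 k j) h) x)"
    by (simp only: polarised_trace_3 cubic_def rho_sum copies_commute copies_commute_left mult.assoc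
        rho_second[abs_def])
  also have "\<dots> = (\<Sum>i\<in>UNIV. \<Sum>k\<in>UNIV. \<Sum>j\<in>UNIV.
      app_endo (E2 i k) (rho P Q (copy_gen 1 j i * copy_gen 1 k j) h) x)"
    by (rule sum.cong[OF refl], rule sum.swap)
  also have "\<dots> = (\<Sum>i\<in>UNIV. \<Sum>k\<in>UNIV. app_endo (E2 i k) (app_endo (square_endo P Q i k) h) x)"
    by (simp only: rho_first_square[symmetric, abs_def]) (simp add: sum_3 app_endo_add)
  finally show ?thesis by (simp add: endo112_def app_endo_sum app_endo_simps)
qed

lemma rho_1122: "rho P Q (ptrace [1, 1, 2, 2]) h x = app_endo (endo1122 P Q) h x"
proof -
  have "rho P Q (ptrace [1, 1, 2, 2]) h x = (\<Sum>i\<in>UNIV. \<Sum>j\<in>UNIV. \<Sum>k\<in>UNIV. \<Sum>l\<in>UNIV.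
      app_endo (E2 l k * E2 i l) (rho P Q (copy_gen 1 j i * copy_gen 1 k j) h) x)"
    by (simp only: polarised_trace_4 rho_sum copies_commute copies_commute_left mult.assoc
        rho_second[abs_def] times_endo.rep_eq)
  also have "\<dots> = (\<Sum>i\<in>UNIV. \<Sum>j\<in>UNIV. \<Sum>k\<in>UNIV.
      app_endo (square2 k i) (rho P Q (copy_gen 1 j i * copy_gen 1 k j) h) x)"
    by (simp only: square2_def app_endo_sum)
  also have "\<dots> = (\<Sum>i\<in>UNIV. \<Sum>k\<in>UNIV. \<Sum>j\<in>UNIV.
      app_endo (square2 k i) (rho P Q (copy_gen 1 j i * copy_gen 1 k j) h) x)"
    by (rule sum.cong[OF refl], rule sum.swap)
  also have "\<dots> = (\<Sum>i\<in>UNIV. \<Sum>k\<in>UNIV. app_endo (square2 k i) (app_endo (square_endo P Q i k) h) x)"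
    by (simp only: rho_first_square[symmetric, abs_def]) (simp add: sum_3 app_endo_add)
  finally show ?thesis by (simp add: endo1122_def app_endo_sum app_endo_simps)
qed

section \<open>The action on lines of singular vectors\<close>

definition tau :: "point \<Rightarrow> complex" where
  "tau = (\<lambda>(n1, n3, m1, m2, m3). (n1 + n3 - m1 - m2 - m3) / 3)"

definition trace_part :: "point endo" where
  "trace_part = (1/3) *\<^sub>C (\<Sum>r\<in>UNIV. G2 r r)"

lemma trace_part_app: "app_endo trace_part h x = tau x * h x"
proof -
  obtain n1 n3 m1 m2 m3 where x: "x = (n1, n3, m1, m2, m3)" by (rule prod_cases5)
  show ?thesis
    unfolding x by (simp add: trace_part_def tau_def sum_3 app_endo_simps G2.rep_eq second_gl_simps field_simps)
qed

lemma trace_part_commute: "G2 p q * trace_part = trace_part * G2 p q"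
proof -
  have "(\<Sum>r\<in>UNIV. G2 p q * G2 r r - G2 r r * G2 p q) = 0"
    unfolding G2_rel by (simp add: sum_subtractf)
  then show ?thesis
    by (simp add: trace_part_def sum_distrib_left sum_distrib_right sum_subtractf mult_scaleC_left mult_scaleC_right)
qed

lemma trace_part_commute_left: "G2 p q * (trace_part * z) = trace_part * (G2 p q * z)"
  by (simp only: mult.assoc[symmetric] trace_part_commute)

lemma E2_eq: "E2 p q = G2 p q - (if p = q then trace_part else 0)"
  by (simp add: traceless_def trace_part_def)

lemmas expand_words = sum_3 E2_eq left_diff_distrib right_diff_distrib distrib_left distrib_right mult.assoc
  trace_part_commute trace_part_commute_left mult_scaleC_left mult_scaleC_right

lemmas expand_app = app_endo_simps trace_part_app G2.rep_eq second_gl_simps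

lemma shift_simps:
  "x + 2 - 1 = x + (1::complex)" "x - 2 + 1 = x - (1::complex)" "x + 2 + 1 = x + (3::complex)" "x - 2 - 1 = x - (3::complex)"
  by simp_all

lemmas shift_args = add_one_diff shift_simps

text \<open>The polynomial obtained by expanding \<open>endo12\<close> into shifts. Here and below
  \<open>T\<close> stands for the value of \<open>tau\<close>, and \<open>La\<close>,
  \<open>Lb\<close>, \<open>Lc\<close> for the weights \<open>hw\<close>, kept symbolic to shorten
  the identities.\<close>

definition coeff12 where
  "coeff12 (n1::complex) n3 m1 m2 m3 T La Lb Lc =
      (- n1*n3 - n1*m1 + n1*La - n3*m3 + n3*Lc - 2*n3) + (- m1*m2 - m1*m3 - m1*La - 2*m1 -
      1*m2*m3 - m2*Lb) + (- m2 - m3*Lc - T*La - T*Lb - T*Lc)"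

lemma endo12_app:
  "app_endo (endo12 P Q) h (n1, n3, m1, m2, m3) =
    coeff12 n1 n3 m1 m2 m3 (tau (n1, n3, m1, m2, m3)) (hw P Q 1) (hw P Q 2) (hw P Q 3) * h (n1, n3, m1, m2, m3)"
  unfolding coeff12_def
  apply (simp only: endo12_def expand_words three_neq if_True if_False simp_thms diff_0_right)
  apply (simp only: expand_app mult_zero_left mult_zero_right diff_0_right add_0 add_0_right)
  apply (simp only: shift_args)
  apply Groebner_Basis.algebra
  done

definition coeff122 where
  "coeff122 (n1::complex) n3 m1 m2 m3 T La Lb Lc =
      ((- 1*n1^2*n3 - n1^2*m1 + n1^2*La - n1*n3^2 - n1*n3*m3) + (2*n1*n3*T + n1*n3*La + n1*n3*Lc -
      1*n1*n3)) + ((n1*m1^2 + n1*m1*m3 + 2*n1*m1*T - n1*m1*La + n1*m1*Lb) + (n1*m1 - 2*n1*T*La + n1*Lb +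
      n1*Lc)) + ((- 1*n3^2*m3 + n3^2*Lc - 2*n3^2 + n3*m3^2 + 2*n3*m3*T) + (n3*m3*Lb - n3*m3*Lc + 2*n3*m3
      - 2*n3*T*Lc)) + ((4*n3*T + n3*La + n3*Lb + 2*n3 + m1^2*m2) + (m1^2*m3 + m1^2*La + 2*m1^2 + m1*m2^2))
      + ((3*m1*m2*m3 + 2*m1*m2*T + m1*m2*La + m1*m2*Lb + 5*m1*m2) + (m1*m3^2 + 2*m1*m3*T + m1*m3*La +
      m1*m3*Lc)) + ((4*m1*m3 + 2*m1*T*La + 4*m1*T + 2*m1*La + 4*m1) + (m2^2*m3 + m2^2*Lb + m2^2 +
      m2*m3^2)) + ((2*m2*m3*T + m2*m3*Lb + m2*m3*Lc + 3*m2*m3 + 2*m2*T*Lb) + (2*m2*T + 2*m2*Lb + 2*m2 +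
      m3^2*Lc)) + (2*m3*T*Lc + 2*m3*Lc + T^2*La + T^2*Lb + T^2*Lc)"

definition coeff122_up where
  "coeff122_up (n1::complex) n3 m1 m2 m3 T La Lb Lc =
      - n1*n3*m3 - n3*m2*m3 - n3*m3*La + n3*m3*Lb - 2*n3*m3"

definition coeff122_down where
  "coeff122_down (n1::complex) n3 m1 m2 m3 T La Lb Lc =
      n1*m1*m3 + n1*m1*Lb - n1*m1*Lc + 2*n1*m1"

text \<open>The degrees \<open>n1 + n3\<close>, \<open>m1 + m2 + m3\<close> and the weights
  \<open>n1 - m1\<close>, \<open>m2\<close>, \<open>n3 - m3\<close> are preserved, so shifts can
  only be multiples of \<open>(1, -1, 1, 0, -1)\<close>. This direction is the origin of the lines
  used later.\<close>

lemma endo122_app: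
  "app_endo (endo122 P Q) h (n1, n3, m1, m2, m3) =
    coeff122 n1 n3 m1 m2 m3 (tau (n1, n3, m1, m2, m3)) (hw P Q 1) (hw P Q 2) (hw P Q 3) * h (n1, n3, m1, m2, m3) +
    coeff122_up n1 n3 m1 m2 m3 (tau (n1, n3, m1, m2, m3)) (hw P Q 1) (hw P Q 2) (hw P Q 3) * h (n1 + 1, n3 - 1, m1 + 1, m2, m3 - 1) +
    coeff122_down n1 n3 m1 m2 m3 (tau (n1, n3, m1, m2, m3)) (hw P Q 1) (hw P Q 2) (hw P Q 3) * h (n1 - 1, n3 + 1, m1 - 1, m2, m3 + 1)"
  unfolding coeff122_def coeff122_up_def coeff122_down_def
  apply (simp only: endo122_def square2_def expand_words three_neq if_True if_False simp_thms diff_0_right)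
  apply (simp only: expand_app mult_zero_left mult_zero_right diff_0_right add_0 add_0_right)
  apply (simp only: shift_args)
  apply Groebner_Basis.algebra
  done

definition coeff112 where
  "coeff112 (n1::complex) n3 m1 m2 m3 T La Lb Lc =
      (n1*n3*m3 - n1*n3*La - n1*n3*Lc + 2*n1*n3 - n1*m1*m3 - n1*m1*La - n1*m1*Lb) + (n1*La^2 -
      1*n3*m3*Lb - n3*m3*Lc + 3*n3*m3 + n3*Lc^2 - 4*n3*Lc + 4*n3) + (- m1*m2*m3 - m1*m2*La -
      1*m1*m2*Lb - m1*m3*La - m1*m3*Lc + m1*m3 - m1*La^2) + (- 2*m1*La - m1*Lb - m1*Lc + 2*m1 -
      1*m2*m3*Lb - m2*m3*Lc + 2*m2*m3) + (- m2*La - m2*Lb^2 - m2*Lc + 2*m2 - m3*La - m3*Lb -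
      1*m3*Lc^2) + (2*m3*Lc - T*La^2 - 2*T*La - T*Lb^2 - T*Lc^2 + 2*T*Lc)"

definition coeff112_up where
  "coeff112_up (n1::complex) n3 m1 m2 m3 T La Lb Lc =
      n1*n3*m3 + n3*m2*m3 + n3*m3*La - n3*m3*Lb + 2*n3*m3"

definition coeff112_down where
  "coeff112_down (n1::complex) n3 m1 m2 m3 T La Lb Lc =
      - n1*m1*m3 - n1*m1*Lb + n1*m1*Lc - 2*n1*m1"

lemma endo112_app:
  "app_endo (endo112 P Q) h (n1, n3, m1, m2, m3) =
    coeff112 n1 n3 m1 m2 m3 (tau (n1, n3, m1, m2, m3)) (hw P Q 1) (hw P Q 2) (hw P Q 3) * h (n1, n3, m1, m2, m3) +
    coeff112_up n1 n3 m1 m2 m3 (tau (n1, n3, m1, m2, m3)) (hw P Q 1) (hw P Q 2) (hw P Q 3) * h (n1 + 1, n3 - 1, m1 + 1, m2, m3 - 1) +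
    coeff112_down n1 n3 m1 m2 m3 (tau (n1, n3, m1, m2, m3)) (hw P Q 1) (hw P Q 2) (hw P Q 3) * h (n1 - 1, n3 + 1, m1 - 1, m2, m3 + 1)"
  unfolding coeff112_def coeff112_up_def coeff112_down_def
  apply (simp only: endo112_def square_endo_def mult_1_left mult_1_right expand_words three_neq if_True if_False simp_thms diff_0_right)
  apply (simp only: expand_app mult_zero_left mult_zero_right diff_0_right add_0 add_0_right)
  apply (simp only: shift_args)
  apply Groebner_Basis.algebra
  done

definition coeff1122 where
  "coeff1122 (n1::complex) n3 m1 m2 m3 T La Lb Lc =
      ((n1^2*n3*m3 - n1^2*n3*La - n1^2*n3*Lc + 2*n1^2*n3 - n1^2*m1*m3 - n1^2*m1*La - n1^2*m1*Lb)
      + (n1^2*La^2 + n1*n3^2*m3 - n1*n3^2*La - n1*n3^2*Lc + 2*n1*n3^2 - n1*n3*m3^2 - 2*n1*n3*m3*T) +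
      (- 2*n1*n3*m3*Lb + n1*n3*m3 + 2*n1*n3*T*La + 2*n1*n3*T*Lc - 4*n1*n3*T + n1*n3*La^2 + n1*n3*La)) +
      ((n1*n3*Lc^2 - 3*n1*n3*Lc + 2*n1*n3 + n1*m1^2*m3 + n1*m1^2*La + n1*m1^2*Lb + n1*m1*m3^2) +
      (2*n1*m1*m3*T + 2*n1*m1*m3*Lb + n1*m1*m3 + 2*n1*m1*T*La + 2*n1*m1*T*Lb - n1*m1*La^2 + n1*m1*La) +
      (n1*m1*Lb^2 + n1*m1*Lb - 2*n1*T*La^2 + 2*n1*La + n1*Lb^2 + n1*Lc^2 - 2*n1*Lc)) + ((- 1*n3^2*m3*Lb -
      1*n3^2*m3*Lc + 3*n3^2*m3 + n3^2*Lc^2 - 4*n3^2*Lc + 4*n3^2 + n3*m3^2*Lb) + (n3*m3^2*Lc - 3*n3*m3^2 +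
      2*n3*m3*T*Lb + 2*n3*m3*T*Lc - 6*n3*m3*T + n3*m3*Lb^2 - n3*m3*Lb) + (- n3*m3*Lc^2 + 5*n3*m3*Lc -
      6*n3*m3 - 2*n3*T*Lc^2 + 8*n3*T*Lc - 8*n3*T + n3*La^2)) + ((2*n3*La + n3*Lb^2 + 2*n3*Lc - 4*n3 +
      m1^2*m2*m3 + m1^2*m2*La + m1^2*m2*Lb) + (m1^2*m3*La + m1^2*m3*Lc - m1^2*m3 + m1^2*La^2 + 2*m1^2*La
      + m1^2*Lb + m1^2*Lc) + (- 2*m1^2 + m1*m2^2*m3 + m1*m2^2*La + m1*m2^2*Lb + m1*m2*m3^2 + 2*m1*m2*m3*T
      + 2*m1*m2*m3*La)) + ((2*m1*m2*m3*Lb + 2*m1*m2*m3*Lc - m1*m2*m3 + 2*m1*m2*T*La + 2*m1*m2*T*Lb +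
      m1*m2*La^2 + 5*m1*m2*La) + (m1*m2*Lb^2 + 3*m1*m2*Lb + 2*m1*m2*Lc - 4*m1*m2 + m1*m3^2*La + m1*m3^2*Lc
      - m1*m3^2) + (2*m1*m3*T*La + 2*m1*m3*T*Lc - 2*m1*m3*T + m1*m3*La^2 + 5*m1*m3*La + 2*m1*m3*Lb +
      m1*m3*Lc^2)) + ((m1*m3*Lc - 4*m1*m3 + 2*m1*T*La^2 + 4*m1*T*La + 2*m1*T*Lb + 2*m1*T*Lc - 4*m1*T) +
      (2*m1*La^2 + 4*m1*La + 2*m1*Lb + 2*m1*Lc - 4*m1 + m2^2*m3*Lb + m2^2*m3*Lc) + (- 2*m2^2*m3 + m2^2*La
      + m2^2*Lb^2 + m2^2*Lc - 2*m2^2 + m2*m3^2*Lb + m2*m3^2*Lc)) + ((- 2*m2*m3^2 + 2*m2*m3*T*Lb +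
      2*m2*m3*T*Lc - 4*m2*m3*T + 2*m2*m3*La + m2*m3*Lb^2 + 3*m2*m3*Lb) + (m2*m3*Lc^2 + m2*m3*Lc - 6*m2*m3
      + 2*m2*T*La + 2*m2*T*Lb^2 + 2*m2*T*Lc - 4*m2*T) + (2*m2*La + 2*m2*Lb^2 + 2*m2*Lc - 4*m2 + m3^2*La +
      m3^2*Lb + m3^2*Lc^2)) + ((- 2*m3^2*Lc + 2*m3*T*La + 2*m3*T*Lb + 2*m3*T*Lc^2 - 4*m3*T*Lc + 2*m3*La +
      2*m3*Lb) + (2*m3*Lc^2 - 4*m3*Lc + T^2*La^2 + 2*T^2*La + T^2*Lb^2 + T^2*Lc^2 - 2*T^2*Lc))"

definition coeff1122_up where
  "coeff1122_up (n1::complex) n3 m1 m2 m3 T La Lb Lc =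
      (n1^2*n3*m3 + n1*n3^2*m3 + n1*n3*m2*m3 - n1*n3*m3^2 - 2*n1*n3*m3*T - 2*n1*n3*m3*Lb + 2*n1*n3*m3) +
      (n3^2*m2*m3 + n3^2*m3*La - n3^2*m3*Lb + 2*n3^2*m3 - n3*m2*m3^2 - 2*n3*m2*m3*T - n3*m2*m3*La) +
      (- n3*m2*m3*Lb - n3*m3^2*La + n3*m3^2*Lb - 2*n3*m3^2 - 2*n3*m3*T*La + 2*n3*m3*T*Lb - 4*n3*m3*T)
      + (- n3*m3*La^2 - 2*n3*m3*La + n3*m3*Lb^2 - 2*n3*m3*Lb)"

definition coeff1122_down where
  "coeff1122_down (n1::complex) n3 m1 m2 m3 T La Lb Lc =
      (- 1*n1^2*m1*m3 - n1^2*m1*Lb + n1^2*m1*Lc - 2*n1^2*m1 + n1*m1^2*m3 + n1*m1^2*Lb - n1*m1^2*Lc +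
      2*n1*m1^2) + (n1*m1*m2*m3 + n1*m1*m2*Lb - n1*m1*m2*Lc + 2*n1*m1*m2 + n1*m1*m3^2 + 2*n1*m1*m3*T +
      2*n1*m1*m3*Lb + 2*n1*m1*m3) + (2*n1*m1*T*Lb - 2*n1*m1*T*Lc + 4*n1*m1*T + n1*m1*Lb^2 + 2*n1*m1*Lb -
      1*n1*m1*Lc^2 + 2*n1*m1*Lc)"

lemma endo1122_app:
  "app_endo (endo1122 P Q) h (n1, n3, m1, m2, m3) =
    coeff1122 n1 n3 m1 m2 m3 (tau (n1, n3, m1, m2, m3)) (hw P Q 1) (hw P Q 2) (hw P Q 3) * h (n1, n3, m1, m2, m3) +
    coeff1122_up n1 n3 m1 m2 m3 (tau (n1, n3, m1, m2, m3)) (hw P Q 1) (hw P Q 2) (hw P Q 3) * h (n1 + 1, n3 - 1, m1 + 1, m2, m3 - 1) +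
    coeff1122_down n1 n3 m1 m2 m3 (tau (n1, n3, m1, m2, m3)) (hw P Q 1) (hw P Q 2) (hw P Q 3) * h (n1 - 1, n3 + 1, m1 - 1, m2, m3 + 1)"
  unfolding coeff1122_def coeff1122_up_def coeff1122_down_def
  apply (simp only: endo1122_def square2_def square_endo_def mult_1_left mult_1_right expand_words three_neq if_True if_False simp_thms diff_0_right)
  apply (simp only: expand_app mult_zero_left mult_zero_right diff_0_right add_0 add_0_right)
  apply (simp only: shift_args)
  apply Groebner_Basis.algebra
  done

section \<open>Eigenvalues of the Casimir elements\<close>

definition coeff22 where
  "coeff22 (n1::complex) n3 m1 m2 m3 T =
      (n1^2 + 2*n1*n3 - 2*n1*T + 2*n1 + n3^2 - 2*n3*T + 2*n3) + (m1^2 + 2*m1*m2 + 2*m1*m3 + 2*m1*T + 2*m1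
      + m2^2 + 2*m2*m3) + (2*m2*T + 2*m2 + m3^2 + 2*m3*T + 2*m3 + 3*T^2)"

lemma quadratic_second_app:
  "app_endo (\<Sum>i\<in>UNIV. \<Sum>j\<in>UNIV. E2 j i * E2 i j) h (n1, n3, m1, m2, m3) =
    coeff22 n1 n3 m1 m2 m3 (tau (n1, n3, m1, m2, m3)) * h (n1, n3, m1, m2, m3)"
  unfolding coeff22_def
  apply (simp only:  expand_words three_neq if_True if_False simp_thms diff_0_right)
  apply (simp only: expand_app mult_zero_left mult_zero_right diff_0_right add_0 add_0_right)
  apply (simp only: shift_args)
  apply Groebner_Basis.algebra
  done

definition coeff222 where
  "coeff222 (n1::complex) n3 m1 m2 m3 T =
      (n1^3 + 3*n1^2*n3 - 3*n1^2*T + 2*n1^2 + 3*n1*n3^2 - 6*n1*n3*T + 4*n1*n3 - n1*m1) + (- n1*m2 -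
      1*n1*m3 + 3*n1*T^2 - 6*n1*T - 2*n1 + n3^3 - 3*n3^2*T + 2*n3^2) + (- n3*m1 - n3*m2 - n3*m3 +
      3*n3*T^2 - 6*n3*T - 2*n3 - m1^3 - 3*m1^2*m2) + (- 3*m1^2*m3 - 3*m1^2*T - 4*m1^2 - 3*m1*m2^2 -
      6*m1*m2*m3 - 6*m1*m2*T - 8*m1*m2 - 3*m1*m3^2) + (- 6*m1*m3*T - 8*m1*m3 - 3*m1*T^2 - 6*m1*T - 4*m1 -
      1*m2^3 - 3*m2^2*m3 - 3*m2^2*T) + (- 4*m2^2 - 3*m2*m3^2 - 6*m2*m3*T - 8*m2*m3 - 3*m2*T^2 - 6*m2*T -
      4*m2 - m3^3) + (- 3*m3^2*T - 4*m3^2 - 3*m3*T^2 - 6*m3*T - 4*m3 - 3*T^3)"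

lemma cubic_second_app:
  "app_endo (\<Sum>i\<in>UNIV. \<Sum>j\<in>UNIV. \<Sum>k\<in>UNIV. E2 j i * E2 k j * E2 i k) h (n1, n3, m1, m2, m3) =
    coeff222 n1 n3 m1 m2 m3 (tau (n1, n3, m1, m2, m3)) * h (n1, n3, m1, m2, m3)"
  unfolding coeff222_def
  apply (simp only:  expand_words three_neq if_True if_False simp_thms diff_0_right)
  apply (simp only: expand_app mult_zero_left mult_zero_right diff_0_right add_0 add_0_right)
  apply (simp only: shift_args)
  apply Groebner_Basis.algebra
  done

definition coeff222_bar where
  "coeff222_bar (n1::complex) n3 m1 m2 m3 T =
      (n1^3 + 3*n1^2*n3 - 3*n1^2*T + 4*n1^2 + 3*n1*n3^2 - 6*n1*n3*T + 8*n1*n3 + n1*m1) + (n1*m2 + n1*m3 +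
      3*n1*T^2 - 6*n1*T + 4*n1 + n3^3 - 3*n3^2*T + 4*n3^2) + (n3*m1 + n3*m2 + n3*m3 + 3*n3*T^2 - 6*n3*T +
      4*n3 - m1^3 - 3*m1^2*m2) + (- 3*m1^2*m3 - 3*m1^2*T - 2*m1^2 - 3*m1*m2^2 - 6*m1*m2*m3 - 6*m1*m2*T -
      4*m1*m2 - 3*m1*m3^2) + (- 6*m1*m3*T - 4*m1*m3 - 3*m1*T^2 - 6*m1*T + 2*m1 - m2^3 - 3*m2^2*m3 -
      3*m2^2*T) + (- 2*m2^2 - 3*m2*m3^2 - 6*m2*m3*T - 4*m2*m3 - 3*m2*T^2 - 6*m2*T + 2*m2 - m3^3) + (-
      3*m3^2*T - 2*m3^2 - 3*m3*T^2 - 6*m3*T + 2*m3 - 3*T^3)"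

lemma cubic_bar_second_app:
  "app_endo (\<Sum>i\<in>UNIV. \<Sum>j\<in>UNIV. \<Sum>k\<in>UNIV. E2 i j * E2 j k * E2 k i) h (n1, n3, m1, m2, m3) =
    coeff222_bar n1 n3 m1 m2 m3 (tau (n1, n3, m1, m2, m3)) * h (n1, n3, m1, m2, m3)"
  unfolding coeff222_bar_def
  apply (simp only:  expand_words three_neq if_True if_False simp_thms diff_0_right)
  apply (simp only: expand_app mult_zero_left mult_zero_right diff_0_right add_0 add_0_right)
  apply (simp only: shift_args)
  apply Groebner_Basis.algebra
  done

text \<open>Reversing the two factors costs one commutator for each \<open>q\<close>: three of them
  contribute \<open>copy_gen a r p\<close>, and the diagonal terms add up to the trace, which is
  zero.\<close>

lemma square_bar:
  "(\<Sum>q\<in>UNIV. copy_gen a r q * copy_gen a q p) = (\<Sum>q\<in>UNIV. copy_gen a q p * copy_gen a r q) + 3 * copy_gen a r p"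
proof -
  have "copy_gen a r q * copy_gen a q p - copy_gen a q p * copy_gen a r q =
      copy_gen a r p - (if p = r then copy_gen a q q else 0)" for q
    using copy_gen_commute[of a r q a q p] by simp
  then have "(\<Sum>q\<in>UNIV. copy_gen a r q * copy_gen a q p - copy_gen a q p * copy_gen a r q) = 3 * copy_gen a r p"
    using copy_gen_trace[of a] by (simp add: sum_subtractf) (simp add: sum_3 algebra_simps)
  then show ?thesis by (simp add: sum_subtractf algebra_simps)
qed

lemma cubic_bar_eq: "cubic_bar a a b = cubic a a b + 3 * quadratic a b"
proof -
  have "cubic_bar a a b = (\<Sum>i\<in>UNIV. \<Sum>k\<in>UNIV. \<Sum>j\<in>UNIV. copy_gen a i j * copy_gen a j k * copy_gen b k i)"
    unfolding cubic_bar_def by (rule sum.cong[OF refl], rule sum.swap)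
  also have "\<dots> = (\<Sum>i\<in>UNIV. \<Sum>k\<in>UNIV. (\<Sum>j\<in>UNIV. copy_gen a j k * copy_gen a i j) * copy_gen b k i
      + 3 * (copy_gen a i k * copy_gen b k i))"
    by (simp only: sum_distrib_right[symmetric] square_bar) (simp add: distrib_right mult.assoc)
  also have "\<dots> = (\<Sum>i\<in>UNIV. \<Sum>k\<in>UNIV. \<Sum>j\<in>UNIV. copy_gen a j k * copy_gen a i j * copy_gen b k i)
      + 3 * (\<Sum>i\<in>UNIV. \<Sum>k\<in>UNIV. copy_gen a i k * copy_gen b k i)"
    by (simp only: sum.distrib sum_distrib_left sum_distrib_right)
  also have "(\<Sum>i\<in>UNIV. \<Sum>k\<in>UNIV. \<Sum>j\<in>UNIV. copy_gen a j k * copy_gen a i j * copy_gen b k i) =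
      (\<Sum>k\<in>UNIV. \<Sum>i\<in>UNIV. \<Sum>j\<in>UNIV. copy_gen a j k * copy_gen a i j * copy_gen b k i)"
    by (rule sum.swap)
  also have "\<dots> = cubic a a b"
    unfolding cubic_def by (rule sum.cong[OF refl], rule sum.swap)
  also have "(\<Sum>i\<in>UNIV. \<Sum>k\<in>UNIV. copy_gen a i k * copy_gen b k i) = quadratic a b"
    unfolding quadratic_def by (rule sum.swap)
  finally show ?thesis .
qed

lemma quadratic_commute: "quadratic 2 1 = quadratic 1 2"
  by (simp add: quadratic_def sum_3 copies_commute ac_simps)

lemma cubic_mixed:
  "cubic 1 2 1 = cubic_bar 1 1 2" "cubic 2 1 1 = cubic 1 1 2" "cubic_bar 1 2 1 = cubic 1 1 2" "cubic_bar 2 1 1 = cubic_bar 1 1 2"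
  "cubic 2 1 2 = cubic_bar 2 2 1" "cubic 1 2 2 = cubic 2 2 1" "cubic_bar 2 1 2 = cubic 2 2 1" "cubic_bar 1 2 2 = cubic_bar 2 2 1"
  by (simp_all add: cubic_def cubic_bar_def sum_3 mult.assoc copies_commute copies_commute_left ac_simps)

lemma kU_3: "kU 3 = kU 1 + kU 2 + 2 * ptrace [1, 2]"
  by (simp add: kU_lU_simps coproduct_casimir2 polarised_trace_2 quadratic_commute mult_2 algebra_simps)

lemma lU_3: "lU 3 = - (lU 1 + lU 2 + 3 * (ptrace [1, 1, 2] + ptrace [1, 2, 2]) + 9 * ptrace [1, 2])"
proof -
  have half: "(1/2) *\<^sub>C x + (1/2) *\<^sub>C x = x" for x :: U2
    by (simp add: scaleC_one flip: scaleC_add_left)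
  have num: "3 * x = x + x + x" "9 * x = 3 * (3 * x)" for x :: U2
  proof -
    have "(3 :: U2) = 1 + 1 + 1" "(9 :: U2) = 3 * 3" by simp_all
    then show "3 * x = x + x + x" "9 * x = 3 * (3 * x)" by (simp_all only: distrib_right mult_1_left mult.assoc)
  qed
  have "coproduct casimir3 + coproduct casimir3_bar = (cubic 1 1 1 + cubic_bar 1 1 1) + (cubic 2 2 2 + cubic_bar 2 2 2)
      + ((3 * (cubic 1 1 2 + cubic 1 2 2) + 9 * quadratic 1 2) + (3 * (cubic 1 1 2 + cubic 1 2 2) + 9 * quadratic 1 2))"
    by (simp add: coproduct_casimir3 coproduct_casimir3_bar cubic_mixed cubic_bar_eq[of 1 2] cubic_bar_eq[of 2 1]
        quadratic_commute num ac_simps distrib_left)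
  then have "(1/2) *\<^sub>C (coproduct casimir3 + coproduct casimir3_bar) = lU 1 + lU 2
      + (3 * (cubic 1 1 2 + cubic 1 2 2) + 9 * quadratic 1 2)"
    by (simp only: scaleC_add_right[of _ "_ + _" "_ + _"] half kU_lU_simps)
  then show ?thesis by (simp add: kU_lU_simps(6) polarised_trace_2 polarised_trace_3 algebra_simps)
qed

text \<open>With \<open>lval\<close>, the eigenvalues of the quadratic and the symmetrised cubic
  Casimir element for the weight \<open>p\<close>, \<open>0\<close>, \<open>- q\<close> up to trace,
  that is, with Dynkin labels \<open>p\<close> and \<open>q\<close>. \<open>kval\<close> is
  symmetric and \<open>lval\<close> antisymmetric in the labels.\<close>

definition kval :: "complex \<Rightarrow> complex \<Rightarrow> complex" where
  "kval p q = 2/3 * (p\<^sup>2 + p * q + q\<^sup>2) + 2 * (p + q)"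

definition lval :: "complex \<Rightarrow> complex \<Rightarrow> complex" where
  "lval p q = (p - q) * (2 * p + q + 3) * (p + 2 * q + 3) / 9"

text \<open>One third of the difference of the labels becomes a variable of its own, which removes
  the denominators from the polynomial identities.\<close>

lemma kval_eq: "kval (q + 3 * w) q = 2 * q\<^sup>2 + 6 * q * w + 6 * w\<^sup>2 + 2 * (2 * q + 3 * w)"
  by (simp add: kval_def power2_eq_square field_simps)

lemma lval_eq: "lval (q + 3 * w) q = 3 * w * (q + 2 * w + 1) * (q + w + 1)"
  by (simp add: lval_def field_simps)

lemma hw_eq: "hw (Q + 3 * w) Q 1 = Q + 2 * w" "hw (Q + 3 * w) Q 2 = - w" "hw (Q + 3 * w) Q 3 = - Q - w"
  by (simp_all add: hw_def)

lemma rho_mult_numeral: "rho P Q (numeral n * z) h x = numeral n * rho P Q z h x"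
proof -
  have "(numeral n :: U2) = numeral n *\<^sub>C 1" for n
    by (induction n) (simp_all only: numeral.simps scaleC_one scaleC_add_left)
  then have "numeral n * z = numeral n *\<^sub>C z" by (simp only: mult_scaleC_left mult_1_left)
  then show ?thesis by (simp only: rho_scaleC)
qed

lemma rho_uminus: "rho P Q (- z) h x = - rho P Q z h x"
  using rho_scaleC[of P Q "-1" z h x] by (simp add: scaleC_minus_one)

lemma rho_kU_1: "rho P Q (kU 1) h x = kval P Q * h x"
proof -
  define w where "w = (P - Q) / 3"
  have P: "P = Q + 3 * w" by (simp add: w_def)
  have "rho P Q (kU 1) h x = (\<Sum>i\<in>UNIV. app_endo (square_endo P Q i i) h x)"
    by (simp only: kU_lU_simps quadratic_def rho_sum rho_first_square)
  then show ?thesis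
    by (simp add: P hw_eq kval_eq sum_3 square_endo_def app_endo_simps) (simp add: power2_eq_square algebra_simps)
qed

lemma rho_lU_1: "rho P Q (lU 1) h x = lval P Q * h x"
proof -
  define w where "w = (P - Q) / 3"
  have P: "P = Q + 3 * w" by (simp add: w_def)
  have w: "(P - Q) / 3 = w" by (simp add: w_def)
  have "rho P Q (cubic 1 1 1) h x + rho P Q (cubic_bar 1 1 1) h x = 2 * (3 * w * (Q + 2 * w + 1) * (Q + w + 1)) * h x"
    unfolding cubic_def cubic_bar_def rho_sum
    apply (simp add: sum_3 rho_def act_mult act_gen E12_def app_endo_simps first_app first_gl_simps w
        singular_vector_base)
    apply (simp only: P)
    apply Groebner_Basis.algebra
    done
  then show ?thesis
    by (simp add: kU_lU_simps rho_add rho_scaleC P lval_eq)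
qed

lemma rho_second_words:
  "rho P Q (copy_gen 2 p q * copy_gen 2 r s) h x = app_endo (E2 p q * E2 r s) h x"
  "rho P Q (copy_gen 2 p q * copy_gen 2 r s * copy_gen 2 i j) h x = app_endo (E2 p q * E2 r s * E2 i j) h x"
proof -
  have 1: "rho P Q (copy_gen 2 p q) h x = app_endo (E2 p q) h x" for p q h x
    using rho_second[of P Q p q 1 h x] by (simp add: rho_one[abs_def])
  show "rho P Q (copy_gen 2 p q * copy_gen 2 r s) h x = app_endo (E2 p q * E2 r s) h x"
    "rho P Q (copy_gen 2 p q * copy_gen 2 r s * copy_gen 2 i j) h x = app_endo (E2 p q * E2 r s * E2 i j) h x"
    by (simp_all only: mult.assoc rho_second[abs_def] 1[abs_def] times_endo.rep_eq)
qed

lemma coeff22_eq: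
  fixes n1 n3 m1 m2 m3 T :: complex
  assumes "m2 = n1 + n3 - m1 - m3 - 3 * T"
  shows "coeff22 n1 n3 m1 m2 m3 T = 2 * (n1 + n3)\<^sup>2 - 6 * (n1 + n3) * T + 6 * T\<^sup>2 + 2 * (2 * (n1 + n3) - 3 * T)"
  unfolding coeff22_def assms by Groebner_Basis.algebra

lemma coeff222_eq:
  fixes n1 n3 m1 m2 m3 T :: complex
  assumes "m2 = n1 + n3 - m1 - m3 - 3 * T"
  shows "coeff222 n1 n3 m1 m2 m3 T + coeff222_bar n1 n3 m1 m2 m3 T = 2 * (3 * T * (n1 + n3 - T + 1) * (n1 + n3 - 2 * T + 1))"
  unfolding coeff222_def coeff222_bar_def assms by Groebner_Basis.algebra

lemma rho_kU_2: "rho P Q (kU 2) h (n1, n3, m1, m2, m3) = kval (n1 + n3) (m1 + m2 + m3) * h (n1, n3, m1, m2, m3)"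
proof -
  define T where "T = tau (n1, n3, m1, m2, m3)"
  have m2: "m2 = n1 + n3 - m1 - m3 - 3 * T" by (simp add: T_def tau_def)
  have "rho P Q (kU 2) h (n1, n3, m1, m2, m3) = coeff22 n1 n3 m1 m2 m3 T * h (n1, n3, m1, m2, m3)"
    unfolding T_def quadratic_second_app[symmetric]
    by (simp only: kU_lU_simps quadratic_def rho_sum rho_second_words app_endo_sum)
  moreover have "n1 + n3 = (m1 + m2 + m3) + 3 * T" by (simp add: m2)
  then have "kval (n1 + n3) (m1 + m2 + m3) = kval ((m1 + m2 + m3) + 3 * T) (m1 + m2 + m3)" by simp
  moreover have "coeff22 n1 n3 m1 m2 m3 T = kval ((m1 + m2 + m3) + 3 * T) (m1 + m2 + m3)"
    unfolding kval_eq coeff22_eq[OF m2] unfolding m2 by Groebner_Basis.algebra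
  ultimately show ?thesis by simp
qed

lemma rho_lU_2: "rho P Q (lU 2) h (n1, n3, m1, m2, m3) = lval (n1 + n3) (m1 + m2 + m3) * h (n1, n3, m1, m2, m3)"
proof -
  define T where "T = tau (n1, n3, m1, m2, m3)"
  have m2: "m2 = n1 + n3 - m1 - m3 - 3 * T" by (simp add: T_def tau_def)
  have "rho P Q (cubic 2 2 2) h (n1, n3, m1, m2, m3) = coeff222 n1 n3 m1 m2 m3 T * h (n1, n3, m1, m2, m3)"
    "rho P Q (cubic_bar 2 2 2) h (n1, n3, m1, m2, m3) = coeff222_bar n1 n3 m1 m2 m3 T * h (n1, n3, m1, m2, m3)"
    unfolding T_def cubic_second_app[symmetric] cubic_bar_second_app[symmetric]
    by (simp_all only: cubic_def cubic_bar_def rho_sum rho_second_words app_endo_sum)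
  then have "rho P Q (lU 2) h (n1, n3, m1, m2, m3) =
      (1/2) * (coeff222 n1 n3 m1 m2 m3 T + coeff222_bar n1 n3 m1 m2 m3 T) * h (n1, n3, m1, m2, m3)"
    by (simp add: kU_lU_simps rho_add rho_scaleC algebra_simps)
  moreover have "n1 + n3 = (m1 + m2 + m3) + 3 * T" by (simp add: m2)
  then have "lval (n1 + n3) (m1 + m2 + m3) = lval ((m1 + m2 + m3) + 3 * T) (m1 + m2 + m3)" by simp
  moreover have "3 * T * (n1 + n3 - T + 1) * (n1 + n3 - 2 * T + 1) = lval ((m1 + m2 + m3) + 3 * T) (m1 + m2 + m3)"
    unfolding lval_eq m2 by Groebner_Basis.algebra
  ultimately show ?thesis unfolding coeff222_eq[OF m2] by simp
qed

section \<open>Difference operators along a line\<close>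

lemma coeff12_eq:
  fixes c u A M T Q w :: complex
  assumes "r = u + A - M - 3 * T" "P = Q + 3 * w" "p = P + u + r" "q = Q + M - A - r"
  shows "2 * coeff12 (c + u) (A - c) c r (M - c) T (Q + 2 * w) (- w) (- Q - w)
    + (2 * Q\<^sup>2 + 6 * Q * w + 6 * w\<^sup>2 + 2 * (2 * Q + 3 * w)) + (2 * (u + A)\<^sup>2 - 6 * (u + A) * T + 6 * T\<^sup>2 + 2 * (2 * (u + A) - 3 * T))
    = 2 * q\<^sup>2 + 6 * q * (u + A - M - 2 * T + w) + 6 * (u + A - M - 2 * T + w)\<^sup>2 + 2 * (2 * q + 3 * (u + A - M - 2 * T + w))"
  unfolding coeff12_def assms by Groebner_Basis.algebra

lemma coeff112_122_eq:
  fixes c u A M T Q w :: complex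
  assumes "r = u + A - M - 3 * T" "P = Q + 3 * w" "q = Q + M - A - r" "v = u + A - M - 2 * T + w"
  shows "3 * w * (Q + 2 * w + 1) * (Q + w + 1) + 3 * T * (u + A - T + 1) * (u + A - 2 * T + 1)
    + 3 * (coeff112 (c + u) (A - c) c r (M - c) T (Q + 2 * w) (- w) (- Q - w)
      + coeff122 (c + u) (A - c) c r (M - c) T (Q + 2 * w) (- w) (- Q - w))
    + 9 * coeff12 (c + u) (A - c) c r (M - c) T (Q + 2 * w) (- w) (- Q - w)
    = 3 * v * (q + 2 * v + 1) * (q + v + 1)"
  unfolding coeff12_def coeff112_def coeff122_def assms by Groebner_Basis.algebra

text \<open>After subtraction of the two off-diagonal coefficients the diagonal coefficient of
  \<open>X\<close> is linear in \<open>c\<close>, and \<open>beta_num / 54\<close> is its constant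
  term. The same subtraction for \<open>Y\<close> leaves a quadratic polynomial with linear
  coefficient \<open>eta1_num / 3\<close> and constant term \<open>eta0_num / 12\<close>.\<close>

definition beta_num where
  "beta_num (u::complex) A M r P Q =
      ((- 4*u^3 - 3*u^2*A - 6*u^2*M - 6*u^2*r - 6*u^2*P) + (- 3*u^2*Q - 18*u^2 - 3*u*A^2 - 12*u*A*M +
      6*u*A*r)) + ((- 12*u*A*P + 12*u*A*Q + 9*u*A + 6*u*M^2 - 6*u*M*r) + (- 6*u*M*P + 6*u*M*Q + 6*u*r^2 -
      6*u*r*P - 12*u*r*Q)) + ((- 18*u*r + 6*u*P^2 + 6*u*P*Q - 3*u*Q^2 - 9*u*Q) + (- 18*u - 4*A^3 + 3*A^2*M
      - 6*A^2*r + 3*A^2*P)) + ((6*A^2*Q - 3*A*M^2 - 42*A*M*r - 24*A*M*P + 6*A*M*Q) + (- 45*A*M + 6*A*r^2 +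
      12*A*r*P + 6*A*r*Q + 18*A*r)) + ((- 3*A*P^2 + 6*A*P*Q + 9*A*P + 6*A*Q^2 + 36*A*Q) + (36*A + 4*M^3 +
      3*M^2*r + 3*M^2*P + 6*M^2*Q)) + ((18*M^2 + 3*M*r^2 + 24*M*r*P + 12*M*r*Q + 27*M*r) + (3*M*P^2 -
      6*M*P*Q + 9*M*P - 6*M*Q^2 + 18*M)) + ((4*r^3 + 3*r^2*P - 3*r^2*Q + 9*r^2 + 3*r*P^2) + (12*r*P*Q +
      27*r*P + 3*r*Q^2 + 9*r*Q + 18*r)) + (4*P^3 + 6*P^2*Q + 18*P^2 - 6*P*Q^2 + 18*P - 4*Q^3 - 18*Q^2 -
      18*Q)"

definition eta1_num where
  "eta1_num (u::complex) A M r P Q =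
      (1*u*A*r + 1*u*A + 2*u*r*P - u*r*Q - 2*u*r + 2*u*P - u*Q - 2*u) + (1*A^2*r + 1*A^2 - A*M*r -
      1*A*M + 2*A*r^2 + 1*A*r*P + 6*A*r + 1*A*P) + (4*A + 3*M*r^2 + 1*M*r*P - 2*M*r*Q + 5*M*r + 1*M*P -
      2*M*Q + 2*M) + (1*r^2*P + 1*r^2*Q + 2*r^2 + 1*r*P^2 + 3*r*P - r*Q^2 - r*Q + 2*r) + (1*P^2 + 2*P
      - Q^2 - 2*Q)"

definition eta0_num where
  "eta0_num (u::complex) A M r P Q =
      ((- 1*u^2*A^2 + 2*u^2*A*Q + 2*u^2*A - u^2*Q^2 - 2*u^2*Q) + (- 2*u*A^2*M - 2*u*A^2*P - 2*u*A^2 -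
      6*u*A*M*r + 2*u*A*M*P)) + ((2*u*A*M*Q - 4*u*A*M - 2*u*A*r*P + 2*u*A*r*Q + 2*u*A*r) + (2*u*A*P*Q +
      4*u*A*Q + 4*u*A - 4*u*M*r*P - 2*u*M*r*Q)) + ((- 4*u*M*r + 2*u*M*P*Q - 2*u*r*P*Q - 4*u*r*P -
      2*u*r*Q^2) + (- 6*u*r*Q - 4*u*r - 2*u*Q^2 - 4*u*Q - A^2*M^2)) + ((- 4*A^2*M*r - 2*A^2*M*P -
      6*A^2*M - A^2*P^2 - 2*A^2*P) + (2*A*M^2*r + 2*A*M^2*P + 2*A*M^2 - 8*A*M*r^2 - 4*A*M*r*P)) +
      ((6*A*M*r*Q - 14*A*M*r + 2*A*M*P^2 + 4*A*M*P*Q + 4*A*M*P) + (8*A*M*Q - 4*A*M - 2*A*r*P^2 - 2*A*r*P*Q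
      - 6*A*r*P)) + ((- 2*A*P^2 - 4*A*P - M^2*r^2 - 2*M^2*r*P - 2*M^2*r) + (- 1*M^2*P^2 - 2*M^2*P -
      2*M*r^2*P - 2*M*r^2*Q - 4*M*r^2)) + ((- 2*M*r*P^2 - 2*M*r*P*Q - 10*M*r*P - 4*M*r*Q - 8*M*r) + (-
      2*M*P^2 - 4*M*P - r^2*P^2 - 2*r^2*P*Q - 4*r^2*P)) + ((- 1*r^2*Q^2 - 4*r^2*Q - 3*r^2 - 2*r*P^2 -
      4*r*P*Q) + (- 8*r*P - 2*r*Q^2 - 8*r*Q - 6*r))"

lemma beta_identity:
  fixes c u A M T Q w :: complex
  assumes "r = u + A - M - 3 * T" "P = Q + 3 * w"
  shows "54 * (coeff112 (c + u) (A - c) c r (M - c) T (Q + 2 * w) (- w) (- Q - w)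
      - coeff122 (c + u) (A - c) c r (M - c) T (Q + 2 * w) (- w) (- Q - w))
    + 36 * (3 * w * (Q + 2 * w + 1) * (Q + w + 1) - 3 * T * (u + A - T + 1) * (u + A - 2 * T + 1))
    = 108 * (c * (c + u) * (c - Q - M - 2) + (A - c) * (M - c) * (c + P + u + r + 2) + (r + 1) * (A - P - Q - 2) * c)
      + 2 * beta_num u A M r P Q"
  unfolding coeff112_def coeff122_def beta_num_def assms by Groebner_Basis.algebra

lemma eta_identity:
  fixes c u A M T Q w :: complex
  assumes "r = u + A - M - 3 * T" "P = Q + 3 * w"
    and "t = coeff12 (c + u) (A - c) c r (M - c) T (Q + 2 * w) (- w) (- Q - w)"
  shows "12 * coeff1122 (c + u) (A - c) c r (M - c) T (Q + 2 * w) (- w) (- Q - w)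
    + 18 * (coeff112 (c + u) (A - c) c r (M - c) T (Q + 2 * w) (- w) (- Q - w)
      + coeff122 (c + u) (A - c) c r (M - c) T (Q + 2 * w) (- w) (- Q - w))
    - t * t - 5 * ((2 * Q\<^sup>2 + 6 * Q * w + 6 * w\<^sup>2 + 2 * (2 * Q + 3 * w))
        * (2 * (u + A)\<^sup>2 - 6 * (u + A) * T + 6 * T\<^sup>2 + 2 * (2 * (u + A) - 3 * T))) + 30 * t
    = 12 * (c * (c + u) * (c - Q - M - 2) * (c - A + T + Q + 2 * w)
        + (A - c) * (M - c) * (c + P + u + r + 2) * (c + u + A - M - 2 * T - Q - w) - (r + 1) * (r + 2) * c\<^sup>2)
      + 4 * eta1_num u A M r P Q * c + 1 * eta0_num u A M r P Q"
  unfolding coeff12_def coeff112_def coeff122_def coeff1122_def eta1_num_def eta0_num_def assms by Groebner_Basis.algebra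

text \<open>The quantities \<open>u = n1 - m1\<close>, \<open>A = n3 + m1\<close>,
  \<open>M = m1 + m3\<close>, \<open>r = m2\<close> are constant along the line. The redundant
  parameters \<open>s\<close> and \<open>t\<close>, the thirds of \<open>P - Q\<close> and of the
  difference of the two degrees, avoid fractions.\<close>

locale line =
  fixes u A M r P Q s t :: complex
  assumes P_eq: "P = Q + 3 * s" and r_eq: "r = u + A - M - 3 * t"
begin

definition pt :: "complex \<Rightarrow> point" where
  "pt c = (c + u, A - c, c, r, M - c)"

definition al :: "complex \<Rightarrow> complex" where
  "al c = c * (c + u) * (c - Q - M - 2)"

definition ga :: "complex \<Rightarrow> complex" where
  "ga c = (A - c) * (M - c) * (c + P + u + r + 2)"

definition L1 :: "complex \<Rightarrow> complex" where
  "L1 c = c + (u - 2 * A - M - r + 2 * P + Q) / 3"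

definition L2 :: "complex \<Rightarrow> complex" where
  "L2 c = c + (u + A - M + 2 * r - P - 2 * Q) / 3"

definition be :: "complex \<Rightarrow> complex" where
  "be c = al c + ga c + (r + 1) * (A - P - Q - 2) * c + beta_num u A M r P Q / 54"

definition et :: "complex \<Rightarrow> complex" where
  "et c = al c * L1 c + ga c * L2 c - (r + 1) * (r + 2) * c\<^sup>2 + eta1_num u A M r P Q / 3 * c
    + eta0_num u A M r P Q / 12"

definition opX :: "(complex \<Rightarrow> complex) \<Rightarrow> complex \<Rightarrow> complex" where
  "opX g c = al c * g (c - 1) + be c * g c + ga c * g (c + 1)"

definition opY :: "(complex \<Rightarrow> complex) \<Rightarrow> complex \<Rightarrow> complex" where
  "opY g c = al c * L1 c * g (c - 1) + et c * g c + ga c * L2 c * g (c + 1)"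

text \<open>For the index 3 the labels belong to the weight \<open>P + u\<close>,
  \<open>- r\<close>, \<open>A - M - Q\<close> of the singular vector under the diagonal
  copy.\<close>

definition kv :: "3 \<Rightarrow> complex" where
  "kv i = (if i = 1 then kval P Q else if i = 2 then kval (u + A) (M + r) else kval (P + u + r) (Q + M - A - r))"

definition lv :: "3 \<Rightarrow> complex" where
  "lv i = (if i = 1 then lval P Q else if i = 2 then lval (u + A) (M + r) else - lval (P + u + r) (Q + M - A - r))"

definition acts :: "U2 \<Rightarrow> ((complex \<Rightarrow> complex) \<Rightarrow> complex \<Rightarrow> complex) \<Rightarrow> bool" where
  "acts z T \<longleftrightarrow> (\<exists>n. trace_span n z) \<and> (\<forall>h c. rho P Q z h (pt c) = T (\<lambda>c. h (pt c)) c)"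

lemma acts_one: "acts 1 (\<lambda>g. g)"
  unfolding acts_def using trace_span.one by (auto simp: rho_one)

lemma acts_scaleC: "acts z T \<Longrightarrow> acts (a *\<^sub>C z) (\<lambda>g c. a * T g c)"
  unfolding acts_def by (auto simp: rho_scaleC intro: trace_span.scale)

lemma acts_add:
  assumes "acts z S" "acts w T"
  shows "acts (z + w) (\<lambda>g c. S g c + T g c)"
proof -
  obtain m n where "trace_span m z" "trace_span n w" using assms unfolding acts_def by blast
  then have "trace_span (max m n) z" "trace_span (max m n) w"
    by (auto intro: trace_span.mono)
  then have "trace_span (max m n) (z + w)"
    by (rule trace_span.add)
  with assms show ?thesis unfolding acts_def by (auto simp: rho_add)
qed

lemma acts_mult:
  assumes "acts z S" "acts w T"
  shows "acts (z * w) (\<lambda>g. S (T g))"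
proof -
  obtain m n where "trace_span m z" "trace_span n w" using assms unfolding acts_def by blast
  then show ?thesis
    using assms trace_span_mult[of m z n w] unfolding acts_def by (auto simp: rho_mult)
qed

lemma acts_uminus: "acts z T \<Longrightarrow> acts (- z) (\<lambda>g c. - T g c)"
  using acts_scaleC[of z T "-1"] by (simp add: scaleC_minus_one)

lemma acts_diff:
  assumes "acts z S" "acts w T"
  shows "acts (z - w) (\<lambda>g c. S g c - T g c)"
  using acts_add[OF assms(1) acts_uminus[OF assms(2)]] by simp

text \<open>Every function of \<open>c\<close> is the restriction to the line of a function of
  points, through the coordinate \<open>m1 = c\<close>.\<close>

lemma acts_unique: "acts z S \<Longrightarrow> acts z T \<Longrightarrow> S g c = T g c"
proof -
  assume "acts z S" "acts z T"
  then have eq: "S (\<lambda>c. h (pt c)) c = T (\<lambda>c. h (pt c)) c" for h c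
    unfolding acts_def by metis
  have "(\<lambda>c. (\<lambda>(n1, n3, m1, m2, m3). g m1) (pt c)) = g" by (simp add: pt_def)
  then show ?thesis using eq[of "\<lambda>(n1, n3, m1, m2, m3). g m1" c] by simp
qed

lemma pt_shift:
  "(c + u + 1, A - c - 1, c + 1, r, M - c - 1) = pt (c + 1)"
  "(c + u - 1, A - c + 1, c - 1, r, M - c + 1) = pt (c - 1)"
  by (simp_all add: pt_def algebra_simps)

lemma hw_s: "hw P Q 1 = Q + 2 * s" "hw P Q 2 = - s" "hw P Q 3 = - Q - s"
  unfolding P_eq by (rule hw_eq)+

lemma tau_pt: "tau (c + u, A - c, c, r, M - c) = t"
  by (simp add: tau_def r_eq)

lemma kv_simps:
  "kv 1 = 2 * Q\<^sup>2 + 6 * Q * s + 6 * s\<^sup>2 + 2 * (2 * Q + 3 * s)"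
  "kv 2 = 2 * (u + A)\<^sup>2 - 6 * (u + A) * t + 6 * t\<^sup>2 + 2 * (2 * (u + A) - 3 * t)"
  "kv 3 = 2 * (Q + M - A - r)\<^sup>2 + 6 * (Q + M - A - r) * (u + A - M - 2 * t + s) + 6 * (u + A - M - 2 * t + s)\<^sup>2
    + 2 * (2 * (Q + M - A - r) + 3 * (u + A - M - 2 * t + s))"
proof -
  have "P + u + r = (Q + M - A - r) + 3 * (u + A - M - 2 * t + s)"
    by (simp add: P_eq r_eq)
  then show "kv 3 = 2 * (Q + M - A - r)\<^sup>2 + 6 * (Q + M - A - r) * (u + A - M - 2 * t + s) + 6 * (u + A - M - 2 * t + s)\<^sup>2
    + 2 * (2 * (Q + M - A - r) + 3 * (u + A - M - 2 * t + s))"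
    by (simp only: kv_def three_neq if_False kval_eq)
  show "kv 1 = 2 * Q\<^sup>2 + 6 * Q * s + 6 * s\<^sup>2 + 2 * (2 * Q + 3 * s)"
    unfolding kv_def by (simp only: simp_thms if_True P_eq kval_eq)
  have "u + A = (M + r) + 3 * t" by (simp add: r_eq)
  then have "kv 2 = kval ((M + r) + 3 * t) (M + r)" by (simp add: kv_def)
  also have "\<dots> = 2 * (u + A)\<^sup>2 - 6 * (u + A) * t + 6 * t\<^sup>2 + 2 * (2 * (u + A) - 3 * t)"
    unfolding kval_eq r_eq by Groebner_Basis.algebra
  finally show "kv 2 = 2 * (u + A)\<^sup>2 - 6 * (u + A) * t + 6 * t\<^sup>2 + 2 * (2 * (u + A) - 3 * t)" .
qed

lemma lv_simps:
  "lv 1 = 3 * s * (Q + 2 * s + 1) * (Q + s + 1)"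
  "lv 2 = 3 * t * (u + A - t + 1) * (u + A - 2 * t + 1)"
  "v = u + A - M - 2 * t + s \<Longrightarrow> lv 3 = - (3 * v * ((Q + M - A - r) + 2 * v + 1) * ((Q + M - A - r) + v + 1))"
proof -
  have "P + u + r = (Q + M - A - r) + 3 * (u + A - M - 2 * t + s)"
    by (simp add: P_eq r_eq)
  then show "lv 3 = - (3 * v * ((Q + M - A - r) + 2 * v + 1) * ((Q + M - A - r) + v + 1))"
    if "v = u + A - M - 2 * t + s"
    unfolding that by (simp only: lv_def three_neq if_False lval_eq)
  show "lv 1 = 3 * s * (Q + 2 * s + 1) * (Q + s + 1)"
    unfolding lv_def by (simp only: simp_thms if_True P_eq lval_eq)
  have "u + A = (M + r) + 3 * t" by (simp add: r_eq)
  then have "lv 2 = lval ((M + r) + 3 * t) (M + r)" by (simp add: lv_def)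
  also have "\<dots> = 3 * t * (u + A - t + 1) * (u + A - 2 * t + 1)"
    unfolding lval_eq r_eq by Groebner_Basis.algebra
  finally show "lv 2 = 3 * t * (u + A - t + 1) * (u + A - 2 * t + 1)" .
qed

abbreviation "c12 c \<equiv> coeff12 (c + u) (A - c) c r (M - c) t (Q + 2 * s) (- s) (- Q - s)"
abbreviation "c112 c \<equiv> coeff112 (c + u) (A - c) c r (M - c) t (Q + 2 * s) (- s) (- Q - s)"
abbreviation "c122 c \<equiv> coeff122 (c + u) (A - c) c r (M - c) t (Q + 2 * s) (- s) (- Q - s)"
abbreviation "c1122 c \<equiv> coeff1122 (c + u) (A - c) c r (M - c) t (Q + 2 * s) (- s) (- Q - s)"

lemma rho_pt:
  "rho P Q (ptrace [1, 2]) h (pt c) = c12 c * h (pt c)"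
  "rho P Q (ptrace [1, 1, 2]) h (pt c) = al c * h (pt (c - 1)) + c112 c * h (pt c) + ga c * h (pt (c + 1))"
  "rho P Q (ptrace [1, 2, 2]) h (pt c) = - al c * h (pt (c - 1)) + c122 c * h (pt c) - ga c * h (pt (c + 1))"
  "rho P Q (ptrace [1, 1, 2, 2]) h (pt c) = al c * L1 c * h (pt (c - 1)) + c1122 c * h (pt c)
    + ga c * L2 c * h (pt (c + 1))"
proof -
  have c: "rho P Q z h (c + u, A - c, c, r, M - c) = rho P Q z h (pt c)" for z by (simp add: pt_def)
  have L: "L1 c = c - A + t + Q + 2 * s" "L2 c = c + u + A - M - 2 * t - Q - s"
    unfolding L1_def L2_def by (simp_all add: P_eq r_eq field_simps)
  have down: "coeff112_down (c + u) (A - c) c r (M - c) t (Q + 2 * s) (- s) (- Q - s) = al c"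
    "coeff122_down (c + u) (A - c) c r (M - c) t (Q + 2 * s) (- s) (- Q - s) = - al c"
    "coeff1122_down (c + u) (A - c) c r (M - c) t (Q + 2 * s) (- s) (- Q - s) = al c * L1 c"
    unfolding coeff112_down_def coeff122_down_def coeff1122_down_def al_def L unfolding r_eq P_eq by Groebner_Basis.algebra+
  have up: "coeff112_up (c + u) (A - c) c r (M - c) t (Q + 2 * s) (- s) (- Q - s) = ga c"
    "coeff122_up (c + u) (A - c) c r (M - c) t (Q + 2 * s) (- s) (- Q - s) = - ga c"
    "coeff1122_up (c + u) (A - c) c r (M - c) t (Q + 2 * s) (- s) (- Q - s) = ga c * L2 c"
    unfolding coeff112_up_def coeff122_up_def coeff1122_up_def ga_def L unfolding r_eq P_eq by Groebner_Basis.algebra+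
  show "rho P Q (ptrace [1, 2]) h (pt c) = c12 c * h (pt c)"
    "rho P Q (ptrace [1, 1, 2]) h (pt c) = al c * h (pt (c - 1)) + c112 c * h (pt c) + ga c * h (pt (c + 1))"
    "rho P Q (ptrace [1, 2, 2]) h (pt c) = - al c * h (pt (c - 1)) + c122 c * h (pt c) - ga c * h (pt (c + 1))"
    "rho P Q (ptrace [1, 1, 2, 2]) h (pt c) = al c * L1 c * h (pt (c - 1)) + c1122 c * h (pt c)
      + ga c * L2 c * h (pt (c + 1))"
    using endo12_app[of P Q h "c + u" "A - c" c r "M - c"] endo112_app[of P Q h "c + u" "A - c" c r "M - c"]
      endo122_app[of P Q h "c + u" "A - c" c r "M - c"] endo1122_app[of P Q h "c + u" "A - c" c r "M - c"]
    by (simp_all only: rho_12[symmetric] rho_112[symmetric] rho_122[symmetric] rho_1122[symmetric]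
        c tau_pt hw_s up down pt_shift) (simp_all add: pt_def)
qed

lemma acts_kU: "acts (kU i) (\<lambda>g c. kv i * g c)" and acts_lU: "acts (lU i) (\<lambda>g c. lv i * g c)"
proof -
  have k: "rho P Q (kU 1) h (pt c) = kv 1 * h (pt c)" "rho P Q (kU 2) h (pt c) = kv 2 * h (pt c)"
    and l: "rho P Q (lU 1) h (pt c) = lv 1 * h (pt c)" "rho P Q (lU 2) h (pt c) = lv 2 * h (pt c)" for h c
    by (simp_all add: rho_kU_1 rho_lU_1 rho_kU_2 rho_lU_2 kv_def lv_def pt_def add.commute)
  have k3: "rho P Q (kU 3) h (pt c) = kv 3 * h (pt c)" for h c
  proof -
    have "kv 1 + kv 2 + 2 * c12 c = kv 3"
      using coeff12_eq[OF r_eq P_eq refl refl, of c] by (simp add: kv_simps algebra_simps)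
    then show ?thesis
      unfolding kU_3 rho_add rho_mult_numeral k rho_pt by (simp flip: distrib_right add: mult.assoc[symmetric])
  qed
  have l3: "rho P Q (lU 3) h (pt c) = lv 3 * h (pt c)" for h c
  proof -
    have "lv 1 + lv 2 + 3 * (c112 c + c122 c) + 9 * c12 c = - lv 3"
      unfolding lv_simps(1,2) lv_simps(3)[OF refl] using coeff112_122_eq[OF r_eq P_eq refl refl, of c] by simp
    then have lv3: "lv 3 = - (lv 1 + lv 2 + 3 * (c112 c + c122 c) + 9 * c12 c)" by simp
    then show ?thesis
      unfolding lU_3 rho_uminus rho_add rho_mult_numeral l rho_pt lv3 by Groebner_Basis.algebra
  qed
  have "trace_span 2 (kU i)" "trace_span 3 (lU i)" by (rule kU_trace_span lU_trace_span)+
  then show "acts (kU i) (\<lambda>g c. kv i * g c)" "acts (lU i) (\<lambda>g c. lv i * g c)"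
    using three_cases[of i] k l k3 l3 unfolding acts_def by auto
qed

lemma acts_X: "acts X_elem opX"
proof -
  have "be c = 1/2 * (c112 c - c122 c) + 1/3 * (lv 1 - lv 2)" for c
  proof -
    have "108 * be c = 108 * (c * (c + u) * (c - Q - M - 2) + (A - c) * (M - c) * (c + P + u + r + 2)
        + (r + 1) * (A - P - Q - 2) * c) + 2 * beta_num u A M r P Q"
      by (simp add: be_def al_def ga_def)
    also have "\<dots> = 54 * (c112 c - c122 c) + 36 * (lv 1 - lv 2)"
      unfolding lv_simps(1,2) using beta_identity[OF r_eq P_eq, of c] by simp
    finally have "108 * be c = 108 * (1/2 * (c112 c - c122 c) + 1/3 * (lv 1 - lv 2))"
      by (simp add: distrib_left right_diff_distrib diff_divide_distrib)
    then show ?thesis unfolding mult_cancel_left by simp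
  qed
  note be = this
  have l: "rho P Q (lU i) h (pt c) = lv i * h (pt c)" for i h c
    using acts_lU[of i] by (simp add: acts_def)
  have "rho P Q X_elem h (pt c) = opX (\<lambda>c. h (pt c)) c" for h c
    unfolding X_elem_def rho_add rho_scaleC rho_diff rho_pt l opX_def be by (simp add: algebra_simps)
  then show ?thesis using X_trace_span unfolding acts_def by blast
qed

lemma acts_Y: "acts Y_elem opY"
proof -
  have tr: "trace_span 2 (ptrace [1, 1])" "trace_span 2 (ptrace [2, 2])" "trace_span 2 (ptrace [1, 2])"
    by (simp_all add: polarised_trace_2 quadratic_trace_span)
  have kk: "ptrace [1, 1] = kU 1" "ptrace [2, 2] = kU 2"
    by (simp_all add: polarised_trace_2 kU_lU_simps)
  have "et c = c1122 c + 3/2 * (c112 c + c122 c) - 1/12 * (c12 c * c12 c) - 5/12 * (kv 1 * kv 2) + 5/2 * c12 c" for c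
  proof -
    have L: "L1 c = c - A + t + Q + 2 * s" "L2 c = c + u + A - M - 2 * t - Q - s"
      unfolding L1_def L2_def by (simp_all add: P_eq r_eq field_simps)
    have "12 * et c = 12 * (c * (c + u) * (c - Q - M - 2) * (c - A + t + Q + 2 * s)
        + (A - c) * (M - c) * (c + P + u + r + 2) * (c + u + A - M - 2 * t - Q - s) - (r + 1) * (r + 2) * c\<^sup>2)
      + 4 * eta1_num u A M r P Q * c + 1 * eta0_num u A M r P Q"
      by (simp add: et_def al_def ga_def L)
    then have "12 * et c = 12 * c1122 c + 18 * (c112 c + c122 c) - c12 c * c12 c - 5 * (kv 1 * kv 2) + 30 * c12 c"
      unfolding kv_simps(1,2) using eta_identity[OF r_eq P_eq refl, of c] by simp
    also have "\<dots> = 12 * (c1122 c + 3/2 * (c112 c + c122 c) - 1/12 * (c12 c * c12 c) - 5/12 * (kv 1 * kv 2) + 5/2 * c12 c)"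
      by (simp add: distrib_left right_diff_distrib diff_divide_distrib add_divide_distrib)
    finally show ?thesis unfolding mult_cancel_left by simp
  qed
  then have et: "et c = c1122 c + 3/2 * (c112 c + c122 c) - 1/12 * (c12 c * c12 c) - 5/12 * (kv 1 * kv 2) + 5/2 * c12 c" for c .
  have k: "rho P Q (kU i) h (pt c) = kv i * h (pt c)" for i h c
    using acts_kU[of i] by (simp add: acts_def)
  have mult: "rho P Q (ptrace [1, 2] * ptrace [1, 2]) h (pt c) = c12 c * (c12 c * h (pt c))"
    "rho P Q (kU 1 * kU 2) h (pt c) = kv 1 * (kv 2 * h (pt c))" for h c
    using rho_mult[OF tr(3) tr(3)] rho_mult[OF tr(1) tr(2)] by (simp_all add: rho_pt kk k)
  have "rho P Q Y_elem h (pt c) = opY (\<lambda>c. h (pt c)) c" for h c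
    unfolding Y_elem_def power2_eq_square kk rho_add rho_scaleC rho_diff rho_pt mult opY_def et by (simp add: algebra_simps)
  then show ?thesis using Y_trace_span unfolding acts_def by blast
qed

lemma acts_Z: "acts Z_elem (\<lambda>g c. opX (opY g) c - opY (opX g) c)"
  unfolding Z_elem_def commutator_def
  by (rule acts_diff[OF acts_mult[OF acts_X acts_Y] acts_mult[OF acts_Y acts_X]])

end

text \<open>The arguments are \<open>3 * k\<close> and \<open>9 * l\<close>, which are polynomials
  with integral coefficients in the line parameters; the sum of the six terms is then
  \<open>69984 * a6\<close>.\<close>

definition sym6_term :: "complex \<Rightarrow> _" where
  "sym6_term a b c x y = 27*(2*a^2*b - a^3 - 6*a*b*c) + 486*(a^2 - 2*a*b) + 24*x^2 - 240*x*y"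

text \<open>The functions are multiples of the coefficients of the tridiagonal operators \<open>X\<close> and \<open>Y\<close>. The
  eight identities below say that the coefficients of the shifts by 1 and 2 in \<open>[X, Z] + 6 Y\<^sup>2 - a\<^sub>2 X\<^sup>2 - a\<^sub>5 X\<close>
  and \<open>[Y, Z] + 2 X\<^sup>3 + a\<^sub>2 {X, Y} + a\<^sub>5 Y - a\<^sub>6 X\<close> vanish.\<close>

locale shift_data =
  fixes u A M r P Q W S2 S5 S6 :: complex and al ga la lb bb B H p :: "complex \<Rightarrow> complex"
    and k_1 k_2 k_3 l_1 l_2 l_3 :: complex
  assumes al: "\<And>x. al x = x * (x + u) * (x - Q - M - 2)"
    and ga: "\<And>x. ga x = (A - x) * (M - x) * (x + P + u + r + 2)"
    and la: "\<And>x. la x = 36 * (3 * x + (u - 2 * A - M - r + 2 * P + Q))"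
    and lb: "\<And>x. lb x = 36 * (3 * x + (u + A - M + 2 * r - P - 2 * Q))"
    and bb: "\<And>x. bb x = al x + ga x + (r + 1) * (A - P - Q - 2) * x"
    and B: "\<And>x. B x = 108 * bb x + 2 * beta_num u A M r P Q"
    and H: "\<And>x. H x = al x * la x + ga x * lb x - 108 * ((r + 1) * (r + 2) * x^2)
        + 36 * eta1_num u A M r P Q * x + 9 * eta0_num u A M r P Q"
    and p: "\<And>x. p x = al x * ga (x - 1)"
    and W: "W = A + r - P - Q"
    and kl: "k_1 = (2*(P^2+P*Q+Q^2)+6*(P+Q))" "k_2 = (2*((u+A)^2+(u+A)*(M+r)+(M+r)^2)+6*(u+A+M+r))" "k_3 = (2*((P+u+r)^2+(P+u+r)*(Q+M-A-r)+(Q+M-A-r)^2)+6*(P+u+Q+M-A))"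
      "l_1 = ((P-Q)*(2*P+Q+3)*(P+2*Q+3))" "l_2 = (((u+A)-(M+r))*(2*(u+A)+(M+r)+3)*((u+A)+2*(M+r)+3))" "l_3 = (- 1*((P+u+r)-(Q+M-A-r))*(2*(P+u+r)+(Q+M-A-r)+3)*((P+u+r)+2*(Q+M-A-r)+3))"
    and S2: "S2 = k_1 + k_2 + k_3"
    and S5: "S5 = (k_2*l_1-k_1*l_2+k_3*l_2-k_2*l_3+k_1*l_3-k_3*l_1)"
    and S6: "S6 = sym6_term k_1 k_2 k_3 l_1 l_2 + sym6_term k_1 k_3 k_2 l_1 l_3 + sym6_term k_2 k_1 k_3 l_2 l_1
      + sym6_term k_2 k_3 k_1 l_2 l_3 + sym6_term k_3 k_1 k_2 l_3 l_1 + sym6_term k_3 k_2 k_1 l_3 l_2"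
begin

lemma XZ_up2: "108 * ((lb (c + 1) * (bb (c + 1) - bb (c + 2)) + (H (c + 2) - H (c + 1))) - (lb c * (bb c - bb (c + 1)) + (H
    (c + 1) - H c))) + 11664 * (bb c - bb (c + 2)) + 6 * lb c * (lb c + 108) - 1944 * S2 = 0"
  unfolding beta_num_def eta1_num_def eta0_num_def al ga la lb bb B H p W kl S2 S5 S6 sym6_term_def by Groebner_Basis.algebra

lemma XZ_down2: "108 * ((la (c - 1) * (bb (c - 1) - bb (c - 2)) + (H (c - 2) - H (c - 1))) - (la c * (bb c - bb (c - 1)) + (H
    (c - 1) - H c))) - 11664 * (bb c - bb (c - 2)) + 6 * la c * (la c - 108) - 1944 * S2 = 0"
  unfolding beta_num_def eta1_num_def eta0_num_def al ga la lb bb B H p W kl S2 S5 S6 sym6_term_def by Groebner_Basis.algebra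

lemma XZ_up1: "11664 * ((W - 1) * (p (c + 1) - p (c + 2)) - (W - 1) * (p c - p (c + 1)) + p c - p (c + 2)) + 108 * (lb c *
    (bb c - bb (c + 1)) + (H (c + 1) - H c)) * (bb c - bb (c + 1)) + 6 * lb c * (H c + H (c + 1)) - 18 * S2 * (B c
    + B (c + 1)) - 144 * S5 = 0"
  unfolding beta_num_def eta1_num_def eta0_num_def al ga la lb bb B H p W kl S2 S5 S6 sym6_term_def by Groebner_Basis.algebra

lemma XZ_down1: "11664 * ((W - 1) * (p (c - 1) - p c) - (W - 1) * (p c - p (c + 1)) - p (c + 1) + p (c - 1)) + 108 * (la c *
    (bb c - bb (c - 1)) + (H (c - 1) - H c)) * (bb c - bb (c - 1)) + 6 * la c * (H c + H (c - 1)) - 18 * S2 * (B c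
    + B (c - 1)) - 144 * S5 = 0"
  unfolding beta_num_def eta1_num_def eta0_num_def al ga la lb bb B H p W kl S2 S5 S6 sym6_term_def by Groebner_Basis.algebra

lemma YZ_up2: "6 * (lb c * (lb (c + 1) * (bb (c + 1) - bb (c + 2)) + (H (c + 2) - H (c + 1))) - (lb c * (bb c - bb (c + 1)) +
    (H (c + 1) - H c)) * (lb c + 108) + 108 * (H c - H (c + 2)) + 216 * (B c + B (c + 1) + B (c + 2))) + 108 * S2
    * (2 * lb c + 108) = 0"
  unfolding beta_num_def eta1_num_def eta0_num_def al ga la lb bb B H p W kl S2 S5 S6 sym6_term_def by Groebner_Basis.algebra

lemma YZ_down2: "6 * (la c * (la (c - 1) * (bb (c - 1) - bb (c - 2)) + (H (c - 2) - H (c - 1))) - (la c * (bb c - bb (c - 1)) +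
    (H (c - 1) - H c)) * (la c - 108) - 108 * (H c - H (c - 2)) + 216 * (B c + B (c - 1) + B (c - 2))) + 108 * S2
    * (2 * la c - 108) = 0"
  unfolding beta_num_def eta1_num_def eta0_num_def al ga la lb bb B H p W kl S2 S5 S6 sym6_term_def by Groebner_Basis.algebra

lemma YZ_up1: "6 * (108 * lb c * ((W - 1) * (p (c + 1) - p (c + 2)) - (W - 1) * (p c - p (c + 1))) + (lb c * (bb c - bb (c +
    1)) + (H (c + 1) - H c)) * (H c - H (c + 1)) + 108 * (la c * p c - p (c + 2) * (la c + 216)) + 2 * (B c * B c
    + B c * B (c + 1) + B (c + 1) * B (c + 1) + 11664 * (p c + p (c + 1) + p (c + 2)))) + S2 * (108 * (H c + H (c
    + 1)) + lb c * (B c + B (c + 1))) + 8 * S5 * lb c - S6 = 0"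
  unfolding beta_num_def eta1_num_def eta0_num_def al ga la lb bb B H p W kl S2 S5 S6 sym6_term_def by Groebner_Basis.algebra

lemma YZ_down1: "6 * (108 * la c * ((W - 1) * (p (c - 1) - p c) - (W - 1) * (p c - p (c + 1))) + (la c * (bb c - bb (c - 1)) +
    (H (c - 1) - H c)) * (H c - H (c - 1)) + 108 * (p (c - 1) * (lb c - 216) - p (c + 1) * lb c) + 2 * (B c * B c
    + B c * B (c - 1) + B (c - 1) * B (c - 1) + 11664 * (p c + p (c + 1) + p (c - 1)))) + S2 * (108 * (H c + H (c
    - 1)) + la c * (B c + B (c - 1))) + 8 * S5 * la c - S6 = 0"
  unfolding beta_num_def eta1_num_def eta0_num_def al ga la lb bb B H p W kl S2 S5 S6 sym6_term_def by Groebner_Basis.algebra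

end

section \<open>Vanishing of the shifts in the two commutator relations\<close>

context line
begin

definition wt where "wt = A + r - P - Q"
definition bb where "bb c = al c + ga c + (r + 1) * (A - P - Q - 2) * c"
definition sk where "sk = 3 * (kv 1 + kv 2 + kv 3)"
definition skl where "skl = 27 * (kv 2 * lv 1 - kv 1 * lv 2 + kv 3 * lv 2 - kv 2 * lv 3 + kv 1 * lv 3 - kv 3 * lv 1)"
definition sym6 where "sym6 = sym6_term (3 * kv 1) (3 * kv 2) (3 * kv 3) (9 * lv 1) (9 * lv 2)
  + sym6_term (3 * kv 1) (3 * kv 3) (3 * kv 2) (9 * lv 1) (9 * lv 3) + sym6_term (3 * kv 2) (3 * kv 1) (3 * kv 3) (9 * lv 2) (9 * lv 1)
  + sym6_term (3 * kv 2) (3 * kv 3) (3 * kv 1) (9 * lv 2) (9 * lv 3) + sym6_term (3 * kv 3) (3 * kv 1) (3 * kv 2) (9 * lv 3) (9 * lv 1)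
  + sym6_term (3 * kv 3) (3 * kv 2) (3 * kv 1) (9 * lv 3) (9 * lv 2)"

definition b0 where "b0 = beta_num u A M r P Q / 54"

lemma be_bb: "be c = bb c + b0"
  by (simp add: be_def bb_def b0_def)

lemma beta_b0: "beta_num u A M r P Q = 54 * b0"
  by (simp add: b0_def)

definition e0 where "e0 = eta0_num u A M r P Q / 12"
definition e1 where "e1 = eta1_num u A M r P Q / 3"

lemma et_eq: "et c = al c * L1 c + ga c * L2 c - (r + 1) * (r + 2) * c^2 + e1 * c + e0"
  by (simp add: et_def e0_def e1_def)

lemma eta_e: "eta1_num u A M r P Q = 3 * e1" "eta0_num u A M r P Q = 12 * e0"
  by (simp_all add: e0_def e1_def)

lemma kval_3: "3 * kval p q = 2 * (p^2 + p * q + q^2) + 6 * (p + q)"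
  by (simp add: kval_def field_simps)

lemma lval_9: "9 * lval p q = (p - q) * (2 * p + q + 3) * (p + 2 * q + 3)"
  by (simp add: lval_def)

lemma shift_data: "shift_data u A M r P Q wt sk skl sym6 al ga (\<lambda>x. 108 * L1 x) (\<lambda>x. 108 * L2 x) bb (\<lambda>x. 108 * be x)
    (\<lambda>x. 108 * et x) (\<lambda>x. al x * ga (x - 1)) (3 * kv 1) (3 * kv 2) (3 * kv 3) (9 * lv 1) (9 * lv 2) (9 * lv 3)"
proof
  fix x
  show "al x = x * (x + u) * (x - Q - M - 2)" by (rule al_def)
  show "ga x = (A - x) * (M - x) * (x + P + u + r + 2)" by (rule ga_def)
  show "108 * L1 x = 36 * (3 * x + (u - 2 * A - M - r + 2 * P + Q))"
    unfolding L1_def by (simp add: field_simps)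
  show "108 * L2 x = 36 * (3 * x + (u + A - M + 2 * r - P - 2 * Q))"
    unfolding L2_def by (simp add: field_simps)
  show "bb x = al x + ga x + (r + 1) * (A - P - Q - 2) * x" by (rule bb_def)
  show "108 * be x = 108 * bb x + 2 * beta_num u A M r P Q"
    unfolding be_bb beta_b0 by simp
  show "108 * et x = al x * (108 * L1 x) + ga x * (108 * L2 x) - 108 * ((r + 1) * (r + 2) * x^2)
      + 36 * eta1_num u A M r P Q * x + 9 * eta0_num u A M r P Q"
    unfolding et_eq eta_e by Groebner_Basis.algebra
  show "3 * kv 1 = (2*(P^2+P*Q+Q^2)+6*(P+Q))" "3 * kv 2 = (2*((u+A)^2+(u+A)*(M+r)+(M+r)^2)+6*(u+A+M+r))" "3 * kv 3 = (2*((P+u+r)^2+(P+u+r)*(Q+M-A-r)+(Q+M-A-r)^2)+6*(P+u+Q+M-A))"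
    by (simp_all only: kv_def three_neq if_True if_False simp_thms kval_3) Groebner_Basis.algebra+
  show "9 * lv 1 = ((P-Q)*(2*P+Q+3)*(P+2*Q+3))" "9 * lv 2 = (((u+A)-(M+r))*(2*(u+A)+(M+r)+3)*((u+A)+2*(M+r)+3))" "9 * lv 3 = (- 1*((P+u+r)-(Q+M-A-r))*(2*(P+u+r)+(Q+M-A-r)+3)*((P+u+r)+2*(Q+M-A-r)+3))"
    by (simp_all only: lv_def three_neq if_True if_False simp_thms mult_minus_right lval_9) Groebner_Basis.algebra+
  show "sk = 3 * kv 1 + 3 * kv 2 + 3 * kv 3" by (simp add: sk_def)
  show "skl = ((3 * kv 2)*(9 * lv 1)-(3 * kv 1)*(9 * lv 2)+(3 * kv 3)*(9 * lv 2)-(3 * kv 2)*(9 * lv 3)+(3 * kv 1)*(9 * lv 3)-(3 * kv 3)*(9 * lv 1))" unfolding skl_def by Groebner_Basis.algebra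
qed (simp_all add: wt_def sym6_def)

lemma shift_L:
  "L2 c = L1 c + wt" "L1 (c + 1) = L1 c + 1" "L1 (c + 2) = L1 c + 2" "L1 (c - 1) = L1 c - 1" "L1 (c - 2) = L1 c - 2"
  "L1 (c + 3) = L1 c + 3" "L1 (c - 3) = L1 c - 3"
  unfolding L1_def L2_def wt_def by (simp_all add: field_simps)

definition opZ :: "(complex \<Rightarrow> complex) \<Rightarrow> complex \<Rightarrow> complex" where
  "opZ g c = opX (opY g) c - opY (opX g) c"

lemmas args = add_one_diff shift_simps

text \<open>Assuming \<open>g c = 0\<close> discards the diagonal term, so only the shifts by 1 and
  2 enter. The operator is thereby shown to be diagonal, while its diagonal is not computed.\<close>

lemma XZ_diag:
  assumes g: "g c = 0"
  shows "opX (opZ g) c - opZ (opX g) c + 6 * opY (opY g) c - sk / 6 * opX (opX g) c - skl / 81 * opX g c = 0"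
proof -
  interpret shift_data u A M r P Q wt sk skl sym6 al ga "\<lambda>x. 108 * L1 x" "\<lambda>x. 108 * L2 x" bb "\<lambda>x. 108 * be x"
    "\<lambda>x. 108 * et x" "\<lambda>x. al x * ga (x - 1)" "3 * kv 1" "3 * kv 2" "3 * kv 3" "9 * lv 1" "9 * lv 2" "9 * lv 3"
    by (rule shift_data)
  \<comment> \<open>An identity with the coefficients \<open>al\<close>, \<open>ga\<close>,
    \<open>bb\<close>, \<open>et\<close> as atoms. Their values enter only in the four lemmas for
    the single shifts, which keeps each polynomial computation small.\<close>
  have "11664 * (opX (opZ g) c - opZ (opX g) c + 6 * opY (opY g) c) - 1944 * sk * opX (opX g) c - 144 * skl * opX g c
    = ga c * ga (c + 1) * (108 * (((108 * L2 (c + 1)) * (bb (c + 1) - bb (c + 2)) + ((108 * et (c + 2)) - (108 * et (c + 1)))) - ((108 *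
      L2 c) * (bb c - bb (c + 1)) + ((108 * et (c + 1)) - (108 * et c)))) + 11664 * (bb c - bb (c + 2)) + 6 * (108 *
      L2 c) * ((108 * L2 c) + 108) - 1944 * sk) * g (c + 2)
    + ga c * (11664 * ((wt - 1) * ((al (c + 1) * ga ((c + 1) - 1)) - (al (c + 2) * ga ((c + 2) - 1))) - (wt - 1) * ((al c *
      ga (c - 1)) - (al (c + 1) * ga ((c + 1) - 1))) + (al c * ga (c - 1)) - (al (c + 2) * ga ((c + 2) - 1))) + 108
      * ((108 * L2 c) * (bb c - bb (c + 1)) + ((108 * et (c + 1)) - (108 * et c))) * (bb c - bb (c + 1)) + 6 * (108
      * L2 c) * ((108 * et c) + (108 * et (c + 1))) - 18 * sk * ((108 * be c) + (108 * be (c + 1))) - 144 * skl) * g (c + 1)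
    + al c * (11664 * ((wt - 1) * ((al (c - 1) * ga ((c - 1) - 1)) - (al c * ga (c - 1))) - (wt - 1) * ((al c * ga (c - 1))
      - (al (c + 1) * ga ((c + 1) - 1))) - (al (c + 1) * ga ((c + 1) - 1)) + (al (c - 1) * ga ((c - 1) - 1))) + 108
      * ((108 * L1 c) * (bb c - bb (c - 1)) + ((108 * et (c - 1)) - (108 * et c))) * (bb c - bb (c - 1)) + 6 * (108
      * L1 c) * ((108 * et c) + (108 * et (c - 1))) - 18 * sk * ((108 * be c) + (108 * be (c - 1))) - 144 * skl) * g (c - 1)
    + al c * al (c - 1) * (108 * (((108 * L1 (c - 1)) * (bb (c - 1) - bb (c - 2)) + ((108 * et (c - 2)) - (108 * et (c - 1)))) - ((108 *
      L1 c) * (bb c - bb (c - 1)) + ((108 * et (c - 1)) - (108 * et c)))) - 11664 * (bb c - bb (c - 2)) + 6 * (108 *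
      L1 c) * ((108 * L1 c) - 108) - 1944 * sk) * g (c - 2)"
    unfolding opZ_def opX_def opY_def
    apply (simp only: args g mult_zero_right add_0 add_0_right diff_0_right diff_0)
    apply (simp only: shift_L be_bb)
    apply Groebner_Basis.algebra
    done
  also have "\<dots> = 0"
    by (simp only: XZ_up2 XZ_up1 XZ_down1 XZ_down2 mult_zero_right mult_zero_left add_0)
  finally have "11664 * (opX (opZ g) c - opZ (opX g) c + 6 * opY (opY g) c - sk / 6 * opX (opX g) c - skl / 81 * opX g c) = 0"
    by (simp add: right_diff_distrib mult.assoc)
  then show ?thesis unfolding mult_eq_0_iff by simp
qed

lemma YZ_diag:
  assumes g: "g c = 0"
  shows "opY (opZ g) c - opZ (opY g) c + 2 * opX (opX (opX g)) c + sk / 6 * (opX (opY g) c + opY (opX g) c)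
    + skl / 81 * opY g c - sym6 / 69984 * opX g c = 0"
proof -
  interpret shift_data u A M r P Q wt sk skl sym6 al ga "\<lambda>x. 108 * L1 x" "\<lambda>x. 108 * L2 x" bb "\<lambda>x. 108 * be x"
    "\<lambda>x. 108 * et x" "\<lambda>x. al x * ga (x - 1)" "3 * kv 1" "3 * kv 2" "3 * kv 3" "9 * lv 1" "9 * lv 2" "9 * lv 3"
    by (rule shift_data)
  have "69984 * (opY (opZ g) c - opZ (opY g) c + 2 * opX (opX (opX g)) c) + 11664 * sk * (opX (opY g) c + opY (opX g) c)
    + 864 * skl * opY g c - sym6 * opX g c
    = ga c * ga (c + 1) * (6 * ((108 * L2 c) * ((108 * L2 (c + 1)) * (bb (c + 1) - bb (c + 2)) + ((108 * et (c + 2)) - (108 * et (c +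
      1)))) - ((108 * L2 c) * (bb c - bb (c + 1)) + ((108 * et (c + 1)) - (108 * et c))) * ((108 * L2 c) + 108) +
      108 * ((108 * et c) - (108 * et (c + 2))) + 216 * ((108 * be c) + (108 * be (c + 1)) + (108 * be (c + 2)))) +
      108 * sk * (2 * (108 * L2 c) + 108)) * g (c + 2)
    + ga c * (6 * (108 * (108 * L2 c) * ((wt - 1) * ((al (c + 1) * ga ((c + 1) - 1)) - (al (c + 2) * ga ((c + 2) - 1))) -
      (wt - 1) * ((al c * ga (c - 1)) - (al (c + 1) * ga ((c + 1) - 1)))) + ((108 * L2 c) * (bb c - bb (c + 1)) +
      ((108 * et (c + 1)) - (108 * et c))) * ((108 * et c) - (108 * et (c + 1))) + 108 * ((108 * L1 c) * (al c * ga
      (c - 1)) - (al (c + 2) * ga ((c + 2) - 1)) * ((108 * L1 c) + 216)) + 2 * ((108 * be c) * (108 * be c) + (108 *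
      be c) * (108 * be (c + 1)) + (108 * be (c + 1)) * (108 * be (c + 1)) + 11664 * ((al c * ga (c - 1)) + (al (c +
      1) * ga ((c + 1) - 1)) + (al (c + 2) * ga ((c + 2) - 1))))) + sk * (108 * ((108 * et c) + (108 * et (c + 1)))
      + (108 * L2 c) * ((108 * be c) + (108 * be (c + 1)))) + 8 * skl * (108 * L2 c) - sym6) * g (c + 1)
    + al c * (6 * (108 * (108 * L1 c) * ((wt - 1) * ((al (c - 1) * ga ((c - 1) - 1)) - (al c * ga (c - 1))) - (wt - 1) *
      ((al c * ga (c - 1)) - (al (c + 1) * ga ((c + 1) - 1)))) + ((108 * L1 c) * (bb c - bb (c - 1)) + ((108 * et (c
      - 1)) - (108 * et c))) * ((108 * et c) - (108 * et (c - 1))) + 108 * ((al (c - 1) * ga ((c - 1) - 1)) * ((108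
      * L2 c) - 216) - (al (c + 1) * ga ((c + 1) - 1)) * (108 * L2 c)) + 2 * ((108 * be c) * (108 * be c) + (108 *
      be c) * (108 * be (c - 1)) + (108 * be (c - 1)) * (108 * be (c - 1)) + 11664 * ((al c * ga (c - 1)) + (al (c +
      1) * ga ((c + 1) - 1)) + (al (c - 1) * ga ((c - 1) - 1))))) + sk * (108 * ((108 * et c) + (108 * et (c - 1)))
      + (108 * L1 c) * ((108 * be c) + (108 * be (c - 1)))) + 8 * skl * (108 * L1 c) - sym6) * g (c - 1)
    + al c * al (c - 1) * (6 * ((108 * L1 c) * ((108 * L1 (c - 1)) * (bb (c - 1) - bb (c - 2)) + ((108 * et (c - 2)) - (108 * et (c -
      1)))) - ((108 * L1 c) * (bb c - bb (c - 1)) + ((108 * et (c - 1)) - (108 * et c))) * ((108 * L1 c) - 108) -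
      108 * ((108 * et c) - (108 * et (c - 2))) + 216 * ((108 * be c) + (108 * be (c - 1)) + (108 * be (c - 2)))) +
      108 * sk * (2 * (108 * L1 c) - 108)) * g (c - 2)"
    unfolding opZ_def opX_def opY_def
    apply (simp only: args g mult_zero_right add_0 add_0_right diff_0_right diff_0)
    apply (simp only: shift_L be_bb)
    apply Groebner_Basis.algebra
    done
  also have "\<dots> = 0"
    by (simp only: YZ_up2 YZ_up1 YZ_down1 YZ_down2 mult_zero_right mult_zero_left add_0)
  finally have "69984 * (opY (opZ g) c - opZ (opY g) c + 2 * opX (opX (opX g)) c + sk / 6 * (opX (opY g) c + opY (opX g) c)
    + skl / 81 * opY g c - sym6 / 69984 * opX g c) = 0"
    by (simp add: distrib_left right_diff_distrib mult.assoc)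
  then show ?thesis unfolding mult_eq_0_iff by simp
qed

end

section \<open>Normal forms\<close>

abbreviation "lookup \<equiv> Poly_Mapping.lookup"
abbreviation "single \<equiv> Poly_Mapping.single"
abbreviation "keys \<equiv> Poly_Mapping.keys"

text \<open>A product in a fixed order, so that it makes sense in a noncommutative algebra.
  \<open>pmap\<close> serves both for evaluation at complex numbers and for the substitution of
  central elements.\<close>

definition pmon :: "(param \<Rightarrow> 'a::complex_algebra_1) \<Rightarrow> (param \<Rightarrow>\<^sub>0 nat) \<Rightarrow> 'a" where
  "pmon v m = prod_list (map (\<lambda>x. v x ^ lookup m x)
    [Par_k 1, Par_k 2, Par_k 3, Par_l 1, Par_l 2, Par_l 3])"

definition pmap :: "(param \<Rightarrow> 'a::complex_algebra_1) \<Rightarrow> params \<Rightarrow> 'a" where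
  "pmap v p = (\<Sum>m\<in>keys p. lookup p m *\<^sub>C pmon v m)"

lemma pmap_superset:
  assumes "finite K" "keys p \<subseteq> K"
  shows "pmap v p = (\<Sum>m\<in>K. lookup p m *\<^sub>C pmon v m)"
  unfolding pmap_def using assms by (intro sum.mono_neutral_left) (auto simp: in_keys_iff)

lemma pmap_single: "pmap v (single m c) = c *\<^sub>C pmon v m"
  by (subst pmap_superset[of "{m}"]) auto

lemma pmap_zero: "pmap v 0 = 0"
  by (simp add: pmap_def)

lemma pmap_add: "pmap v (p + q) = pmap v p + pmap v q"
proof -
  let ?K = "keys p \<union> keys q"
  have "keys (p + q) \<subseteq> ?K" by (rule Poly_Mapping.keys_add)
  then show ?thesis
    by (simp add: pmap_superset[of ?K] lookup_add scaleC_add_left sum.distrib)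
qed

lemma pmap_diff: "pmap v (p - q) = pmap v p - pmap v q"
  using pmap_add[of v "p - q" q] by simp

lemma pmap_uminus: "pmap v (- p) = - pmap v p"
  using pmap_diff[of v 0 p] by (simp add: pmap_zero)

lemma pmap_scaleC: "pmap v (c *\<^sub>C p) = c *\<^sub>C pmap v p"
  by (induction p rule: poly_mapping_induct_single)
    (simp_all add: pmap_zero pmap_add pmap_single scaleC_single scaleC_add_right scaleC_scaleC scaleC_complex_def)

lemma pmap_sum: "pmap v (sum f S) = (\<Sum>i\<in>S. pmap v (f i))"
  by (induction S rule: infinite_finite_induct) (simp_all add: pmap_zero pmap_add)

lemma pmon_zero: "pmon v 0 = 1"
  by (simp add: pmon_def)

lemma pmap_one: "pmap v 1 = 1"
  using pmap_single[of v 0 1] by (simp add: pmon_zero scaleC_one)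

lemma pmap_var: "pmap v (kp i) = v (Par_k i)" "pmap v (lp i) = v (Par_l i)"
  using three_cases[of i]
  by (auto simp: kp_def lp_def pmap_single scaleC_one pmon_def lookup_single when_def)

lemma pmap_commute:
  assumes "\<And>x. v x * z = z * v x"
  shows "pmap v p * z = z * pmap v p"
  unfolding pmap_def pmon_def
  by (intro commute_sum commute_scaleC commute_prod_list)
    (auto intro: power_commuting_commutes assms)

lemma
  fixes v :: "param \<Rightarrow> 'a::complex_algebra_1"
  assumes comm: "\<And>x y. v x * v y = v y * v x"
  shows pmon_add: "pmon v (m + n) = pmon v m * pmon v n"
    and pmap_mult: "pmap v (p * q) = pmap v p * pmap v q"
    and pmap_power: "pmap v (p ^ e) = pmap v p ^ e"
proof -
  have pow: "v x ^ a * v y ^ b = v y ^ b * v x ^ a" for x y a b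
  proof -
    have "v x ^ a * v y = v y * v x ^ a" by (rule power_commuting_commutes[OF comm])
    from power_commuting_commutes[OF this[symmetric], of b] show ?thesis by simp
  qed
  have prod: "prod_list (map (\<lambda>x. v x ^ (f x + g x)) xs) =
      prod_list (map (\<lambda>x. v x ^ f x) xs) * prod_list (map (\<lambda>x. v x ^ g x) xs)" for f g xs
  proof (induction xs)
    case (Cons x xs)
    have "prod_list (map (\<lambda>x. v x ^ f x) xs) * v x ^ g x = v x ^ g x * prod_list (map (\<lambda>x. v x ^ f x) xs)"
      by (rule commute_prod_list) (auto simp: pow)
    then have "prod_list (map (\<lambda>x. v x ^ f x) xs) * (v x ^ g x * z) = v x ^ g x * (prod_list (map (\<lambda>x. v x ^ f x) xs) * z)" for z
      by (simp only: mult.assoc[symmetric])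
    with Cons show ?case by (simp add: power_add mult.assoc)
  qed simp
  show pm: "pmon v (m + n) = pmon v m * pmon v n" for m n
    unfolding pmon_def lookup_add by (rule prod)
  show mult: "pmap v (p * q) = pmap v p * pmap v q" for p q
  proof (induction p rule: poly_mapping_induct_single)
    case (single m c)
    show ?case
      by (induction q rule: poly_mapping_induct_single)
        (simp_all add: pmap_zero pmap_add pmap_single mult_single pm distrib_left mult_scaleC_left
          mult_scaleC_right scaleC_scaleC mult.commute[where 'a = complex])
  qed (simp_all add: pmap_zero pmap_add distrib_right)
  show "pmap v (p ^ e) = pmap v p ^ e"
    by (induction e) (simp_all add: pmap_one mult)
qed

definition pwt :: "(param \<Rightarrow>\<^sub>0 nat) \<Rightarrow> nat" where
  "pwt m = 2 * (\<Sum>i\<in>UNIV. lookup m (Par_k i)) + 3 * (\<Sum>i\<in>UNIV. lookup m (Par_l i))"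

lemma pwt_add: "pwt (m + n) = pwt m + pwt n"
  by (simp add: pwt_def lookup_add sum.distrib)

lemma pwt_single: "pwt (single (Par_k i) 1) = 2" "pwt (single (Par_l i) 1) = 3"
  using three_cases[of i] by (auto simp: pwt_def lookup_single when_def)

type_synonym nf_index = "nat \<times> nat \<times> bool"

fun iwt :: "nf_index \<Rightarrow> nat" where
  "iwt (j, i, e) = 4 * j + 3 * i + (if e then 6 else 0)"


definition wle :: "nat \<Rightarrow> (nf_index \<Rightarrow>\<^sub>0 params) \<Rightarrow> bool" where
  "wle n F \<longleftrightarrow> (\<forall>k m. lookup (lookup F k) m \<noteq> 0 \<longrightarrow> pwt m + iwt k \<le> n)"

lemma wle_zero: "wle n 0"
  by (simp add: wle_def)

lemma wle_add: "wle n F \<Longrightarrow> wle n G \<Longrightarrow> wle n (F + G)"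
  unfolding wle_def by (metis add_0 lookup_add)

definition imon :: "(zgen \<Rightarrow> 'a::complex_algebra_1) \<Rightarrow> nf_index \<Rightarrow> 'a" where
  "imon v k = (case k of (j, i, e) \<Rightarrow> v ZY ^ j * v ZX ^ i * (if e then v ZS else 1))"

definition zpar :: "(zgen \<Rightarrow> 'a) \<Rightarrow> param \<Rightarrow> 'a" where
  "zpar v x = (case x of Par_k i \<Rightarrow> v (ZK i) | Par_l i \<Rightarrow> v (ZL i))"

definition nf :: "(zgen \<Rightarrow> 'a::complex_algebra_1) \<Rightarrow> (nf_index \<Rightarrow>\<^sub>0 params) \<Rightarrow> 'a" where
  "nf v F = (\<Sum>k\<in>keys F. pmap (zpar v) (lookup F k) * imon v k)"

lemma nf_superset:
  assumes "finite K" "keys F \<subseteq> K"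
  shows "nf v F = (\<Sum>k\<in>K. pmap (zpar v) (lookup F k) * imon v k)"
  unfolding nf_def using assms by (intro sum.mono_neutral_left) (auto simp: in_keys_iff pmap_zero)

lemma nf_single: "nf v (single k p) = pmap (zpar v) p * imon v k"
  by (subst nf_superset[of "{k}"]) auto

lemma nf_zero: "nf v 0 = 0"
  by (simp add: nf_def)

lemma nf_add: "nf v (F + G) = nf v F + nf v G"
proof -
  let ?K = "keys F \<union> keys G"
  have "keys (F + G) \<subseteq> ?K" by (rule Poly_Mapping.keys_add)
  then show ?thesis
    by (simp add: nf_superset[of ?K] lookup_add pmap_add distrib_right sum.distrib)
qed

lemma nf_diff: "nf v (F - G) = nf v F - nf v G"
  using nf_add[of v "F - G" G] by simp

text \<open>The instances are \<open>zval\<close> and \<open>zvalZ\<close> with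
  \<open>I = {0}\<close>, and \<open>vA\<close> with the ideal generated by
  \<open>Omega - a12\<close>. In \<open>comm\<close> the case of total weight 0 is separate, because
  truncated subtraction would not lower the weight there. Both sides of the reduction
  \<open>square\<close> are compared modulo \<open>I\<close>.\<close>

locale sorted_filtration =
  fixes v :: "zgen \<Rightarrow> 'a::complex_algebra_1" and I :: "'a set"
  assumes I_zero: "0 \<in> I" and I_add: "x \<in> I \<Longrightarrow> y \<in> I \<Longrightarrow> x + y \<in> I"
    and I_mult_left: "x \<in> I \<Longrightarrow> a * x \<in> I" and I_mult_right: "x \<in> I \<Longrightarrow> x * a \<in> I"
    and central: "v (ZK i) * v g = v g * v (ZK i)" "v (ZL i) * v g = v g * v (ZL i)"
    and comm: "filt v zwt m x \<Longrightarrow> filt v zwt n y \<Longrightarrow>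
      x * y - y * x = 0 \<or> 1 \<le> m + n \<and> filt v zwt (m + n - 1) (x * y - y * x)"
    and square: "\<exists>a b. filt (\<lambda>g. if g = ZS then 0 else v g) zwt 12 a \<and>
      filt (\<lambda>g. if g = ZS then 0 else v g) zwt 6 b \<and> v ZS * v ZS - (a + b * v ZS) \<in> I"
begin

abbreviation "full \<equiv> filt v zwt"
abbreviation "low \<equiv> filt (\<lambda>g. if g = ZS then 0 else v g) zwt"
abbreviation "coef \<equiv> pmon (zpar v)"

section \<open>Reduction to sorted monomials\<close>

definition lower :: "nat \<Rightarrow> 'a \<Rightarrow> bool" where
  "lower n x \<longleftrightarrow> x = 0 \<or> (\<exists>m<n. full m x)"

lemma lower_zero: "lower n 0"
  by (simp add: lower_def)

lemma lower_mono: "lower m x \<Longrightarrow> m \<le> n \<Longrightarrow> lower n x"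
  unfolding lower_def using order.strict_trans2 by blast

lemma lower_add:
  assumes "lower n x" "lower n y"
  shows "lower n (x + y)"
proof (cases "x = 0 \<or> y = 0")
  case True
  then show ?thesis using assms by auto
next
  case False
  then obtain a b where ab: "a < n" "full a x" "b < n" "full b y"
    using assms unfolding lower_def by blast
  then have "full (max a b) x" "full (max a b) y" by (auto intro: filt.mono)
  then have "full (max a b) (x + y)" by (rule filt.add)
  moreover have "max a b < n" using ab by simp
  ultimately show ?thesis unfolding lower_def by blast
qed

lemma lower_scaleC: "lower n x \<Longrightarrow> lower n (c *\<^sub>C x)"
  unfolding lower_def by (auto intro: filt.scale)

lemma lower_mult_left: "full a y \<Longrightarrow> lower n x \<Longrightarrow> lower (a + n) (y * x)"
  unfolding lower_def by (metis add_strict_left_mono filt_mult mult_zero_right)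

lemma lower_mult_right: "lower n x \<Longrightarrow> full a y \<Longrightarrow> lower (n + a) (x * y)"
  unfolding lower_def by (metis add_strict_right_mono filt_mult mult_zero_left)

lemma lower_commutator: "full m x \<Longrightarrow> full n y \<Longrightarrow> lower (m + n) (x * y - y * x)"
  using comm[of m x n y] unfolding lower_def by (metis One_nat_def Suc_le_lessD diff_less zero_less_one)

lemma filt_power: "filt w zwt n x \<Longrightarrow> filt w zwt (k * n) (x ^ k)"
proof (induction k)
  case 0
  show ?case by (simp add: filt.one)
next
  case (Suc k)
  then show ?case using filt_mult[of w zwt n x "k * n" "x ^ k"] by simp
qed

lemma coef_low: "low (pwt m) (coef m)"
proof -
  have k: "low 2 (v (ZK i))" and l: "low 3 (v (ZL i))" for i
    using filt_gen[of "\<lambda>g. if g = ZS then 0 else v g" zwt "ZK i"]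
      filt_gen[of "\<lambda>g. if g = ZS then 0 else v g" zwt "ZL i"] by auto
  have "low (lookup m (Par_k 1) * 2 + (lookup m (Par_k 2) * 2
      + (lookup m (Par_k 3) * 2 + (lookup m (Par_l 1) * 3
      + (lookup m (Par_l 2) * 3 + (lookup m (Par_l 3) * 3 + 0)))))) (coef m)"
    unfolding pmon_def zpar_def list.map prod_list.Cons prod_list.Nil param.case
    by (intro filt_mult filt_power k l filt.one)
  then show ?thesis by (simp add: pwt_def sum_3 algebra_simps)
qed

lemma low_full: "low n x \<Longrightarrow> full n x"
  by (erule filt_transfer) (auto simp: filt_zero filt_gen)

lemma YX_low: "low (4 * j + 3 * i) (v ZY ^ j * v ZX ^ i)"
proof -
  have "low 4 (v ZY)" "low 3 (v ZX)"
    using filt_gen[of "\<lambda>g. if g = ZS then 0 else v g" zwt ZY]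
      filt_gen[of "\<lambda>g. if g = ZS then 0 else v g" zwt ZX] by auto
  then have "low (j * 4 + i * 3) (v ZY ^ j * v ZX ^ i)" by (intro filt_mult filt_power)
  then show ?thesis by (simp add: mult.commute)
qed

lemma S_full: "full 6 (v ZS)"
  using filt_gen[of v zwt ZS] by simp

lemma imon_full: "full (iwt (j, i, e)) (imon v (j, i, e))"
  using filt_mult[OF low_full[OF YX_low[of j i]] S_full] low_full[OF YX_low[of j i]] by (simp add: imon_def)

lemma coef_commute: "coef m * v g = v g * coef m"
  unfolding pmon_def
  by (intro commute_prod_list) (auto intro!: power_commuting_commutes simp: zpar_def central split: param.split)

lemma coef_times: "zpar v x * coef m = coef (single x 1 + m)"
proof -
  have "zpar v x * zpar v y = zpar v y * zpar v x" for x y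
    unfolding zpar_def by (cases x; cases y; simp only: param.case; rule central)
  moreover have "coef (single x 1) = zpar v x"
    using pmap_var[of "zpar v"] three_cases
    by (cases x) (simp_all add: kp_def lp_def pmap_single scaleC_one)
  ultimately show ?thesis by (simp add: pmon_add)
qed

inductive sorted :: "bool \<Rightarrow> nat \<Rightarrow> 'a \<Rightarrow> bool" for b n where
  zero: "sorted b n 0"
| add: "sorted b n x \<Longrightarrow> sorted b n y \<Longrightarrow> sorted b n (x + y)"
| monomial: "pwt m + iwt (j, i, e) \<le> n \<Longrightarrow> (e \<Longrightarrow> b) \<Longrightarrow> sorted b n (c *\<^sub>C (coef m * imon v (j, i, e)))"

lemma sorted_mono: "sorted b m x \<Longrightarrow> m \<le> n \<Longrightarrow> sorted b n x"
  by (induction rule: sorted.induct) (auto intro: sorted.intros simp del: iwt.simps)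

lemma sorted_True: "sorted b n x \<Longrightarrow> sorted True n x"
  by (induction rule: sorted.induct) (auto intro: sorted.intros)

lemma sorted_scaleC: "sorted b n x \<Longrightarrow> sorted b n (c *\<^sub>C x)"
proof (induction rule: sorted.induct)
  case (monomial m j i e d)
  then show ?case using sorted.monomial[of m j i e n b "c * d"] by (simp add: scaleC_scaleC)
qed (auto simp: scaleC_add_right intro: sorted.intros)

lemma sorted_term: "pwt m + iwt (j, i, e) \<le> n \<Longrightarrow> (e \<Longrightarrow> b) \<Longrightarrow> sorted b n (coef m * imon v (j, i, e))"
  using sorted.monomial[of m j i e n b 1] by (simp add: scaleC_one)

lemma sorted_nf:
  assumes "sorted b n x"
  shows "\<exists>F. wle n F \<and> nf v F = x \<and> (\<not> b \<longrightarrow> (\<forall>j i. lookup F (j, i, True) = 0))"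
  using assms
proof (induction rule: sorted.induct)
  case zero
  show ?case by (rule exI[of _ 0]) (simp add: wle_zero nf_zero)
next
  case (add x y)
  then obtain F G where "wle n F" "nf v F = x" "\<not> b \<longrightarrow> (\<forall>j i. lookup F (j, i, True) = 0)"
    "wle n G" "nf v G = y" "\<not> b \<longrightarrow> (\<forall>j i. lookup G (j, i, True) = 0)" by blast
  then show ?case by (intro exI[of _ "F + G"]) (auto simp: wle_add nf_add lookup_add)
next
  case (monomial m j i e c)
  let ?F = "single (j, i, e) (single m c)"
  have "wle n ?F" unfolding wle_def using monomial by (auto simp: lookup_single when_def split: if_splits)
  moreover have "nf v ?F = c *\<^sub>C (coef m * imon v (j, i, e))"
    by (simp add: nf_single pmap_single mult_scaleC_left)
  ultimately show ?case using monomial by (intro exI[of _ ?F]) (auto simp: lookup_single when_def)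
qed

definition reduces :: "bool \<Rightarrow> nat \<Rightarrow> 'a \<Rightarrow> bool" where
  "reduces b n x \<longleftrightarrow> (\<exists>y r. sorted b n y \<and> lower n r \<and> x = y + r)"

lemma reducesI: "sorted b n y \<Longrightarrow> lower n r \<Longrightarrow> reduces b n (y + r)"
  unfolding reduces_def by blast

lemma reduces_sorted: "sorted b n y \<Longrightarrow> reduces b n y"
  using reducesI[of b n y 0] by (simp add: lower_zero)

lemma reduces_lower: "lower n r \<Longrightarrow> reduces b n r"
  using reducesI[OF sorted.zero] by simp

lemma reduces_add:
  assumes "reduces b n x" "reduces b n x'"
  shows "reduces b n (x + x')"
proof -
  obtain y r y' r' where "sorted b n y" "lower n r" "x = y + r" "sorted b n y'" "lower n r'" "x' = y' + r'"
    using assms unfolding reduces_def by blast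
  moreover have "y + r + (y' + r') = (y + y') + (r + r')" by simp
  ultimately show ?thesis using reducesI[OF sorted.add lower_add] by metis
qed

lemma reduces_scaleC: "reduces b n x \<Longrightarrow> reduces b n (c *\<^sub>C x)"
  unfolding reduces_def by (metis lower_scaleC scaleC_add_right sorted_scaleC)

lemma reduces_mono: "reduces b m x \<Longrightarrow> m \<le> n \<Longrightarrow> reduces b n x"
  unfolding reduces_def using sorted_mono lower_mono by blast


text \<open>Parameters are central and a further \<open>ZY\<close> belongs in front anyway. Only
  \<open>ZX\<close> has to pass a power of \<open>ZY\<close>, and that commutator has smaller
  weight.\<close>

lemma gen_times_term:
  assumes "g \<noteq> ZS" "pwt m + iwt (j, i, e) \<le> n" "e \<Longrightarrow> b"
  shows "reduces b (zwt g + n) (v g * (coef m * imon v (j, i, e)))"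
proof (cases g)
  case (ZK h)
  have "v g * (coef m * imon v (j, i, e)) = coef (single (Par_k h) 1 + m) * imon v (j, i, e)"
    using coef_times[of "Par_k h" m] by (simp add: ZK zpar_def mult.assoc[symmetric])
  then show ?thesis using assms sorted_term[of _ j i e _ b] pwt_single(1)[of h]
    by (auto intro!: reduces_sorted simp: ZK pwt_add)
next
  case (ZL h)
  have "v g * (coef m * imon v (j, i, e)) = coef (single (Par_l h) 1 + m) * imon v (j, i, e)"
    using coef_times[of "Par_l h" m] by (simp add: ZL zpar_def mult.assoc[symmetric])
  then show ?thesis using assms sorted_term[of _ j i e _ b] pwt_single(2)[of h]
    by (auto intro!: reduces_sorted simp: ZL pwt_add)
next
  case ZY
  have "v g * (coef m * imon v (j, i, e)) = coef m * (v ZY * imon v (j, i, e))"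
    using coef_commute[of m ZY] by (simp add: ZY mult.assoc[symmetric])
  also have "\<dots> = coef m * imon v (Suc j, i, e)" by (simp add: imon_def mult.assoc)
  finally show ?thesis using assms sorted_term[of m "Suc j" i e _ b] by (auto intro!: reduces_sorted simp: ZY)
next
  case ZX
  let ?s = "if e then v ZS else 1" and ?q = "pwt m + iwt (j, i, e)"
  have "v g * (coef m * imon v (j, i, e)) = coef m * (v ZX * imon v (j, i, e))"
    using coef_commute[of m ZX] by (simp add: ZX mult.assoc[symmetric])
  also have "v ZX * imon v (j, i, e) = imon v (j, Suc i, e)
      + (v ZX * v ZY ^ j - v ZY ^ j * v ZX) * imon v (0, i, e)"
    by (simp add: imon_def algebra_simps)
  finally have eq: "v g * (coef m * imon v (j, i, e)) = coef m * imon v (j, Suc i, e)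
      + coef m * ((v ZX * v ZY ^ j - v ZY ^ j * v ZX) * imon v (0, i, e))"
    by (simp only: distrib_left)
  have "full 3 (v ZX)" "full (4 * j) (v ZY ^ j)"
    using low_full[OF YX_low[of 0 1]] low_full[OF YX_low[of j 0]] by simp_all
  from lower_commutator[OF this]
  have "lower (pwt m + ((3 + 4 * j) + iwt (0, i, e))) (coef m * ((v ZX * v ZY ^ j - v ZY ^ j * v ZX) * imon v (0, i, e)))"
    by (intro lower_mult_left low_full[OF coef_low] lower_mult_right imon_full)
  then have "lower (zwt g + n) (coef m * ((v ZX * v ZY ^ j - v ZY ^ j * v ZX) * imon v (0, i, e)))"
    by (rule lower_mono) (use assms in \<open>simp add: ZX\<close>)
  moreover have "sorted b (zwt g + n) (coef m * imon v (j, Suc i, e))"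
    using assms by (intro sorted_term) (auto simp: ZX)
  ultimately show ?thesis unfolding eq by (intro reducesI)
qed (use assms in simp)

text \<open>The remainder is bounded in the full filtration only, since commuting \<open>ZX\<close>
  with \<open>ZY\<close> may bring in \<open>ZS\<close>.\<close>

lemma low_reduces: "low n x \<Longrightarrow> reduces False n x"
proof (induction rule: filt.induct)
  case one
  show ?case using sorted_term[of 0 0 0 False 0 False] by (auto intro!: reduces_sorted simp: pmon_zero imon_def pwt_def)
next
  case (mult n x g)
  obtain y r where x: "sorted False n y" "lower n r" "x = y + r"
    using mult.IH unfolding reduces_def by blast
  show ?case
  proof (cases "g = ZS")
    case True
    then show ?thesis by (simp add: reduces_sorted sorted.zero)
  next
    case False
    have "reduces False (zwt g + n) (v g * y)"
      using x(1)
    proof (induction rule: sorted.induct)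
      case (monomial m j i e c)
      have "reduces False (zwt g + n) (v g * (coef m * imon v (j, i, e)))"
        by (rule gen_times_term[OF False monomial(1)]) (use monomial(2) in auto)
      then show ?case using reduces_scaleC by (simp add: mult_scaleC_right)
    qed (auto simp: distrib_left intro: reduces_add reduces_sorted sorted.zero)
    moreover have "full (zwt g) (v g)" by (rule filt_gen)
    then have "reduces False (zwt g + n) (v g * r)"
      by (intro reduces_lower lower_mult_left x(2))
    ultimately show ?thesis using False by (simp add: x(3) distrib_left reduces_add)
  qed
qed (auto intro: reduces_scaleC reduces_add reduces_mono)

definition congruent :: "nat \<Rightarrow> 'a \<Rightarrow> bool" where
  "congruent n x \<longleftrightarrow> (\<exists>y. sorted True n y \<and> x - y \<in> I)"

lemma congruent_I: "congruent n x \<Longrightarrow> z - x \<in> I \<Longrightarrow> congruent n z"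
  unfolding congruent_def using I_add[of "z - x"] by (metis diff_add_cancel add_diff_eq)

lemma congruent_sorted: "sorted b n y \<Longrightarrow> congruent n y"
  unfolding congruent_def using sorted_True I_zero by (metis diff_self)

lemma congruent_add:
  assumes "congruent n x" "congruent n x'"
  shows "congruent n (x + x')"
proof -
  obtain y y' where y: "sorted True n y" "x - y \<in> I" "sorted True n y'" "x' - y' \<in> I"
    using assms unfolding congruent_def by blast
  have "x + x' - (y + y') \<in> I" using I_add[OF y(2,4)] by (simp add: algebra_simps)
  with y show ?thesis unfolding congruent_def by (blast intro: sorted.add)
qed

lemma congruent_scaleC: "congruent n x \<Longrightarrow> congruent n (c *\<^sub>C x)"
proof -
  assume "congruent n x"
  then obtain y where y: "sorted True n y" "x - y \<in> I" unfolding congruent_def by blast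
  have "c *\<^sub>C x - c *\<^sub>C y \<in> I"
    using I_mult_left[OF y(2), of "c *\<^sub>C 1"] by (simp add: mult_scaleC_left scaleC_diff_right)
  with y show ?thesis unfolding congruent_def by (blast intro: sorted_scaleC)
qed

lemma congruent_mono: "congruent m x \<Longrightarrow> m \<le> n \<Longrightarrow> congruent n x"
  unfolding congruent_def using sorted_mono by blast

text \<open>Remainders of lower weight are absorbed by the outer induction. A second factor
  \<open>v ZS\<close> is replaced by means of \<open>square\<close>, at the price of an element of
  \<open>I\<close>.\<close>

theorem full_congruent: "full n x \<Longrightarrow> congruent n x"
proof (induction n arbitrary: x rule: less_induct)
  case (less n)
  have lower: "congruent n r" if "lower n r" for r
    using that less.IH congruent_mono congruent_sorted[OF sorted.zero] unfolding lower_def by (metis less_imp_le)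
  have reduces: "congruent n x" if "reduces b n x" for b x
    using that lower congruent_sorted congruent_add unfolding reduces_def by blast
  have low: "congruent n x" if "low n x" for x
    by (rule reduces[OF low_reduces[OF that]])
  have low_S: "congruent n (x * v ZS)" if qx: "low q x" and qn: "q + 6 \<le> n" for q x
  proof -
    obtain y r where x: "sorted False q y" "lower q r" "x = y + r"
      using low_reduces[OF qx] unfolding reduces_def by blast
    have "sorted True (q + 6) (y * v ZS)"
      using x(1)
    proof (induction rule: sorted.induct)
      case (monomial m j i e c)
      then have e: "\<not> e" by blast
      then have "coef m * imon v (j, i, e) * v ZS = coef m * imon v (j, i, True)" by (simp add: imon_def mult.assoc)
      with e show ?case using monomial(1) sorted.monomial[of m j i True "q + 6" True c] by (simp add: mult_scaleC_left)
    qed (auto simp: distrib_right intro: sorted.intros)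
    then have "congruent n (y * v ZS)" using sorted_mono[OF _ qn] congruent_sorted by blast
    moreover have "congruent n (r * v ZS)"
      using lower lower_mono[OF lower_mult_right[OF x(2) S_full] qn] by blast
    ultimately show ?thesis by (simp add: x(3) distrib_right congruent_add)
  qed
  have S_term: "congruent n (v ZS * (coef m * imon v (j, i, e)))" if q: "6 + (pwt m + iwt (j, i, e)) \<le> n" for m j i e
  proof -
    let ?w = "v ZY ^ j * v ZX ^ i" and ?s = "if e then v ZS else 1"
    have "v ZS * (coef m * imon v (j, i, e)) = coef m * (v ZS * imon v (j, i, e))"
      using coef_commute[of m ZS] by (simp add: mult.assoc[symmetric])
    also have "v ZS * imon v (j, i, e) = ?w * (v ZS * ?s) + (v ZS * ?w - ?w * v ZS) * ?s"
      by (simp add: imon_def algebra_simps)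
    finally have eq: "v ZS * (coef m * imon v (j, i, e)) =
        coef m * (?w * (v ZS * ?s)) + coef m * ((v ZS * ?w - ?w * v ZS) * ?s)"
      by (simp only: distrib_left)
    have s: "full (iwt (0, 0, e)) ?s" using imon_full[of 0 0 e] by (simp add: imon_def)
    have "lower (pwt m + ((6 + (4 * j + 3 * i)) + iwt (0, 0, e))) (coef m * ((v ZS * ?w - ?w * v ZS) * ?s))"
      by (intro lower_mult_left low_full[OF coef_low] lower_mult_right s lower_commutator S_full low_full[OF YX_low])
    then have 1: "congruent n (coef m * ((v ZS * ?w - ?w * v ZS) * ?s))"
      by (rule lower[OF lower_mono]) (use q in simp)
    have "congruent n (coef m * (?w * (v ZS * ?s)))"
    proof (cases e)
      case False
      then show ?thesis using q congruent_sorted[OF sorted_term[of m j i True n True]] by (simp add: imon_def)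
    next
      case True
      obtain a b where ab: "low 12 a" "low 6 b" "v ZS * v ZS - (a + b * v ZS) \<in> I" using square by blast
      have w: "low (pwt m + (4 * j + 3 * i)) (coef m * ?w)" by (intro filt_mult coef_low YX_low)
      have "congruent n (coef m * ?w * a)"
        by (rule low, rule filt.mono[OF filt_mult[OF w ab(1)]]) (use q True in simp)
      moreover have "congruent n (coef m * ?w * b * v ZS)"
        by (rule low_S[OF filt_mult[OF w ab(2)]]) (use q True in simp)
      ultimately have sum: "congruent n (coef m * ?w * a + coef m * ?w * b * v ZS)" by (rule congruent_add)
      have diff: "coef m * (?w * (v ZS * ?s)) - (coef m * ?w * a + coef m * ?w * b * v ZS) =
          coef m * ?w * (v ZS * v ZS - (a + b * v ZS))"
        using True by (simp add: algebra_simps)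
      from sum show ?thesis
        by (rule congruent_I) (unfold diff, rule I_mult_left[OF ab(3)])
    qed
    from congruent_add[OF this 1] show ?thesis by (simp only: eq)
  qed
  have gen: "congruent n (v g * y)" if "sorted True m y" "zwt g + m \<le> n" for g m y
    using that(1)
  proof (induction rule: sorted.induct)
    case (monomial p j i e c)
    have "congruent n (v g * (coef p * imon v (j, i, e)))"
    proof (cases "g = ZS")
      case True
      then show ?thesis using S_term[of p j i e] monomial that(2) by simp
    next
      case False
      from gen_times_term[OF False monomial(1), of True] show ?thesis
        using reduces reduces_mono that(2) by blast
    qed
    then show ?case using congruent_scaleC by (simp add: mult_scaleC_right)
  qed (auto simp: distrib_left intro: congruent_add congruent_sorted sorted.zero)
  have "congruent n x" if "full m x" "m \<le> n" for m x
    using that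
  proof (induction rule: filt.induct)
    case one
    show ?case using sorted_term[of 0 0 0 False n True] congruent_sorted
      by (auto simp: pmon_zero imon_def pwt_def)
  next
    case (mult k x g)
    have "0 < zwt g" by (cases g) auto
    then have "k < n" using mult.prems by linarith
    then obtain y where y: "sorted True k y" "x - y \<in> I"
      using less.IH mult.hyps unfolding congruent_def by blast
    have "v g * x - v g * y \<in> I" using I_mult_left[OF y(2), of "v g"] by (simp add: right_diff_distrib)
    with gen[OF y(1) mult.prems] show ?case by (rule congruent_I)
  qed (auto intro: congruent_scaleC congruent_add)
  with less.prems show ?case by blast
qed

theorem normal_form: "full n x \<Longrightarrow> \<exists>F. wle n F \<and> x - nf v F \<in> I"
  using full_congruent[of n x] sorted_nf[of True n] unfolding congruent_def by metis

end

section \<open>Independence of the normal forms\<close>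

text \<open>The products are Newton polynomials in \<open>c\<close>, monic of degree
  \<open>j\<close>. A combination that vanishes outside a finite set is the zero polynomial, and the
  coefficients are read off from the top degree downwards.\<close>

lemma newton_basis_zero:
  fixes b :: "nat \<Rightarrow> complex"
  assumes fin: "finite R" and zero: "\<And>c. c \<notin> R \<Longrightarrow> (\<Sum>j\<le>n. b j * (\<Prod>k<j. c + d + s * of_nat k)) = 0"
  shows "j \<le> n \<Longrightarrow> b j = 0"
proof -
  define q where "q j = (\<Prod>k<j. [:d + s * of_nat k, 1:] :: complex poly)" for j
  have deg: "degree (q j) = j" and lead: "coeff (q j) j = 1" for j
  proof -
    show d: "degree (q j) = j"
      unfolding q_def by (subst degree_prod_eq_sum_degree) auto
    have "lead_coeff (q j) = 1" unfolding q_def lead_coeff_prod by simp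
    then show "coeff (q j) j = 1" by (simp add: d)
  qed
  have poly_q: "poly (q j) c = (\<Prod>k<j. c + d + s * of_nat k)" for j c
    by (simp add: q_def poly_prod algebra_simps)
  have "(\<Sum>j\<le>n. smult (b j) (q j)) = 0"
  proof (rule ccontr)
    assume "(\<Sum>j\<le>n. smult (b j) (q j)) \<noteq> 0"
    then have "finite {c. poly (\<Sum>j\<le>n. smult (b j) (q j)) c = 0}" by (rule poly_roots_finite)
    moreover have "- R \<subseteq> {c. poly (\<Sum>j\<le>n. smult (b j) (q j)) c = 0}"
      using zero by (auto simp: poly_sum poly_q)
    ultimately have "finite (- R)" by (rule rev_finite_subset)
    with fin have "finite (UNIV :: complex set)" by (metis Compl_partition finite_Un)
    then show False using infinite_UNIV_char_0 by blast
  qed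
  then show "j \<le> n \<Longrightarrow> b j = 0"
  proof (induction n arbitrary: j)
    case 0
    then show ?case using lead[of 0] by auto
  next
    case (Suc n)
    have "0 = coeff (\<Sum>j\<le>Suc n. smult (b j) (q j)) (Suc n)" using Suc.prems by (simp only: coeff_0)
    also have "\<dots> = (\<Sum>j\<le>n. b j * coeff (q j) (Suc n)) + b (Suc n)"
      by (simp add: coeff_sum lead)
    also have "(\<Sum>j\<le>n. b j * coeff (q j) (Suc n)) = 0"
      by (rule sum.neutral) (auto simp: coeff_eq_0 deg)
    finally have top: "b (Suc n) = 0" by simp
    then have "(\<Sum>j\<le>n. smult (b j) (q j)) = 0" using Suc.prems by simp
    with top show ?case using Suc.IH[of j] Suc.prems by (cases "j = Suc n") auto
  qed
qed

text \<open>The extreme coefficient, in the direction of \<open>s\<close>, of a difference operator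
  with shifts of length at most \<open>n\<close>. Testing on functions that vanish on the rest of
  the window avoids a chosen expansion into shifts.\<close>

definition leads :: "int \<Rightarrow> nat \<Rightarrow> ((complex \<Rightarrow> complex) \<Rightarrow> complex \<Rightarrow> complex) \<Rightarrow> (complex \<Rightarrow> complex) \<Rightarrow> bool" where
  "leads s n T t \<longleftrightarrow> (\<forall>g c. (\<forall>m. - int n \<le> m \<and> m < int n \<longrightarrow> g (c + of_int (s * m)) = 0) \<longrightarrow>
    T g c = t c * g (c + of_int (s * int n)))"

lemma leadsD:
  "leads s n T t \<Longrightarrow> (\<And>m. - int n \<le> m \<Longrightarrow> m < int n \<Longrightarrow> g (c + of_int (s * m)) = 0) \<Longrightarrow>
    T g c = t c * g (c + of_int (s * int n))"
  unfolding leads_def by blast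

lemma leads_comp:
  assumes S: "leads s m S f" and T: "leads s n T t"
  shows "leads s (m + n) (\<lambda>g. S (T g)) (\<lambda>c. f c * t (c + of_int (s * int m)))"
  unfolding leads_def
proof (intro allI impI)
  fix g :: "complex \<Rightarrow> complex" and c :: complex
  assume g: "\<forall>k. - int (m + n) \<le> k \<and> k < int (m + n) \<longrightarrow> g (c + of_int (s * k)) = 0"
  have Tg: "T g (c + of_int (s * k)) = t (c + of_int (s * k)) * g (c + of_int (s * (k + int n)))"
    if "- int m \<le> k" "k \<le> int m" for k
  proof -
    have "g (c + of_int (s * k) + of_int (s * l)) = 0" if "- int n \<le> l" "l < int n" for l
      using g[rule_format, of "k + l"] that \<open>- int m \<le> k\<close> \<open>k \<le> int m\<close> by (simp add: algebra_simps)
    from leadsD[OF T, of g "c + of_int (s * k)", OF this] show ?thesis by (simp add: algebra_simps)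
  qed
  have "T g (c + of_int (s * k)) = 0" if "- int m \<le> k" "k < int m" for k
    using Tg[of k] g[rule_format, of "k + int n"] that by simp
  from leadsD[OF S, of "T g" c, OF this] have "S (T g) c = f c * T g (c + of_int (s * int m))" by simp
  then show "S (T g) c = f c * t (c + of_int (s * int m)) * g (c + of_int (s * int (m + n)))"
    using Tg[of "int m"] by simp
qed

lemma leads_lower:
  assumes "leads s m T t" "m < n"
  shows "leads s n T (\<lambda>c. 0)"
  unfolding leads_def
proof (intro allI impI)
  fix g :: "complex \<Rightarrow> complex" and c :: complex
  assume g: "\<forall>k. - int n \<le> k \<and> k < int n \<longrightarrow> g (c + of_int (s * k)) = 0"
  have "T g c = t c * g (c + of_int (s * int m))"
    by (rule leadsD[OF assms(1)]) (use g assms(2) in auto)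
  then show "T g c = 0 * g (c + of_int (s * int n))" using g[rule_format, of "int m"] assms(2) by simp
qed

lemma leads_sum:
  assumes "\<And>k. k \<in> A \<Longrightarrow> leads s n (T k) (t k)"
  shows "leads s n (\<lambda>g c. \<Sum>k\<in>A. a k * T k g c) (\<lambda>c. \<Sum>k\<in>A. a k * t k c)"
  using assms unfolding leads_def by (simp add: sum_distrib_right mult.assoc)

lemma leads_coeff:
  assumes T: "leads s n T t" and s: "s \<noteq> 0"
  shows "t c = T (\<lambda>x. if x = c + of_int (s * int n) then 1 else 0) c"
proof -
  define g where "g x = (if x = c + of_int (s * int n) then 1 else 0 :: complex)" for x
  have "g (c + of_int (s * m)) = 0" if "m < int n" for m
    unfolding g_def using that s by (simp only: add_left_cancel of_int_eq_iff) simp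
  then show ?thesis using leadsD[OF T, of g c] by (simp add: g_def[abs_def])
qed

definition zvalZ :: "zgen \<Rightarrow> U2" where
  "zvalZ g = (if g = ZS then Z_elem else zval g)"

section \<open>Extreme coefficients of words in \<open>X\<close>, \<open>Y\<close>,
  \<open>Z\<close>\<close>

context line
begin

definition xs :: "int \<Rightarrow> complex \<Rightarrow> complex" where
  "xs sg = (if sg = 1 then ga else al)"

definition ys :: "int \<Rightarrow> complex \<Rightarrow> complex" where
  "ys sg = (if sg = 1 then L2 else L1)"

definition Gam :: "int \<Rightarrow> nat \<Rightarrow> complex \<Rightarrow> complex" where
  "Gam sg n c = (\<Prod>k<n. xs sg (c + of_int sg * of_nat k))"

definition Lam :: "int \<Rightarrow> nat \<Rightarrow> complex \<Rightarrow> complex" where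
  "Lam sg n c = (\<Prod>k<n. ys sg (c + of_int sg * of_nat k))"

lemma Gam_add: "Gam sg (m + n) c = Gam sg m c * Gam sg n (c + of_int sg * of_nat m)"
  by (induction n) (simp_all add: Gam_def algebra_simps)

lemma ys_shift: "sg = 1 \<or> sg = -1 \<Longrightarrow> ys sg (c + of_int sg) = ys sg c + of_int sg"
  by (auto simp: ys_def L1_def L2_def)

lemma leads_X: "sg = 1 \<or> sg = -1 \<Longrightarrow> leads sg 1 opX (xs sg)"
proof -
  have "opX g c = xs sg c * g (c + of_int sg)" if "sg = 1 \<or> sg = -1" "\<forall>m. -1 \<le> m \<and> m < 1 \<longrightarrow> g (c + of_int (sg * m)) = 0" for g c
    using that(1) that(2)[rule_format, of "-1"] that(2)[rule_format, of 0] by (auto simp: opX_def xs_def)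
  then show "sg = 1 \<or> sg = -1 \<Longrightarrow> leads sg 1 opX (xs sg)" unfolding leads_def by simp
qed

lemma leads_Y: "sg = 1 \<or> sg = -1 \<Longrightarrow> leads sg 1 opY (\<lambda>c. xs sg c * ys sg c)"
proof -
  have "opY g c = xs sg c * ys sg c * g (c + of_int sg)"
    if "sg = 1 \<or> sg = -1" "\<forall>m. -1 \<le> m \<and> m < 1 \<longrightarrow> g (c + of_int (sg * m)) = 0" for g c
    using that(1) that(2)[rule_format, of "-1"] that(2)[rule_format, of 0] by (auto simp: opY_def xs_def ys_def)
  then show "sg = 1 \<or> sg = -1 \<Longrightarrow> leads sg 1 opY (\<lambda>c. xs sg c * ys sg c)" unfolding leads_def by simp
qed

text \<open>The extreme coefficients of \<open>X Y\<close> and \<open>Y X\<close> differ only in the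
  place where the linear factor \<open>ys\<close> is evaluated, and one step changes
  \<open>ys\<close> by \<open>sg\<close>. The resulting sign distinguishes \<open>Z\<close> from
  words in \<open>X\<close> and \<open>Y\<close> alone.\<close>

lemma leads_Z:
  assumes sg: "sg = 1 \<or> sg = -1"
  shows "leads sg 2 opZ (\<lambda>c. of_int sg * Gam sg 2 c)"
proof -
  have XY: "leads sg 2 (\<lambda>g. opX (opY g)) (\<lambda>c. xs sg c * (xs sg (c + of_int sg) * ys sg (c + of_int sg)))"
    using leads_comp[OF leads_X[OF sg] leads_Y[OF sg]] by (simp add: numeral_2_eq_2)
  have YX: "leads sg 2 (\<lambda>g. opY (opX g)) (\<lambda>c. xs sg c * ys sg c * xs sg (c + of_int sg))"
    using leads_comp[OF leads_Y[OF sg] leads_X[OF sg]] by (simp add: numeral_2_eq_2)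
  show ?thesis
    unfolding leads_def
  proof (intro allI impI)
    fix g :: "complex \<Rightarrow> complex" and c :: complex
    assume g: "\<forall>m. - int 2 \<le> m \<and> m < int 2 \<longrightarrow> g (c + of_int (sg * m)) = 0"
    have "opZ g c = xs sg c * (xs sg (c + of_int sg) * ys sg (c + of_int sg)) * g (c + of_int (sg * int 2))
        - xs sg c * ys sg c * xs sg (c + of_int sg) * g (c + of_int (sg * int 2))"
      unfolding opZ_def using leadsD[OF XY, of g c] leadsD[OF YX, of g c] g by simp
    then show "opZ g c = of_int sg * Gam sg 2 c * g (c + of_int (sg * int 2))"
      by (simp add: ys_shift[OF sg] Gam_def numeral_2_eq_2 algebra_simps)
  qed
qed

fun opW :: "nf_index \<Rightarrow> (complex \<Rightarrow> complex) \<Rightarrow> complex \<Rightarrow> complex" where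
  "opW (j, i, e) = (\<lambda>g. (opY ^^ j) ((opX ^^ i) (if e then opZ g else g)))"

fun width :: "nf_index \<Rightarrow> nat" where
  "width (j, i, e) = j + i + (if e then 2 else 0)"

lemma leads_id: "leads sg 0 (\<lambda>g. g) (\<lambda>c. 1)"
  by (simp add: leads_def)

lemma leads_X_pow:
  assumes sg: "sg = 1 \<or> sg = -1"
  shows "leads sg i (opX ^^ i) (Gam sg i)"
proof (induction i)
  case 0
  show ?case using leads_id[of sg] by (simp add: Gam_def id_def)
next
  case (Suc i)
  have "leads sg (1 + i) (\<lambda>g. opX ((opX ^^ i) g)) (\<lambda>c. xs sg c * Gam sg i (c + of_int (sg * int 1)))"
    by (rule leads_comp[OF leads_X[OF sg] Suc])
  moreover have "(\<lambda>c. xs sg c * Gam sg i (c + of_int (sg * int 1))) = Gam sg (Suc i)"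
    using Gam_add[of sg 1 i] by (simp add: Gam_def fun_eq_iff)
  ultimately show ?case by (simp add: o_def)
qed

lemma leads_Y_pow:
  assumes sg: "sg = 1 \<or> sg = -1"
  shows "leads sg j (opY ^^ j) (\<lambda>c. Gam sg j c * Lam sg j c)"
proof (induction j)
  case 0
  show ?case using leads_id[of sg] by (simp add: Gam_def Lam_def id_def)
next
  case (Suc j)
  have "leads sg (1 + j) (\<lambda>g. opY ((opY ^^ j) g)) (\<lambda>c. xs sg c * ys sg c * (Gam sg j (c + of_int (sg * int 1)) * Lam sg j (c + of_int (sg * int 1))))"
    by (rule leads_comp[OF leads_Y[OF sg] Suc])
  moreover have "(\<lambda>c. xs sg c * ys sg c * (Gam sg j (c + of_int (sg * int 1)) * Lam sg j (c + of_int (sg * int 1)))) =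
      (\<lambda>c. Gam sg (Suc j) c * Lam sg (Suc j) c)"
    unfolding Gam_def Lam_def prod.lessThan_Suc_shift by (simp add: fun_eq_iff algebra_simps)
  ultimately show ?case by (simp add: o_def)
qed

lemma leads_W:
  assumes sg: "sg = 1 \<or> sg = -1"
  shows "leads sg (width (j, i, e)) (opW (j, i, e))
    (\<lambda>c. Gam sg (width (j, i, e)) c * Lam sg j c * (if e then of_int sg else 1))"
proof -
  have "leads sg (if e then 2 else 0) (\<lambda>g. if e then opZ g else g) (\<lambda>c. (if e then of_int sg else 1) * Gam sg (if e then 2 else 0) c)"
    using leads_Z[OF sg] leads_id[of sg] by (auto simp: Gam_def)
  from leads_comp[OF leads_X_pow[OF sg, of i] this]
  have "leads sg (i + (if e then 2 else 0)) (\<lambda>g. (opX ^^ i) (if e then opZ g else g))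
      (\<lambda>c. (if e then of_int sg else 1) * Gam sg (i + (if e then 2 else 0)) c)"
    by (simp add: Gam_add mult_ac)
  from leads_comp[OF leads_Y_pow[OF sg, of j] this]
  show ?thesis by (simp only: opW.simps width.simps add.assoc Gam_add[of sg j]) (simp add: mult_ac)
qed

lemma finite_Gam_zero: "finite {c. Gam sg n c = 0}"
proof -
  have "c = A \<or> c = M \<or> c = - (P + u + r + 2)" if "ga c = 0" for c
    using that unfolding ga_def mult_eq_0_iff
    by (simp only: eq_neg_iff_add_eq_0 add.assoc right_minus_eq) auto
  moreover have "c = 0 \<or> c = - u \<or> c = Q + M + 2" if "al c = 0" for c
    using that unfolding al_def mult_eq_0_iff
    by (simp only: eq_neg_iff_add_eq_0 diff_diff_add right_minus_eq) auto
  ultimately have "{c. xs sg c = 0} \<subseteq> {A, M, - (P + u + r + 2), 0, - u, Q + M + 2}"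
    by (auto simp: xs_def)
  then have fin: "finite {c. xs sg c = 0}" by (rule finite_subset) simp
  have "{c. Gam sg n c = 0} \<subseteq> (\<Union>k<n. (\<lambda>c. c - of_int sg * of_nat k) ` {c. xs sg c = 0})"
  proof
    fix c assume "c \<in> {c. Gam sg n c = 0}"
    then obtain k where k: "k < n" "xs sg (c + of_int sg * of_nat k) = 0" by (auto simp: Gam_def)
    then have "c \<in> (\<lambda>c. c - of_int sg * of_nat k) ` {c. xs sg c = 0}"
      by (intro image_eqI[of _ _ "c + of_int sg * of_nat k"]) auto
    with k show "c \<in> (\<Union>k<n. (\<lambda>c. c - of_int sg * of_nat k) ` {c. xs sg c = 0})" by blast
  qed
  then show ?thesis by (rule finite_subset) (use fin in auto)
qed

definition pv :: "param \<Rightarrow> complex" where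
  "pv x = (case x of Par_k i \<Rightarrow> kv i | Par_l i \<Rightarrow> lv i)"

lemma acts_power: "acts z T \<Longrightarrow> acts (z ^ n) (T ^^ n)"
proof (induction n)
  case (Suc n)
  then show ?case using acts_mult[of z T "z ^ n" "T ^^ n"] by (simp add: o_def)
qed (use acts_one in \<open>simp add: id_def\<close>)

lemma acts_zero: "acts 0 (\<lambda>g c. 0)"
  using acts_scaleC[OF acts_one, of 0] by simp

lemma acts_sum: "(\<And>i. i \<in> S \<Longrightarrow> acts (z i) (T i)) \<Longrightarrow> acts (sum z S) (\<lambda>g c. \<Sum>i\<in>S. T i g c)"
proof (induction S rule: infinite_finite_induct)
  case (insert i S)
  then have "acts (z i + sum z S) (\<lambda>g c. T i g c + (\<Sum>i\<in>S. T i g c))" by (intro acts_add) auto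
  with insert show ?case by simp
qed (simp_all add: acts_zero)

lemma acts_pmap: "acts (pmap (zpar zvalZ) p) (\<lambda>g c. pmap pv p * g c)"
proof -
  have var: "acts (zpar zvalZ x) (\<lambda>g c. pv x * g c)" for x
    using acts_kU acts_lU by (cases x) (auto simp: zpar_def zvalZ_def pv_def)
  have pow: "acts (zpar zvalZ x ^ n) (\<lambda>g c. pv x ^ n * g c)" for x n
  proof -
    have eq: "((\<lambda>g c. pv x * g c) ^^ n) = (\<lambda>g c. pv x ^ n * g c)" by (induction n) (auto simp: fun_eq_iff)
    show ?thesis using acts_power[OF var[of x], of n] unfolding eq .
  qed
  have prod: "acts (prod_list (map (\<lambda>x. zpar zvalZ x ^ f x) xs)) (\<lambda>g c. prod_list (map (\<lambda>x. pv x ^ f x) xs) * g c)" for f xs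
  proof (induction xs)
    case (Cons x xs)
    from acts_mult[OF pow[of x "f x"] Cons] show ?case by (simp add: mult.assoc)
  qed (simp add: acts_one)
  have mon: "acts (pmon (zpar zvalZ) m) (\<lambda>g c. pmon pv m * g c)" for m
    unfolding pmon_def by (rule prod)
  have "acts (\<Sum>m\<in>keys p. lookup p m *\<^sub>C pmon (zpar zvalZ) m)
      (\<lambda>g c. \<Sum>m\<in>keys p. lookup p m * (pmon pv m * g c))"
    by (intro acts_sum acts_scaleC mon)
  moreover have eq: "(\<lambda>g c. \<Sum>m\<in>keys p. lookup p m * (pmon pv m * g c)) = (\<lambda>g c. pmap pv p * g c)"
    by (simp add: pmap_def fun_eq_iff sum_distrib_right scaleC_complex_def mult.assoc)
  ultimately show ?thesis unfolding eq pmap_def[of "zpar zvalZ", symmetric] by simp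
qed

lemma acts_imon: "acts (imon zvalZ (j, i, e)) (opW (j, i, e))"
proof -
  have "acts (if e then Z_elem else 1) (\<lambda>g. if e then opZ g else g)"
    using acts_Z acts_one by (cases e) (simp_all add: opZ_def[abs_def])
  from acts_mult[OF acts_mult[OF acts_power[OF acts_Y, of j] acts_power[OF acts_X, of i]] this]
  show ?thesis by (cases e) (simp_all add: imon_def zvalZ_def)
qed

lemma acts_nf: "acts (nf zvalZ F) (\<lambda>g c. \<Sum>k\<in>keys F. pmap pv (lookup F k) * opW k g c)"
proof -
  have "acts (pmap (zpar zvalZ) p * imon zvalZ k) (\<lambda>g c. pmap pv p * opW k g c)" for p k
    using acts_mult[OF acts_pmap acts_imon] by (cases k) auto
  then show ?thesis unfolding nf_def by (intro acts_sum)
qed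

text \<open>A weak form of acting without shifts: extreme coefficients at positive distance vanish
  wherever \<open>Gam\<close> does not. It is general enough to include \<open>Omega_U2\<close>, for
  which commutation with \<open>X\<close> and \<open>Y\<close> is used instead of a direct
  computation.\<close>

definition slight :: "((complex \<Rightarrow> complex) \<Rightarrow> complex \<Rightarrow> complex) \<Rightarrow> bool" where
  "slight T \<longleftrightarrow> (\<forall>sg N t c. (sg = 1 \<or> sg = -1) \<and> 0 < N \<and> leads sg N T t \<and> Gam sg (Suc N) c \<noteq> 0 \<longrightarrow> t c = 0)"

lemma slight_diagonal:
  assumes diag: "\<And>g c. g c = 0 \<Longrightarrow> T g c = 0"
  shows "slight T"
  unfolding slight_def
proof (intro allI impI)
  fix sg N t c assume *: "(sg = 1 \<or> sg = -1) \<and> 0 < N \<and> leads sg N T t \<and> Gam sg (Suc N) c \<noteq> 0"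
  then have "t c = T (\<lambda>x. if x = c + of_int (sg * int N) then 1 else 0) c" by (intro leads_coeff) auto
  also have "\<dots> = 0" using * by (intro diag) auto
  finally show "t c = 0" .
qed

text \<open>Commutation with \<open>X\<close> yields
  \<open>xs sg c * t (c + sg) = t c * xs sg d\<close> with \<open>d = c + sg * N\<close>;
  commutation with \<open>Y\<close> yields the same with the further factors \<open>ys sg c\<close>
  and \<open>ys sg d\<close>. These two differ by \<open>sg * N\<close>, which is not zero, so
  \<open>t c\<close> vanishes.\<close>

lemma slight_commute:
  assumes X: "\<And>g c. opX (T g) c = T (opX g) c" and Y: "\<And>g c. opY (T g) c = T (opY g) c"
  shows "slight T"
  unfolding slight_def
proof (intro allI impI)
  fix sg N t c assume *: "(sg = 1 \<or> sg = -1) \<and> 0 < N \<and> leads sg N T t \<and> Gam sg (Suc N) c \<noteq> 0"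
  then have sg: "sg = 1 \<or> sg = -1" and T: "leads sg N T t" and N: "0 < N" by blast+
  have unique: "f c = h c" if "leads sg n S f" "leads sg n S h" for S f h n
    using leads_coeff[OF that(1)] leads_coeff[OF that(2)] sg by auto
  have eqX: "(\<lambda>g. T (opX g)) = (\<lambda>g. opX (T g))" and eqY: "(\<lambda>g. T (opY g)) = (\<lambda>g. opY (T g))"
    by (simp_all add: fun_eq_iff X Y)
  let ?d = "c + of_int (sg * int N)"
  have "leads sg (1 + N) (\<lambda>g. opX (T g)) (\<lambda>c. xs sg c * t (c + of_int (sg * int 1)))"
    "leads sg (1 + N) (\<lambda>g. opX (T g)) (\<lambda>c. t c * xs sg (c + of_int (sg * int N)))"
    using leads_comp[OF leads_X[OF sg] T] leads_comp[OF T leads_X[OF sg]] unfolding eqX by (simp_all only: add.commute)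
  from unique[OF this] have x: "xs sg c * t (c + of_int sg) = t c * xs sg ?d" by simp
  have "leads sg (1 + N) (\<lambda>g. opY (T g)) (\<lambda>c. xs sg c * ys sg c * t (c + of_int (sg * int 1)))"
    "leads sg (1 + N) (\<lambda>g. opY (T g)) (\<lambda>c. t c * (xs sg (c + of_int (sg * int N)) * ys sg (c + of_int (sg * int N))))"
    using leads_comp[OF leads_Y[OF sg] T] leads_comp[OF T leads_Y[OF sg]] unfolding eqY by (simp_all only: add.commute)
  from unique[OF this] have y: "xs sg c * ys sg c * t (c + of_int sg) = t c * (xs sg ?d * ys sg ?d)" by simp
  have ysd: "ys sg ?d = ys sg c + of_int (sg * int N)"
    using sg by (auto simp: ys_def L1_def L2_def)
  then have "t c * xs sg ?d * (ys sg c + of_int (sg * int N)) = xs sg c * ys sg c * t (c + of_int sg)"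
    unfolding y by (simp only: mult.assoc)
  also have "\<dots> = (xs sg c * t (c + of_int sg)) * ys sg c" by (simp only: mult_ac)
  finally have "t c * xs sg ?d * of_int (sg * int N) = 0" unfolding x distrib_left by simp
  moreover have "xs sg ?d \<noteq> 0" using * by (auto simp: Gam_def)
  ultimately show "t c = 0" using N sg by auto
qed

text \<open>Among the terms with nonzero coefficient those of maximal width \<open>N\<close> give
  the extreme coefficient, a combination of the Newton polynomials \<open>Lam\<close>. The
  directions 1 and -1 give the sum and the difference of the coefficients without and with
  \<open>Z\<close>, so both vanish.\<close>

theorem nf_slight:
  assumes acts: "acts (nf zvalZ F) T" and slight: "slight T" and k: "k \<noteq> (0, 0, False)"
  shows "pmap pv (lookup F k) = 0"
proof (rule ccontr)
  assume nz: "pmap pv (lookup F k) \<noteq> 0"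
  define a where "a k = pmap pv (lookup F k)" for k
  define K where "K = {k \<in> keys F. a k \<noteq> 0}"
  define N where "N = Max (width ` K)"
  have kK: "k \<in> K" using nz by (auto simp: K_def a_def in_keys_iff pmap_zero)
  have K_fin: "finite K" by (simp add: K_def)
  then have le: "width k \<le> N" if "k \<in> K" for k using that by (simp add: N_def)
  have "0 < width k" using k by (cases k) auto
  with le[OF kK] have N: "0 < N" by simp
  have "N \<in> width ` K" unfolding N_def using K_fin kK by (intro Max_in) auto
  then obtain j0 i0 e0 where k0: "(j0, i0, e0) \<in> K" "width (j0, i0, e0) = N" by auto
  \<comment> \<open>For given \<open>j\<close> there are at most two words of width
    \<open>N\<close>, one without and one with \<open>Z\<close>; the latter contributes with the
    sign of the direction.\<close>
  define b where "b sg j = a (j, N - j, False) + (if j + 2 \<le> N then sg * a (j, N - 2 - j, True) else 0)" for sg j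
  have b0: "b (of_int sg) j = 0" if sg: "sg = 1 \<or> sg = -1" and j: "j \<le> N" for sg :: int and j
  proof (rule newton_basis_zero[where n = N and b = "\<lambda>j. b (of_int sg) j" and d = "ys sg 0" and s = "of_int sg",
        OF finite_Gam_zero[of sg "Suc N"] _ j])
    fix c assume "c \<notin> {c. Gam sg (Suc N) c = 0}"
    then have G': "Gam sg (Suc N) c \<noteq> 0" by simp
    then have G: "Gam sg N c \<noteq> 0" by (simp add: Gam_def)
    define t where "t k c = (case k of (j, i, e) \<Rightarrow> if width (j, i, e) = N then Gam sg N c * Lam sg j c * (if e then of_int sg else 1) else 0)" for k c
    have lead_k: "leads sg N (opW k) (t k)" if "k \<in> K" for k
    proof -
      obtain j i e where k: "k = (j, i, e)" by (cases k)
      show ?thesis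
        using leads_W[OF sg, of j i e] leads_lower[OF leads_W[OF sg, of j i e], of N] le[OF that]
        unfolding k t_def by (cases "width (j, i, e) = N") auto
    qed
    have "leads sg N (\<lambda>g c. \<Sum>k\<in>K. a k * opW k g c) (\<lambda>c. \<Sum>k\<in>K. a k * t k c)"
      by (rule leads_sum[OF lead_k])
    moreover have "T g c = (\<Sum>k\<in>K. a k * opW k g c)" for g c
    proof -
      have "T g c = (\<Sum>k\<in>keys F. a k * opW k g c)"
        unfolding a_def by (rule acts_unique[OF acts acts_nf])
      also have "\<dots> = (\<Sum>k\<in>K. a k * opW k g c)" unfolding K_def by (rule sum.mono_neutral_right) auto
      finally show ?thesis .
    qed
    ultimately have "leads sg N T (\<lambda>c. \<Sum>k\<in>K. a k * t k c)" by (simp add: leads_def)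
    then have "(\<Sum>k\<in>K. a k * t k c) = 0"
      using slight sg N G' unfolding slight_def by blast
    also have "(\<Sum>k\<in>K. a k * t k c) = (\<Sum>k \<in> (\<lambda>j. (j, N - j, False)) ` {..N} \<union> (\<lambda>j. (j, N - 2 - j, True)) ` {j. j + 2 \<le> N}. a k * t k c)"
    proof (rule sum.mono_neutral_cong)
      have "finite {j. j + 2 \<le> N}" by (rule finite_subset[of _ "{..N}"]) auto
      then show "finite ((\<lambda>j. (j, N - j, False)) ` {..N} \<union> (\<lambda>j. (j, N - 2 - j, True)) ` {j. j + 2 \<le> N})"
        by (intro finite_UnI finite_imageI) auto
      show "a k * t k c = 0" if "k \<in> K - ((\<lambda>j. (j, N - j, False)) ` {..N} \<union> (\<lambda>j. (j, N - 2 - j, True)) ` {j. j + 2 \<le> N})" for k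
      proof -
        obtain j i e where k: "k = (j, i, e)" by (cases k)
        have "width (j, i, e) \<noteq> N"
          using that by (cases e) (auto simp: k image_iff)
        then show ?thesis by (simp add: k t_def)
      qed
      show "a k * t k c = 0" if "k \<in> ((\<lambda>j. (j, N - j, False)) ` {..N} \<union> (\<lambda>j. (j, N - 2 - j, True)) ` {j. j + 2 \<le> N}) - K" for k
        using that by (auto simp: K_def a_def in_keys_iff pmap_zero)
    qed (use K_fin in auto)
    also have "\<dots> = (\<Sum>j\<le>N. a (j, N - j, False) * t (j, N - j, False) c) + (\<Sum>j | j + 2 \<le> N. a (j, N - 2 - j, True) * t (j, N - 2 - j, True) c)"
    proof -
      have fin2: "finite {j. j + 2 \<le> N}" by (rule finite_subset[of _ "{..N}"]) auto
      show ?thesis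
        by (subst sum.union_disjoint[OF finite_imageI finite_imageI[OF fin2]]) (auto simp: sum.reindex inj_on_def)
    qed
    also have "(\<Sum>j | j + 2 \<le> N. a (j, N - 2 - j, True) * t (j, N - 2 - j, True) c) =
        (\<Sum>j\<le>N. if j + 2 \<le> N then a (j, N - 2 - j, True) * t (j, N - 2 - j, True) c else 0)"
      by (rule sum.mono_neutral_cong_left) auto
    also have "(\<Sum>j\<le>N. a (j, N - j, False) * t (j, N - j, False) c) + \<dots> =
        (\<Sum>j\<le>N. Gam sg N c * (b (of_int sg) j * Lam sg j c))"
      unfolding sum.distrib[symmetric] by (rule sum.cong) (auto simp: t_def b_def algebra_simps)
    also have "\<dots> = Gam sg N c * (\<Sum>j\<le>N. b (of_int sg) j * Lam sg j c)"
      by (simp add: sum_distrib_left)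
    finally have "Gam sg N c * (\<Sum>j\<le>N. b (of_int sg) j * Lam sg j c) = 0" .
    moreover have "Lam sg j c = (\<Prod>k<j. c + ys sg 0 + of_int sg * of_nat k)" for j
      unfolding Lam_def ys_def by (rule prod.cong) (auto simp: L1_def L2_def)
    ultimately show "(\<Sum>j\<le>N. b (of_int sg) j * (\<Prod>k<j. c + ys sg 0 + of_int sg * of_nat k)) = 0"
      using G by simp
  qed
  have "a (j0, i0, e0) = 0"
  proof (cases e0)
    case False
    then have "i0 = N - j0" "j0 \<le> N" using k0(2) by auto
    then show ?thesis using b0[of 1 j0] b0[of "-1" j0] False by (auto simp: b_def split: if_splits)
  next
    case True
    then have "i0 = N - 2 - j0" "j0 + 2 \<le> N" using k0(2) by auto
    then show ?thesis using b0[of 1 j0] b0[of "-1" j0] True by (auto simp: b_def)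
  qed
  then show False using k0(1) by (simp add: K_def)
qed

end

section \<open>Polynomials in the parameters and realisation of all their values\<close>

lemma base_digit:
  fixes a B x y b :: nat
  assumes "a + B * x = b + B * y" "a < B" "b < B"
  shows "a = b \<and> x = y"
proof -
  have "(a + B * x) mod B = a" "(b + B * y) mod B = b" using assms(2,3) by simp_all
  with assms show ?thesis by simp
qed

text \<open>Kronecker substitution: the variables become powers of one number, with exponents that are the
  powers of a base exceeding all exponents that occur.\<close>

lemma params_eq_0:
  assumes "\<And>v :: param \<Rightarrow> complex. pmap v p = 0"
  shows "p = 0"
proof -
  define B where "B = Suc (\<Sum>m\<in>keys p. \<Sum>x\<leftarrow>[Par_k 1, Par_k 2, Par_k 3, Par_l 1, Par_l 2, Par_l 3]. lookup m x)"
  define en where "en m = lookup m (Par_k 1) + B * (lookup m (Par_k 2) + B * (lookup m (Par_k 3)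
    + B * (lookup m (Par_l 1) + B * (lookup m (Par_l 2) + B * lookup m (Par_l 3)))))" for m
  have small: "lookup m x < B" if "m \<in> keys p" for m x
  proof -
    have "(\<Sum>x\<leftarrow>[Par_k 1, Par_k 2, Par_k 3, Par_l 1, Par_l 2, Par_l 3]. lookup m x) < B"
      unfolding B_def less_Suc_eq_le by (rule member_le_sum[OF that]) auto
    then show ?thesis using three_cases[of "case x of Par_k i \<Rightarrow> i | Par_l i \<Rightarrow> i"] by (cases x) auto
  qed
  have inj: "inj_on en (keys p)"
  proof (rule inj_onI)
    fix m n assume m: "m \<in> keys p" and n: "n \<in> keys p" and eq: "en m = en n"
    note d = base_digit[OF _ small[OF m] small[OF n]]
    note e1 = d[OF eq[unfolded en_def]]
    note e2 = d[OF conjunct2[OF e1]]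
    note e3 = d[OF conjunct2[OF e2]]
    note e4 = d[OF conjunct2[OF e3]]
    note e5 = d[OF conjunct2[OF e4]]
    have "lookup m x = lookup n x" for x
      using three_cases[of "case x of Par_k i \<Rightarrow> i | Par_l i \<Rightarrow> i"] e1 e2 e3 e4 e5 by (cases x) auto
    then show "m = n" by (simp add: poly_mapping_eq_iff fun_eq_iff)
  qed
  define q where "q = (\<Sum>m\<in>keys p. monom (lookup p m) (en m))"
  have "poly q z = 0" for z
  proof -
    define v where "v x = (case x of Par_k i \<Rightarrow> z ^ (if i = 1 then 1 else if i = 2 then B else B ^ 2)
      | Par_l i \<Rightarrow> z ^ (if i = 1 then B ^ 3 else if i = 2 then B ^ 4 else B ^ 5))" for x
    have "pmon v m = z ^ en m" for m
    proof -
      let ?l = "\<lambda>x. lookup m x"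
      have "pmon v m = z ^ (?l (Par_k 1) + (B * ?l (Par_k 2) + (B ^ 2 * ?l (Par_k 3) + (B ^ 3 * ?l (Par_l 1)
          + (B ^ 4 * ?l (Par_l 2) + B ^ 5 * ?l (Par_l 3))))))"
        by (simp add: pmon_def v_def power_add power_mult)
      also have "?l (Par_k 1) + (B * ?l (Par_k 2) + (B ^ 2 * ?l (Par_k 3) + (B ^ 3 * ?l (Par_l 1)
          + (B ^ 4 * ?l (Par_l 2) + B ^ 5 * ?l (Par_l 3))))) = en m"
        by (simp add: en_def distrib_left mult.assoc[symmetric] flip: power_Suc2) (simp add: eval_nat_numeral)
      finally show ?thesis .
    qed
    then have "poly q z = pmap v p" by (simp add: q_def pmap_def poly_sum poly_monom scaleC_complex_def)
    then show ?thesis using assms by simp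
  qed
  then have "q = 0" using poly_all_0_iff_0 by blast
  have "lookup p n = 0" for n
  proof (rule ccontr)
    assume "lookup p n \<noteq> 0"
    then have n: "n \<in> keys p" by (simp add: in_keys_iff)
    have "coeff q (en n) = (\<Sum>m\<in>keys p. if m = n then lookup p m else 0)"
      unfolding q_def coeff_sum coeff_monom using inj n by (intro sum.cong) (auto dest: inj_onD)
    then show False using n \<open>q = 0\<close> by (simp add: in_keys_iff)
  qed
  then show ?thesis by (simp add: poly_mapping_eq_iff fun_eq_iff)
qed

lemma quadratic_root:
  fixes k x :: complex
  shows "\<exists>y. k + 2 = 2 * (x\<^sup>2 + x * y + y\<^sup>2)"
proof -
  \<comment> \<open>A square root of the discriminant of
    \<open>y^2 + x y + x^2 - (k + 2) / 2\<close> as a polynomial in \<open>y\<close>.\<close>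
  define d where "d = csqrt (2 * (k + 2) - 3 * x\<^sup>2)"
  have "d\<^sup>2 = 2 * (k + 2) - 3 * x\<^sup>2" by (simp add: d_def)
  then have k: "k + 2 = (d\<^sup>2 + 3 * x\<^sup>2) / 2" by simp
  have "k + 2 = 2 * (x\<^sup>2 + x * ((d - x) / 2) + ((d - x) / 2)\<^sup>2)"
    unfolding k by (simp add: power2_eq_square field_simps)
  then show ?thesis by blast
qed

lemma cubic_root:
  fixes k l :: complex
  shows "\<exists>x. l = 3 * x ^ 3 - 3/2 * (k + 2) * x"
proof -
  have "\<exists>x. poly [:- l, - (3/2 * (k + 2)), 0, 3:] x = 0"
    by (rule fundamental_theorem_of_algebra_alt) (auto simp: pCons_eq_0_iff)
  then obtain x where "poly [:- l, - (3/2 * (k + 2)), 0, 3:] x = 0" by blast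
  then show ?thesis by (intro exI[of _ x]) (simp add: algebra_simps eval_nat_numeral)
qed


text \<open>The cubic has the roots \<open>x\<close>, \<open>y\<close>, \<open>- x - y\<close> once
  \<open>k + 2 = 2 (x^2 + x y + y^2)\<close>, and in terms of shifted labels \<open>x\<close> is
  \<open>(2 p + q + 3) / 3\<close>. Any root may be put in this position, which is the freedom
  exploited on the hypersurface.\<close>

lemma weight_of_root:
  fixes k x :: complex
  shows "\<exists>p q. kval p q = k \<and> lval p q = 3 * x ^ 3 - 3/2 * (k + 2) * x \<and> 2 * p + q + 3 = 3 * x"
proof -
  obtain y where y: "k + 2 = 2 * (x\<^sup>2 + x * y + y\<^sup>2)" using quadratic_root by blast
  then have k: "k = 2 * (x\<^sup>2 + x * y + y\<^sup>2) - 2" by (simp add: eq_diff_eq)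
  have "kval (x - y - 1) (x + 2 * y - 1) = k" unfolding k
    by (simp add: kval_def power2_eq_square field_simps)
  moreover have "lval (x - y - 1) (x + 2 * y - 1) = 3 * x ^ 3 - 3/2 * (k + 2) * x" unfolding k
    by (simp add: lval_def power2_eq_square power3_eq_cube field_simps)
  ultimately show ?thesis by (intro exI[of _ "x - y - 1"] exI[of _ "x + 2 * y - 1"]) simp
qed

text \<open>\<open>P\<close> and \<open>Q\<close> are the first pair of labels; \<open>u\<close>,
  \<open>M\<close>, \<open>r\<close> are adjusted to the second pair and to the first label of the
  third, and \<open>A\<close> solves the one equation that is left.\<close>

lemma line_exists: "\<exists>u A M r P Q s t. line u A M r P Q s t \<and> (\<forall>x. line.pv u A M r P Q x = v x)"
proof -
  have "\<exists>p q. kval p q = k \<and> lval p q = l" for k l :: complex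
    using cubic_root[of l k] weight_of_root[of k] by metis
  then obtain p1 q1 p2 q2 p3 q3 where
    1: "kval p1 q1 = v (Par_k 1)" "lval p1 q1 = v (Par_l 1)" and
    2: "kval p2 q2 = v (Par_k 2)" "lval p2 q2 = v (Par_l 2)" and
    3: "kval p3 q3 = v (Par_k 3)" "lval p3 q3 = - v (Par_l 3)" by metis
  define A where "A = (q1 + q2 - 2 * p3 + 2 * p1 + 2 * p2 - q3) / 3"
  define u where "u = p2 - A"
  define r where "r = p3 - p1 - u"
  define M where "M = q2 - r"
  interpret line u A M r p1 q1 "(p1 - q1) / 3" "(u + A - M - r) / 3"
    by unfold_locales simp_all
  have w: "p1 + u + r = p3" "u + A = p2" "M + r = q2" by (simp_all add: M_def r_def u_def)
  have A3: "3 * A = q1 + q2 - 2 * p3 + 2 * p1 + 2 * p2 - q3" by (simp add: A_def)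
  have "q1 + M - A - r = q1 + q2 - 2 * (p3 - p1 - p2) - 3 * A" by (simp add: M_def r_def u_def)
  also have "\<dots> = q3" unfolding A3 by simp
  finally have w4: "q1 + M - A - r = q3" .
  have "kv i = v (Par_k i)" "lv i = v (Par_l i)" for i
    using three_cases[of i] unfolding kv_def lv_def w w4 by (auto simp: 1 2 3)
  then have "pv x = v x" for x by (cases x) (simp_all add: pv_def)
  then show ?thesis using line_axioms by blast
qed

definition kap :: "params \<Rightarrow> U2" where
  "kap p = pmap (zpar zvalZ) p"

lemma nf_slight_single:
  assumes z: "\<And>u A M r P Q s t. line u A M r P Q s t \<Longrightarrow>
    \<exists>T. line.acts u A M r P Q (nf zvalZ F) T \<and> line.slight u A M r P Q T"
  shows "F = single (0, 0, False) (lookup F (0, 0, False))"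
proof -
  have "lookup F k = 0" if k: "k \<noteq> (0, 0, False)" for k
  proof (rule params_eq_0)
    fix v :: "param \<Rightarrow> complex"
    obtain u A M r P Q s t where L: "line u A M r P Q s t" and v: "\<And>x. line.pv u A M r P Q x = v x"
      using line_exists by metis
    interpret line u A M r P Q s t by (rule L)
    have "pmap pv (lookup F k) = 0" using z[OF L] nf_slight[OF _ _ k] by blast
    moreover have "pv = v" using v by blast
    ultimately show "pmap v (lookup F k) = 0" by simp
  qed
  then show ?thesis by (auto simp: poly_mapping_eq_iff fun_eq_iff lookup_single when_def)
qed

lemma kap_eq_0: "kap p = 0 \<Longrightarrow> p = 0"
proof (rule params_eq_0)
  fix v :: "param \<Rightarrow> complex"
  assume p: "kap p = 0"
  obtain u A M r P Q s t where L: "line u A M r P Q s t" and v: "\<And>x. line.pv u A M r P Q x = v x"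
    using line_exists by metis
  interpret line u A M r P Q s t by (rule L)
  have "pmap pv p * 1 = 0"
    using acts_unique[OF acts_pmap[of p] , of "\<lambda>g c. 0" "\<lambda>c. 1"] acts_zero p by (simp add: kap_def)
  moreover have "pv = v" using v by blast
  ultimately show "pmap v p = 0" by simp
qed

theorem nf_zvalZ_eq_0:
  assumes "nf zvalZ F = 0"
  shows "F = 0"
proof -
  define p where "p = lookup F (0, 0, False)"
  have F: "F = single (0, 0, False) p"
    unfolding p_def
  proof (rule nf_slight_single)
    fix u A M r P Q s t assume "line u A M r P Q s t"
    then interpret line u A M r P Q s t .
    show "\<exists>T. acts (nf zvalZ F) T \<and> slight T"
      using acts_zero slight_diagonal[of "\<lambda>g c. 0"] assms by auto
  qed
  then have "nf zvalZ F = kap p" by (simp add: nf_single imon_def kap_def)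
  then have "p = 0" using assms kap_eq_0 by simp
  with F show ?thesis by simp
qed

section \<open>Exchange of \<open>s_elem\<close> for \<open>Z_elem\<close>\<close>

lemma sorted_filtrationI:
  fixes v :: "zgen \<Rightarrow> U2"
  assumes tr: "\<And>n x. filt v zwt n x \<longleftrightarrow> trace_span n x" and low: "\<And>g. g \<noteq> ZS \<Longrightarrow> v g = zval g"
    and square: "\<exists>a b. filt (\<lambda>g. if g = ZS then 0 else v g) zwt 12 a \<and>
      filt (\<lambda>g. if g = ZS then 0 else v g) zwt 6 b \<and> v ZS * v ZS = a + b * v ZS"
  shows "sorted_filtration v {0}"
proof
  have v: "trace_span (zwt g) (v g)" for g using filt_gen[of v zwt g] tr by blast
  show "v (ZK i) * v g = v g * v (ZK i)" "v (ZL i) * v g = v g * v (ZL i)" for i g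
    using kU_central[OF v] lU_central[OF v] low by simp_all
  show "x * y - y * x = 0 \<or> 1 \<le> m + n \<and> filt v zwt (m + n - 1) (x * y - y * x)"
    if "filt v zwt m x" "filt v zwt n y" for m x n y
  proof (cases "m + n = 0")
    case True
    then have "trace_span 0 x" using that tr by auto
    then obtain c where "x = c *\<^sub>C 1" using trace_span_0 by blast
    then show ?thesis by (simp add: mult_scaleC_left mult_scaleC_right)
  next
    case False
    then show ?thesis using that trace_span_commutator[of m x n y] by (auto simp: tr)
  qed
  show "\<exists>a b. filt (\<lambda>g. if g = ZS then 0 else v g) zwt 12 a \<and>
      filt (\<lambda>g. if g = ZS then 0 else v g) zwt 6 b \<and> v ZS * v ZS - (a + b * v ZS) \<in> {0}"
    using square by auto
qed auto

lemma zval_sorted_filtration: "sorted_filtration zval {0}"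
proof (rule sorted_filtrationI)
  show "filt zval zwt n x \<longleftrightarrow> trace_span n x" for n x using trace_span_iff_gen_filt by blast
  have "gen_filt 12 (s_elem * s_elem)" using filt_mult[OF gen_filt_s gen_filt_s] by simp
  from gen_filt_normal[OF this] obtain x y where "low_filt 12 x" "low_filt 6 y" "s_elem * s_elem = x + y * s_elem"
    by (auto elim!: normal_filtE)
  then show "\<exists>a b. filt (\<lambda>g. if g = ZS then 0 else zval g) zwt 12 a \<and>
      filt (\<lambda>g. if g = ZS then 0 else zval g) zwt 6 b \<and> zval ZS * zval ZS = a + b * zval ZS"
    by (auto simp: zval0_def[abs_def])
qed simp

lemma Z_trace_span: "trace_span 6 Z_elem"
  using trace_span_commutator[OF X_trace_span Y_trace_span] by (simp add: Z_elem_def commutator_def)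

lemma low_filt_imp:
  fixes v w :: "zgen \<Rightarrow> U2"
  assumes "low_filt n x" "\<And>g. g \<noteq> ZS \<Longrightarrow> v g = zval g"
  shows "filt (\<lambda>g. if g = ZS then 0 else v g) zwt n x"
proof -
  have "(\<lambda>g. if g = ZS then 0 else v g) = zval0" using assms(2) by (auto simp: zval0_def)
  with assms(1) show ?thesis by simp
qed


text \<open>The remainders left by \<open>low_reduces\<close> have weight below 6 and hence cannot
  involve \<open>s_elem\<close>; so the induction never leaves the words without it.\<close>

lemma low_filt_sorted:
  assumes "low_filt n x" "n \<le> 6"
  shows "sorted_filtration.sorted zval False n x"
proof -
  interpret sorted_filtration zval "{0}" by (rule zval_sorted_filtration)
  have eq: "(\<lambda>g. if g = ZS then 0 else zval g) = zval0" by (simp add: zval0_def fun_eq_iff)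
  show ?thesis
    using assms
  proof (induction n arbitrary: x rule: less_induct)
    case (less n)
    then have "low n x" by (simp only: eq)
    then obtain y r where x: "sorted False n y" "lower n r" "x = y + r"
      using low_reduces unfolding reduces_def by blast
    have "sorted False n r"
    proof (cases "r = 0")
      case False
      then obtain m where m: "m < n" "gen_filt m r" using x(2) unfolding lower_def by blast
      then have "low_filt m r" using gen_low_filt less.prems(2) by simp
      then have "sorted False m r" using less.IH m(1) less.prems(2) by simp
      then show ?thesis using sorted_mono m(1) by simp
    qed (simp add: sorted.zero)
    with x show ?case by (simp add: sorted.add)
  qed
qed

text \<open>By the independence of the normal forms, \<open>Z\<close> can replace \<open>s_elem\<close> as a generator of weight 6.\<close>

lemma Z_leading: "\<exists>a c. low_filt 6 a \<and> c \<noteq> 0 \<and> Z_elem = a + c *\<^sub>C s_elem"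
proof -
  have "gen_filt 6 Z_elem" using Z_trace_span trace_span_iff_gen_filt by blast
  from gen_filt_normal[OF this] obtain a b where a: "low_filt 6 a" and Z: "Z_elem = a + b * s_elem"
    and b: "low_filt (6 - 6) b"
    by (rule normal_filtE)
  from b have "trace_span 0 b"
    using trace_span_iff_gen_filt low_gen_filt by simp
  then obtain c where c: "b = c *\<^sub>C 1" using trace_span_0 by blast
  \<comment> \<open>Otherwise \<open>Z_elem\<close> would be a combination of sorted words without
    \<open>s_elem\<close>. These are also words for \<open>zvalZ\<close>, so this would be a linear
    relation between independent normal forms.\<close>
  have "c \<noteq> 0"
  proof
    assume "c = 0"
    then have "a = Z_elem" using Z c by simp
    interpret sorted_filtration zval "{0}" by (rule zval_sorted_filtration)
    from sorted_nf[OF low_filt_sorted[OF a]] obtain F where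
      F: "nf zval F = Z_elem" "\<And>j i. lookup F (j, i, True) = 0"
      using \<open>a = Z_elem\<close> by auto
    have "pmap (zpar zval) (lookup F k) * imon zval k = pmap (zpar zvalZ) (lookup F k) * imon zvalZ k" for k
    proof -
      obtain j i e where k: "k = (j, i, e)" by (cases k)
      have "zpar zval = zpar zvalZ" by (auto simp: zpar_def zvalZ_def fun_eq_iff split: param.splits)
      then show ?thesis using F(2) by (cases e) (auto simp: k pmap_zero imon_def zvalZ_def)
    qed
    then have "nf zvalZ F = Z_elem" using F(1) by (simp add: nf_def)
    then have "nf zvalZ (F - single (0, 0, True) 1) = 0"
      by (simp add: nf_diff nf_single pmap_one imon_def zvalZ_def)
    from nf_zvalZ_eq_0[OF this] have "F = single (0, 0, True) 1" by simp
    then show False using F(2)[of 0 0] by simp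
  qed
  with a Z c show ?thesis by (auto simp: mult_scaleC_left)
qed

lemma filt_zvalZ: "filt zvalZ zwt n x \<longleftrightarrow> trace_span n x"
proof
  show "trace_span n x" if "filt zvalZ zwt n x"
    using that unfolding trace_span_iff_gen_filt
    by (rule filt_transfer)
      (use Z_trace_span filt_gen[of zval zwt] trace_span_iff_gen_filt in \<open>auto simp: zvalZ_def\<close>)
  obtain a c where a: "low_filt 6 a" and c: "c \<noteq> 0" and Z: "Z_elem = a + c *\<^sub>C s_elem" using Z_leading by blast
  have low: "filt zvalZ zwt (zwt g) (zval g)" if "g \<noteq> ZS" for g
    using filt_gen[of zvalZ zwt g] that by (simp add: zvalZ_def)
  have "filt zvalZ zwt 6 a"
    using a by (rule filt_transfer) (auto simp: zval0_def filt_zero intro: low)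
  moreover have "filt zvalZ zwt 6 Z_elem" using filt_gen[of zvalZ zwt ZS] by (simp add: zvalZ_def)
  ultimately have "filt zvalZ zwt 6 ((1/c) *\<^sub>C (Z_elem - a))" by (intro filt.scale filt_diff)
  then have "filt zvalZ zwt 6 s_elem" using c by (simp add: Z scaleC_scaleC scaleC_one)
  then have gen: "filt zvalZ zwt (zwt g) (zval g)" for g using low by (cases "g = ZS") auto
  show "filt zvalZ zwt n x" if "trace_span n x"
    using that unfolding trace_span_iff_gen_filt by (rule filt_transfer) (rule gen)
qed

text \<open>The square of \<open>Z_elem\<close> has a normal form with \<open>s_elem\<close>, in
  which \<open>s_elem\<close> is then replaced by \<open>(Z_elem - a) / c\<close>.\<close>

lemma zvalZ_sorted_filtration: "sorted_filtration zvalZ {0}"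
proof (rule sorted_filtrationI[OF filt_zvalZ])
  show "zvalZ g = zval g" if "g \<noteq> ZS" for g using that by (simp add: zvalZ_def)
  have low: "filt (\<lambda>g. if g = ZS then 0 else zvalZ g) zwt m y" if "low_filt m y" for m y
    using that by (rule low_filt_imp) (simp add: zvalZ_def)
  obtain a c where a: "low_filt 6 a" and c: "c \<noteq> 0" and Z: "Z_elem = a + c *\<^sub>C s_elem" using Z_leading by blast
  have "gen_filt 12 (Z_elem * Z_elem)"
    using trace_span_mult[OF Z_trace_span Z_trace_span] trace_span_iff_gen_filt by simp
  from gen_filt_normal[OF this] obtain x y where xy: "low_filt 12 x" "low_filt (12 - 6) y" "Z_elem * Z_elem = x + y * s_elem"
    by (rule normal_filtE)
  have "s_elem = (1/c) *\<^sub>C (Z_elem - a)" using c by (simp add: Z scaleC_scaleC scaleC_one)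
  then have "y * s_elem = y * ((1/c) *\<^sub>C (Z_elem - a))" by (rule arg_cong)
  also have "\<dots> = (1/c) *\<^sub>C (y * Z_elem) - (1/c) *\<^sub>C (y * a)"
    by (simp only: mult_scaleC_right right_diff_distrib scaleC_diff_right)
  finally have "Z_elem * Z_elem = (x - (1/c) *\<^sub>C (y * a)) + ((1/c) *\<^sub>C y) * Z_elem"
    unfolding xy(3) by (simp add: mult_scaleC_left)
  moreover have "low_filt 12 (x - (1/c) *\<^sub>C (y * a))"
    using filt_mult[of zval0 zwt 6 y 6 a] xy a by (intro filt_diff filt.scale) auto
  moreover have "low_filt 6 ((1/c) *\<^sub>C y)" using xy by (intro filt.scale) auto
  ultimately show "\<exists>a b. filt (\<lambda>g. if g = ZS then 0 else zvalZ g) zwt 12 a \<and>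
      filt (\<lambda>g. if g = ZS then 0 else zvalZ g) zwt 6 b \<and> zvalZ ZS * zvalZ ZS = a + b * zvalZ ZS"
    using low by (auto simp: zvalZ_def)
qed

theorem U2_normal_form:
  assumes "trace_span n z"
  shows "\<exists>F. wle n F \<and> z = nf zvalZ F"
proof -
  interpret sorted_filtration zvalZ "{0}" by (rule zvalZ_sorted_filtration)
  show ?thesis using normal_form[of n z] assms by (simp add: filt_zvalZ)
qed

section \<open>The coefficients on a hypersurface of parameters\<close>

text \<open>The even permutations come first; \<open>\<epsilon>\<close> is 1 for
  \<open>Sym_plus\<close> and -1 for \<open>Sym_minus\<close>.\<close>

definition sum_perms :: "(complex \<Rightarrow> complex \<Rightarrow> complex \<Rightarrow> complex \<Rightarrow> complex \<Rightarrow> complex \<Rightarrow> complex) \<Rightarrow> complex \<Rightarrow>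
    complex \<Rightarrow> complex \<Rightarrow> complex \<Rightarrow> complex \<Rightarrow> complex \<Rightarrow> complex \<Rightarrow> complex" where
  "sum_perms \<phi> \<epsilon> ka kb kc na nb nc = \<phi> ka kb kc na nb nc + \<phi> kb kc ka nb nc na + \<phi> kc ka kb nc na nb
    + \<epsilon> * (\<phi> kb ka kc nb na nc + \<phi> ka kc kb na nc nb + \<phi> kc kb ka nc nb na)"

lemma sum_permutes_3:
  fixes f :: "(3 \<Rightarrow> 3) \<Rightarrow> 'a::comm_monoid_add"
  shows "(\<Sum>\<pi> | \<pi> permutes UNIV. f \<pi>) = (f id + f (Transposition.transpose 2 3))
    + (f (Transposition.transpose 1 2) + f (Transposition.transpose 1 2 \<circ> Transposition.transpose 2 3))
    + (f (Transposition.transpose 1 3) + f (Transposition.transpose 1 3 \<circ> Transposition.transpose 2 3))"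
proof -
  have f123: "finite {2::3, 3}" "1 \<notin> {2::3, 3}" and f23: "finite {3::3}" "2 \<notin> {3::3}" by auto
  show ?thesis
    unfolding UNIV_3 sum_over_permutations_insert[OF f123] sum_over_permutations_insert[OF f23] permutes_sing
    by (simp add: add.assoc)
qed

lemma pmap_perm_poly:
  assumes \<pi>: "\<pi> permutes UNIV"
  shows "pmap v (perm_poly \<pi> p) = pmap (\<lambda>x. v (perm_param \<pi> x) :: complex) p"
proof (induction p rule: poly_mapping_induct_single)
  case (single m c)
  let ?m = "Poly_Mapping.map_key (perm_param (Hilbert_Choice.inv \<pi>)) m"
  have lookup: "lookup ?m x = lookup m (perm_param (Hilbert_Choice.inv \<pi>) x)" for x
    by (simp add: Poly_Mapping.map_key.rep_eq inj_perm_param[OF permutes_inv[OF \<pi>]])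
  have prod: "pmon v m = (\<Prod>i\<in>UNIV. v (Par_k i) ^ lookup m (Par_k i)) * (\<Prod>i\<in>UNIV. v (Par_l i) ^ lookup m (Par_l i))"
    for v :: "param \<Rightarrow> complex" and m
    unfolding UNIV_3 by (simp add: pmon_def)
  have "(\<Prod>i\<in>UNIV. v (Par_k i) ^ lookup ?m (Par_k i)) = (\<Prod>i\<in>UNIV. v (Par_k (\<pi> i)) ^ lookup ?m (Par_k (\<pi> i)))"
    "(\<Prod>i\<in>UNIV. v (Par_l i) ^ lookup ?m (Par_l i)) = (\<Prod>i\<in>UNIV. v (Par_l (\<pi> i)) ^ lookup ?m (Par_l (\<pi> i)))"
    by (rule prod.permute[OF \<pi>, unfolded comp_def])+
  then have "pmon v ?m = pmon (\<lambda>x. v (perm_param \<pi> x)) m"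
    using permutes_inverses[OF \<pi>] by (simp add: prod lookup)
  then show ?case by (simp add: perm_poly_single[OF \<pi>] pmap_single)
qed (simp_all add: perm_poly_zero[OF \<pi>] perm_poly_add[OF \<pi>] pmap_zero pmap_add)

lemma pmap_Sym:
  fixes v :: "param \<Rightarrow> complex"
  assumes p: "\<And>v. pmap v p = \<phi> (v (Par_k 1)) (v (Par_k 2)) (v (Par_k 3)) (v (Par_l 1)) (v (Par_l 2)) (v (Par_l 3))"
  shows "pmap v (Sym_plus p) = 1/6 * sum_perms \<phi> 1 (v (Par_k 1)) (v (Par_k 2)) (v (Par_k 3)) (v (Par_l 1)) (v (Par_l 2)) (v (Par_l 3))"
    and "pmap v (Sym_minus p) = 1/6 * sum_perms \<phi> (- 1) (v (Par_k 1)) (v (Par_k 2)) (v (Par_k 3)) (v (Par_l 1)) (v (Par_l 2)) (v (Par_l 3))"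
proof -
  have s: "permutation (Transposition.transpose a b)" "Transposition.transpose a b permutes UNIV" for a b :: 3
    by (simp_all add: permutation_swap_id permutes_swap_id)
  have c: "Transposition.transpose 1 2 \<circ> Transposition.transpose 2 (3::3) permutes UNIV"
    "Transposition.transpose 1 3 \<circ> Transposition.transpose 2 (3::3) permutes UNIV"
    by (auto intro!: permutes_compose s)
  have perm: "pmap v (perm_poly \<pi> p) = \<phi> (v (Par_k (\<pi> 1))) (v (Par_k (\<pi> 2))) (v (Par_k (\<pi> 3))) (v (Par_l (\<pi> 1))) (v (Par_l (\<pi> 2))) (v (Par_l (\<pi> 3)))"
    if "\<pi> permutes UNIV" for \<pi>
    using pmap_perm_poly[OF that, of v p] p by simp
  have neq: "(1::3) \<noteq> 2" "(1::3) \<noteq> 3" "(2::3) \<noteq> 3" by simp_all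
  show "pmap v (Sym_plus p) = 1/6 * sum_perms \<phi> 1 (v (Par_k 1)) (v (Par_k 2)) (v (Par_k 3)) (v (Par_l 1)) (v (Par_l 2)) (v (Par_l 3))"
    unfolding Sym_plus_def pmap_scaleC scaleC_complex_def pmap_sum sum_permutes_3 sum_perms_def
    by (simp add: pmap_add perm permutes_id s c Transposition.transpose_def)
  have minus: "pmap v (- 1 * q) = - pmap v q" for q by (simp add: pmap_uminus)
  show "pmap v (Sym_minus p) = 1/6 * sum_perms \<phi> (- 1) (v (Par_k 1)) (v (Par_k 2)) (v (Par_k 3)) (v (Par_l 1)) (v (Par_l 2)) (v (Par_l 3))"
    unfolding Sym_minus_def pmap_scaleC scaleC_complex_def pmap_sum sum_permutes_3 sum_perms_def
    by (simp add: pmap_add pmap_diff perm permutes_id s c sign_compose sign_swap_id sign_id neq pmap_uminus Transposition.transpose_def)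
qed

lemma pmap_numeral: "pmap v (numeral n) = numeral n"
  by (induction n) (simp_all only: numeral.simps pmap_one pmap_add)

lemmas pmap_eval = pmap_add pmap_diff pmap_uminus pmap_scaleC scaleC_complex_def pmap_mult[of v, OF mult.commute]
  pmap_power[of v, OF mult.commute] pmap_var pmap_numeral pmap_one for v :: "param \<Rightarrow> complex"

text \<open>Up to the factors in the lemmas \<open>eval_a6\<close> to \<open>eval_a12\<close>, the polynomials under the symmetrisers in \<open>a\<^sub>6\<close>, \<open>a\<^sub>8\<close>, \<open>a\<^sub>9\<close>,
  \<open>a\<^sub>1\<^sub>2\<close>; the arguments \<open>n\<close> stand for \<open>2 l\<close>, which makes all coefficients integral.\<close>

definition term6 where
  "term6 (k::complex) kb kc n nb nc = 6*(2*k^2*kb-k^3-6*k*kb*kc)+36*(k^2-2*k*kb)+4*n^2-40*n*nb"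

definition term8 where
  "term8 (k::complex) kb kc n nb nc = 3*(k^4-8*k^3*kb+6*k^2*kb^2+4*k^2*kb*kc)-12*(3*k^3-6*k^2*kb+2*k*kb*kc)-4*(k*(n^2-6*nb^2+4*n*nb-26*nb*nc))+48*n^2+96*n*nb"

definition term9 where
  "term9 (k::complex) kb kc n nb nc = nb*(3*(k^3-2*k^2*kb+k*kb^2+9*k^2*kc)+36*(k^2-k*kb)-8*n^2)"

definition term12 where
  "term12 (k::complex) kb kc n nb nc = 48*k^6 - 288*(k^5*(1+2*kb)) + 288*(k^4*(6*kb+5*kb^2+3*kb*kc-39))
    - 192*(k^3*(6*kb^2+5*kb^3+6*kb^2*kc-648-468*kb-6*kb*kc)) - 48*(k^3*(2*n^2+8*n*nb-12*nb^2+140*nb*nc))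
    - 96*(k^2*(2592*kb+702*kb^2+468*kb*kc+42*kb^2*kc+kb^2*kc^2))
    - 24*(k^2*(416*n*nb-40*n^2-40*kb*n^2-16*kb*n*nb+144*kc*n*nb-464*nb^2+56*kb*nb^2-360*kc*nb^2-560*nb*nc-720*kc*nb*nc))
    + 768*(k*(108*kb*kc)) - 192*(k*(68*kb*n^2-24*n^2+17*kb*kc*n^2-672*n*nb-52*kb*n*nb-296*kc*n*nb-2*kb*kc*n*nb-48*nb^2-206*kc*nb^2+1392*nb*nc))
    + 32*(n*(n^3+24*n^2*nb-26*n*nb^2+244*n*nb*nc)) - 128*(n*(864*n+1728*nb))"

text \<open>The eigenvalues of \<open>4 X\<close> and \<open>48 Y\<close> at the point \<open>c = 0\<close> of a line with \<open>A = 0\<close>. There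
  \<open>a\<close>, \<open>b\<close> and \<open>a + b - 1\<close> are roots of the cubic equations that determine \<open>l\<^sub>1\<close>, \<open>l\<^sub>2\<close>, \<open>- l\<^sub>3\<close>.\<close>

definition xi4 where
  "xi4 (a::complex) b K1 K2 K3 = (K1 + b*K3 + b*K2 + 6*b^2 - K2 - 2*b - 2*b*K1 - 4*b^3) + (2*a + 2*a*K2 + 6*a^2*b + 4*a^3 - a*K3 - a*K1 - 6*a*b^2 - 6*a^2)"

definition eta48 where
  "eta48 (a::complex) b K1 K2 K3 = (12*K3 + 2*K2*K3 + 2*K1*K3 + 2*K1*K2 + 72*b - K3^2 - K2^2 - K1^2) + (12*b*K2 + 24*b*K1 + 72*a + 24*a*K2 - 12*b*K3 - 72*b^2 - 24*b^2*K1 - 12*a*K3) + (12*a*K1 + 24*a*b*K3 + 72*a*b^2 - 144*a*b - 24*a*b*K2 - 24*a*b*K1 - 72*a^2 - 24*a^2*K2) + (72*a^2*b)"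

lemma sum_perms_scale: "sum_perms (\<lambda>ka kb kc na nb nc. \<phi> ka kb kc (2 * na) (2 * nb) (2 * nc) / m) e ka kb kc na nb nc =
    sum_perms \<phi> e ka kb kc (2 * na) (2 * nb) (2 * nc) / m"
  by (simp add: sum_perms_def add_divide_distrib distrib_left)

context
  fixes v :: "param \<Rightarrow> complex"
begin

abbreviation (input) "perms \<phi> e \<equiv> sum_perms \<phi> e (v (Par_k 1)) (v (Par_k 2)) (v (Par_k 3)) (2 * v (Par_l 1)) (2 * v (Par_l 2)) (2 * v (Par_l 3))"

lemma eval_a2: "pmap v a2 = (v (Par_k 1) + v (Par_k 2) + v (Par_k 3)) / 2"
  by (simp add: a2_def pmap_eval)

lemma eval_a5: "6 * pmap v a5 = perms (\<lambda>k kb kc n nb nc. kb * n) (- 1)"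
proof -
  have eq: "pmap v a5 = 1/6 * perms (\<lambda>k kb kc n nb nc. kb * n) (- 1)"
    unfolding a5_def
    by (subst pmap_Sym(2)[where \<phi> = "\<lambda>k kb kc n nb nc. kb * (2 * n) / 1"])
      (simp_all only: sum_perms_scale[where \<phi> = "\<lambda>k kb kc n nb nc. kb * n"] pmap_eval, simp_all add: pmap_eval)
  show ?thesis unfolding eq by simp
qed

lemma eval_a6: "576 * pmap v a6 = perms term6 1"
proof -
  have eq: "pmap v a6 = 1/6 * (perms term6 1 / 96)"
    unfolding a6_def sum_perms_scale[symmetric]
    by (rule pmap_Sym(1)) (simp add: pmap_eval term6_def field_simps)
  show ?thesis unfolding eq by simp
qed

lemma eval_a8: "2304 * pmap v a8 = perms term8 1"
proof -
  have eq: "pmap v a8 = 1/6 * (perms term8 1 / 384)"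
    unfolding a8_def sum_perms_scale[symmetric]
    by (rule pmap_Sym(1)) (simp add: pmap_eval term8_def field_simps)
  show ?thesis unfolding eq by simp
qed

lemma eval_a9: "864 * pmap v a9 = perms term9 (- 1)"
proof -
  have eq: "pmap v a9 = 1/6 * (perms term9 (- 1) / 144)"
    unfolding a9_def sum_perms_scale[symmetric]
    by (rule pmap_Sym(2)) (simp add: pmap_eval term9_def field_simps)
  show ?thesis unfolding eq by simp
qed

lemma eval_a12: "1327104 * pmap v a12 = perms term12 1"
proof -
  have eq: "pmap v a12 = 1/6 * (perms term12 1 / 221184)"
    unfolding a12_def sum_perms_scale[symmetric]
    by (rule pmap_Sym(1)) (simp add: pmap_eval term12_def field_simps)
  show ?thesis unfolding eq by simp
qed

end


section \<open>Values at common eigenvectors and density of the hypersurface\<close>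

definition root_val :: "complex \<Rightarrow> complex \<Rightarrow> complex" where
  "root_val k x = 3 * x ^ 3 - 3/2 * (k + 2) * x"

context
  fixes a b K1 K2 K3 N1 N2 N3 x y :: complex
  assumes N: "N1 = 3 * (2 * a^3 - (K1 + 2) * a)" "N2 = 3 * (2 * b^3 - (K2 + 2) * b)"
      "N3 = - (3 * (2 * (a + b - 1)^3 - (K3 + 2) * (a + b - 1)))"
    and x: "x = xi4 a b K1 K2 K3" and y: "y = eta48 a b K1 K2 K3"
begin

text \<open>At a common eigenvector \<open>Z\<close> acts by zero, and the relation for
  \<open>[X, Z]\<close> reads \<open>6 Y^2 - a2 X^2 - a5 X = a8\<close>. This is the relation times
  2304, with \<open>x = 4 X\<close> and \<open>y = 48 Y\<close>. The next two lemmas are the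
  analogues for \<open>a9\<close> and \<open>a12\<close>.\<close>

lemma hyperplane_8: "sum_perms term8 1 K1 K2 K3 N1 N2 N3 + 72 * (K1 + K2 + K3) * x^2
    + 96 * sum_perms (\<lambda>k kb kc n nb nc. kb * n) (- 1) K1 K2 K3 N1 N2 N3 * x - 6 * y^2 = 0"
  unfolding x y sum_perms_def term8_def xi4_def eta48_def N by Groebner_Basis.algebra

lemma hyperplane_9: "3 * sum_perms term6 1 K1 K2 K3 N1 N2 N3 * x + 8 * sum_perms term9 (- 1) K1 K2 K3 N1 N2 N3
    - 216 * x^3 - 36 * (K1 + K2 + K3) * x * y - 24 * sum_perms (\<lambda>k kb kc n nb nc. kb * n) (- 1) K1 K2 K3 N1 N2 N3 * y = 0"
  unfolding x y sum_perms_def term6_def term9_def xi4_def eta48_def N by Groebner_Basis.algebra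

lemma hyperplane_12: "(331776 * sum_perms (\<lambda>k kb kc n nb nc. kb * n) (- 1) K1 K2 K3 N1 N2 N3 * x + 768 * sum_perms term9 (- 1) K1 K2 K3 N1 N2 N3 * x + 248832 * (K1 + K2 + K3) * x^2 + 144 * sum_perms term6 1 K1 K2 K3 N1 N2 N3 * x^2)
    - (96 * sum_perms term6 1 K1 K2 K3 N1 N2 N3 * y + 24 * sum_perms term8 1 K1 K2 K3 N1 N2 N3 * y + 2304 * sum_perms (\<lambda>k kb kc n nb nc. kb * n) (- 1) K1 K2 K3 N1 N2 N3 * x * y)
    + ((2304 * (K1 + K2 + K3) - 13824) * y^2 + (20736 - 1728 * (K1 + K2 + K3)) * x^2 * y - 5184 * x^4 + 48 * y^3) - sum_perms term12 1 K1 K2 K3 N1 N2 N3 = 0"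
  unfolding x y sum_perms_def term6_def term8_def term9_def term12_def xi4_def eta48_def N by Groebner_Basis.algebra

end

definition param_vec :: "complex \<Rightarrow> complex \<Rightarrow> complex \<Rightarrow> complex \<Rightarrow> complex \<Rightarrow> complex \<Rightarrow> param \<Rightarrow> complex" where
  "param_vec ka kb kc na nb nc x = (case x of Par_k i \<Rightarrow> if i = 1 then ka else if i = 2 then kb else kc
    | Par_l i \<Rightarrow> if i = 1 then na else if i = 2 then nb else nc)"

lemma pmon_param_vec: "pmon (param_vec ka kb kc na nb nc) m = ka ^ lookup m (Par_k 1) * (kb ^ lookup m (Par_k 2)
    * (kc ^ lookup m (Par_k 3) * (na ^ lookup m (Par_l 1) * (nb ^ lookup m (Par_l 2)
    * nc ^ lookup m (Par_l 3)))))"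
  by (simp add: pmon_def param_vec_def)

definition pw :: "nat \<Rightarrow> params \<Rightarrow> bool" where
  "pw n p \<longleftrightarrow> (\<forall>m. lookup p m \<noteq> 0 \<longrightarrow> pwt m \<le> n)"

lemma poly_degree_roots:
  fixes q :: "complex poly"
  assumes "degree q \<le> n" "finite S" "n < card S" "\<And>z. z \<in> S \<Longrightarrow> poly q z = 0"
  shows "q = 0"
proof (rule ccontr)
  assume q: "q \<noteq> 0"
  have "card S \<le> card {z. poly q z = 0}"
    using assms by (intro card_mono poly_roots_finite[OF q]) auto
  also have "\<dots> \<le> degree q" by (rule card_poly_roots_bound[OF q])
  finally show False using assms by simp
qed

text \<open>For fixed \<open>k\<close>, \<open>l\<^sub>2\<close>, \<open>l\<^sub>3\<close> there are nine values of \<open>l\<^sub>1\<close> on the hypersurface, five of which are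
  distinct for generic parameters (as the explicit choice at \<open>\<tau> = 1\<close> shows), while \<open>f\<close> has degree at most 4 in \<open>l\<^sub>1\<close>.\<close>

lemma hypersurface_dense:
  assumes pw: "pw 12 f"
    and zero: "\<And>ka kb kc a b. pmap (param_vec ka kb kc (root_val ka a) (root_val kb b) (- root_val kc (a + b - 1))) f = 0"
  shows "f = 0"
proof (rule params_eq_0)
  fix v :: "param \<Rightarrow> complex"
  define ka where "ka = v (Par_k 1)"
  define na where "na = v (Par_l 1)"
  obtain b1 b2 where b: "v (Par_k 2) + 2 = 2 * (b1\<^sup>2 + b1 * b2 + b2\<^sup>2)" "v (Par_l 2) = root_val (v (Par_k 2)) b1"
    using cubic_root quadratic_root unfolding root_val_def by metis
  obtain d1 d2 where d: "v (Par_k 3) + 2 = 2 * (d1\<^sup>2 + d1 * d2 + d2\<^sup>2)" "- v (Par_l 3) = root_val (v (Par_k 3)) d1"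
    using cubic_root quadratic_root unfolding root_val_def by metis
  define kk where "kk x y = 2 * (x\<^sup>2 + x * y + y\<^sup>2) - 2" for x y :: complex
  have root_other: "root_val (kk x y) y = root_val (kk x y) x" "root_val (kk x y) (- x - y) = root_val (kk x y) x" for x y
    by (simp_all add: root_val_def kk_def power2_eq_square power3_eq_cube field_simps)
  \<comment> \<open>at \<open>\<tau> = 1\<close> the roots are \<open>0, 1, -1\<close> and \<open>0, 3, -3\<close>\<close>
  define B1 where "B1 = [:b1, - b1:]"
  define B2 where "B2 = [:b2, 1 - b2:]"
  define D1 where "D1 = [:d1, - d1:]"
  define D2 where "D2 = [:d2, 3 - d2:]"
  define K where "K = [:ka, - 2 - ka:]"
  \<comment> \<open>Each \<open>x i\<close> is \<open>\<delta> - \<beta> + 1\<close> with a root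
    \<open>\<beta>\<close> of the second and a root \<open>\<delta>\<close> of the third cubic, so
    that \<open>\<delta>\<close> is \<open>x i + \<beta> - 1\<close>. At argument 1 the five values
    are 1, 2, 3, 4, 5, and \<open>K + 2\<close> is zero, so that \<open>root_val\<close> is three
    times the cube and the values of \<open>G\<close> are distinct.\<close>
  define x where "x i = (if i = 0 then D1 - B1 + 1 else if i = 1 then D1 + B1 + B2 + 1 else if i = 2 then D2 - B2 + 1
    else if i = 3 then D2 - B1 + 1 else D2 + B1 + B2 + 1 :: complex poly)" for i :: nat
  define G where "G i = 3 * x i ^ 3 - [:3/2:] * (K + 2) * x i" for i
  have G: "poly (G i) z = root_val (poly K z) (poly (x i) z)" for i z by (simp add: G_def root_val_def)
  define R where "R = (\<Prod>(i, j)\<in>{(i, j). i < j \<and> j < 5}. G i - G j)"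
  have fin: "finite {(i, j). i < j \<and> j < (5::nat)}"
    by (rule finite_subset[of _ "{..<5} \<times> {..<5}"]) auto
  have "poly (G i) 1 = 3 * poly (x i) 1 ^ 3" for i by (simp add: G root_val_def K_def)
  moreover have "poly (x 0) 1 = 1" "poly (x 1) 1 = 2" "poly (x 2) 1 = 3" "poly (x 3) 1 = 4" "poly (x 4) 1 = 5"
    by (simp_all add: x_def B1_def B2_def D1_def D2_def)
  ultimately have "poly (G i) 1 = 3 * of_nat (Suc i) ^ 3" if "i < 5" for i
    using that by (auto simp: less_Suc_eq eval_nat_numeral)
  then have "poly (G i) 1 \<noteq> poly (G j) 1" if "i < j" "j < 5" for i j
    using that power_eq_iff_eq_base[of 3 "Suc i" "Suc j"] by (simp del: of_nat_Suc flip: of_nat_power)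
  then have "poly R 1 \<noteq> 0" using fin unfolding R_def poly_prod by (auto simp: prod_zero_iff)
  then have R: "R \<noteq> 0" by auto
  define w where "w z = param_vec (poly K z) (kk (poly B1 z) (poly B2 z)) (kk (poly D1 z) (poly D2 z)) na
    (root_val (kk (poly B1 z) (poly B2 z)) (poly B1 z)) (- root_val (kk (poly D1 z) (poly D2 z)) (poly D1 z))" for z
  have generic: "pmap (w z) f = 0" if "poly R z \<noteq> 0" for z
  proof -
    define q where "q = (\<Sum>m\<in>keys f. monom (lookup f m * pmon ((w z) (Par_l 1 := 1)) m) (lookup m (Par_l 1)))"
    have upd: "pmon ((w z) (Par_l 1 := y)) m = pmon ((w z) (Par_l 1 := 1)) m * y ^ lookup m (Par_l 1)" for y m
      by (simp add: pmon_def)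
    have q: "poly q y = pmap ((w z) (Par_l 1 := y)) f" for y
      unfolding q_def pmap_def poly_sum poly_monom scaleC_complex_def upd[of y] by (simp add: mult.assoc)
    have "degree q \<le> 4" unfolding q_def
    proof (rule degree_sum_le)
      fix m assume "m \<in> keys f"
      then have "pwt m \<le> 12" using pw by (simp add: pw_def in_keys_iff)
      then have "lookup m (Par_l 1) \<le> 4" by (simp add: pwt_def sum_3)
      then show "degree (monom (lookup f m * pmon ((w z) (Par_l 1 := 1)) m) (lookup m (Par_l 1))) \<le> 4"
        using degree_monom_le order.trans by blast
    qed simp
    moreover have "poly q y = 0" if "y \<in> (\<lambda>i. poly (G i) z) ` {..<5}" for y
    proof -
      from that obtain i where i: "i < 5" "y = root_val (poly K z) (poly (x i) z)" by (auto simp: G)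
      let ?B = "kk (poly B1 z) (poly B2 z)" and ?D = "kk (poly D1 z) (poly D2 z)"
      have "\<exists>\<beta> \<delta>. poly (x i) z + \<beta> - 1 = \<delta> \<and> root_val ?B \<beta> = root_val ?B (poly B1 z) \<and> root_val ?D \<delta> = root_val ?D (poly D1 z)"
      proof -
        let ?\<beta> = "if i = 0 \<or> i = 3 then poly B1 z else if i = 2 then poly B2 z else - poly B1 z - poly B2 z"
        let ?\<delta> = "if i = 0 \<or> i = 1 then poly D1 z else poly D2 z"
        have "poly (x i) z + ?\<beta> - 1 = ?\<delta>" by (simp add: x_def)
        moreover have "root_val ?B ?\<beta> = root_val ?B (poly B1 z)" "root_val ?D ?\<delta> = root_val ?D (poly D1 z)"
          by (simp_all add: root_other)
        ultimately show ?thesis by blast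
      qed
      then obtain \<beta> \<delta> where \<beta>: "poly (x i) z + \<beta> - 1 = \<delta>" "root_val ?B \<beta> = root_val ?B (poly B1 z)" "root_val ?D \<delta> = root_val ?D (poly D1 z)"
        by blast
      have "(w z) (Par_l 1 := y) = param_vec (poly K z) ?B ?D y (root_val ?B (poly B1 z)) (- root_val ?D (poly D1 z))"
        by (auto simp: w_def param_vec_def fun_eq_iff split: param.splits)
      then show ?thesis
        using zero[of "poly K z" ?B ?D "poly (x i) z" \<beta>] by (simp add: q \<beta> i(2))
    qed
    moreover have "card ((\<lambda>i. poly (G i) z) ` {..<5::nat}) = 5"
    proof -
      have "poly (G i) z \<noteq> poly (G j) z" if "i < j" "j < 5" for i j
        using \<open>poly R z \<noteq> 0\<close> that fin unfolding R_def poly_prod by (auto simp: prod_zero_iff)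
      then have "inj_on (\<lambda>i. poly (G i) z) {..<5}" by (auto intro!: linorder_inj_onI')
      then show ?thesis by (simp add: card_image)
    qed
    ultimately have "q = 0"
      by (intro poly_degree_roots[of q 4 "(\<lambda>i. poly (G i) z) ` {..<5::nat}"]) auto
    moreover have "(w z) (Par_l 1 := na) = w z" by (auto simp: w_def param_vec_def fun_eq_iff)
    ultimately show ?thesis using q[of na] by simp
  qed
  \<comment> \<open>\<open>f\<close> vanishes at \<open>w z\<close> except for finitely many
    \<open>z\<close>, so continuity gives its value at \<open>w 0\<close>, which is the prescribed
    \<open>v\<close>.\<close>
  have "((\<lambda>z. pmap (w z) f) \<longlongrightarrow> pmap (w 0) f) (at 0)"
    unfolding pmap_def w_def pmon_param_vec scaleC_complex_def root_val_def kk_def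
    by (intro tendsto_intros isContD[OF poly_isCont])
  moreover have "((\<lambda>z. pmap (w z) f) \<longlongrightarrow> 0) (at 0)"
  proof -
    have "finite {z. poly R z = 0}" by (rule poly_roots_finite[OF R])
    then have "open (- ({z. poly R z = 0} - {0}))"
      by (intro open_Compl finite_imp_closed finite_Diff)
    from eventually_nhds_in_open[OF this, of 0] have "eventually (\<lambda>z. z \<in> - ({z. poly R z = 0} - {0})) (nhds 0)" by simp
    then have "eventually (\<lambda>z. pmap (w z) f = 0) (at 0)"
      unfolding eventually_at_filter by (rule eventually_mono) (use generic in auto)
    then show ?thesis by (rule tendsto_eventually)
  qed
  ultimately have "pmap (w 0) f = 0" by (rule tendsto_unique[OF at_neq_bot])
  moreover have "w 0 = v"
  proof
    fix y
    have "kk b1 b2 = v (Par_k 2)" "kk d1 d2 = v (Par_k 3)" unfolding kk_def b(1)[symmetric] d(1)[symmetric] by simp_all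
    then show "w 0 y = v y"
      using b(2) d(2)[symmetric] three_cases[of "case y of Par_k i \<Rightarrow> i | Par_l i \<Rightarrow> i"]
      by (cases y) (auto simp: w_def param_vec_def B1_def B2_def D1_def D2_def K_def ka_def na_def)
  qed
  ultimately show "pmap v f = 0" by simp
qed

text \<open>\<open>A = 0\<close> makes \<open>al\<close> and \<open>ga\<close> vanish at
  \<open>c = 0\<close>, where \<open>X\<close> and \<open>Y\<close> then act by scalars. In the
  labels of the three pairs it says \<open>(2 p1 + q1) + (2 p2 + q2) = 2 p3 + q3\<close>, and by
  \<open>2 p + q + 3 = 3 x\<close> this means that the third root is
  \<open>a + b - 1\<close>.\<close>

lemma hyperplane_line:
  "\<exists>u M r P Q s t. line u 0 M r P Q s t
    \<and> line.pv u 0 M r P Q = param_vec ka kb kc (root_val ka a) (root_val kb b) (- root_val kc (a + b - 1))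
    \<and> 4 * line.be u 0 M r P Q 0 = xi4 a b ka kb kc \<and> 48 * line.et u 0 M r P Q 0 = eta48 a b ka kb kc"
proof -
  define d where "d = a + b - 1"
  obtain y where y: "ka + 2 = 2 * (a\<^sup>2 + a * y + y\<^sup>2)" using quadratic_root by blast
  obtain y' where y': "kb + 2 = 2 * (b\<^sup>2 + b * y' + y'\<^sup>2)" using quadratic_root by blast
  obtain w where w: "kc + 2 = 2 * (d\<^sup>2 + d * w + w\<^sup>2)" using quadratic_root by blast
  \<comment> \<open>The labels \<open>x - y - 1\<close> and \<open>x + 2 y - 1\<close> of
    \<open>weight_of_root\<close>, for the roots \<open>a\<close> and \<open>b\<close>;
    \<open>r\<close> is fixed by the first label belonging to the root \<open>d\<close>.\<close>
  define P Q u r where "P = a - y - 1" and "Q = a + 2 * y - 1" and "u = b - y' - 1" and "r = y + y' - w"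
  define M where "M = b + 2 * y' - 1 - r"
  note defs = P_def Q_def u_def M_def r_def
  interpret line u 0 M r P Q "- y" "- y'"
    by unfold_locales (simp_all add: defs)
  have cas: "kval (x - z - 1) (x + 2 * z - 1) = k" "lval (x - z - 1) (x + 2 * z - 1) = root_val k x"
    if "k + 2 = 2 * (x\<^sup>2 + x * z + z\<^sup>2)" for x z k
  proof -
    have k: "k = 2 * (x\<^sup>2 + x * z + z\<^sup>2) - 2" using that by (simp add: eq_diff_eq)
    show "kval (x - z - 1) (x + 2 * z - 1) = k" "lval (x - z - 1) (x + 2 * z - 1) = root_val k x" unfolding k
      by (simp_all add: kval_def lval_def root_val_def power2_eq_square power3_eq_cube field_simps)
  qed
  have pq: "P + u + r = d - w - 1" "Q + M - 0 - r = d + 2 * w - 1" "u + 0 = b - y' - 1" "M + r = b + 2 * y' - 1"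
    by (simp_all add: defs d_def)
  have "kv 1 = ka" "lv 1 = root_val ka a" "kv 2 = kb" "lv 2 = root_val kb b" "kv 3 = kc" "lv 3 = - root_val kc d"
    using cas[OF y] cas[OF y'] cas[OF w] unfolding kv_def lv_def pq by (simp_all add: P_def Q_def)
  then have "pv x = param_vec ka kb kc (root_val ka a) (root_val kb b) (- root_val kc d) x" for x
    using three_cases[of "case x of Par_k i \<Rightarrow> i | Par_l i \<Rightarrow> i"] by (cases x) (auto simp: pv_def param_vec_def)
  then have "pv = param_vec ka kb kc (root_val ka a) (root_val kb b) (- root_val kc (a + b - 1))"
    by (auto simp: d_def)
  have k: "ka = 2 * (a\<^sup>2 + a * y + y\<^sup>2) - 2" "kb = 2 * (b\<^sup>2 + b * y' + y'\<^sup>2) - 2"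
    "kc = 2 * ((a + b - 1)\<^sup>2 + (a + b - 1) * w + w\<^sup>2) - 2"
    using y y' w by (simp_all add: eq_diff_eq d_def)
  have zero: "x * 0 = 0" "0 * x = 0" "(0::complex) ^ numeral n = 0" "x + 0 = x" "0 + x = x" "x - 0 = x" for x :: complex and n
    by simp_all
  have "2 * beta_num u 0 M r P Q = 27 * xi4 a b ka kb kc"
    unfolding beta_num_def xi4_def k M_def P_def Q_def u_def r_def zero by Groebner_Basis.algebra
  moreover have "108 * be 0 = 2 * beta_num u 0 M r P Q" by (simp add: be_def al_def ga_def)
  moreover have "4 * eta0_num u 0 M r P Q = eta48 a b ka kb kc"
    unfolding eta0_num_def eta48_def k M_def P_def Q_def u_def r_def zero by Groebner_Basis.algebra
  moreover have "48 * et 0 = 4 * eta0_num u 0 M r P Q" by (simp add: et_def al_def ga_def)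
  ultimately have "4 * be 0 = xi4 a b ka kb kc" "48 * et 0 = eta48 a b ka kb kc" by simp_all
  with \<open>pv = _\<close> line_axioms show ?thesis by blast
qed

section \<open>The defining relations\<close>

lemma eq_by_functionals:
  fixes x y :: "'a::complex_vector"
  assumes "\<And>g. real_linear g \<Longrightarrow> g x = g y"
  shows "x = y"
proof -
  have "x - y = 0"
  proof (rule member_by_functionals[of "\<lambda>z. z = 0" "x - y"])
    fix g :: "'a \<Rightarrow> real" assume "real_linear g"
    then show "g (x - y) = 0" using assms[of g] real_linear_simps(3)[of g] by simp
  qed auto
  then show ?thesis by simp
qed

context
  fixes A B C a2 a5 a6 a8 a9 :: "'a::complex_algebra_1"
  assumes central: "\<And>x z. x \<in> {a2, a5, a6, a8, a9} \<Longrightarrow> z \<in> {A, B, C, a2, a5, a6, a8, a9} \<Longrightarrow> z * x = x * z"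
    and rel: "A * B - B * A = C" "A * C - C * A = - 6 * B^2 + a2 * A^2 + a5 * A + a8"
      "B * C - C * B = - 2 * A^3 - a2 * (A * B + B * A) - a5 * B + a6 * A + a9"
begin

text \<open>A consequence of the relations in any algebra. The rules order every word as
  coefficients, \<open>A\<close>, \<open>B\<close>, \<open>C\<close>; a real functional then turns
  the comparison of the two noncommutative sums into arithmetic of real numbers.\<close>

lemma casimir_commutes:
  defines "W \<equiv> (6 * a5 + 2 * a9) * A + (- 2 * a6 - 2 * a8) * B + (6 * a2 + a6) * A^2 + (- a5) * (A * B + B * A)
    + (8 * a2 - 24) * B^2 + (- 2 * a2 + 12) * (A * B * A) - A^4 + 4 * B^3 + C^2"
  shows "A * W = W * A" "B * W = W * B"
proof -
  have assoc: "p * q = r \<Longrightarrow> p * (q * z) = r * z" for p q r z :: 'a by (simp add: mult.assoc[symmetric])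
  have BA: "B * A = A * B - C" using rel(1) by (simp add: algebra_simps)
  have CA: "C * A = A * C - (a2 * (A * A) + a5 * A + a8 - 6 * (B * B))" using rel(2) by (simp add: algebra_simps power2_eq_square)
  have CB: "C * B = B * C - (a6 * A + a9 - 2 * (A * (A * A)) - a2 * (A * B + B * A) - a5 * B)"
    using rel(3) by (simp add: algebra_simps power3_eq_cube)
  have num: "z * numeral n = numeral n * z" for z :: 'a and n
    by (induction n) (simp_all only: numeral.simps distrib_left distrib_right mult_1_left mult_1_right)
  have cen: "A * a2 = a2 * A" "B * a2 = a2 * B" "C * a2 = a2 * C" "A * a5 = a5 * A" "B * a5 = a5 * B" "C * a5 = a5 * C"
    "A * a6 = a6 * A" "B * a6 = a6 * B" "C * a6 = a6 * C" "A * a8 = a8 * A" "B * a8 = a8 * B" "C * a8 = a8 * C"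
    "A * a9 = a9 * A" "B * a9 = a9 * B" "C * a9 = a9 * C"
    "a5 * a2 = a2 * a5" "a6 * a2 = a2 * a6" "a8 * a2 = a2 * a8" "a9 * a2 = a2 * a9" "a6 * a5 = a5 * a6"
    "a8 * a5 = a5 * a8" "a9 * a5 = a5 * a9" "a8 * a6 = a6 * a8" "a9 * a6 = a6 * a9" "a9 * a8 = a8 * a9"
    by (auto intro: central)
  have n: "A * numeral n = numeral n * A" "B * numeral n = numeral n * B" "C * numeral n = numeral n * C"
    "a2 * numeral n = numeral n * a2" "a5 * numeral n = numeral n * a5" "a6 * numeral n = numeral n * a6"
    "a8 * numeral n = numeral n * a8" "a9 * numeral n = numeral n * a9" for n by (rule num)+
  have pw: "A ^ 4 = A * (A * (A * A))" "A ^ 2 = A * A" "B ^ 2 = B * B" "C ^ 2 = C * C" "B ^ 3 = B * (B * B)"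
    by (simp_all add: eval_nat_numeral)
  note rules = mult.assoc BA assoc[OF BA] CA assoc[OF CA] CB assoc[OF CB] cen assoc[OF cen(1)] assoc[OF cen(2)] assoc[OF cen(3)]
    assoc[OF cen(4)] assoc[OF cen(5)] assoc[OF cen(6)] assoc[OF cen(7)] assoc[OF cen(8)] assoc[OF cen(9)] assoc[OF cen(10)]
    assoc[OF cen(11)] assoc[OF cen(12)] assoc[OF cen(13)] assoc[OF cen(14)] assoc[OF cen(15)] assoc[OF cen(16)] assoc[OF cen(17)]
    assoc[OF cen(18)] assoc[OF cen(19)] assoc[OF cen(20)] assoc[OF cen(21)] assoc[OF cen(22)] assoc[OF cen(23)] assoc[OF cen(24)]
    assoc[OF cen(25)] n assoc[OF n(1)] assoc[OF n(2)] assoc[OF n(3)] assoc[OF n(4)] assoc[OF n(5)] assoc[OF n(6)] assoc[OF n(7)] assoc[OF n(8)]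
    distrib_left distrib_right left_diff_distrib right_diff_distrib minus_mult_left[symmetric] minus_mult_right[symmetric] pw
  show "A * W = W * A"
  proof (rule eq_by_functionals)
    fix g :: "'a \<Rightarrow> real" assume g: "real_linear g"
    have gn: "g (numeral n * z) = numeral n * g z" for n z
      by (induction n) (simp_all only: numeral.simps distrib_right mult_1_left real_linear_simps[OF g])
    show "g (A * W) = g (W * A)"
      unfolding W_def by (simp only: rules real_linear_simps(1-4)[OF g] gn)
  qed
  show "B * W = W * B"
  proof (rule eq_by_functionals)
    fix g :: "'a \<Rightarrow> real" assume g: "real_linear g"
    have gn: "g (numeral n * z) = numeral n * g z" for n z
      by (induction n) (simp_all only: numeral.simps distrib_right mult_1_left real_linear_simps[OF g])
    show "g (B * W) = g (W * B)"
      unfolding W_def by (simp only: rules real_linear_simps(1-4)[OF g] gn)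
  qed
qed

end

section \<open>Weights of polynomials in the parameters\<close>

lemma pw_mono: "pw m p \<Longrightarrow> m \<le> n \<Longrightarrow> pw n p"
  unfolding pw_def using order.trans by blast

lemma pw_add: "pw m p \<Longrightarrow> pw n q \<Longrightarrow> pw (max m n) (p + q)"
  unfolding pw_def lookup_add by (metis add_0 le_max_iff_disj)

lemma pw_uminus: "pw n p \<Longrightarrow> pw n (- p)"
  unfolding pw_def by simp

lemma pw_diff: "pw m p \<Longrightarrow> pw n q \<Longrightarrow> pw (max m n) (p - q)"
  using pw_add[of m p n "- q"] pw_uminus[of n q] by simp

lemma pw_scaleC: "pw n p \<Longrightarrow> pw n (c *\<^sub>C p)"
  unfolding pw_def by (auto simp: scaleC_poly_mapping.rep_eq scaleC_complex_def)

lemma pw_zero: "pw n 0"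
  unfolding pw_def by simp

lemma pw_sum: "(\<And>i. i \<in> S \<Longrightarrow> pw n (f i)) \<Longrightarrow> pw n (sum f S)"
proof (induction S rule: infinite_finite_induct)
  case (insert i S)
  then show ?case using pw_add[of n "f i" n "sum f S"] by simp
qed (simp_all add: pw_zero)

lemma pw_mult:
  assumes "pw m p" "pw n q"
  shows "pw (m + n) (p * q)"
  unfolding pw_def
proof (intro allI impI)
  fix k assume "lookup (p * q) k \<noteq> 0"
  then have "k \<in> {a + b | a b. a \<in> keys p \<and> b \<in> keys q}"
    using keys_mult[of p q] by (auto simp: in_keys_iff)
  then show "pwt k \<le> m + n"
    using assms by (auto simp: pw_def in_keys_iff pwt_add intro!: add_mono)
qed

lemma pw_one: "pw 0 1"
  by (auto simp: pw_def lookup_one when_def pwt_def split: if_splits)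

lemma pw_numeral: "pw 0 (numeral n)"
proof (induction n)
  case (Bit0 n)
  then show ?case using pw_add[of 0 "numeral n" 0 "numeral n"] by (simp only: numeral.simps max.idem)
next
  case (Bit1 n)
  then show ?case using pw_add[OF pw_add[of 0 "numeral n" 0 "numeral n"] pw_one] by (simp only: numeral.simps max.idem)
qed (simp add: pw_one)

lemma pw_power: "pw n p \<Longrightarrow> pw (n * e) (p ^ e)"
proof (induction e)
  case (Suc e)
  then show ?case using pw_mult[of n p "n * e" "p ^ e"] by simp
qed (simp add: pw_one)

lemma pw_kp: "pw 2 (kp i)" and pw_lp: "pw 3 (lp i)"
  using pwt_single[of i] by (auto simp: pw_def kp_def lp_def lookup_single when_def split: if_splits)

lemma pw_perm_poly:
  assumes "\<pi> permutes UNIV" "pw n p"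
  shows "pw n (perm_poly \<pi> p)"
proof -
  have "pwt (Poly_Mapping.map_key (perm_param \<pi>) m) = pwt m" for m :: "param \<Rightarrow>\<^sub>0 nat"
    using sum.permute[OF assms(1), of "\<lambda>i. lookup m (Par_k i)"]
      sum.permute[OF assms(1), of "\<lambda>i. lookup m (Par_l i)"]
    by (simp add: pwt_def Poly_Mapping.map_key.rep_eq inj_perm_param[OF assms(1)] comp_def)
  then show ?thesis
    using assms(2) unfolding pw_def perm_poly_def
    by (simp add: Poly_Mapping.map_key.rep_eq[OF inj_map_key_perm_param[OF assms(1)]]) (metis)
qed

lemma pw_Sym: "pw n p \<Longrightarrow> pw n (Sym_plus p)" "pw n p \<Longrightarrow> pw n (Sym_minus p)"
proof -
  assume p: "pw n p"
  show "pw n (Sym_plus p)" unfolding Sym_plus_def by (intro pw_scaleC pw_sum pw_perm_poly[OF _ p]) simp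
  have "pw n (of_int (sign \<pi>) * perm_poly \<pi> p)" if "\<pi> permutes UNIV" for \<pi>
    using pw_perm_poly[OF that p] by (auto simp: sign_def pw_uminus)
  then show "pw n (Sym_minus p)" unfolding Sym_minus_def by (intro pw_scaleC pw_sum) simp
qed

lemmas pw_rules = pw_scaleC pw_add pw_diff pw_uminus pw_mult pw_power pw_kp pw_lp pw_numeral pw_one

lemma pw_coefficients: "pw 2 a2" "pw 5 a5" "pw 6 a6" "pw 8 a8" "pw 9 a9" "pw 12 a12"
proof -
  show "pw 2 a2" unfolding a2_def by (rule pw_mono, (rule pw_rules)+, simp)
  show "pw 5 a5" unfolding a5_def by (rule pw_Sym, rule pw_mono, (rule pw_rules)+, simp)
  show "pw 6 a6" unfolding a6_def by (rule pw_Sym, rule pw_mono, (rule pw_rules)+, simp)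
  show "pw 8 a8" unfolding a8_def by (rule pw_Sym, rule pw_mono, (rule pw_rules)+, simp)
  show "pw 9 a9" unfolding a9_def by (rule pw_Sym, rule pw_mono, (rule pw_rules)+, simp)
  show "pw 12 a12" unfolding a12_def by (rule pw_Sym, rule pw_mono, (rule pw_rules)+, simp)
qed

lemma pmap_zpar_filt:
  assumes "pw n p"
  shows "filt v zwt n (pmap (zpar v) p)"
proof -
  have pow: "filt v zwt (e * m) (x ^ e)" if "filt v zwt m x" for e m x
  proof (induction e)
    case (Suc e)
    then show ?case using filt_mult[OF that, of "e * m" "x ^ e"] by simp
  qed (simp add: filt.one)
  have k: "filt v zwt 2 (v (ZK i))" and l: "filt v zwt 3 (v (ZL i))" for i
    using filt_gen[of v zwt "ZK i"] filt_gen[of v zwt "ZL i"] by auto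
  have mon: "filt v zwt (pwt m) (pmon (zpar v) m)" for m
  proof -
    have "filt v zwt (lookup m (Par_k 1) * 2 + (lookup m (Par_k 2) * 2
        + (lookup m (Par_k 3) * 2 + (lookup m (Par_l 1) * 3
        + (lookup m (Par_l 2) * 3 + (lookup m (Par_l 3) * 3 + 0)))))) (pmon (zpar v) m)"
      unfolding pmon_def zpar_def list.map prod_list.Cons prod_list.Nil param.case
      by (intro filt_mult pow k l filt.one)
    then show ?thesis by (simp add: pwt_def sum_3 algebra_simps)
  qed
  have sum: "filt v zwt n (sum f S)" if "\<And>i. i \<in> S \<Longrightarrow> filt v zwt n (f i)" for f and S :: "(param \<Rightarrow>\<^sub>0 nat) set"
    using that by (induction S rule: infinite_finite_induct) (auto intro: filt.add filt_zero)
  show ?thesis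
    unfolding pmap_def
  proof (rule sum)
    fix m assume "m \<in> keys p"
    then have "pwt m \<le> n" using assms by (simp add: pw_def in_keys_iff)
    from filt.scale[OF filt.mono[OF mon this]] show "filt v zwt n (lookup p m *\<^sub>C pmon (zpar v) m)" .
  qed
qed

lemma kap_trace_span: "pw n p \<Longrightarrow> trace_span n (kap p)"
  using pmap_zpar_filt[of n p zvalZ] by (simp add: kap_def filt_zvalZ)

lemma kap_central: "trace_span n z \<Longrightarrow> z * kap p = kap p * z"
proof -
  assume z: "trace_span n z"
  have "zpar zvalZ x * z = z * zpar zvalZ x" for x
    using kU_central[OF z] lU_central[OF z] unfolding zpar_def zvalZ_def by (cases x) simp_all
  then show ?thesis unfolding kap_def by (rule pmap_commute[symmetric])
qed

lemma zpar_commute: "zpar zvalZ x * zpar zvalZ y = zpar zvalZ y * zpar zvalZ x"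
proof -
  have "\<exists>n. trace_span n (zpar zvalZ y)"
    using kU_trace_span lU_trace_span unfolding zpar_def zvalZ_def by (cases y) auto
  then obtain n where y: "trace_span n (zpar zvalZ y)" by blast
  have "zpar zvalZ (Par_k i) = kU i" "zpar zvalZ (Par_l i) = lU i" for i by (simp_all add: zpar_def zvalZ_def)
  then show ?thesis using kU_central[OF y] lU_central[OF y] by (cases x) simp_all
qed

lemma kap_simps: "kap (p + q) = kap p + kap q" "kap (p - q) = kap p - kap q" "kap (- p) = - kap p"
  "kap (p * q) = kap p * kap q" "kap 1 = 1" "kap (numeral n) = numeral n" "kap (c *\<^sub>C p) = c *\<^sub>C kap p" "kap 0 = 0"
  by (simp_all add: kap_def pmap_add pmap_diff pmap_uminus pmap_mult[OF zpar_commute] pmap_one pmap_numeral pmap_scaleC pmap_zero)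

lemma kap_var: "kap (kp i) = kU i" "kap (lp i) = lU i"
  by (simp_all add: kap_def pmap_var zpar_def zvalZ_def)

lemma wle_single: "wle n (single (0, 0, False) p) \<longleftrightarrow> pw n p"
  by (auto simp: wle_def pw_def lookup_single when_def)

text \<open>By \<open>nf_slight\<close> only the term without \<open>X\<close>, \<open>Y\<close>,
  \<open>Z\<close> survives in the normal form, and the normal form passes its weight bound on to
  \<open>p\<close>. This bound is what makes the degree argument on the hypersurface
  available.\<close>

lemma slight_is_scalar:
  assumes z: "trace_span n z" and slight: "\<And>u A M r P Q s t. line u A M r P Q s t \<Longrightarrow>
    \<exists>T. line.acts u A M r P Q z T \<and> line.slight u A M r P Q T"
  shows "\<exists>p. pw n p \<and> z = kap p"
proof -
  obtain F where F: "wle n F" "z = nf zvalZ F" using U2_normal_form[OF z] by blast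
  define p where "p = lookup F (0, 0, False)"
  have "F = single (0, 0, False) p"
    unfolding p_def by (rule nf_slight_single) (use slight F(2) in simp)
  then show ?thesis using F by (auto simp: wle_single nf_single imon_def kap_def)
qed

section \<open>The relations as operators on lines\<close>

context line
begin

lemma acts_Z': "acts Z_elem opZ"
  using acts_Z by (simp add: opZ_def[abs_def])

lemma acts_numeral: "acts z T \<Longrightarrow> acts (numeral n * z) (\<lambda>g c. numeral n * T g c)"
proof -
  assume "acts z T"
  from acts_scaleC[OF this, of "numeral n"] have "acts (numeral n *\<^sub>C z) (\<lambda>g c. numeral n * T g c)" .
  moreover have num: "(numeral n :: U2) = numeral n *\<^sub>C 1"
    by (induction n) (simp_all only: numeral.simps scaleC_one scaleC_add_left)
  have "numeral n * z = numeral n *\<^sub>C z" by (subst num) (simp only: mult_scaleC_left mult_1_left)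
  ultimately show ?thesis by simp
qed

lemma acts_kap_mult: "acts z T \<Longrightarrow> acts (kap p * z) (\<lambda>g c. pmap pv p * T g c)"
  using acts_mult[OF acts_pmap, of z T p] by (simp add: kap_def)

lemmas acts_XX = acts_mult[OF acts_X acts_X] and acts_XY = acts_mult[OF acts_X acts_Y] and acts_YX = acts_mult[OF acts_Y acts_X]
  and acts_YY = acts_mult[OF acts_Y acts_Y]

lemma pv_simps: "pv (Par_k i) = kv i" "pv (Par_l i) = lv i"
  by (simp_all add: pv_def)

lemma eval_pv: "pmap pv a2 = sk / 6" "pmap pv a5 = skl / 81" "pmap pv a6 = sym6 / 69984"
proof -
  show "pmap pv a2 = sk / 6" by (simp add: eval_a2 pv_simps sk_def)
  have "6 * pmap pv a5 = 6 * (skl / 81)"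
    unfolding eval_a5 by (simp add: pv_simps sum_perms_def skl_def field_simps)
  then show "pmap pv a5 = skl / 81" unfolding mult_cancel_left by simp
  have "576 * pmap pv a6 = 576 * (sym6 / 69984)"
    unfolding eval_a6 by (simp add: pv_simps sum_perms_def term6_def sym6_def sym6_term_def field_simps)
  then show "pmap pv a6 = sym6 / 69984" unfolding mult_cancel_left by simp
qed

definition op8 :: "(complex \<Rightarrow> complex) \<Rightarrow> complex \<Rightarrow> complex" where
  "op8 g c = opX (opZ g) c - opZ (opX g) c + 6 * opY (opY g) c - pmap pv a2 * opX (opX g) c - pmap pv a5 * opX g c"

lemma acts_op8: "acts (X_elem * Z_elem - Z_elem * X_elem + 6 * (Y_elem * Y_elem) - kap a2 * (X_elem * X_elem) - kap a5 * X_elem) op8"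
  unfolding op8_def[abs_def]
  by (rule acts_diff[OF acts_diff[OF acts_add[OF acts_diff[OF acts_mult[OF acts_X acts_Z'] acts_mult[OF acts_Z' acts_X]]
    acts_numeral[OF acts_YY]] acts_kap_mult[OF acts_XX]] acts_kap_mult[OF acts_X]])

lemma slight_op8: "slight op8"
  by (rule slight_diagonal, unfold op8_def eval_pv, erule XZ_diag)

definition op9 :: "(complex \<Rightarrow> complex) \<Rightarrow> complex \<Rightarrow> complex" where
  "op9 g c = opY (opZ g) c - opZ (opY g) c + 2 * opX (opX (opX g)) c + pmap pv a2 * (opX (opY g) c + opY (opX g) c)
    + pmap pv a5 * opY g c - pmap pv a6 * opX g c"

lemma acts_op9: "acts (Y_elem * Z_elem - Z_elem * Y_elem + 2 * (X_elem * (X_elem * X_elem))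
    + kap a2 * (X_elem * Y_elem + Y_elem * X_elem) + kap a5 * Y_elem - kap a6 * X_elem) op9"
  unfolding op9_def[abs_def]
  by (rule acts_diff[OF acts_add[OF acts_add[OF acts_add[OF acts_diff[OF acts_mult[OF acts_Y acts_Z'] acts_mult[OF acts_Z' acts_Y]]
    acts_numeral[OF acts_mult[OF acts_X acts_XX]]] acts_kap_mult[OF acts_add[OF acts_XY acts_YX]]] acts_kap_mult[OF acts_Y]] acts_kap_mult[OF acts_X]])

lemma slight_op9: "slight op9"
  by (rule slight_diagonal, unfold op9_def eval_pv, erule YZ_diag)

end

locale special_line = line u 0 M r P Q s t for u M r P Q s t :: complex +
  fixes a b ka kb kc :: complex
  assumes pv_eq: "pv = param_vec ka kb kc (root_val ka a) (root_val kb b) (- root_val kc (a + b - 1))"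
    and be_eq: "4 * be 0 = xi4 a b ka kb kc" and et_eq: "48 * et 0 = eta48 a b ka kb kc"
begin

lemma op_0: "opX g 0 = be 0 * g 0" "opY g 0 = et 0 * g 0" "opZ g 0 = 0"
proof -
  have "al 0 = 0" "ga 0 = 0" by (simp_all add: al_def ga_def)
  then show "opX g 0 = be 0 * g 0" "opY g 0 = et 0 * g 0" "opZ g 0 = 0"
    by (simp_all add: opX_def opY_def opZ_def)
qed

lemma special_values:
  fixes x y :: complex
  assumes x: "x = be 0" and y: "y = et 0"
  shows "6 * (y * y) - pmap pv a2 * (x * x) - pmap pv a5 * x = pmap pv a8"
    and "2 * (x * (x * x)) + pmap pv a2 * (x * y + y * x) + pmap pv a5 * y - pmap pv a6 * x = pmap pv a9"
    and "(6 * pmap pv a5 + 2 * pmap pv a9) * x + (- 2 * pmap pv a6 - 2 * pmap pv a8) * y + (6 * pmap pv a2 + pmap pv a6) * x^2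
      - pmap pv a5 * (2 * x * y) + (8 * pmap pv a2 - 24) * y^2 + (- 2 * pmap pv a2 + 12) * (x * y * x) - x^4 + 4 * y^3 = pmap pv a12"
proof -
  have pv': "pv (Par_k 1) = ka" "pv (Par_k 2) = kb" "pv (Par_k 3) = kc" "pv (Par_l 1) = root_val ka a"
    "pv (Par_l 2) = root_val kb b" "pv (Par_l 3) = - root_val kc (a + b - 1)"
    by (simp_all add: pv_eq param_vec_def)
  have N: "2 * root_val k z = 3 * (2 * z ^ 3 - (k + 2) * z)" for k z
    by (simp add: root_val_def field_simps)
  then have N': "2 * - root_val k z = - (3 * (2 * z ^ 3 - (k + 2) * z))" for k z by simp
  have x': "4 * x = xi4 a b ka kb kc" and y': "48 * y = eta48 a b ka kb kc" using x y be_eq et_eq by simp_all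
  note hyp = N[of ka a] N[of kb b] N'[of kc "a + b - 1"] x' y'
  have "2 * pmap pv a2 = ka + kb + kc" by (simp add: eval_a2 pv')
  note e2 = this[symmetric]
  note e = eval_a5[of pv, unfolded pv', symmetric] eval_a6[of pv, unfolded pv', symmetric] eval_a8[of pv, unfolded pv', symmetric]
    eval_a9[of pv, unfolded pv', symmetric] eval_a12[of pv, unfolded pv', symmetric]
  define e2 e5 e6 e8 e9 e12 where "e2 = pmap pv a2" and "e5 = pmap pv a5" and "e6 = pmap pv a6" and "e8 = pmap pv a8"
    and "e9 = pmap pv a9" and "e12 = pmap pv a12"
  note es = e2_def[symmetric] e5_def[symmetric] e6_def[symmetric] e8_def[symmetric] e9_def[symmetric] e12_def[symmetric]
  have "2304 * (6 * (y * y) - e2 * (x * x) - e5 * x) = 2304 * e8"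
    using hyperplane_8[OF hyp] unfolding e e2 es by Groebner_Basis.algebra
  then show "6 * (y * y) - pmap pv a2 * (x * x) - pmap pv a5 * x = pmap pv a8"
    unfolding mult_cancel_left es by simp
  have "6912 * (2 * (x * (x * x)) + e2 * (x * y + y * x) + e5 * y - e6 * x) = 6912 * e9"
    using hyperplane_9[OF hyp] unfolding e e2 es by Groebner_Basis.algebra
  then show "2 * (x * (x * x)) + pmap pv a2 * (x * y + y * x) + pmap pv a5 * y - pmap pv a6 * x = pmap pv a9"
    unfolding mult_cancel_left es by simp
  have "1327104 * ((6 * e5 + 2 * e9) * x + (- 2 * e6 - 2 * e8) * y + (6 * e2 + e6) * x^2
      - e5 * (2 * x * y) + (8 * e2 - 24) * y^2 + (- 2 * e2 + 12) * (x * y * x) - x^4 + 4 * y^3) = 1327104 * e12"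
    using hyperplane_12[OF hyp] unfolding e e2 es by Groebner_Basis.algebra
  then show "(6 * pmap pv a5 + 2 * pmap pv a9) * x + (- 2 * pmap pv a6 - 2 * pmap pv a8) * y + (6 * pmap pv a2 + pmap pv a6) * x^2
      - pmap pv a5 * (2 * x * y) + (8 * pmap pv a2 - 24) * y^2 + (- 2 * pmap pv a2 + 12) * (x * y * x) - x^4 + 4 * y^3 = pmap pv a12"
    unfolding mult_cancel_left es by simp
qed

end

text \<open>A central element is determined by its values at the points \<open>c = 0\<close> of the lines with \<open>A = 0\<close>, where \<open>X\<close>, \<open>Y\<close>, \<open>Z\<close>
  act by scalars.\<close>

lemma scalar_determined:
  assumes z: "trace_span n z" and n: "n \<le> 12" and q: "pw 12 q"
    and slight: "\<And>u A M r P Q s t. line u A M r P Q s t \<Longrightarrow> \<exists>T. line.acts u A M r P Q z T \<and> line.slight u A M r P Q T"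
    and val: "\<And>u M r P Q s t a b ka kb kc. special_line u M r P Q s t a b ka kb kc \<Longrightarrow>
      \<exists>T. line.acts u 0 M r P Q z T \<and> T (\<lambda>c. 1) 0 = pmap (line.pv u 0 M r P Q) q"
  shows "z = kap q"
proof -
  have "\<exists>p. pw n p \<and> z = kap p" by (rule slight_is_scalar[OF z]) (rule slight)
  then obtain p where "pw n p" "z = kap p" by blast
  moreover have "p - q = 0"
  proof (rule hypersurface_dense)
    show "pw 12 (p - q)" using pw_diff[OF pw_mono[OF \<open>pw n p\<close> n] q] by simp
    fix ka kb kc a b
    let ?v = "param_vec ka kb kc (root_val ka a) (root_val kb b) (- root_val kc (a + b - 1))"
    obtain u M r P Q s t where L: "line u 0 M r P Q s t" and pv: "line.pv u 0 M r P Q = ?v"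
      and x: "4 * line.be u 0 M r P Q 0 = xi4 a b ka kb kc" and y: "48 * line.et u 0 M r P Q 0 = eta48 a b ka kb kc"
      using hyperplane_line[of ka kb kc a b] by blast
    interpret special_line u M r P Q s t a b ka kb kc
      using L pv x y unfolding special_line_def special_line_axioms_def by blast
    obtain T where T: "acts (kap p) T" "T (\<lambda>c. 1) 0 = pmap pv q" using val[OF special_line_axioms] \<open>z = kap p\<close> by auto
    have "T (\<lambda>c. 1) 0 = pmap pv p * 1"
      by (rule acts_unique[OF T(1)]) (unfold kap_def, rule acts_pmap)
    then show "pmap ?v (p - q) = 0" using T(2) pv by (simp add: pmap_diff)
  qed
  ultimately show ?thesis by simp
qed

lemma numeral_trace_span: "trace_span n z \<Longrightarrow> trace_span n (numeral m * z)"
  using trace_span_mult[OF kap_trace_span[OF pw_numeral[of m]]] by (simp add: kap_simps)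

lemma kap_mult_trace_span: "pw m p \<Longrightarrow> trace_span n z \<Longrightarrow> m + n \<le> k \<Longrightarrow> trace_span k (kap p * z)"
  using trace_span_mult[OF kap_trace_span] trace_span.mono by blast

lemma mult_trace_span: "trace_span m y \<Longrightarrow> trace_span n z \<Longrightarrow> m + n \<le> k \<Longrightarrow> trace_span k (y * z)"
  using trace_span_mult trace_span.mono by blast

lemmas XYZ_trace_span = X_trace_span Y_trace_span Z_trace_span

text \<open>The difference \<open>E\<close> acts diagonally by \<open>XZ_diag\<close>, hence is a
  scalar of weight at most 8, and at the special points its value is that of
  \<open>a8\<close>.\<close>

lemma commutator_X_Z: "X_elem * Z_elem - Z_elem * X_elem = - 6 * Y_elem^2 + kap a2 * X_elem^2 + kap a5 * X_elem + kap a8"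
proof -
  define E where "E = X_elem * Z_elem - Z_elem * X_elem + 6 * (Y_elem * Y_elem) - kap a2 * (X_elem * X_elem) - kap a5 * X_elem"
  have "E = kap a8"
  proof (rule scalar_determined[of 8])
    have t: "trace_span 8 (X_elem * Z_elem - Z_elem * X_elem)"
      using trace_span_commutator[OF X_trace_span Z_trace_span] by simp
    have t': "trace_span 8 (6 * (Y_elem * Y_elem))"
      by (intro numeral_trace_span mult_trace_span[OF XYZ_trace_span(2,2)]) simp
    have k: "trace_span 8 (kap a2 * (X_elem * X_elem))" "trace_span 8 (kap a5 * X_elem)"
      by (rule kap_mult_trace_span[OF pw_coefficients(1) trace_span_mult[OF XYZ_trace_span(1,1)]]
          kap_mult_trace_span[OF pw_coefficients(2) XYZ_trace_span(1)], simp)+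
    show "trace_span 8 E" unfolding E_def
      by (rule trace_span_diff[OF trace_span_diff[OF trace_span.add[OF t t'] k(1)] k(2)])
    show "pw 12 a8" using pw_mono[OF pw_coefficients(4)] by simp
    show "\<exists>T. line.acts u A M r P Q E T \<and> line.slight u A M r P Q T" if "line u A M r P Q s t" for u A M r P Q s t
      using line.acts_op8[OF that] line.slight_op8[OF that] unfolding E_def by blast
    fix u M r P Q s t a b ka kb kc
    assume "special_line u M r P Q s t a b ka kb kc"
    then interpret special_line u M r P Q s t a b ka kb kc .
    show "\<exists>T. acts E T \<and> T (\<lambda>c. 1) 0 = pmap pv a8"
      using acts_op8 special_values(1)[OF refl refl] unfolding E_def
      by (intro exI[of _ op8]) (simp add: op8_def op_0 mult_ac)
  qed simp
  then show ?thesis unfolding E_def by (simp add: power2_eq_square algebra_simps)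
qed

lemma commutator_Y_Z: "Y_elem * Z_elem - Z_elem * Y_elem = - 2 * X_elem^3 - kap a2 * (X_elem * Y_elem + Y_elem * X_elem)
    - kap a5 * Y_elem + kap a6 * X_elem + kap a9"
proof -
  define E where "E = Y_elem * Z_elem - Z_elem * Y_elem + 2 * (X_elem * (X_elem * X_elem)) + kap a2 * (X_elem * Y_elem + Y_elem * X_elem)
    + kap a5 * Y_elem - kap a6 * X_elem"
  have "E = kap a9"
  proof (rule scalar_determined[of 9])
    have t: "trace_span 9 (Y_elem * Z_elem - Z_elem * Y_elem)"
      using trace_span_commutator[OF Y_trace_span Z_trace_span] by simp
    have t': "trace_span 9 (2 * (X_elem * (X_elem * X_elem)))"
      by (intro numeral_trace_span mult_trace_span[OF XYZ_trace_span(1) trace_span_mult[OF XYZ_trace_span(1,1)]]) simp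
    have "trace_span 7 (X_elem * Y_elem + Y_elem * X_elem)"
      by (intro trace_span.add mult_trace_span[OF XYZ_trace_span(1,2)] mult_trace_span[OF XYZ_trace_span(2,1)]) simp_all
    then have t'': "trace_span 9 (kap a2 * (X_elem * Y_elem + Y_elem * X_elem))"
      by (rule kap_mult_trace_span[OF pw_coefficients(1)]) simp
    have k: "trace_span 9 (kap a5 * Y_elem)" "trace_span 9 (kap a6 * X_elem)"
      by (rule kap_mult_trace_span[OF pw_coefficients(2) XYZ_trace_span(2)] kap_mult_trace_span[OF pw_coefficients(3) XYZ_trace_span(1)], simp)+
    show "trace_span 9 E" unfolding E_def
      by (rule trace_span_diff[OF trace_span.add[OF trace_span.add[OF trace_span.add[OF t t'] t''] k(1)] k(2)])
    show "pw 12 a9" using pw_mono[OF pw_coefficients(5)] by simp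
    show "\<exists>T. line.acts u A M r P Q E T \<and> line.slight u A M r P Q T" if "line u A M r P Q s t" for u A M r P Q s t
      using line.acts_op9[OF that] line.slight_op9[OF that] unfolding E_def by blast
    fix u M r P Q s t a b ka kb kc
    assume "special_line u M r P Q s t a b ka kb kc"
    then interpret special_line u M r P Q s t a b ka kb kc .
    show "\<exists>T. acts E T \<and> T (\<lambda>c. 1) 0 = pmap pv a9"
      using acts_op9 special_values(2)[OF refl refl] unfolding E_def
      by (intro exI[of _ op9]) (simp add: op9_def op_0 mult_ac)
  qed simp
  then show ?thesis unfolding E_def by (simp add: power3_eq_cube algebra_simps)
qed

text \<open>The future image of \<open>Omega\<close>, written with \<open>kap\<close> because its
  value is needed before the morphism is constructed.\<close>

definition Omega_U2 :: U2 where
  "Omega_U2 = (6 * kap a5 + 2 * kap a9) * X_elem + (- 2 * kap a6 - 2 * kap a8) * Y_elem + (6 * kap a2 + kap a6) * X_elem^2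
    + (- kap a5) * (X_elem * Y_elem + Y_elem * X_elem) + (8 * kap a2 - 24) * Y_elem^2
    + (- 2 * kap a2 + 12) * (X_elem * Y_elem * X_elem) - X_elem^4 + 4 * Y_elem^3 + Z_elem^2"

lemma Omega_U2_commutes: "X_elem * Omega_U2 = Omega_U2 * X_elem" "Y_elem * Omega_U2 = Omega_U2 * Y_elem"
proof -
  have central: "z * x = x * z" if x: "x \<in> {kap a2, kap a5, kap a6, kap a8, kap a9}"
    and z: "z \<in> {X_elem, Y_elem, Z_elem, kap a2, kap a5, kap a6, kap a8, kap a9}" for x z
  proof -
    have "\<exists>n. trace_span n z" using z XYZ_trace_span kap_trace_span[OF pw_coefficients(1)] kap_trace_span[OF pw_coefficients(2)]
        kap_trace_span[OF pw_coefficients(3)] kap_trace_span[OF pw_coefficients(4)] kap_trace_span[OF pw_coefficients(5)]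
      unfolding insert_iff empty_iff by metis
    then obtain n where "trace_span n z" by blast
    moreover obtain p where "x = kap p" using x by blast
    ultimately show ?thesis using kap_central by metis
  qed
  have Z: "X_elem * Y_elem - Y_elem * X_elem = Z_elem" by (simp add: Z_elem_def commutator_def)
  note comm = casimir_commutes[where A = X_elem and B = Y_elem and C = Z_elem and ?a2.0 = "kap a2" and ?a5.0 = "kap a5"
      and ?a6.0 = "kap a6" and ?a8.0 = "kap a8" and ?a9.0 = "kap a9", folded Omega_U2_def, OF _ Z commutator_X_Z commutator_Y_Z]
  show "X_elem * Omega_U2 = Omega_U2 * X_elem" by (rule comm(1)) (rule central)
  show "Y_elem * Omega_U2 = Omega_U2 * Y_elem" by (rule comm(2)) (rule central)
qed

lemma Omega_U2_expand: "Omega_U2 = kap (6 * a5 + 2 * a9) * X_elem + kap (- 2 * a6 - 2 * a8) * Y_elem + kap (6 * a2 + a6) * (X_elem * X_elem) + kap (- a5) * (X_elem * Y_elem + Y_elem * X_elem)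
    + kap (8 * a2 - 24) * (Y_elem * Y_elem) + kap (- 2 * a2 + 12) * (X_elem * Y_elem * X_elem) - X_elem * (X_elem * (X_elem * X_elem))
    + 4 * (Y_elem * (Y_elem * Y_elem)) + Z_elem * Z_elem"
  unfolding Omega_U2_def kap_simps by (simp add: eval_nat_numeral)

definition (in line) op12 :: "(complex \<Rightarrow> complex) \<Rightarrow> complex \<Rightarrow> complex" where
  "op12 g c = pmap pv (6 * a5 + 2 * a9) * opX g c + pmap pv (- 2 * a6 - 2 * a8) * opY g c + pmap pv (6 * a2 + a6) * opX (opX g) c + pmap pv (- a5) * (opX (opY g) c + opY (opX g) c)
    + pmap pv (8 * a2 - 24) * opY (opY g) c + pmap pv (- 2 * a2 + 12) * opX (opY (opX g)) c - opX (opX (opX (opX g))) c + 4 * opY (opY (opY g)) c + opZ (opZ g) c"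

lemma (in line) acts_op12: "acts Omega_U2 op12"
  unfolding Omega_U2_expand op12_def[abs_def]
  by (rule acts_add[OF acts_add[OF acts_diff[OF acts_add[OF acts_add[OF acts_add[OF acts_add[OF acts_add[OF
    acts_kap_mult[OF acts_X] acts_kap_mult[OF acts_Y]] acts_kap_mult[OF acts_XX]] acts_kap_mult[OF acts_add[OF acts_XY acts_YX]]]
    acts_kap_mult[OF acts_YY]] acts_kap_mult[OF acts_mult[OF acts_XY acts_X]]] acts_mult[OF acts_X acts_mult[OF acts_X acts_XX]]]
    acts_numeral[OF acts_mult[OF acts_Y acts_YY]]] acts_mult[OF acts_Z' acts_Z']])

lemma (in line) slight_op12: "slight op12"
proof (rule slight_commute)
  show "opX (op12 g) c = op12 (opX g) c" "opY (op12 g) c = op12 (opY g) c" for g c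
    using acts_unique[OF acts_mult[OF acts_X acts_op12], of "\<lambda>g. op12 (opX g)" g c] acts_unique[OF acts_mult[OF acts_Y acts_op12], of "\<lambda>g. op12 (opY g)" g c]
      acts_mult[OF acts_op12 acts_X] acts_mult[OF acts_op12 acts_Y] by (simp_all add: Omega_U2_commutes)
qed

lemma Omega_U2_eq: "Omega_U2 = kap a12"
proof -
  show ?thesis
  proof (rule scalar_determined[of 12])
    have pw: "pw 9 (6 * a5 + 2 * a9)" "pw 8 (- 2 * a6 - 2 * a8)" "pw 6 (6 * a2 + a6)" "pw 5 (- a5)" "pw 2 (8 * a2 - 24)" "pw 2 (- 2 * a2 + 12)"
      by (rule pw_mono, (rule pw_rules pw_coefficients)+, simp)+
    note XX = trace_span_mult[OF XYZ_trace_span(1,1)]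
    have "trace_span 7 (X_elem * Y_elem + Y_elem * X_elem)"
      by (intro trace_span.add mult_trace_span[OF XYZ_trace_span(1,2)] mult_trace_span[OF XYZ_trace_span(2,1)]) simp_all
    note t = kap_mult_trace_span[OF pw(1) XYZ_trace_span(1), of 12] kap_mult_trace_span[OF pw(2) XYZ_trace_span(2), of 12]
      kap_mult_trace_span[OF pw(3) XX, of 12] kap_mult_trace_span[OF pw(4) this, of 12]
      kap_mult_trace_span[OF pw(5) trace_span_mult[OF XYZ_trace_span(2,2)], of 12]
      kap_mult_trace_span[OF pw(6) trace_span_mult[OF trace_span_mult[OF XYZ_trace_span(1,2)] XYZ_trace_span(1)], of 12]
      mult_trace_span[OF XYZ_trace_span(1) trace_span_mult[OF XYZ_trace_span(1) XX], of 12]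
      numeral_trace_span[OF mult_trace_span[OF XYZ_trace_span(2) trace_span_mult[OF XYZ_trace_span(2,2)], of 12]]
      mult_trace_span[OF XYZ_trace_span(3,3), of 12]
    show "trace_span 12 Omega_U2" unfolding Omega_U2_expand
      by (intro trace_span_diff trace_span.add t) simp_all
    show "pw 12 a12" by (rule pw_coefficients)
    show "\<exists>T. line.acts u A M r P Q Omega_U2 T \<and> line.slight u A M r P Q T" if "line u A M r P Q s t" for u A M r P Q s t
      using line.acts_op12[OF that] line.slight_op12[OF that] by blast
    fix u M r P Q s t a b ka kb kc
    assume "special_line u M r P Q s t a b ka kb kc"
    then interpret special_line u M r P Q s t a b ka kb kc .
    have "op12 (\<lambda>c. 1) 0 = pmap pv a12"
      unfolding special_values(3)[OF refl refl, symmetric] by (simp add: op12_def op_0 pmap_eval eval_nat_numeral mult_ac)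
    then show "\<exists>T. acts Omega_U2 T \<and> T (\<lambda>c. 1) 0 = pmap pv a12" using acts_op12 by blast
  qed simp
qed

section \<open>The isomorphism\<close>

lemma complex_algebra_homD:
  assumes "complex_algebra_hom f"
  shows "f 1 = 1" "f (x + y) = f x + f y" "f (x * y) = f x * f y" "f (c *\<^sub>C x) = c *\<^sub>C f x"
    "f 0 = 0" "f (- x) = - f x" "f (x - y) = f x - f y" "f (x ^ n) = f x ^ n" "f (numeral m) = numeral m"
    "f (sum h S) = (\<Sum>i\<in>S. f (h i))"
proof -
  have f: "f 1 = 1" "f (x + y) = f x + f y" "f (x * y) = f x * f y" "f (c *\<^sub>C x) = c *\<^sub>C f x" for x y c
    using assms unfolding complex_algebra_hom_def by blast+
  show "f 1 = 1" "f (x + y) = f x + f y" "f (x * y) = f x * f y" "f (c *\<^sub>C x) = c *\<^sub>C f x" by (rule f)+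
  show zero: "f 0 = 0" using f(2)[of 0 0] by simp
  show neg: "f (- x) = - f x" for x using f(2)[of x "- x"] zero by (simp add: eq_neg_iff_add_eq_0 add.commute)
  show "f (x - y) = f x - f y" using f(2)[of x "- y"] neg by simp
  show "f (x ^ n) = f x ^ n" by (induction n) (simp_all add: f)
  show "f (numeral m) = numeral m" by (induction m) (simp_all only: numeral.simps f)
  show "f (sum h S) = (\<Sum>i\<in>S. f (h i))" by (induction S rule: infinite_finite_induct) (simp_all add: zero f)
qed

lemma hom_pmap:
  assumes f: "complex_algebra_hom f"
  shows "f (pmap v p) = pmap (\<lambda>x. f (v x)) p"
proof -
  have prod: "f (prod_list xs) = prod_list (map f xs)" for xs
    by (induction xs) (simp_all add: complex_algebra_homD[OF f])
  show ?thesis by (simp add: pmap_def pmon_def complex_algebra_homD[OF f] prod)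
qed

lemma hom_nf:
  assumes f: "complex_algebra_hom f"
  shows "f (nf v F) = nf (\<lambda>g. f (v g)) F"
proof -
  have "(\<lambda>x. f (zpar v x)) = zpar (\<lambda>g. f (v g))"
    by (auto simp: zpar_def split: param.splits)
  then have "f (pmap (zpar v) p * imon v k) = pmap (zpar (\<lambda>g. f (v g))) p * imon (\<lambda>g. f (v g)) k" for p k
    by (cases k) (simp add: imon_def complex_algebra_homD[OF f] hom_pmap[OF f])
  then show ?thesis by (simp add: nf_def complex_algebra_homD[OF f])
qed

lemma hom_filt:
  assumes f: "complex_algebra_hom f"
  shows "filt v w n x \<Longrightarrow> filt (\<lambda>g. f (v g)) w n (f x)"
proof (induction rule: filt.induct)
  case (mult n x g)
  then show ?case using filt.mult[of "\<lambda>g. f (v g)" w n "f x" g] by (simp add: complex_algebra_homD[OF f])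
qed (auto simp: complex_algebra_homD[OF f] intro: filt.intros)

lemma pmap_variables: "pmap (\<lambda>x. single (single x 1) 1) p = (p :: params)"
proof (induction p rule: poly_mapping_induct_single)
  case (single m c)
  have pow: "single (single x 1) (1::complex) ^ n = single (single x n) 1"
    for x :: param and n :: nat
    by (induction n) (simp_all add: mult_single single_add[symmetric])
  let ?s = "\<lambda>x. single x (lookup m x)"
  let ?m = "?s (Par_k 1) + (?s (Par_k 2) + (?s (Par_k 3) + (?s (Par_l 1) + (?s (Par_l 2) + ?s (Par_l 3)))))"
  have m: "?m = m"
  proof (rule poly_mapping_eqI)
    fix x
    show "lookup ?m x = lookup m x"
      using three_cases[of "case x of Par_k i \<Rightarrow> i | Par_l i \<Rightarrow> i"]
      by (cases x) (auto simp: lookup_add lookup_single when_def)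
  qed
  have "pmon (\<lambda>x. single (single x 1) 1) m = (single ?m 1 :: params)"
    by (simp add: pmon_def pow[simplified] mult_single)
  also have "?m = m" by (rule m)
  finally have "pmon (\<lambda>x. single (single x 1) 1) m = (single m 1 :: params)" .
  then show ?case by (simp add: pmap_single scaleC_single scaleC_complex_def)
qed (simp_all add: pmap_zero pmap_add)

lemma coeff_A_hom: "complex_algebra_hom coeff_A"
proof -
  have "coeff_A 1 = 1" by (simp add: coeff_A_def one_alg_A_def)
  moreover have "coeff_A (p + q) = coeff_A p + coeff_A q" for p q
    by (simp add: coeff_A_def plus_alg_A.abs_eq single_add)
  moreover have "coeff_A (p * q) = coeff_A p * coeff_A q" for p q
    by (simp add: coeff_A_def times_alg_A.abs_eq mult_single)
  moreover have "coeff_A (c *\<^sub>C p) = c *\<^sub>C coeff_A p" for c p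
    by (simp add: coeff_A_def scaleC_alg_A.abs_eq scaleC_single)
  ultimately show ?thesis unfolding complex_algebra_hom_def by blast
qed

fun vA :: "zgen \<Rightarrow> alg_A" where
  "vA (ZK i) = coeff_A (kp i)" | "vA (ZL i) = coeff_A (lp i)" | "vA ZX = A_A" | "vA ZY = B_A" | "vA ZS = C_A"

lemma coeff_A_pmap: "coeff_A p = pmap (zpar vA) p"
proof -
  have "coeff_A p = pmap (\<lambda>x. coeff_A (single (single x 1) 1)) p"
    using hom_pmap[OF coeff_A_hom, of _ p] pmap_variables[of p] by metis
  also have "(\<lambda>x. coeff_A (single (single x 1) 1)) = zpar vA"
    by (auto simp: zpar_def kp_def lp_def split: param.splits)
  finally show ?thesis .
qed

lemma coeff_A_central: "coeff_A p * x = x * coeff_A p"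
proof (induction x)
  fix q
  have "single 0 p * q = q * single 0 p" for q :: "(abc, params) free_algebra"
    by (induction q rule: poly_mapping_induct_single) (simp_all add: mult_single mult.commute distrib_left distrib_right)
  then show "coeff_A p * abs_alg_A q = abs_alg_A q * coeff_A p"
    by (simp add: coeff_A_def times_alg_A.abs_eq)
qed

fun gen_A :: "abc \<Rightarrow> alg_A" where
  "gen_A Gen_A = A_A" | "gen_A Gen_B = B_A" | "gen_A Gen_C = C_A"

lemma alg_A_induct:
  assumes coeff: "\<And>p. P (coeff_A p)" and add: "\<And>x y. P x \<Longrightarrow> P y \<Longrightarrow> P (x + y)"
    and mult: "\<And>x g. P x \<Longrightarrow> P (gen_A g * x)"
  shows "P x"
proof (induction x)
  fix q :: "(abc, params) free_algebra"
  have word: "P (abs_alg_A (single (Free_Mon w) p))" for w p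
  proof (induction w)
    case Nil
    then show ?case using coeff[of p] by (simp add: coeff_A_def zero_free_mon_def)
  next
    case (Cons g w)
    have "gen_A g = abs_alg_A (free_gen g)" by (cases g) (simp_all add: A_A.abs_eq B_A.abs_eq C_A.abs_eq)
    then have "gen_A g * abs_alg_A (single (Free_Mon w) p) = abs_alg_A (single (Free_Mon (g # w)) p)"
      by (simp add: times_alg_A.abs_eq free_gen_def mult_single plus_free_mon_def)
    then show ?case using mult[OF Cons, of g] by simp
  qed
  show "P (abs_alg_A q)"
  proof (induction q rule: poly_mapping_induct_single)
    case zero
    then show ?case using word[of "[]" 0] by simp
  next
    case (single m c)
    then show ?case using word by (cases m) simp
  next
    case (add p q)
    then show ?case using assms(2) by (simp add: plus_alg_A.abs_eq[symmetric])
  qed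
qed

section \<open>The morphism \<open>phi\<close>\<close>

fun gen_U :: "abc \<Rightarrow> U2" where
  "gen_U Gen_A = X_elem" | "gen_U Gen_B = Y_elem" | "gen_U Gen_C = Z_elem"

text \<open>\<open>free_ext\<close> covers complex coefficients only. Here the coefficients are
  polynomials, sent by \<open>kap\<close> to elements that commute with \<open>X\<close>,
  \<open>Y\<close>, \<open>Z\<close>, on which multiplicativity rests.\<close>

definition free_phi :: "(abc, params) free_algebra \<Rightarrow> U2" where
  "free_phi p = (\<Sum>w\<in>keys p. kap (lookup p w) * prod_list (map gen_U (letters w)))"

lemma free_phi_superset:
  assumes "finite K" "keys p \<subseteq> K"
  shows "free_phi p = (\<Sum>w\<in>K. kap (lookup p w) * prod_list (map gen_U (letters w)))"
  unfolding free_phi_def using assms by (intro sum.mono_neutral_left) (auto simp: in_keys_iff kap_simps)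

lemma free_phi_single: "free_phi (single w p) = kap p * prod_list (map gen_U (letters w))"
  by (subst free_phi_superset[of "{w}"]) auto

lemma free_phi_zero: "free_phi 0 = 0"
  by (simp add: free_phi_def)

lemma free_phi_add: "free_phi (p + q) = free_phi p + free_phi q"
proof -
  let ?K = "keys p \<union> keys q"
  have "keys (p + q) \<subseteq> ?K" by (rule Poly_Mapping.keys_add)
  then show ?thesis
    by (simp add: free_phi_superset[of ?K] lookup_add kap_simps distrib_right sum.distrib)
qed

lemma free_phi_diff: "free_phi (p - q) = free_phi p - free_phi q"
  using free_phi_add[of "p - q" q] by simp

lemma free_phi_mult: "free_phi (p * q) = free_phi p * free_phi q"
proof (induction p rule: poly_mapping_induct_single)
  case (single v c)
  show ?case
  proof (induction q rule: poly_mapping_induct_single)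
    case (single w d)
    have "prod_list (map gen_U xs) * kap d = kap d * prod_list (map gen_U xs)" for xs
    proof (rule commute_prod_list)
      fix x assume "x \<in> set (map gen_U xs)"
      then obtain g where "x = gen_U g" by auto
      then show "x * kap d = kap d * x"
        using kap_central[OF X_trace_span] kap_central[OF Y_trace_span] kap_central[OF Z_trace_span] by (cases g) auto
    qed
    then have "kap c * (prod_list (map gen_U (letters v)) * kap d) * prod_list (map gen_U (letters w))
        = kap c * (kap d * prod_list (map gen_U (letters v))) * prod_list (map gen_U (letters w))" by simp
    then show ?case by (simp add: mult_single free_phi_single kap_simps plus_free_mon_def mult.assoc)
  qed (simp_all add: free_phi_zero free_phi_add distrib_left)
qed (simp_all add: free_phi_zero free_phi_add distrib_right)

lemma free_phi_gen: "free_phi (free_gen g) = gen_U g"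
  by (simp add: free_gen_def free_phi_single kap_simps)

lemma free_phi_coeff: "free_phi (single 0 p) = kap p"
  by (simp add: free_phi_single zero_free_mon_def)

lemma free_phi_simps: "free_phi 1 = 1" "free_phi (- x) = - free_phi x" "free_phi (x ^ n) = free_phi x ^ n" "free_phi (numeral m) = numeral m"
proof -
  show one: "free_phi 1 = 1" using free_phi_coeff[of 1] by (simp add: kap_simps)
  show "free_phi (- x) = - free_phi x" using free_phi_diff[of 0 x] by (simp add: free_phi_zero)
  show "free_phi (x ^ n) = free_phi x ^ n" by (induction n) (simp_all add: one free_phi_mult)
  show "free_phi (numeral m) = numeral m" by (induction m) (simp_all only: numeral.simps free_phi_add one)
qed

lemma free_phi_relations: "p \<in> A_relations \<Longrightarrow> free_phi p = 0"
  using commutator_X_Z commutator_Y_Z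
  by (auto simp: A_relations_def Let_def commutator_def anticommutator_def free_phi_diff free_phi_add free_phi_mult free_phi_simps
      free_phi_gen free_phi_coeff Z_elem_def[unfolded commutator_def, symmetric])

lift_definition phi :: "alg_A \<Rightarrow> U2" is free_phi
proof -
  fix p q assume "ideal_cong A_relations p q"
  then have "free_phi (p - q) = 0"
    unfolding ideal_cong_def by (rule Idl_subset_kernel[OF free_phi_add free_phi_mult free_phi_relations, rotated])
  then show "free_phi p = free_phi q" by (simp add: free_phi_diff)
qed

lemma phi_coeff: "phi (coeff_A p) = kap p"
  by (simp add: coeff_A_def phi.abs_eq free_phi_coeff)

lemma phi_gen: "phi A_A = X_elem" "phi B_A = Y_elem" "phi C_A = Z_elem"
  by (simp_all add: A_A.abs_eq B_A.abs_eq C_A.abs_eq phi.abs_eq free_phi_gen)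

lemma phi_hom: "complex_algebra_hom phi"
proof -
  have one: "phi 1 = 1" by transfer (rule free_phi_simps)
  have add: "phi (x + y) = phi x + phi y" and mult: "phi (x * y) = phi x * phi y" for x y
    by (transfer, rule free_phi_add, transfer, rule free_phi_mult)
  have "phi (c *\<^sub>C x) = c *\<^sub>C phi x" for c x
  proof -
    have "c *\<^sub>C x = coeff_A (c *\<^sub>C 1) * x"
      by (simp add: complex_algebra_homD[OF coeff_A_hom] mult_scaleC_left)
    then show ?thesis by (simp add: mult phi_coeff kap_simps mult_scaleC_left)
  qed
  with one add mult show ?thesis unfolding complex_algebra_hom_def by blast
qed

lemma phi_unique:
  assumes f: "complex_algebra_hom f" and gen: "f A_A = X_elem" "f B_A = Y_elem" "f C_A = Z_elem"
    and par: "\<And>i. f (coeff_A (kp i)) = kU i" "\<And>i. f (coeff_A (lp i)) = lU i"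
  shows "f x = phi x"
proof (induction x rule: alg_A_induct)
  case (1 p)
  have "(\<lambda>x. f (zpar vA x)) = zpar zvalZ"
    using par by (auto simp: zpar_def zvalZ_def split: param.splits)
  then have "f (coeff_A p) = kap p" unfolding coeff_A_pmap hom_pmap[OF f] kap_def by simp
  then show ?case by (simp add: phi_coeff)
next
  case (2 x y)
  then show ?case by (simp add: complex_algebra_homD[OF f] complex_algebra_homD[OF phi_hom])
next
  case (3 x g)
  then show ?case using gen by (cases g) (simp_all add: complex_algebra_homD[OF f] complex_algebra_homD[OF phi_hom] phi_gen)
qed

section \<open>The weighted filtration of the abstract algebra\<close>

abbreviation "filt_A \<equiv> filt vA zwt"

lemma coeff_filt: "pw n p \<Longrightarrow> filt_A n (coeff_A p)"
  using pmap_zpar_filt[of n p vA] by (simp add: coeff_A_pmap)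

lemma filt_A_exists: "\<exists>n. filt_A n x"
proof (induction x rule: alg_A_induct)
  case (1 p)
  have "pw (\<Sum>m\<in>keys p. pwt m) p"
    unfolding pw_def by (auto simp: in_keys_iff intro!: member_le_sum)
  then show ?case using coeff_filt by blast
next
  case (2 x y)
  then obtain m n where "filt_A m x" "filt_A n y" by blast
  then have "filt_A (m + n) x" "filt_A (m + n) y" using filt.mono by (metis le_add1, metis le_add2)
  then show ?case using filt.add by blast
next
  case (3 x g)
  then obtain n where n: "filt_A n x" by blast
  show ?case using filt.mult[OF n, of ZX] filt.mult[OF n, of ZY] filt.mult[OF n, of ZS] by (cases g) auto
qed

lemma filt_0: "filt v zwt n x \<Longrightarrow> n = 0 \<Longrightarrow> \<exists>c. x = c *\<^sub>C 1"
proof (induction rule: filt.induct)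
  case one
  show ?case using scaleC_one by metis
next
  case (scale n x c)
  then show ?case by (metis scaleC_scaleC)
next
  case (add n x y)
  then show ?case by (metis scaleC_add_left)
next
  case (mult n x g)
  then show ?case by (cases g) auto
qed auto

text \<open>With \<open>a2\<close>, \<open>a5\<close>, \<open>a6\<close>, \<open>a8\<close>,
  \<open>a9\<close> of weight at most 2, 5, 6, 8, 9, the terms of \<open>[A, B]\<close>,
  \<open>[A, C]\<close>, \<open>[B, C]\<close> have weight at most 6, 8, 9, in each case one less
  than the sum of the weights of the two generators.\<close>

lemma commutator_filt_gen: "filt_A (zwt g + zwt h - 1) (vA g * vA h - vA h * vA g)"
proof -
  have cen: "vA (ZK i) * x = x * vA (ZK i)" "vA (ZL i) * x = x * vA (ZL i)" for i x
    by (simp_all add: coeff_A_central)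
  have gen: "filt_A 3 A_A" "filt_A 4 B_A" "filt_A 6 C_A"
    using filt_gen[of vA zwt ZX] filt_gen[of vA zwt ZY] filt_gen[of vA zwt ZS] by simp_all
  have num: "filt_A n (numeral m * x)" if "filt_A n x" for n m x
    using filt_mult[OF coeff_filt[OF pw_numeral[of m]] that] by (simp add: complex_algebra_homD[OF coeff_A_hom])
  note a = coeff_filt[OF pw_coefficients(1)] coeff_filt[OF pw_coefficients(2)] coeff_filt[OF pw_coefficients(3)]
    coeff_filt[OF pw_coefficients(4)] coeff_filt[OF pw_coefficients(5)]
  have AB: "filt_A 6 (A_A * B_A - B_A * A_A)" using gen(3) commutator_A_B by (simp add: commutator_def)
  have "filt_A 8 (coeff_A a2 * (A_A * A_A) + coeff_A a5 * A_A + coeff_A a8 - 6 * (B_A * B_A))"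
    using filt_mult[OF a(1) filt_mult[OF gen(1,1)]] filt_mult[OF a(2) gen(1)] a(4) num[OF filt_mult[OF gen(2,2)]]
    by (intro filt_diff filt.add) simp_all
  moreover have "A_A * C_A - C_A * A_A = coeff_A a2 * (A_A * A_A) + coeff_A a5 * A_A + coeff_A a8 - 6 * (B_A * B_A)"
    using commutator_A_C by (simp add: commutator_def power2_eq_square algebra_simps)
  ultimately have AC: "filt_A 8 (A_A * C_A - C_A * A_A)" by (simp only:)
  have "filt_A 9 (coeff_A a6 * A_A + coeff_A a9 - 2 * (A_A * (A_A * A_A)) - coeff_A a2 * (A_A * B_A + B_A * A_A) - coeff_A a5 * B_A)"
  proof -
    have "filt_A 7 (A_A * B_A + B_A * A_A)" using filt_mult[OF gen(1,2)] filt_mult[OF gen(2,1)] by (intro filt.add) simp_all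
    from filt_mult[OF a(1) this] have "filt_A 9 (coeff_A a2 * (A_A * B_A + B_A * A_A))" by simp
    then show ?thesis
      using filt_mult[OF a(3) gen(1)] a(5) filt_mult[OF a(2) gen(2)] num[OF filt_mult[OF gen(1) filt_mult[OF gen(1,1)]]]
      by (intro filt_diff filt.add) simp_all
  qed
  moreover have "B_A * C_A - C_A * B_A = coeff_A a6 * A_A + coeff_A a9 - 2 * (A_A * (A_A * A_A))
      - coeff_A a2 * (A_A * B_A + B_A * A_A) - coeff_A a5 * B_A"
    using commutator_B_C by (simp add: commutator_def anticommutator_def power3_eq_cube algebra_simps)
  ultimately have BC: "filt_A 9 (B_A * C_A - C_A * B_A)" by (simp only:)
  have neg: "filt_A n (y * x - x * y)" if "filt_A n (x * y - y * x)" for n x y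
    using filt_uminus[OF that] by simp
  have zero: "x = y \<Longrightarrow> filt_A n (x - y)" for x y n by (simp add: filt_zero)
  show ?thesis
  proof (cases "\<exists>i. g = ZK i \<or> g = ZL i \<or> h = ZK i \<or> h = ZL i")
    case True
    then obtain i where "g = ZK i \<or> g = ZL i \<or> h = ZK i \<or> h = ZL i" by blast
    then show ?thesis using cen[of i] by (intro zero) (elim disjE; simp only:)
  next
    case False
    have "g = ZX \<or> g = ZY \<or> g = ZS" using False by (cases g) auto
    moreover have "h = ZX \<or> h = ZY \<or> h = ZS" using False by (cases h) auto
    ultimately show ?thesis
      using AB AC BC neg[OF AB] neg[OF AC] neg[OF BC] by (elim disjE) (simp_all add: filt_zero)
  qed
qed

lemma commutator_filt:
  assumes x: "filt_A m x" and y: "filt_A n y"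
  shows "filt_A (m + n - 1) (x * y - y * x)"
proof -
  have pos: "1 \<le> zwt g" for g by (cases g) auto
  have gen: "filt_A (zwt h + n - 1) (vA h * y - y * vA h)" for h
    using y
  proof (induction rule: filt.induct)
    case (scale n x c)
    then show ?case using filt.scale[OF scale.IH, of c] by (simp add: mult_scaleC_left mult_scaleC_right scaleC_diff_right)
  next
    case (add n x y)
    then show ?case using filt.add[OF add.IH] by (simp add: algebra_simps)
  next
    case (mono m x n)
    then show ?case using filt.mono[OF mono.IH] by simp
  next
    case (mult n x g)
    have "filt_A (zwt h + zwt g - 1 + n) ((vA h * vA g - vA g * vA h) * x)" "filt_A (zwt g + (zwt h + n - 1)) (vA g * (vA h * x - x * vA h))"
      using filt_mult[OF commutator_filt_gen mult.hyps] filt.mult[OF mult.IH] .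
    then have "filt_A (zwt h + (zwt g + n) - 1) ((vA h * vA g - vA g * vA h) * x + vA g * (vA h * x - x * vA h))"
      using pos[of h] pos[of g] by (intro filt.add) (simp_all add: algebra_simps)
    then show ?case by (simp add: algebra_simps)
  qed (simp add: filt_zero)
  show ?thesis
    using x
  proof (induction rule: filt.induct)
    case (scale m x c)
    then show ?case using filt.scale[OF scale.IH, of c] by (simp add: mult_scaleC_left mult_scaleC_right scaleC_diff_right)
  next
    case (add m x x')
    then show ?case using filt.add[OF add.IH] by (simp add: algebra_simps)
  next
    case (mono k x m)
    then show ?case using filt.mono[OF mono.IH, of "m + n - 1"] by simp
  next
    case (mult m x g)
    have 1: "filt_A (zwt g + (m + n) - 1) (vA g * (x * y - y * x))"
    proof (cases "m + n = 0")
      case True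
      then obtain c where "x = c *\<^sub>C 1" using filt_0[OF mult.hyps] by auto
      then show ?thesis by (simp add: mult_scaleC_left mult_scaleC_right filt_zero)
    next
      case False
      then have "zwt g + (m + n - 1) = zwt g + (m + n) - 1" by arith
      then show ?thesis using filt.mult[OF mult.IH, of g] by (simp only:)
    qed
    have "filt_A (zwt g + n - 1 + m) ((vA g * y - y * vA g) * x)" by (rule filt_mult[OF gen mult.hyps])
    then have 2: "filt_A (zwt g + (m + n) - 1) ((vA g * y - y * vA g) * x)" using pos[of g] by (simp add: algebra_simps)
    show ?case using filt.add[OF 1 2] by (simp add: algebra_simps)
  qed (simp add: filt_zero)
qed

abbreviation "I_A \<equiv> Idl\<^bsub>ring_of_type_algebra\<^esub> {Omega - coeff_A a12}"

text \<open>Modulo the ideal the relation expresses the square of \<open>C_A\<close> through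
  \<open>A_A\<close>, \<open>B_A\<close> and the parameters, so \<open>square\<close> holds with
  coefficient 0 at \<open>C_A\<close>.\<close>

lemma vA_sorted_filtration: "sorted_filtration vA I_A"
proof
  show "vA (ZK i) * vA g = vA g * vA (ZK i)" "vA (ZL i) * vA g = vA g * vA (ZL i)" for i g
    by (simp_all add: coeff_A_central)
  show "x * y - y * x = 0 \<or> 1 \<le> m + n \<and> filt_A (m + n - 1) (x * y - y * x)" if x: "filt_A m x" and y: "filt_A n y" for m n x y
  proof (cases "m + n = 0")
    case True
    then obtain c where "x = c *\<^sub>C 1" using filt_0[OF x] by auto
    then show ?thesis by (simp add: mult_scaleC_left mult_scaleC_right)
  next
    case False
    then have "1 \<le> m + n" by arith
    then show ?thesis using commutator_filt[OF x y] by simp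
  qed
  let ?v = "\<lambda>g. if g = ZS then 0 else vA g"
  have coeff: "filt ?v zwt n (coeff_A p)" if "pw n p" for n p
  proof -
    have "zpar ?v = zpar vA" by (auto simp: zpar_def split: param.splits)
    then show ?thesis using pmap_zpar_filt[OF that, of ?v] by (simp add: coeff_A_pmap)
  qed
  have gen: "filt ?v zwt 3 A_A" "filt ?v zwt 4 B_A"
    using filt_gen[of ?v zwt ZX] filt_gen[of ?v zwt ZY] by simp_all
  let ?x1 = "6 * a5 + 2 * a9" and ?x2 = "- 2 * a6 - 2 * a8" and ?x3 = "6 * a2 + a6" and ?x5 = "8 * a2 - 24" and ?x7 = "- 2 * a2 + 12"
  have pw: "pw 9 ?x1" "pw 8 ?x2" "pw 6 ?x3" "pw 5 (- a5)" "pw 2 ?x5" "pw 2 ?x7"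
    by (rule pw_mono, (rule pw_rules pw_coefficients)+, simp)+
  define w where "w = coeff_A ?x1 * A_A + coeff_A ?x2 * B_A + coeff_A ?x3 * (A_A * A_A) + coeff_A (- a5) * (A_A * B_A + B_A * A_A)
    + coeff_A ?x5 * (B_A * B_A) + coeff_A ?x7 * (A_A * B_A * A_A) - A_A * (A_A * (A_A * A_A)) + coeff_A 4 * (B_A * (B_A * B_A))"
  have Omega: "Omega = w + C_A * C_A"
    unfolding Omega_def w_def Let_def by (simp add: complex_algebra_homD(9)[OF coeff_A_hom] anticommutator_def eval_nat_numeral)
  have AB: "filt ?v zwt 7 (A_A * B_A + B_A * A_A)"
    using filt_mult[OF gen(1,2)] filt_mult[OF gen(2,1)] by (intro filt.add) simp_all
  have "filt ?v zwt 12 w" unfolding w_def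
    using filt_mult[OF coeff[OF pw(1)] gen(1)] filt_mult[OF coeff[OF pw(2)] gen(2)] filt_mult[OF coeff[OF pw(3)] filt_mult[OF gen(1,1)]]
      filt_mult[OF coeff[OF pw(4)] AB] filt.mono[OF filt_mult[OF coeff[OF pw(5)] filt_mult[OF gen(2,2)]], of 12]
      filt_mult[OF coeff[OF pw(6)] filt_mult[OF filt_mult[OF gen(1,2)] gen(1)]] filt_mult[OF gen(1) filt_mult[OF gen(1) filt_mult[OF gen(1,1)]]]
      filt_mult[OF coeff[OF pw_numeral[of "num.Bit0 (num.Bit0 num.One)"]] filt_mult[OF gen(2) filt_mult[OF gen(2,2)]]]
    by (intro filt_diff filt.add) simp_all
  then have "filt ?v zwt 12 (coeff_A a12 - w)" by (intro filt_diff coeff pw_coefficients)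
  moreover have "Omega - coeff_A a12 \<in> I_A" by (rule Idl_base) simp
  then have "vA ZS * vA ZS - (coeff_A a12 - w + 0 * vA ZS) \<in> I_A" by (simp add: Omega algebra_simps)
  ultimately show "\<exists>a b. filt ?v zwt 12 a \<and> filt ?v zwt 6 b \<and> vA ZS * vA ZS - (a + b * vA ZS) \<in> I_A"
    using filt_zero by blast
qed (auto intro: Idl_zero Idl_add Idl_mult_left Idl_mult_right)

section \<open>Kernel and image of \<open>phi\<close>\<close>

lemma phi_vA: "phi (vA g) = zvalZ g"
  by (cases g) (simp_all add: zvalZ_def phi_coeff kap_var phi_gen)

lemma phi_nf: "phi (nf vA F) = nf zvalZ F"
  by (simp add: hom_nf[OF phi_hom] phi_vA)

lemma phi_Omega: "phi (Omega - coeff_A a12) = 0"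
proof -
  have "phi Omega = Omega_U2"
    unfolding Omega_def Omega_U2_def Let_def anticommutator_def
    by (simp add: complex_algebra_homD[OF phi_hom] phi_coeff phi_gen kap_simps)
  then show ?thesis by (simp add: complex_algebra_homD[OF phi_hom] phi_coeff Omega_U2_eq)
qed

text \<open>Modulo the ideal an element is a normal form \<open>nf vA F\<close>, and
  \<open>phi\<close> maps this to \<open>nf zvalZ F\<close> with the same \<open>F\<close>;
  independence of the latter forces \<open>F = 0\<close>.\<close>

lemma phi_kernel: "phi x = 0 \<longleftrightarrow> x \<in> I_A"
proof
  show "phi x = 0" if "x \<in> I_A"
    using that by (rule Idl_subset_kernel[rotated 3]) (use phi_Omega in \<open>auto simp: complex_algebra_homD[OF phi_hom]\<close>)
  interpret sorted_filtration vA I_A by (rule vA_sorted_filtration)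
  assume x: "phi x = 0"
  obtain n where "filt_A n x" using filt_A_exists by blast
  then obtain F where F: "x - nf vA F \<in> I_A" using normal_form by blast
  then have "phi (x - nf vA F) = 0" 
    by (rule Idl_subset_kernel[rotated 3]) (use phi_Omega in \<open>auto simp: complex_algebra_homD[OF phi_hom]\<close>)
  then have "nf zvalZ F = 0" using x by (simp add: complex_algebra_homD[OF phi_hom] phi_nf)
  then have "F = 0" by (rule nf_zvalZ_eq_0)
  then show "x \<in> I_A" using F by (simp add: nf_zero)
qed

lemma range_phi: "range phi = Z2_sl3"
proof (intro equalityI subsetI)
  fix z assume "z \<in> range phi"
  then obtain x n where "z = phi x" "filt_A n x" using filt_A_exists by blast
  then have "filt zvalZ zwt n z" using hom_filt[OF phi_hom, of vA zwt n x] by (simp add: phi_vA)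
  then show "z \<in> Z2_sl3" unfolding filt_zvalZ Z2_sl3_iff_trace_span by blast
next
  fix z assume "z \<in> Z2_sl3"
  then obtain F where "z = nf zvalZ F" unfolding Z2_sl3_iff_trace_span using U2_normal_form by blast
  then show "z \<in> range phi" using phi_nf by (metis rangeI)
qed

lemma ring_hom_ring_phi: "ring_hom_ring ring_of_type_algebra ring_of_type_algebra phi"
proof (rule ring_hom_ringI)
  show "ring (ring_of_type_algebra :: alg_A ring)" "ring (ring_of_type_algebra :: U2 ring)"
    by (rule ring_ring_of_type_algebra)+
qed (simp_all add: complex_algebra_homD(1-3)[OF phi_hom])

lemma phi_quotient:
  fixes R :: "alg_A ring" and S :: "U2 ring"
  assumes R: "R = ring_of_type_algebra" and S: "S = ring_of_type_algebra"
  shows "(\<lambda>K. the_elem (phi ` K)) \<in> ring_iso (R Quot I_A) (S\<lparr>carrier := Z2_sl3\<rparr>)"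
    and "the_elem (phi ` (I_A +>\<^bsub>R\<^esub> x)) = phi x"
proof -
  have hom: "ring_hom_ring R S phi" unfolding R S by (rule ring_hom_ring_phi)
  have ker: "a_kernel R S phi = I_A" unfolding a_kernel_def' by (auto simp: R S phi_kernel)
  have "phi ` carrier R = Z2_sl3" by (simp add: R range_phi)
  then show "(\<lambda>K. the_elem (phi ` K)) \<in> ring_iso (R Quot I_A) (S\<lparr>carrier := Z2_sl3\<rparr>)"
    using ring_hom_ring.FactRing_iso_set_aux[OF hom] unfolding ker by simp
  show "the_elem (phi ` (I_A +>\<^bsub>R\<^esub> x)) = phi x"
    using ring_hom_ring.the_elem_simp[OF hom, of x] unfolding ker by (simp add: R)
qed

theorem theorem4p1:
  shows "\<exists>!\<phi> :: alg_A \<Rightarrow> U2.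
    complex_algebra_hom \<phi> \<and>
    \<phi> A_A = X_elem \<and> \<phi> B_A = Y_elem \<and> \<phi> C_A = Z_elem \<and>
    (\<forall>i. \<phi> (coeff_A (kp i)) = kU i) \<and> (\<forall>i. \<phi> (coeff_A (lp i)) = lU i) \<and>
    range \<phi> = Z2_sl3 \<and>
    (let R = ring_of_type_algebra :: alg_A ring;
         I = Idl\<^bsub>R\<^esub> {Omega - coeff_A a12};
         S = ring_of_type_algebra\<lparr>carrier := Z2_sl3\<rparr>
     in \<exists>\<psi> \<in> ring_iso (R Quot I) S. \<forall>x. \<psi> (I +>\<^bsub>R\<^esub> x) = \<phi> x)"
proof (intro ex1I[of _ phi] conjI allI)
  show "let R = ring_of_type_algebra :: alg_A ring; I = Idl\<^bsub>R\<^esub> {Omega - coeff_A a12}; S = ring_of_type_algebra\<lparr>carrier := Z2_sl3\<rparr>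
     in \<exists>\<psi> \<in> ring_iso (R Quot I) S. \<forall>x. \<psi> (I +>\<^bsub>R\<^esub> x) = phi x"
    unfolding Let_def
    by (rule bexI[OF _ phi_quotient(1)[OF refl refl]]) (intro allI phi_quotient(2)[OF refl refl])
qed (use phi_unique in \<open>auto simp: phi_hom phi_gen phi_coeff kap_var range_phi simp del: Let_def\<close>)

end
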